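(* Let $k$ be a commutative ring, $A$ an abelian group, and $G$ a finite group. There exists a $k$-algebra isomorphism $$\bigoplus_{\{K,\kappa\}_G\in\mathcal{M}_G^G/\sim}\mathrm{Mat}_{|\{K,\kappa\}_G|}(k\Gamma_{(G,K,\kappa)})\ \xrightarrow{\ \sim\ }\ E_G^c$$ (where one representative $(K,\kappa)$ is chosen in each $G$-linkage class) with the following property: for every $(K,\kappa)\in\mathcal{M}_G^G$, writing $\{K,\kappa\}_G=\{(K_1,\kappa_1),\ldots,(K_n,\kappa_n)\}$, the element $f_{(K_i,\kappa_i)}\in E_G^c$ corresponds under this isomorphism to the diagonal idempotent matrix $e_i=\mathrm{diag}(0,\ldots,0,1,0,\ldots,0)$ ($1$ in position $i$) in the $\{K,\kappa\}_G$-component, for $i=1,\ldots,n$.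
   Context: $A$ is written multiplicatively. For a finite group $K$ put $K^*=\mathrm{Hom}(K,A)$. $\mathcal{M}_G$ is the set of pairs $(K,\kappa)$ with $K\le G$, $\kappa\in K^*$, partially ordered by $(L,\lambda)\le(K,\kappa)$ iff $L\le K$ and $\lambda=\kappa|_L$; $\mathcal{M}_G^G$ is the subset of pairs fixed under $G$-conjugation, i.e. $K\trianglelefteq G$ and $\kappa(gxg^{-1})=\kappa(x)$ for $g\in G,x\in K$. For $(U,\phi)\in\mathcal{M}_{G\times H}$ let $p_1(U)\le G$, $p_2(U)\le H$ be the projections, $k_1(U)=\{g: (g,1)\in U\}$, $k_2(U)=\{h:(1,h)\in U\}$, and define $\phi_i\in k_i(U)^*$ by $\phi(g,h)=\phi_1(g)\phi_2(h)^{-1}$ on $k_1(U)\times k_2(U)$. Put $l(U,\phi)=(p_1(U),k_1(U),\phi_1)$, $r(U,\phi)=(p_2(U),k_2(U),\phi_2)$. An $A$-fibered $(G,H)$-biset is a left $A\times G\times H$-set which is free as an $A$-set and has finitely many $A$-orbits. For $(U,\phi)\in\mathcal{M}_{G\times H}$, $\left(\frac{G\times H}{U,\phi}\right)=(A\times G\times H)/U_\phi$ with $U_\phi=\{(\phi(u)^{-1},u): u\in U\}$; these are, up to isomorphism, the transitive ones, two being isomorphic iff the pairs are $G\times H$-conjugate. For an $A$-fibered $(G,H)$-biset $X$ and an $A$-fibered $(H,I)$-biset $Y$, let $A\times H$ act on $X\times Y$ by $(a,h)\cdot(x,y)=((a^{-1},1,h)x,(a,h,1)y)$; the orbit set is an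 $A\times G\times I$-set via $(a,g,i)[x,y]=[(a,g,1)x,(1,1,i)y]$, and $X\otimes_{AH}Y$ is its subset of elements with trivial stabilizer in $A$. $B^A(G,H)$ is the Grothendieck group of isomorphism classes of $A$-fibered $(G,H)$-bisets under disjoint union, with $\mathbb{Z}$-basis the classes $\left[\frac{G\times H}{U,\phi}\right]$ ($(U,\phi)$ up to conjugacy); $B_k^A(G,H)=k\otimes B^A(G,H)$. $E_G=B_k^A(G,G)$ is a $k$-algebra with product induced by $\otimes_{AG}$. $E_G^c\subseteq E_G$ is the $k$-subalgebra spanned by the $\left[\frac{G\times G}{U,\phi}\right]$ with $p_1(U)=G=p_2(U)$. For $(K,\kappa)\in\mathcal{M}_G^G$: $e_{(K,\kappa)}=\left[\frac{G\times G}{\Delta_K(G),\phi_\kappa}\right]$, where $\Delta_K(G)=\{(g_1,g_2): g_1K=g_2K\}$ and $\phi_\kappa(g_1,g_2)=\kappa(g_1g_2^{-1})$; $f_{(K,\kappa)}=\sum_{(K,\kappa)\le(L,\lambda)\in\mathcal{M}_G^G}\mu^{\triangleleft}_{K,L}e_{(L,\lambda)}\in E_G^c$, where $\mu^\triangleleft$ is the Möbius function of the poset of normal subgroups of $G$. $\Gamma_{(G,K,\kappa)}$ is the group, under the product of $E_G$ and with identity $e_{(K,\kappa)}$, of all classes $\left[\frac{G\times G}{U,\phi}\right]$ with $l(U,\phi)=(G,K,\kappa)=r(U,\phi)$. $G$-linkage: $(K,\kappa)\sim(K',\kappa')$ in $\mathcal{M}_G^G$ iff there is $(U,\phi)\in\mathcal{M}_{G\times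 G}$ with $l(U,\phi)=(G,K,\kappa)$ and $r(U,\phi)=(G,K',\kappa')$. This is an equivalence relation; $\{K,\kappa\}_G$ is the class of $(K,\kappa)$.
   Formalization: The set M_G^G is assumed finite; otherwise (for k nonzero) some sum defining f_(K,κ) has infinitely many nonzero terms and is not in E_G, and the left side is an infinite direct sum without identity while E_G^c has one. *)

theory Defs
  imports
    "HOL-Algebra.Group_Action"
    "HOL-Algebra.Left_Coset"
    "HOL-Algebra.Module"
    "HOL-Algebra.QuotRing"
begin

section \<open>Algebras over a commutative ring\<close>

text \<open>
  An algebra over \<open>R\<close> is represented by the record type \<^type>\<open>module\<close>, which
  extends rings by a scalar multiplication. (The locale \<open>algebra\<close> of the library is about
  commutative algebras only.)
\<close>

definition alg_iso ::
  "('k, 'r) ring_scheme \<Rightarrow> ('k, 'x, 'm) module_scheme \<Rightarrow> ('k, 'y, 'n) module_scheme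
    \<Rightarrow> ('x \<Rightarrow> 'y) \<Rightarrow> bool" where
  "alg_iso R B C h \<longleftrightarrow>
     h \<in> ring_iso B C \<and>
     (\<forall>c \<in> carrier R. \<forall>x \<in> carrier B. h (c \<odot>\<^bsub>B\<^esub> x) = c \<odot>\<^bsub>C\<^esub> h x)"

definition lin_span ::
  "('k, 'r) ring_scheme \<Rightarrow> ('k, 'x, 'm) module_scheme \<Rightarrow> 'x set \<Rightarrow> 'x set" where
  "lin_span R M S = \<Inter> {N. submodule N R M \<and> S \<subseteq> N}"

definition quot_alg ::
  "('k, 'r) ring_scheme \<Rightarrow> ('k, 'x, 'm) module_scheme \<Rightarrow> 'x set \<Rightarrow> ('k, 'x set) module" where
  "quot_alg R B I =
     \<lparr>carrier = carrier (B Quot I), mult = mult (B Quot I), one = one (B Quot I),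
      zero = zero (B Quot I), add = add (B Quot I),
      smult = (\<lambda>c X. \<Union>x\<in>X. I +>\<^bsub>B\<^esub> (c \<odot>\<^bsub>B\<^esub> x))\<rparr>"

text \<open>
  The monoid algebra \<open>R[M]\<close>: finitely supported functions from \<open>M\<close> to \<open>R\<close>, made
  extensional, with the convolution product. For a group \<open>M\<close> it is the group algebra.
\<close>

definition supp :: "('k, 'r) ring_scheme \<Rightarrow> ('x, 'm) monoid_scheme \<Rightarrow> ('x \<Rightarrow> 'k) \<Rightarrow> 'x set" where
  "supp R M f = {x \<in> carrier M. f x \<noteq> \<zero>\<^bsub>R\<^esub>}"

definition delta ::
  "('k, 'r) ring_scheme \<Rightarrow> ('x, 'm) monoid_scheme \<Rightarrow> 'x \<Rightarrow> 'x \<Rightarrow> 'k" where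
  "delta R M x = (\<lambda>y\<in>carrier M. if y = x then \<one>\<^bsub>R\<^esub> else \<zero>\<^bsub>R\<^esub>)"

definition monoid_alg ::
  "('k, 'r) ring_scheme \<Rightarrow> ('x, 'm) monoid_scheme \<Rightarrow> ('k, 'x \<Rightarrow> 'k) module" where
  "monoid_alg R M =
     \<lparr>carrier = {f \<in> carrier M \<rightarrow>\<^sub>E carrier R. finite (supp R M f)},
      mult = (\<lambda>f g. \<lambda>z\<in>carrier M.
        finsum R (\<lambda>(x, y). f x \<otimes>\<^bsub>R\<^esub> g y)
          {(x, y). x \<in> supp R M f \<and> y \<in> supp R M g \<and> x \<otimes>\<^bsub>M\<^esub> y = z}),
      one = delta R M \<one>\<^bsub>M\<^esub>,
      zero = (\<lambda>x\<in>carrier M. \<zero>\<^bsub>R\<^esub>),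
      add = (\<lambda>f g. \<lambda>x\<in>carrier M. f x \<oplus>\<^bsub>R\<^esub> g x),
      smult = (\<lambda>c f. \<lambda>x\<in>carrier M. c \<otimes>\<^bsub>R\<^esub> f x)\<rparr>"

text \<open>Square matrices have their rows and columns numbered \<open>0, \<dots>, n - 1\<close>.\<close>

definition mat_alg :: "nat \<Rightarrow> ('k, 'x, 'm) module_scheme \<Rightarrow> ('k, nat \<times> nat \<Rightarrow> 'x) module" where
  "mat_alg n B =
     \<lparr>carrier = {..<n} \<times> {..<n} \<rightarrow>\<^sub>E carrier B,
      mult = (\<lambda>X Y. \<lambda>(i, j)\<in>{..<n} \<times> {..<n}. \<Oplus>\<^bsub>B\<^esub>l\<in>{..<n}. X (i, l) \<otimes>\<^bsub>B\<^esub> Y (l, j)),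
      one = (\<lambda>(i, j)\<in>{..<n} \<times> {..<n}. if i = j then \<one>\<^bsub>B\<^esub> else \<zero>\<^bsub>B\<^esub>),
      zero = (\<lambda>p\<in>{..<n} \<times> {..<n}. \<zero>\<^bsub>B\<^esub>),
      add = (\<lambda>X Y. \<lambda>p\<in>{..<n} \<times> {..<n}. X p \<oplus>\<^bsub>B\<^esub> Y p),
      smult = (\<lambda>c X. \<lambda>p\<in>{..<n} \<times> {..<n}. c \<odot>\<^bsub>B\<^esub> X p)\<rparr>"

definition diag_idem :: "nat \<Rightarrow> ('k, 'x, 'm) module_scheme \<Rightarrow> nat \<Rightarrow> nat \<times> nat \<Rightarrow> 'x" where
  "diag_idem n B i =
     (\<lambda>(p, q)\<in>{..<n} \<times> {..<n}. if p = i \<and> q = i then \<one>\<^bsub>B\<^esub> else \<zero>\<^bsub>B\<^esub>)"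

text \<open>The direct sum of a family of algebras; the index set \<open>J\<close> is meant to be finite.\<close>

definition dsum_alg ::
  "'j set \<Rightarrow> ('j \<Rightarrow> ('k, 'x, 'm) module_scheme) \<Rightarrow> ('k, 'j \<Rightarrow> 'x) module" where
  "dsum_alg J B =
     \<lparr>carrier = (\<Pi>\<^sub>E j\<in>J. carrier (B j)),
      mult = (\<lambda>x y. \<lambda>j\<in>J. x j \<otimes>\<^bsub>B j\<^esub> y j),
      one = (\<lambda>j\<in>J. \<one>\<^bsub>B j\<^esub>),
      zero = (\<lambda>j\<in>J. \<zero>\<^bsub>B j\<^esub>),
      add = (\<lambda>x y. \<lambda>j\<in>J. x j \<oplus>\<^bsub>B j\<^esub> y j),
      smult = (\<lambda>c x. \<lambda>j\<in>J. c \<odot>\<^bsub>B j\<^esub> x j)\<rparr>"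

definition dsum_inj ::
  "'j set \<Rightarrow> ('j \<Rightarrow> ('k, 'x, 'm) module_scheme) \<Rightarrow> 'j \<Rightarrow> 'x \<Rightarrow> 'j \<Rightarrow> 'x" where
  "dsum_inj J B i x = (\<lambda>j\<in>J. if j = i then x else \<zero>\<^bsub>B j\<^esub>)"


section \<open>Pairs of subgroups and homomorphisms to \<open>A\<close>\<close>

text \<open>
  \<open>chars A G K\<close> is \<open>K\<^sup>* = Hom(K, A)\<close>; homomorphisms are extensional on \<open>K\<close>, so that
  equality of pairs \<open>(K, \<kappa>)\<close> is equality of HOL values.
\<close>

definition chars ::
  "('a, 'm) monoid_scheme \<Rightarrow> ('g, 'n) monoid_scheme \<Rightarrow> 'g set \<Rightarrow> ('g \<Rightarrow> 'a) set" where
  "chars A G K = hom (G\<lparr>carrier := K\<rparr>) A \<inter> extensional K"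

definition pairs ::
  "('a, 'm) monoid_scheme \<Rightarrow> ('g, 'n) monoid_scheme \<Rightarrow> ('g set \<times> ('g \<Rightarrow> 'a)) set" where
  "pairs A G = {(K, \<kappa>). subgroup K G \<and> \<kappa> \<in> chars A G K}"

definition pair_le :: "'g set \<times> ('g \<Rightarrow> 'a) \<Rightarrow> 'g set \<times> ('g \<Rightarrow> 'a) \<Rightarrow> bool" where
  "pair_le p q \<longleftrightarrow> fst p \<subseteq> fst q \<and> snd p = restrict (snd q) (fst p)"

definition fixed_pairs ::
  "('a, 'm) monoid_scheme \<Rightarrow> ('g, 'n) monoid_scheme \<Rightarrow> ('g set \<times> ('g \<Rightarrow> 'a)) set" where
  "fixed_pairs A G = {(K, \<kappa>) \<in> pairs A G. K \<lhd> G \<and>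
     (\<forall>g \<in> carrier G. \<forall>x \<in> K. \<kappa> (g \<otimes>\<^bsub>G\<^esub> x \<otimes>\<^bsub>G\<^esub> inv\<^bsub>G\<^esub> g) = \<kappa> x)}"

definition k1 :: "('h, 'n) monoid_scheme \<Rightarrow> ('g \<times> 'h) set \<Rightarrow> 'g set" where
  "k1 H U = {g. (g, \<one>\<^bsub>H\<^esub>) \<in> U}"

definition k2 :: "('g, 'n) monoid_scheme \<Rightarrow> ('g \<times> 'h) set \<Rightarrow> 'h set" where
  "k2 G U = {h. (\<one>\<^bsub>G\<^esub>, h) \<in> U}"

text \<open>
  The equation \<open>\<phi>(g, h) = \<phi>\<^sub>1(g) \<phi>\<^sub>2(h)\<^sup>-\<^sup>1\<close> on \<open>k\<^sub>1(U) \<times> k\<^sub>2(U)\<close> amounts to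
  \<open>\<phi>\<^sub>1(g) = \<phi>(g, 1)\<close> and \<open>\<phi>\<^sub>2(h) = \<phi>(1, h)\<^sup>-\<^sup>1\<close>.
\<close>

definition l_data ::
  "('h, 'n) monoid_scheme \<Rightarrow> ('g \<times> 'h) set \<times> ('g \<times> 'h \<Rightarrow> 'a) \<Rightarrow> 'g set \<times> 'g set \<times> ('g \<Rightarrow> 'a)"
  where "l_data H = (\<lambda>(U, \<phi>). (fst ` U, k1 H U, \<lambda>g\<in>k1 H U. \<phi> (g, \<one>\<^bsub>H\<^esub>)))"

definition r_data ::
  "('a, 'm) monoid_scheme \<Rightarrow> ('g, 'n) monoid_scheme
    \<Rightarrow> ('g \<times> 'h) set \<times> ('g \<times> 'h \<Rightarrow> 'a) \<Rightarrow> 'h set \<times> 'h set \<times> ('h \<Rightarrow> 'a)"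
  where "r_data A G =
    (\<lambda>(U, \<phi>). (snd ` U, k2 G U, \<lambda>h\<in>k2 G U. inv\<^bsub>A\<^esub> (\<phi> (\<one>\<^bsub>G\<^esub>, h))))"

definition linkage ::
  "('a, 'm) monoid_scheme \<Rightarrow> ('g, 'n) monoid_scheme
    \<Rightarrow> (('g set \<times> ('g \<Rightarrow> 'a)) \<times> ('g set \<times> ('g \<Rightarrow> 'a))) set" where
  "linkage A G = {(p, q). p \<in> fixed_pairs A G \<and> q \<in> fixed_pairs A G \<and>
     (\<exists>u \<in> pairs A (G \<times>\<times> G). l_data G u = (carrier G, p) \<and> r_data A G u = (carrier G, q))}"

definition linkage_classes ::
  "('a, 'm) monoid_scheme \<Rightarrow> ('g, 'n) monoid_scheme \<Rightarrow> ('g set \<times> ('g \<Rightarrow> 'a)) set set" where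
  "linkage_classes A G = fixed_pairs A G // linkage A G"

text \<open>The Moebius function of the poset of normal subgroups of \<open>G\<close>.\<close>

function normal_moebius :: "('g, 'n) monoid_scheme \<Rightarrow> 'g set \<Rightarrow> 'g set \<Rightarrow> int" where
  "normal_moebius G K L =
     (if K = L then 1
      else if finite L \<and> K \<subseteq> L
        then - (\<Sum>N \<in> {N. N \<lhd> G \<and> K \<subseteq> N \<and> N \<subset> L}. normal_moebius G K N)
      else 0)"
  by pat_completeness auto
termination
  by (relation "measure (\<lambda>(G, K, L). card L)") (auto intro: psubset_card_mono)

declare normal_moebius.simps [simp del]


section \<open>Fibered bisets\<close>

text \<open>
  An \<open>A \<times> G \<times> H\<close>-set is a set of points with an action; as for \<^locale>\<open>group_action\<close>, each
  group element acts by a function that is extensional on the points.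
\<close>

record ('a, 'g, 'h, 'x) fbiset =
  pts :: "'x set"
  act :: "'a \<times> 'g \<times> 'h \<Rightarrow> 'x \<Rightarrow> 'x"

definition fibered_biset ::
  "('a, 'm) monoid_scheme \<Rightarrow> ('g, 'n) monoid_scheme \<Rightarrow> ('h, 'l) monoid_scheme
    \<Rightarrow> ('a, 'g, 'h, 'x) fbiset \<Rightarrow> bool" where
  "fibered_biset A G H X \<longleftrightarrow>
     group_action (A \<times>\<times> G \<times>\<times> H) (pts X) (act X) \<and>
     (\<forall>x \<in> pts X. stabilizer A (\<lambda>a. act X (a, \<one>\<^bsub>G\<^esub>, \<one>\<^bsub>H\<^esub>)) x = {\<one>\<^bsub>A\<^esub>}) \<and>
     finite (orbits A (pts X) (\<lambda>a. act X (a, \<one>\<^bsub>G\<^esub>, \<one>\<^bsub>H\<^esub>)))"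

definition fb_isomorphic ::
  "('a, 'm) monoid_scheme \<Rightarrow> ('g, 'n) monoid_scheme \<Rightarrow> ('h, 'l) monoid_scheme
    \<Rightarrow> ('a, 'g, 'h, 'x) fbiset \<Rightarrow> ('a, 'g, 'h, 'y) fbiset \<Rightarrow> bool" where
  "fb_isomorphic A G H X Y \<longleftrightarrow>
     (\<exists>f. bij_betw f (pts X) (pts Y) \<and>
        (\<forall>t \<in> carrier (A \<times>\<times> G \<times>\<times> H). \<forall>x \<in> pts X. f (act X t x) = act Y t (f x)))"

text \<open>\<open>(A \<times> G \<times> H)/U\<^sub>\<phi>\<close> with \<open>U\<^sub>\<phi> = {(\<phi>(u)\<^sup>-\<^sup>1, u) | u \<in> U}\<close>.\<close>

definition trans_fb ::
  "('a, 'm) monoid_scheme \<Rightarrow> ('g, 'n) monoid_scheme \<Rightarrow> ('h, 'l) monoid_scheme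
    \<Rightarrow> ('g \<times> 'h) set \<times> ('g \<times> 'h \<Rightarrow> 'a) \<Rightarrow> ('a, 'g, 'h, ('a \<times> 'g \<times> 'h) set) fbiset" where
  "trans_fb A G H = (\<lambda>(U, \<phi>).
     let T = A \<times>\<times> G \<times>\<times> H; C = lcosets\<^bsub>T\<^esub> ((\<lambda>u. (inv\<^bsub>A\<^esub> (\<phi> u), u)) ` U)
     in \<lparr>pts = C, act = (\<lambda>t. \<lambda>c\<in>C. t <#\<^bsub>T\<^esub> c)\<rparr>)"

definition union_fb ::
  "('a, 'g, 'h, 'x) fbiset \<Rightarrow> ('a, 'g, 'h, 'y) fbiset \<Rightarrow> ('a, 'g, 'h, 'x + 'y) fbiset" where
  "union_fb X Y =
     \<lparr>pts = pts X <+> pts Y,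
      act = (\<lambda>t. \<lambda>z\<in>pts X <+> pts Y.
        case z of Inl x \<Rightarrow> Inl (act X t x) | Inr y \<Rightarrow> Inr (act Y t y))\<rparr>"

text \<open>
  The tensor product \<open>X \<otimes>\<^sub>A\<^sub>H Y\<close>. The \<open>A \<times> H\<close>-action on \<open>X \<times> Y\<close> commutes with
  \<open>(x, y) \<mapsto> ((a, g, 1)x, (1, 1, i)y)\<close>, so the image of the orbit \<open>[x, y]\<close> under this map is
  the orbit \<open>[(a, g, 1)x, (1, 1, i)y]\<close>.
\<close>

definition tensor_orbits ::
  "('a, 'm) monoid_scheme \<Rightarrow> ('g, 'n) monoid_scheme \<Rightarrow> ('h, 'l) monoid_scheme
    \<Rightarrow> ('i, 'o) monoid_scheme
    \<Rightarrow> ('a, 'g, 'h, 'x) fbiset \<Rightarrow> ('a, 'h, 'i, 'y) fbiset \<Rightarrow> ('x \<times> 'y) set set" where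
  "tensor_orbits A G H I X Y =
     orbits (A \<times>\<times> H) (pts X \<times> pts Y)
       (\<lambda>(a, h) (x, y). (act X (inv\<^bsub>A\<^esub> a, \<one>\<^bsub>G\<^esub>, h) x, act Y (a, h, \<one>\<^bsub>I\<^esub>) y))"

definition tensor_act ::
  "('a, 'm) monoid_scheme \<Rightarrow> ('h, 'l) monoid_scheme
    \<Rightarrow> ('a, 'g, 'h, 'x) fbiset \<Rightarrow> ('a, 'h, 'i, 'y) fbiset
    \<Rightarrow> 'a \<times> 'g \<times> 'i \<Rightarrow> ('x \<times> 'y) set \<Rightarrow> ('x \<times> 'y) set" where
  "tensor_act A H X Y = (\<lambda>(a, g, i) w.
     (\<lambda>(x, y). (act X (a, g, \<one>\<^bsub>H\<^esub>) x, act Y (\<one>\<^bsub>A\<^esub>, \<one>\<^bsub>H\<^esub>, i) y)) ` w)"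

definition tensor_fb ::
  "('a, 'm) monoid_scheme \<Rightarrow> ('g, 'n) monoid_scheme \<Rightarrow> ('h, 'l) monoid_scheme
    \<Rightarrow> ('i, 'o) monoid_scheme
    \<Rightarrow> ('a, 'g, 'h, 'x) fbiset \<Rightarrow> ('a, 'h, 'i, 'y) fbiset
    \<Rightarrow> ('a, 'g, 'i, ('x \<times> 'y) set) fbiset" where
  "tensor_fb A G H I X Y =
     (let P = {w \<in> tensor_orbits A G H I X Y.
                 stabilizer A (\<lambda>a. tensor_act A H X Y (a, \<one>\<^bsub>G\<^esub>, \<one>\<^bsub>I\<^esub>)) w = {\<one>\<^bsub>A\<^esub>}}
      in \<lparr>pts = P, act = (\<lambda>t. restrict (tensor_act A H X Y t) P)\<rparr>)"

text \<open>
  A fibered biset with \<open>n\<close> \<open>A\<close>-orbits is in bijection with \<open>A \<times> {0, \<dots>, n - 1}\<close>, hence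
  isomorphic to one whose points lie in the type \<^typ>\<open>'a \<times> nat\<close>. The isomorphism class of a
  fibered biset with points of any type is therefore represented by the set of all the
  isomorphic fibered bisets with points in \<^typ>\<open>'a \<times> nat\<close>.
\<close>

type_synonym ('a, 'g) fb_class = "('a, 'g, 'g, 'a \<times> nat) fbiset set"

definition fb_class ::
  "('a, 'm) monoid_scheme \<Rightarrow> ('g, 'n) monoid_scheme \<Rightarrow> ('a, 'g, 'g, 'x) fbiset
    \<Rightarrow> ('a, 'g) fb_class" where
  "fb_class A G X = {Y. fibered_biset A G G Y \<and> fb_isomorphic A G G X Y}"

text \<open>The element \<open>(\<Delta>\<^sub>K(G), \<phi>\<^sub>\<kappa>)\<close>.\<close>

definition Delta_pair ::
  "('g, 'n) monoid_scheme \<Rightarrow> 'g set \<times> ('g \<Rightarrow> 'a) \<Rightarrow> ('g \<times> 'g) set \<times> ('g \<times> 'g \<Rightarrow> 'a)" where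
  "Delta_pair G = (\<lambda>(K, \<kappa>).
     let D = {(g1, g2) \<in> carrier G \<times> carrier G. g1 <#\<^bsub>G\<^esub> K = g2 <#\<^bsub>G\<^esub> K}
     in (D, \<lambda>(g1, g2)\<in>D. \<kappa> (g1 \<otimes>\<^bsub>G\<^esub> inv\<^bsub>G\<^esub> g2)))"

text \<open>
  The monoid of isomorphism classes of \<open>A\<close>-fibered \<open>(G, G)\<close>-bisets under the tensor product,
  with identity the class of \<open>(G \<times> G)/(\<Delta>(G), 1)\<close>.
\<close>

definition fb_monoid ::
  "('a, 'm) monoid_scheme \<Rightarrow> ('g, 'n) monoid_scheme \<Rightarrow> ('a, 'g) fb_class monoid" where
  "fb_monoid A G =
     \<lparr>carrier = fb_class A G ` {X :: ('a, 'g, 'g, 'a \<times> nat) fbiset. fibered_biset A G G X},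
      mult = (\<lambda>C D. \<Union>X\<in>C. \<Union>Y\<in>D. fb_class A G (tensor_fb A G G G X Y)),
      one = fb_class A G (trans_fb A G G
              (Delta_pair G ({\<one>\<^bsub>G\<^esub>}, \<lambda>x\<in>{\<one>\<^bsub>G\<^esub>}. \<one>\<^bsub>A\<^esub>)))\<rparr>"


section \<open>The algebras \<open>E\<^sub>G\<close> and \<open>E\<^sup>c\<^sub>G\<close>\<close>

text \<open>
  \<open>k \<otimes> B\<^sup>A(G, G)\<close> is the free \<open>k\<close>-module on the isomorphism classes modulo the Grothendieck
  relations \<open>[X \<squnion> Y] = [X] + [Y]\<close> of the disjoint union. The product induced by the tensor
  product is the one inherited from the monoid algebra of \<^const>\<open>fb_monoid\<close>.
\<close>

definition groth_rel ::
  "('k, 'r) ring_scheme \<Rightarrow> ('a, 'm) monoid_scheme \<Rightarrow> ('g, 'n) monoid_scheme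
    \<Rightarrow> (('a, 'g) fb_class \<Rightarrow> 'k) set" where
  "groth_rel k A G =
     lin_span k (monoid_alg k (fb_monoid A G))
       {delta k (fb_monoid A G) (fb_class A G (union_fb X Y))
          \<ominus>\<^bsub>monoid_alg k (fb_monoid A G)\<^esub>
            (delta k (fb_monoid A G) (fb_class A G X)
             \<oplus>\<^bsub>monoid_alg k (fb_monoid A G)\<^esub> delta k (fb_monoid A G) (fb_class A G Y))
        | (X :: ('a, 'g, 'g, 'a \<times> nat) fbiset)
          (Y :: ('a, 'g, 'g, 'a \<times> nat) fbiset).
          fibered_biset A G G X \<and> fibered_biset A G G Y}"

type_synonym ('k, 'a, 'g) E_elem = "(('a, 'g) fb_class \<Rightarrow> 'k) set"

definition E_alg ::
  "('k, 'r) ring_scheme \<Rightarrow> ('a, 'm) monoid_scheme \<Rightarrow> ('g, 'n) monoid_scheme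
    \<Rightarrow> ('k, ('k, 'a, 'g) E_elem) module" where
  "E_alg k A G = quot_alg k (monoid_alg k (fb_monoid A G)) (groth_rel k A G)"

text \<open>The class of \<open>(G \<times> G)/(U, \<phi>)\<close> in \<open>E\<^sub>G\<close>.\<close>

definition std_elem ::
  "('k, 'r) ring_scheme \<Rightarrow> ('a, 'm) monoid_scheme \<Rightarrow> ('g, 'n) monoid_scheme
    \<Rightarrow> ('g \<times> 'g) set \<times> ('g \<times> 'g \<Rightarrow> 'a) \<Rightarrow> ('k, 'a, 'g) E_elem" where
  "std_elem k A G u =
     groth_rel k A G +>\<^bsub>monoid_alg k (fb_monoid A G)\<^esub>
       delta k (fb_monoid A G) (fb_class A G (trans_fb A G G u))"

definition Ec_alg ::
  "('k, 'r) ring_scheme \<Rightarrow> ('a, 'm) monoid_scheme \<Rightarrow> ('g, 'n) monoid_scheme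
    \<Rightarrow> ('k, ('k, 'a, 'g) E_elem) module" where
  "Ec_alg k A G = (E_alg k A G)
     \<lparr>carrier := lin_span k (E_alg k A G)
        {std_elem k A G (U, \<phi>) | U \<phi>.
          (U, \<phi>) \<in> pairs A (G \<times>\<times> G) \<and> fst ` U = carrier G \<and> snd ` U = carrier G}\<rparr>"

definition e_elem ::
  "('k, 'r) ring_scheme \<Rightarrow> ('a, 'm) monoid_scheme \<Rightarrow> ('g, 'n) monoid_scheme
    \<Rightarrow> 'g set \<times> ('g \<Rightarrow> 'a) \<Rightarrow> ('k, 'a, 'g) E_elem" where
  "e_elem k A G p = std_elem k A G (Delta_pair G p)"

definition f_elem ::
  "('k, 'r) ring_scheme \<Rightarrow> ('a, 'm) monoid_scheme \<Rightarrow> ('g, 'n) monoid_scheme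
    \<Rightarrow> 'g set \<times> ('g \<Rightarrow> 'a) \<Rightarrow> ('k, 'a, 'g) E_elem" where
  "f_elem k A G p =
     finsum (E_alg k A G)
       (\<lambda>q. [normal_moebius G (fst p) (fst q)] \<cdot>\<^bsub>E_alg k A G\<^esub> e_elem k A G q)
       {q \<in> fixed_pairs A G. pair_le p q}"

definition Gamma ::
  "('k, 'r) ring_scheme \<Rightarrow> ('a, 'm) monoid_scheme \<Rightarrow> ('g, 'n) monoid_scheme
    \<Rightarrow> 'g set \<times> ('g \<Rightarrow> 'a) \<Rightarrow> ('k, 'a, 'g) E_elem monoid" where
  "Gamma k A G p =
     \<lparr>carrier = {std_elem k A G u | u. u \<in> pairs A (G \<times>\<times> G) \<and>
        l_data G u = (carrier G, p) \<and> r_data A G u = (carrier G, p)},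
      mult = mult (E_alg k A G),
      one = e_elem k A G p\<rparr>"

text \<open>
  The component \<open>Mat\<^sub>|\<^sub>c\<^sub>|(k\<Gamma>)\<close> at the linkage class \<open>c\<close>, where \<open>rep c\<close> is the chosen
  representative of \<open>c\<close>.
\<close>

definition link_block ::
  "('k, 'r) ring_scheme \<Rightarrow> ('a, 'm) monoid_scheme \<Rightarrow> ('g, 'n) monoid_scheme
    \<Rightarrow> (('g set \<times> ('g \<Rightarrow> 'a)) set \<Rightarrow> 'g set \<times> ('g \<Rightarrow> 'a))
    \<Rightarrow> ('g set \<times> ('g \<Rightarrow> 'a)) set
    \<Rightarrow> ('k, nat \<times> nat \<Rightarrow> ('k, 'a, 'g) E_elem \<Rightarrow> 'k) module" where
  "link_block k A G rep c = mat_alg (card c) (monoid_alg k (Gamma k A G (rep c)))"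

end

theory Submission
  imports Defs
begin

text \<open>
  Write \<open>U\<^sub>\<phi>\<close> for the subgroup of \<open>A \<times> G \<times> G\<close> belonging to a pair \<open>(U, \<phi>)\<close>; the pairs correspond to
  the subgroups that meet \<open>A\<close> trivially. Call such a subgroup covering if both of its projections
  to \<open>G\<close> are onto. For covering subgroups the Mackey formula for the tensor product has a single
  term: the product of the classes of \<open>W\<close> and \<open>W'\<close> is the class of the composite relation
  \<open>rel_comp W W'\<close>, or zero if this composite meets \<open>A\<close> nontrivially (lemma \<open>\<beta>_mult\<close>). The classes
  of covering subgroups are linearly independent, because the number of orbits with a given point
  stabilizer is additive on bisets and separates them (if \<open>\<one> \<noteq> \<zero>\<close> in \<open>k\<close>). So
  the nonzero elements of a finite semigroup with zero form a basis of \<open>E\<^sub>G\<^sup>c\<close>, and the zero of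
  the semigroup is the zero of the algebra.

  This semigroup is an inverse semigroup (lemma \<open>inverse_semigroup\<close>). The inverse of a class is the
  class of the opposite subgroup; the idempotents are the \<open>e\<^bsub>(K, \<kappa>)\<^esub>\<close> for fixed pairs \<open>(K, \<kappa>)\<close>;
  and \<open>s s\<^sup>-\<^sup>1\<close>, \<open>s\<^sup>-\<^sup>1 s\<close> are the idempotents of the left and the right kernel of \<open>s\<close> together with
  their characters. Hence linkage is the relation that some \<open>s\<close> leads from one fixed pair to the
  other, and \<open>\<Gamma>\<^bsub>(G, K, \<kappa>)\<^esub>\<close> is the group of all \<open>s\<close> leading from \<open>(K, \<kappa>)\<close> to itself.

  For a finite inverse semigroup, the algebra is isomorphic to the algebra of the groupoid with the
  same nonzero elements, where only elements with matching idempotents are composable: \<open>psi\<close> sends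
  \<open>s\<close> to the sum of its restrictions \<open>e q \<otimes> s\<close>, over all fixed pairs \<open>q\<close> above the left kernel of
  \<open>s\<close>. It is multiplicative because the restriction of \<open>s\<close> to \<open>q\<close> is composable with a restriction
  of \<open>t\<close> exactly if \<open>s \<otimes> t\<close> is nonzero and has a restriction to \<open>q\<close>; for subgroups this is lemma
  \<open>lker_le_rker_act\<close>. It is bijective by Moebius inversion. The groupoid algebra is in turn a
  direct sum of matrix algebras over the algebras of its vertex groups, one for each connected
  component, that is, for each linkage class (\<open>tag\<close>, \<open>munit\<close>).

  The matrix unit at the diagonal position of \<open>p\<close> is the identity arrow of \<open>p\<close>. Its preimage
  under \<open>psi\<close> is the Moebius inversion of the idempotents \<open>e q\<close> over the fixed pairs \<open>q\<close> above \<open>p\<close>.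
  Intervals of fixed pairs are intervals of normal subgroups (lemma \<open>moebius_sum\<close>), so this
  preimage is \<open>f\<^sub>p\<close>. The isomorphism of the theorem is the inverse \<open>phi\<close> of \<open>psi\<close>.
\<close>

section \<open>Linear maps and bilinear algebras\<close>

definition lin_map ::
  "('k, 'r) ring_scheme \<Rightarrow> ('k, 'x, 'm) module_scheme \<Rightarrow> ('k, 'y, 'n) module_scheme
    \<Rightarrow> ('x \<Rightarrow> 'y) \<Rightarrow> bool" where
  "lin_map R B C h \<longleftrightarrow> h \<in> carrier B \<rightarrow> carrier C \<and>
     (\<forall>x \<in> carrier B. \<forall>y \<in> carrier B. h (x \<oplus>\<^bsub>B\<^esub> y) = h x \<oplus>\<^bsub>C\<^esub> h y) \<and>
     (\<forall>c \<in> carrier R. \<forall>x \<in> carrier B. h (c \<odot>\<^bsub>B\<^esub> x) = c \<odot>\<^bsub>C\<^esub> h x)"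

lemma lin_mapI:
  assumes "\<And>x. x \<in> carrier B \<Longrightarrow> h x \<in> carrier C"
    and "\<And>x y. x \<in> carrier B \<Longrightarrow> y \<in> carrier B \<Longrightarrow> h (x \<oplus>\<^bsub>B\<^esub> y) = h x \<oplus>\<^bsub>C\<^esub> h y"
    and "\<And>c x. c \<in> carrier R \<Longrightarrow> x \<in> carrier B \<Longrightarrow> h (c \<odot>\<^bsub>B\<^esub> x) = c \<odot>\<^bsub>C\<^esub> h x"
  shows "lin_map R B C h"
  using assms by (auto simp: lin_map_def)

lemma lin_mapD:
  assumes "lin_map R B C h"
  shows "\<And>x. x \<in> carrier B \<Longrightarrow> h x \<in> carrier C"
    and "\<And>x y. x \<in> carrier B \<Longrightarrow> y \<in> carrier B \<Longrightarrow> h (x \<oplus>\<^bsub>B\<^esub> y) = h x \<oplus>\<^bsub>C\<^esub> h y"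
    and "\<And>c x. c \<in> carrier R \<Longrightarrow> x \<in> carrier B \<Longrightarrow> h (c \<odot>\<^bsub>B\<^esub> x) = c \<odot>\<^bsub>C\<^esub> h x"
  using assms by (auto simp: lin_map_def)

lemma lin_map_comp:
  assumes "lin_map R B C h" and "lin_map R C D g"
  shows "lin_map R B D (\<lambda>x. g (h x))"
  using assms by (auto simp: lin_map_def Pi_iff)

lemma lin_map_zero:
  assumes "module R B" and "module R C" and h: "lin_map R B C h"
  shows "h \<zero>\<^bsub>B\<^esub> = \<zero>\<^bsub>C\<^esub>"
proof -
  interpret B: module R B by fact
  interpret C: module R C by fact
  have "h (\<zero>\<^bsub>R\<^esub> \<odot>\<^bsub>B\<^esub> \<zero>\<^bsub>B\<^esub>) = \<zero>\<^bsub>R\<^esub> \<odot>\<^bsub>C\<^esub> h \<zero>\<^bsub>B\<^esub>"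
    using lin_mapD(3)[OF h B.R.zero_closed B.M.zero_closed] .
  then show ?thesis using lin_mapD(1)[OF h] by simp
qed

lemma lin_map_neg:
  assumes "module R B" and "module R C" and h: "lin_map R B C h" and x: "x \<in> carrier B"
  shows "h (\<ominus>\<^bsub>B\<^esub> x) = \<ominus>\<^bsub>C\<^esub> h x"
proof -
  interpret B: module R B by fact
  interpret C: module R C by fact
  have "h (\<ominus>\<^bsub>B\<^esub> x) \<oplus>\<^bsub>C\<^esub> h x = \<zero>\<^bsub>C\<^esub>"
    using lin_mapD(2)[OF h, of "\<ominus>\<^bsub>B\<^esub> x" x] x lin_map_zero[OF assms(1-3)] by (simp add: B.l_neg)
  then show ?thesis
    using lin_mapD(1)[OF h] x by (metis B.M.a_inv_closed C.M.minus_equality)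
qed

lemma lin_map_minus:
  assumes "module R B" and "module R C" and h: "lin_map R B C h"
    and x: "x \<in> carrier B" and y: "y \<in> carrier B"
  shows "h (x \<ominus>\<^bsub>B\<^esub> y) = h x \<ominus>\<^bsub>C\<^esub> h y"
proof -
  interpret B: module R B by fact
  show ?thesis using lin_mapD(2)[OF h x B.M.a_inv_closed[OF y]] lin_map_neg[OF assms(1-3) y]
    by (simp add: a_minus_def)
qed

lemma lin_map_finsum:
  assumes "module R B" and "module R C" and h: "lin_map R B C h" and f: "f \<in> I \<rightarrow> carrier B"
  shows "h (finsum B f I) = finsum C (\<lambda>i. h (f i)) I"
proof -
  interpret B: module R B by fact
  interpret C: module R C by fact
  note z = lin_map_zero[OF assms(1-3)]
  show ?thesis using f
  proof (induction I rule: infinite_finite_induct)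
    case (insert x F)
    then show ?case using lin_mapD[OF h] by (simp add: Pi_iff)
  qed (use z in auto)
qed

lemma submodule_vimage:
  assumes "module R B" and "module R C" and h: "lin_map R B C h" and N: "submodule N R C"
  shows "submodule {x \<in> carrier B. h x \<in> N} R B"
proof -
  interpret B: module R B by fact
  interpret C: module R C by fact
  note zero = lin_map_zero[OF assms(1-3)] and neg = lin_map_neg[OF assms(1-3)]
  show ?thesis
  proof (rule B.submoduleI)
    show "\<zero>\<^bsub>B\<^esub> \<in> {x \<in> carrier B. h x \<in> N}"
      using subgroup.one_closed[OF submodule.axioms(1)[OF N]] by (simp add: zero)
  qed (auto simp: neg lin_mapD[OF h] C.submoduleE(3-5)[OF N])
qed

lemma submodule_equalizer:
  assumes "module R B" and "module R C" and h: "lin_map R B C h" and h': "lin_map R B C h'"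
  shows "submodule {x \<in> carrier B. h x = h' x} R B"
proof -
  interpret B: module R B by fact
  interpret C: module R C by fact
  show ?thesis
    by (rule B.submoduleI)
      (auto simp: lin_mapD[OF h] lin_map_zero[OF assms(1-3)] lin_map_neg[OF assms(1-3)]
        lin_mapD[OF h'] lin_map_zero[OF assms(1,2,4)] lin_map_neg[OF assms(1,2,4)])
qed

context module
begin

lemma submodule_zero: "submodule N R M \<Longrightarrow> \<zero>\<^bsub>M\<^esub> \<in> N"
  using subgroup.one_closed[OF submodule.axioms(1)] by fastforce

lemma submodule_Inter:
  assumes "\<And>N. N \<in> \<N> \<Longrightarrow> submodule N R M" and "\<N> \<noteq> {}"
  shows "submodule (\<Inter>\<N>) R M"
proof (rule submoduleI)
  show "\<Inter>\<N> \<subseteq> carrier M" using assms(2) submoduleE(1)[OF assms(1)] by auto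
qed (use submodule_zero[OF assms(1)] submoduleE(3-5)[OF assms(1)] in auto)

lemma lin_span_submodule:
  assumes "S \<subseteq> carrier M"
  shows "submodule (lin_span R M S) R M"
  unfolding lin_span_def using assms carrier_is_submodule by (intro submodule_Inter) auto

lemma lin_span_incl: "S \<subseteq> lin_span R M S"
  by (auto simp: lin_span_def)

lemma lin_span_min: "submodule N R M \<Longrightarrow> S \<subseteq> N \<Longrightarrow> lin_span R M S \<subseteq> N"
  by (auto simp: lin_span_def)

lemma lin_span_carrier: "S \<subseteq> carrier M \<Longrightarrow> lin_span R M S \<subseteq> carrier M"
  using lin_span_min[OF carrier_is_submodule] .

lemma submodule_finsum:
  assumes "submodule N R M" and "f \<in> I \<rightarrow> N"
  shows "finsum M f I \<in> N"
  using assms(2)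
proof (induction I rule: infinite_finite_induct)
  case (insert x F)
  then have "f x \<in> N" "f \<in> F \<rightarrow> N" "f \<in> insert x F \<rightarrow> carrier M"
    using submoduleE(1)[OF assms(1)] by auto
  with insert show ?case by (simp add: submoduleE(5)[OF assms(1)])
qed (use submodule_zero[OF assms(1)] in auto)

lemma finsum_swap:
  assumes "finite I" and "finite J" and "\<And>i j. i \<in> I \<Longrightarrow> j \<in> J \<Longrightarrow> f i j \<in> carrier M"
  shows "(\<Oplus>\<^bsub>M\<^esub>i\<in>I. \<Oplus>\<^bsub>M\<^esub>j\<in>J. f i j) = (\<Oplus>\<^bsub>M\<^esub>j\<in>J. \<Oplus>\<^bsub>M\<^esub>i\<in>I. f i j)"
  using assms
proof (induction I rule: finite_induct)
  case (insert x F)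
  then have "(\<Oplus>\<^bsub>M\<^esub>i\<in>insert x F. \<Oplus>\<^bsub>M\<^esub>j\<in>J. f i j)
      = (\<Oplus>\<^bsub>M\<^esub>j\<in>J. f x j) \<oplus>\<^bsub>M\<^esub> (\<Oplus>\<^bsub>M\<^esub>j\<in>J. \<Oplus>\<^bsub>M\<^esub>i\<in>F. f i j)"
    by (subst M.finsum_insert) auto
  also have "\<dots> = (\<Oplus>\<^bsub>M\<^esub>j\<in>J. f x j \<oplus>\<^bsub>M\<^esub> (\<Oplus>\<^bsub>M\<^esub>i\<in>F. f i j))"
    using insert by (subst M.finsum_addf) auto
  also have "\<dots> = (\<Oplus>\<^bsub>M\<^esub>j\<in>J. \<Oplus>\<^bsub>M\<^esub>i\<in>insert x F. f i j)"
    using insert by (intro M.finsum_cong') (auto simp: Pi_iff)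
  finally show ?case .
qed (auto simp: M.finsum_zero)

lemma finsum_if:
  assumes "finite I" and "\<And>i. i \<in> I \<Longrightarrow> P i \<Longrightarrow> f i \<in> carrier M"
  shows "finsum M f {i \<in> I. P i} = (\<Oplus>\<^bsub>M\<^esub>i\<in>I. if P i then f i else \<zero>\<^bsub>M\<^esub>)"
  using assms by (intro M.add.finprod_mono_neutral_cong_left) auto

lemma add_pow_int_smult:
  assumes "x \<in> carrier M"
  shows "[(n::int)] \<cdot>\<^bsub>M\<^esub> x = ([n] \<cdot>\<^bsub>R\<^esub> \<one>\<^bsub>R\<^esub>) \<odot>\<^bsub>M\<^esub> x"
proof -
  have nat: "[(m::nat)] \<cdot>\<^bsub>M\<^esub> x = ([m] \<cdot>\<^bsub>R\<^esub> \<one>\<^bsub>R\<^esub>) \<odot>\<^bsub>M\<^esub> x" for m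
    by (induction m) (use assms in \<open>auto simp: smult_l_distr\<close>)
  show ?thesis
  proof (cases n rule: int_cases2)
    case (nonneg m)
    then show ?thesis using nat[of m] by (simp add: add_pow_def int_pow_int)
  next
    case (nonpos m)
    have "[n] \<cdot>\<^bsub>M\<^esub> x = \<ominus>\<^bsub>M\<^esub> ([m] \<cdot>\<^bsub>M\<^esub> x)"
      using M.add.int_pow_neg_int[OF assms, of m] nonpos by (simp add: add_pow_def a_inv_def)
    moreover have "[n] \<cdot>\<^bsub>R\<^esub> \<one>\<^bsub>R\<^esub> = \<ominus>\<^bsub>R\<^esub> ([m] \<cdot>\<^bsub>R\<^esub> \<one>\<^bsub>R\<^esub>)"
      using R.add.int_pow_neg_int[OF R.one_closed, of m] nonpos by (simp add: add_pow_def a_inv_def)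
    ultimately show ?thesis using nat[of m] assms by (simp add: smult_l_minus)
  qed
qed

end

lemma (in abelian_group) add_pow_int_sum:
  assumes "finite I" and "x \<in> carrier G"
  shows "[(\<Sum>i\<in>I. n i :: int)] \<cdot> x = (\<Oplus>i\<in>I. [n i] \<cdot> x)"
  using assms
proof (induction I rule: finite_induct)
  case (insert i F)
  have closed: "[m] \<cdot> x \<in> carrier G" for m :: int
    using insert.prems add.int_pow_closed[of x m] by (simp add: add_pow_def)
  have "[(n i + sum n F)] \<cdot> x = [n i] \<cdot> x \<oplus> [sum n F] \<cdot> x"
    using insert.prems add.int_pow_mult[of x "n i" "sum n F"] by (simp add: add_pow_def)
  then show ?case using insert closed by (simp add: Pi_iff)
qed (simp add: add_pow_def)

text \<open>
  An identity between products of elements of two spans is checked on generators: by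
  bilinearity, the elements that satisfy it with a fixed factor form a submodule
  (\<open>submodule_equalizer\<close>, \<open>lin_span_mult\<close>).
\<close>

locale bilinear_algebra = module R B for R (structure) and B (structure) +
  assumes bilin_closed [simp, intro]:
      "x \<in> carrier B \<Longrightarrow> y \<in> carrier B \<Longrightarrow> x \<otimes>\<^bsub>B\<^esub> y \<in> carrier B"
    and bilin_add_left:
      "x \<in> carrier B \<Longrightarrow> x' \<in> carrier B \<Longrightarrow> y \<in> carrier B
        \<Longrightarrow> (x \<oplus>\<^bsub>B\<^esub> x') \<otimes>\<^bsub>B\<^esub> y = x \<otimes>\<^bsub>B\<^esub> y \<oplus>\<^bsub>B\<^esub> x' \<otimes>\<^bsub>B\<^esub> y"
    and bilin_add_right:
      "x \<in> carrier B \<Longrightarrow> y \<in> carrier B \<Longrightarrow> y' \<in> carrier B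
        \<Longrightarrow> x \<otimes>\<^bsub>B\<^esub> (y \<oplus>\<^bsub>B\<^esub> y') = x \<otimes>\<^bsub>B\<^esub> y \<oplus>\<^bsub>B\<^esub> x \<otimes>\<^bsub>B\<^esub> y'"
    and bilin_smult_left:
      "c \<in> carrier R \<Longrightarrow> x \<in> carrier B \<Longrightarrow> y \<in> carrier B
        \<Longrightarrow> (c \<odot>\<^bsub>B\<^esub> x) \<otimes>\<^bsub>B\<^esub> y = c \<odot>\<^bsub>B\<^esub> (x \<otimes>\<^bsub>B\<^esub> y)"
    and bilin_smult_right:
      "c \<in> carrier R \<Longrightarrow> x \<in> carrier B \<Longrightarrow> y \<in> carrier B
        \<Longrightarrow> x \<otimes>\<^bsub>B\<^esub> (c \<odot>\<^bsub>B\<^esub> y) = c \<odot>\<^bsub>B\<^esub> (x \<otimes>\<^bsub>B\<^esub> y)"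
begin

lemma lin_map_mult_left: "x \<in> carrier B \<Longrightarrow> lin_map R B B (\<lambda>y. x \<otimes>\<^bsub>B\<^esub> y)"
  by (intro lin_mapI) (auto simp: bilin_add_right bilin_smult_right)

lemma lin_map_mult_right: "y \<in> carrier B \<Longrightarrow> lin_map R B B (\<lambda>x. x \<otimes>\<^bsub>B\<^esub> y)"
  by (intro lin_mapI) (auto simp: bilin_add_left bilin_smult_left)

lemma mult_zero_left: "x \<in> carrier B \<Longrightarrow> \<zero>\<^bsub>B\<^esub> \<otimes>\<^bsub>B\<^esub> x = \<zero>\<^bsub>B\<^esub>"
  using lin_map_zero[OF module_axioms module_axioms lin_map_mult_right] .

lemma mult_zero_right: "x \<in> carrier B \<Longrightarrow> x \<otimes>\<^bsub>B\<^esub> \<zero>\<^bsub>B\<^esub> = \<zero>\<^bsub>B\<^esub>"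
  using lin_map_zero[OF module_axioms module_axioms lin_map_mult_left] .

lemma lin_span_mult:
  assumes S: "S \<subseteq> carrier B" and S': "S' \<subseteq> carrier B" and N: "submodule N R B"
    and mult: "\<And>x y. x \<in> S \<Longrightarrow> y \<in> S' \<Longrightarrow> x \<otimes>\<^bsub>B\<^esub> y \<in> N"
    and x: "x \<in> lin_span R B S" and y: "y \<in> lin_span R B S'"
  shows "x \<otimes>\<^bsub>B\<^esub> y \<in> N"
proof -
  have 1: "s \<otimes>\<^bsub>B\<^esub> y \<in> N" if s: "s \<in> S" for s
  proof -
    have "submodule {z \<in> carrier B. s \<otimes>\<^bsub>B\<^esub> z \<in> N} R B"
      using s S by (intro submodule_vimage[OF module_axioms module_axioms lin_map_mult_left N]) auto
    then have "lin_span R B S' \<subseteq> {z \<in> carrier B. s \<otimes>\<^bsub>B\<^esub> z \<in> N}"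
      using mult s S' by (intro lin_span_min) auto
    then show ?thesis using y by auto
  qed
  have yc: "y \<in> carrier B" using y lin_span_carrier[OF S'] by auto
  have "submodule {z \<in> carrier B. z \<otimes>\<^bsub>B\<^esub> y \<in> N} R B"
    by (intro submodule_vimage[OF module_axioms module_axioms lin_map_mult_right[OF yc] N])
  then have "lin_span R B S \<subseteq> {z \<in> carrier B. z \<otimes>\<^bsub>B\<^esub> y \<in> N}"
    using 1 S by (intro lin_span_min) auto
  then show ?thesis using x by auto
qed

end

section \<open>Monoid algebras, matrix algebras and direct sums\<close>

text \<open>
  The common source of the three module structures: functions with pointwise operations.
  The carrier may be a proper subset of the product, as for finitely supported functions.
\<close>

lemma pointwise_module:
  assumes R: "cring R" and B: "\<And>j. j \<in> J \<Longrightarrow> module R (B j)"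
    and sub: "carrier C \<subseteq> (\<Pi>\<^sub>E j\<in>J. carrier (B j))"
    and zero_eq: "\<zero>\<^bsub>C\<^esub> = (\<lambda>j\<in>J. \<zero>\<^bsub>B j\<^esub>)" and zero: "\<zero>\<^bsub>C\<^esub> \<in> carrier C"
    and add_eq: "\<And>x y. x \<in> carrier C \<Longrightarrow> y \<in> carrier C \<Longrightarrow> x \<oplus>\<^bsub>C\<^esub> y = (\<lambda>j\<in>J. x j \<oplus>\<^bsub>B j\<^esub> y j)"
    and add: "\<And>x y. x \<in> carrier C \<Longrightarrow> y \<in> carrier C \<Longrightarrow> x \<oplus>\<^bsub>C\<^esub> y \<in> carrier C"
    and smult_eq: "\<And>c x. c \<in> carrier R \<Longrightarrow> x \<in> carrier C \<Longrightarrow> c \<odot>\<^bsub>C\<^esub> x = (\<lambda>j\<in>J. c \<odot>\<^bsub>B j\<^esub> x j)"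
    and smult: "\<And>c x. c \<in> carrier R \<Longrightarrow> x \<in> carrier C \<Longrightarrow> c \<odot>\<^bsub>C\<^esub> x \<in> carrier C"
  shows "module R C"
proof -
  interpret R: cring R by fact
  have ev: "x j \<in> carrier (B j)" if "x \<in> carrier C" "j \<in> J" for x j
    using that sub by auto
  have ext: "x \<in> extensional J" if "x \<in> carrier C" for x
    using that sub by (auto simp: PiE_def)
  note abgrp = module.axioms(2)[OF B]
  note intros = abelian_groupE[OF abgrp]
  show ?thesis
  proof (rule moduleI)
    show "abelian_group C"
    proof (rule abelian_groupI)
      fix x assume x: "x \<in> carrier C"
      show "\<zero>\<^bsub>C\<^esub> \<oplus>\<^bsub>C\<^esub> x = x"
        using x zero ext[OF x]
        by (auto simp: add_eq ev intros(5) zero_eq extensional_def restrict_def)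
      show "\<exists>y\<in>carrier C. y \<oplus>\<^bsub>C\<^esub> x = \<zero>\<^bsub>C\<^esub>"
      proof (rule bexI)
        show m: "(\<ominus>\<^bsub>R\<^esub> \<one>\<^bsub>R\<^esub>) \<odot>\<^bsub>C\<^esub> x \<in> carrier C" using x by (intro smult) auto
        have "\<ominus>\<^bsub>R\<^esub> \<one>\<^bsub>R\<^esub> \<odot>\<^bsub>B j\<^esub> x j \<oplus>\<^bsub>B j\<^esub> x j = \<zero>\<^bsub>B j\<^esub>" if j: "j \<in> J" for j
        proof -
          interpret Bj: module R "B j" using B[OF j] .
          show ?thesis using ev[OF x j] by (simp add: Bj.smult_l_minus Bj.M.l_neg)
        qed
        then show "(\<ominus>\<^bsub>R\<^esub> \<one>\<^bsub>R\<^esub>) \<odot>\<^bsub>C\<^esub> x \<oplus>\<^bsub>C\<^esub> x = \<zero>\<^bsub>C\<^esub>"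
          using x m by (auto simp: add_eq smult_eq zero_eq intro!: restrict_ext)
      qed
      fix y assume y: "y \<in> carrier C"
      show "x \<oplus>\<^bsub>C\<^esub> y \<in> carrier C" using x y by (rule add)
      show "x \<oplus>\<^bsub>C\<^esub> y = y \<oplus>\<^bsub>C\<^esub> x"
        using x y by (auto simp: add_eq ev intros(4) intro!: restrict_ext)
      fix z assume z: "z \<in> carrier C"
      show "x \<oplus>\<^bsub>C\<^esub> y \<oplus>\<^bsub>C\<^esub> z = x \<oplus>\<^bsub>C\<^esub> (y \<oplus>\<^bsub>C\<^esub> z)"
        unfolding add_eq[OF add[OF x y] z] add_eq[OF x add[OF y z]]
        using x y z by (auto simp: add_eq[OF x y] add_eq[OF y z] ev intros(3) intro!: restrict_ext)
    qed (fact zero)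
    fix x assume x: "x \<in> carrier C"
    have one: "(\<lambda>j\<in>J. \<one>\<^bsub>R\<^esub> \<odot>\<^bsub>B j\<^esub> x j) = (\<lambda>j\<in>J. x j)"
      using x by (intro restrict_ext) (simp add: module.smult_one[OF B] ev)
    show "\<one>\<^bsub>R\<^esub> \<odot>\<^bsub>C\<^esub> x = x"
      using x ext[OF x] by (simp add: smult_eq one extensional_restrict)
    fix a assume a: "a \<in> carrier R"
    show "a \<odot>\<^bsub>C\<^esub> x \<in> carrier C" using a x by (rule smult)
    {
      fix y assume y: "y \<in> carrier C"
      show "a \<odot>\<^bsub>C\<^esub> (x \<oplus>\<^bsub>C\<^esub> y) = a \<odot>\<^bsub>C\<^esub> x \<oplus>\<^bsub>C\<^esub> a \<odot>\<^bsub>C\<^esub> y"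
        using a x y smult[OF a x] smult[OF a y] add[OF x y]
        by (simp add: add_eq smult_eq module.smult_r_distr[OF B] ev
            cong: restrict_cong)
    }
    fix b assume b: "b \<in> carrier R"
    show "(a \<oplus>\<^bsub>R\<^esub> b) \<odot>\<^bsub>C\<^esub> x = a \<odot>\<^bsub>C\<^esub> x \<oplus>\<^bsub>C\<^esub> b \<odot>\<^bsub>C\<^esub> x"
      using a b x smult[OF a x] smult[OF b x]
      by (auto simp: add_eq smult_eq module.smult_l_distr[OF B] ev intro!: restrict_ext)
    show "(a \<otimes>\<^bsub>R\<^esub> b) \<odot>\<^bsub>C\<^esub> x = a \<odot>\<^bsub>C\<^esub> (b \<odot>\<^bsub>C\<^esub> x)"
      unfolding smult_eq[OF a smult[OF b x]] smult_eq[OF R.m_closed[OF a b] x]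
      unfolding smult_eq[OF b x] using a b x by (auto simp: module.smult_assoc1[OF B] ev intro!: restrict_ext)
  qed fact
qed

lemma dsum_alg_bilinear:
  assumes R: "cring R" and B: "\<And>j. j \<in> J \<Longrightarrow> bilinear_algebra R (B j)"
  shows "bilinear_algebra R (dsum_alg J B)"
proof -
  note mod = bilinear_algebra.axioms(1)[OF B]
  have closed: "\<zero>\<^bsub>B j\<^esub> \<in> carrier (B j)"
    "x \<in> carrier (B j) \<Longrightarrow> y \<in> carrier (B j) \<Longrightarrow> x \<oplus>\<^bsub>B j\<^esub> y \<in> carrier (B j)"
    "c \<in> carrier R \<Longrightarrow> x \<in> carrier (B j) \<Longrightarrow> c \<odot>\<^bsub>B j\<^esub> x \<in> carrier (B j)"
    "x \<in> carrier (B j) \<Longrightarrow> y \<in> carrier (B j) \<Longrightarrow> x \<otimes>\<^bsub>B j\<^esub> y \<in> carrier (B j)"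
    if "j \<in> J" for j x y c
  proof -
    interpret bilinear_algebra R "B j" using B[OF that] .
    show "\<zero>\<^bsub>B j\<^esub> \<in> carrier (B j)"
    "x \<in> carrier (B j) \<Longrightarrow> y \<in> carrier (B j) \<Longrightarrow> x \<oplus>\<^bsub>B j\<^esub> y \<in> carrier (B j)"
    "c \<in> carrier R \<Longrightarrow> x \<in> carrier (B j) \<Longrightarrow> c \<odot>\<^bsub>B j\<^esub> x \<in> carrier (B j)"
    "x \<in> carrier (B j) \<Longrightarrow> y \<in> carrier (B j) \<Longrightarrow> x \<otimes>\<^bsub>B j\<^esub> y \<in> carrier (B j)" by auto
  qed
  have "module R (dsum_alg J B)"
    by (rule pointwise_module[where J = J and B = B])
      (use R mod in \<open>auto simp: dsum_alg_def closed PiE_iff\<close>)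
  then show ?thesis
    by (rule bilinear_algebra.intro, unfold_locales)
      (auto simp: dsum_alg_def PiE_iff closed bilinear_algebra.bilin_add_left[OF B]
        bilinear_algebra.bilin_add_right[OF B] bilinear_algebra.bilin_smult_left[OF B]
        bilinear_algebra.bilin_smult_right[OF B] cong: restrict_cong)
qed

lemma mat_alg_bilinear:
  assumes "bilinear_algebra R B"
  shows "bilinear_algebra R (mat_alg n B)"
proof -
  interpret B: bilinear_algebra R B by fact
  let ?C = "mat_alg n B"
  have mod: "module R ?C"
    by (rule pointwise_module[where J = "{..<n} \<times> {..<n}" and B = "\<lambda>_. B"])
      (use B.R.is_cring B.module_axioms in \<open>auto simp: mat_alg_def PiE_iff\<close>)
  interpret C: module R ?C by (rule mod)
  have ev: "x (i, j) \<in> carrier B" if "x \<in> carrier ?C" "i < n" "j < n" for x i j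
    using that by (auto simp: mat_alg_def)
  have eqI: "x = y" if "x \<in> carrier ?C" "y \<in> carrier ?C"
    "\<And>i j. i < n \<Longrightarrow> j < n \<Longrightarrow> x (i, j) = y (i, j)" for x y
    using that by (intro PiE_ext[of x "{..<n} \<times> {..<n}" "\<lambda>_. carrier B" y]) (auto simp: mat_alg_def)
  have add: "(x \<oplus>\<^bsub>?C\<^esub> y) (i, j) = x (i, j) \<oplus>\<^bsub>B\<^esub> y (i, j)" if "i < n" "j < n" for x y i j
    using that by (simp add: mat_alg_def)
  have smult: "(c \<odot>\<^bsub>?C\<^esub> x) (i, j) = c \<odot>\<^bsub>B\<^esub> x (i, j)" if "i < n" "j < n" for x c i j
    using that by (simp add: mat_alg_def)
  have mult: "(x \<otimes>\<^bsub>?C\<^esub> y) (i, j) = (\<Oplus>\<^bsub>B\<^esub>l\<in>{..<n}. x (i, l) \<otimes>\<^bsub>B\<^esub> y (l, j))"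
    if "i < n" "j < n" for x y i j using that by (simp add: mat_alg_def)
  have closed: "x \<otimes>\<^bsub>?C\<^esub> y \<in> carrier ?C" if "x \<in> carrier ?C" "y \<in> carrier ?C" for x y
    using that by (auto simp: mat_alg_def PiE_iff intro!: B.M.finsum_closed)
  have "bilinear_algebra_axioms R ?C"
  proof
    fix x y assume x: "x \<in> carrier ?C" and y: "y \<in> carrier ?C"
    show "x \<otimes>\<^bsub>?C\<^esub> y \<in> carrier ?C" by (rule closed[OF x y])
    {
      fix x' assume x': "x' \<in> carrier ?C"
      show "(x \<oplus>\<^bsub>?C\<^esub> x') \<otimes>\<^bsub>?C\<^esub> y = x \<otimes>\<^bsub>?C\<^esub> y \<oplus>\<^bsub>?C\<^esub> x' \<otimes>\<^bsub>?C\<^esub> y"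
      proof (rule eqI)
        fix i j assume ij: "i < n" "j < n"
        show "((x \<oplus>\<^bsub>?C\<^esub> x') \<otimes>\<^bsub>?C\<^esub> y) (i, j) = (x \<otimes>\<^bsub>?C\<^esub> y \<oplus>\<^bsub>?C\<^esub> x' \<otimes>\<^bsub>?C\<^esub> y) (i, j)"
          unfolding add[OF ij] mult[OF ij] using ij
          by (subst B.M.finsum_addf[symmetric])
            (auto simp: ev x x' y B.bilin_add_left add simp del: B.M.add.finprod_multf intro!: B.M.finsum_cong')
      qed (intro closed C.a_closed x x' y)+
      show "y \<otimes>\<^bsub>?C\<^esub> (x \<oplus>\<^bsub>?C\<^esub> x') = y \<otimes>\<^bsub>?C\<^esub> x \<oplus>\<^bsub>?C\<^esub> y \<otimes>\<^bsub>?C\<^esub> x'"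
      proof (rule eqI)
        fix i j assume ij: "i < n" "j < n"
        show "(y \<otimes>\<^bsub>?C\<^esub> (x \<oplus>\<^bsub>?C\<^esub> x')) (i, j) = (y \<otimes>\<^bsub>?C\<^esub> x \<oplus>\<^bsub>?C\<^esub> y \<otimes>\<^bsub>?C\<^esub> x') (i, j)"
          unfolding add[OF ij] mult[OF ij] using ij
          by (subst B.M.finsum_addf[symmetric])
            (auto simp: ev x x' y B.bilin_add_right add simp del: B.M.add.finprod_multf intro!: B.M.finsum_cong')
      qed (intro closed C.a_closed x x' y)+
    }
    fix c assume c: "c \<in> carrier R"
    show "(c \<odot>\<^bsub>?C\<^esub> x) \<otimes>\<^bsub>?C\<^esub> y = c \<odot>\<^bsub>?C\<^esub> (x \<otimes>\<^bsub>?C\<^esub> y)"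
    proof (rule eqI)
      fix i j assume ij: "i < n" "j < n"
      show "((c \<odot>\<^bsub>?C\<^esub> x) \<otimes>\<^bsub>?C\<^esub> y) (i, j) = (c \<odot>\<^bsub>?C\<^esub> (x \<otimes>\<^bsub>?C\<^esub> y)) (i, j)"
        unfolding smult[OF ij] mult[OF ij] using ij c
        by (subst B.finsum_smult_ldistr)
          (auto simp: ev x y B.bilin_smult_left smult simp del: B.M.add.finprod_multf intro!: B.M.finsum_cong')
    qed (intro closed C.smult_closed c x y)+
    show "x \<otimes>\<^bsub>?C\<^esub> (c \<odot>\<^bsub>?C\<^esub> y) = c \<odot>\<^bsub>?C\<^esub> (x \<otimes>\<^bsub>?C\<^esub> y)"
    proof (rule eqI)
      fix i j assume ij: "i < n" "j < n"
      show "(x \<otimes>\<^bsub>?C\<^esub> (c \<odot>\<^bsub>?C\<^esub> y)) (i, j) = (c \<odot>\<^bsub>?C\<^esub> (x \<otimes>\<^bsub>?C\<^esub> y)) (i, j)"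
        unfolding smult[OF ij] mult[OF ij] using ij c
        by (subst B.finsum_smult_ldistr)
          (auto simp: ev x y B.bilin_smult_right smult simp del: B.M.add.finprod_multf intro!: B.M.finsum_cong')
    qed (intro closed C.smult_closed c x y)+
  qed
  with mod show ?thesis by (rule bilinear_algebra.intro)
qed

definition self_module :: "('k, 'r) ring_scheme \<Rightarrow> ('k, 'k) module" where
  "self_module R = \<lparr>carrier = carrier R, mult = mult R, one = \<one>\<^bsub>R\<^esub>, zero = \<zero>\<^bsub>R\<^esub>,
    add = add R, smult = mult R\<rparr>"

lemma self_module_simps [simp]:
  "carrier (self_module R) = carrier R"
  "add (self_module R) = add R" "zero (self_module R) = zero R" "smult (self_module R) = mult R"
  by (simp_all add: self_module_def)

lemma (in cring) self_module: "module R (self_module R)"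
proof (rule moduleI)
  show "abelian_group (self_module R)"
  proof (rule abelian_groupI)
    fix x assume "x \<in> carrier (self_module R)"
    then show "\<exists>y\<in>carrier (self_module R). y \<oplus>\<^bsub>self_module R\<^esub> x = \<zero>\<^bsub>self_module R\<^esub>"
      by (intro bexI[of _ "\<ominus> x"]) (auto simp: l_neg)
  qed (simp_all add: a_ac)
qed (simp_all add: is_cring l_distr r_distr m_assoc)

lemma monoid_alg_simps:
  "carrier (monoid_alg R M) = {f \<in> carrier M \<rightarrow>\<^sub>E carrier R. finite (supp R M f)}"
  "f \<otimes>\<^bsub>monoid_alg R M\<^esub> g = (\<lambda>z\<in>carrier M. finsum R (\<lambda>(x, y). f x \<otimes>\<^bsub>R\<^esub> g y)
     {(x, y). x \<in> supp R M f \<and> y \<in> supp R M g \<and> x \<otimes>\<^bsub>M\<^esub> y = z})"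
  "\<one>\<^bsub>monoid_alg R M\<^esub> = delta R M \<one>\<^bsub>M\<^esub>"
  "\<zero>\<^bsub>monoid_alg R M\<^esub> = (\<lambda>x\<in>carrier M. \<zero>\<^bsub>R\<^esub>)"
  "f \<oplus>\<^bsub>monoid_alg R M\<^esub> g = (\<lambda>x\<in>carrier M. f x \<oplus>\<^bsub>R\<^esub> g x)"
  "c \<odot>\<^bsub>monoid_alg R M\<^esub> f = (\<lambda>x\<in>carrier M. c \<otimes>\<^bsub>R\<^esub> f x)"
  by (simp_all add: monoid_alg_def)

locale monoid_algebra = R?: cring R for R (structure) + fixes M (structure)
  assumes M_closed: "x \<in> carrier M \<Longrightarrow> y \<in> carrier M \<Longrightarrow> x \<otimes>\<^bsub>M\<^esub> y \<in> carrier M"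
begin

abbreviation B where "B \<equiv> monoid_alg R M"

lemma coeff_closed: "f \<in> carrier B \<Longrightarrow> x \<in> carrier M \<Longrightarrow> f x \<in> carrier R"
  by (auto simp: monoid_alg_simps)

lemma coeff_ext: "f \<in> carrier B \<Longrightarrow> f \<in> extensional (carrier M)"
  by (simp add: monoid_alg_simps PiE_iff)

lemma finite_supp: "f \<in> carrier B \<Longrightarrow> finite (supp R M f)"
  by (simp add: monoid_alg_simps)

lemma carrierI:
  assumes "\<And>x. x \<in> carrier M \<Longrightarrow> f x \<in> carrier R" and "f \<in> extensional (carrier M)"
    and "finite F" and "\<And>x. x \<in> carrier M \<Longrightarrow> x \<notin> F \<Longrightarrow> f x = \<zero>"
  shows "f \<in> carrier B"
proof -
  have "supp R M f \<subseteq> F" using assms(4) unfolding supp_def by blast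
  then have "finite (supp R M f)" using assms(3) by (rule finite_subset)
  moreover have "f \<in> carrier M \<rightarrow>\<^sub>E carrier R"
    unfolding PiE_def using Pi_I[of "carrier M" f "\<lambda>_. carrier R", OF assms(1)] assms(2) by (rule IntI)
  ultimately show ?thesis unfolding monoid_alg_simps by simp
qed

lemma coeff_supp: "x \<in> carrier M \<Longrightarrow> x \<notin> supp R M f \<Longrightarrow> f x = \<zero>"
  by (auto simp: supp_def)

lemma B_eqI:
  assumes "f \<in> carrier B" and "g \<in> carrier B" and "\<And>x. x \<in> carrier M \<Longrightarrow> f x = g x"
  shows "f = g"
  using coeff_ext[OF assms(1)] coeff_ext[OF assms(2)] assms(3) by (intro extensionalityI)

lemma coeff_add: "x \<in> carrier M \<Longrightarrow> (f \<oplus>\<^bsub>B\<^esub> g) x = f x \<oplus> g x"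
  by (simp add: monoid_alg_simps)

lemma coeff_smult: "x \<in> carrier M \<Longrightarrow> (c \<odot>\<^bsub>B\<^esub> g) x = c \<otimes> g x"
  by (simp add: monoid_alg_simps)

lemma coeff_zero: "x \<in> carrier M \<Longrightarrow> \<zero>\<^bsub>B\<^esub> x = \<zero>"
  by (simp add: monoid_alg_simps)

lemma B_module: "module R B"
proof (rule pointwise_module[where J = "carrier M" and B = "\<lambda>_. self_module R"])
  show "\<zero>\<^bsub>B\<^esub> \<in> carrier B"
    by (rule carrierI[of _ "{}"]) (simp_all add: coeff_zero, simp add: monoid_alg_simps)
  show "f \<oplus>\<^bsub>B\<^esub> g \<in> carrier B" if "f \<in> carrier B" "g \<in> carrier B" for f g
  proof (rule carrierI[of _ "supp R M f \<union> supp R M g"])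
    show "f \<oplus>\<^bsub>B\<^esub> g \<in> extensional (carrier M)" by (simp add: monoid_alg_simps)
  qed (use finite_supp that in \<open>simp_all add: coeff_add coeff_supp coeff_closed[OF that(1)] coeff_closed[OF that(2)]\<close>)
  show "c \<odot>\<^bsub>B\<^esub> f \<in> carrier B" if "c \<in> carrier R" "f \<in> carrier B" for c f
  proof (rule carrierI[of _ "supp R M f"])
    show "c \<odot>\<^bsub>B\<^esub> f \<in> extensional (carrier M)" by (simp add: monoid_alg_simps)
  qed (use finite_supp that in \<open>simp_all add: coeff_smult coeff_supp coeff_closed[OF that(2)]\<close>)
  show "carrier B \<subseteq> (\<Pi>\<^sub>E j\<in>carrier M. carrier (self_module R))"
    by (auto simp: monoid_alg_simps)
qed (simp_all add: R.is_cring R.self_module monoid_alg_simps)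

sublocale B: module R B by (rule B_module)

lemma coeff_mult:
  assumes f: "f \<in> carrier B" and g: "g \<in> carrier B" and z: "z \<in> carrier M"
    and X: "finite X" "X \<subseteq> carrier M" "supp R M f \<subseteq> X"
    and Y: "finite Y" "Y \<subseteq> carrier M" "supp R M g \<subseteq> Y"
  shows "(f \<otimes>\<^bsub>B\<^esub> g) z
    = (\<Oplus>p\<in>X \<times> Y. if fst p \<otimes>\<^bsub>M\<^esub> snd p = z then f (fst p) \<otimes> g (snd p) else \<zero>)"
proof -
  have "(f \<otimes>\<^bsub>B\<^esub> g) z = finsum R (\<lambda>(x, y). f x \<otimes> g y)
          {(x, y). x \<in> supp R M f \<and> y \<in> supp R M g \<and> x \<otimes>\<^bsub>M\<^esub> y = z}"
    using z by (simp add: monoid_alg_simps)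
  also have "\<dots> = (\<Oplus>p\<in>X \<times> Y. if fst p \<otimes>\<^bsub>M\<^esub> snd p = z then f (fst p) \<otimes> g (snd p) else \<zero>)"
  proof (rule R.add.finprod_mono_neutral_cong_left)
    fix p assume p: "p \<in> X \<times> Y - {(x, y). x \<in> supp R M f \<and> y \<in> supp R M g \<and> x \<otimes>\<^bsub>M\<^esub> y = z}"
    then have c: "fst p \<in> carrier M" "snd p \<in> carrier M" using X Y by auto
    from p have "fst p \<notin> supp R M f \<or> snd p \<notin> supp R M g \<or> fst p \<otimes>\<^bsub>M\<^esub> snd p \<noteq> z" by auto
    then show "(if fst p \<otimes>\<^bsub>M\<^esub> snd p = z then f (fst p) \<otimes> g (snd p) else \<zero>) = \<zero>"
      using coeff_supp[OF c(1), of f] coeff_supp[OF c(2), of g] coeff_closed[OF f c(1)] coeff_closed[OF g c(2)] by auto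
  qed (use X Y in \<open>auto simp: subset_iff coeff_closed[OF f] coeff_closed[OF g]\<close>)
  finally show ?thesis .
qed

lemma B_mult_closed:
  assumes f: "f \<in> carrier B" and g: "g \<in> carrier B"
  shows "f \<otimes>\<^bsub>B\<^esub> g \<in> carrier B"
proof (rule carrierI[of _ "(\<lambda>(x, y). x \<otimes>\<^bsub>M\<^esub> y) ` (supp R M f \<times> supp R M g)"])
  have sub: "supp R M f \<subseteq> carrier M" "supp R M g \<subseteq> carrier M" by (auto simp: supp_def)
  fix z assume z: "z \<in> carrier M"
  note eq = coeff_mult[OF f g z finite_supp[OF f] sub(1) order_refl finite_supp[OF g] sub(2) order_refl]
  show "(f \<otimes>\<^bsub>B\<^esub> g) z \<in> carrier R"
    unfolding eq using sub by (intro R.finsum_closed) (auto simp: subset_iff coeff_closed[OF f] coeff_closed[OF g])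
  assume nz: "z \<notin> (\<lambda>(x, y). x \<otimes>\<^bsub>M\<^esub> y) ` (supp R M f \<times> supp R M g)"
  show "(f \<otimes>\<^bsub>B\<^esub> g) z = \<zero>"
    unfolding eq using nz by (intro R.add.finprod_one_eqI) auto
next
  show "f \<otimes>\<^bsub>B\<^esub> g \<in> extensional (carrier M)" by (simp add: monoid_alg_simps)
  show "finite ((\<lambda>(x, y). x \<otimes>\<^bsub>M\<^esub> y) ` (supp R M f \<times> supp R M g))"
    by (intro finite_imageI finite_cartesian_product finite_supp f g)
qed

lemma B_bilinear: "bilinear_algebra R B"
proof (rule bilinear_algebra.intro[OF B_module], rule bilinear_algebra_axioms.intro)
  fix f g
  assume f: "f \<in> carrier B" and g: "g \<in> carrier B"
  show "f \<otimes>\<^bsub>B\<^esub> g \<in> carrier B" by (rule B_mult_closed[OF f g])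
  {
    fix h
    assume h: "h \<in> carrier B"
    define X where "X = supp R M f \<union> supp R M g \<union> supp R M h"
    have X: "finite X" "X \<subseteq> carrier M" "supp R M f \<subseteq> X" "supp R M g \<subseteq> X" "supp R M h \<subseteq> X"
      using finite_supp[OF f] finite_supp[OF g] finite_supp[OF h] by (auto simp: X_def supp_def)
    have Xa: "supp R M (x \<oplus>\<^bsub>B\<^esub> y) \<subseteq> X" if "supp R M x \<subseteq> X" "supp R M y \<subseteq> X" for x y
      using that coeff_supp[of _ x] coeff_supp[of _ y] by (fastforce simp: supp_def coeff_add)
    have ev: "f x \<in> carrier R" "g x \<in> carrier R" "h x \<in> carrier R" if "x \<in> X" for x
      using that X coeff_closed[OF f] coeff_closed[OF g] coeff_closed[OF h] by auto
    have XM: "x \<in> carrier M" if "x \<in> X" for x using that X by auto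
    note cm = coeff_mult[OF _ _ _ X(1,2) _ X(1,2)]
    show "(f \<oplus>\<^bsub>B\<^esub> h) \<otimes>\<^bsub>B\<^esub> g = f \<otimes>\<^bsub>B\<^esub> g \<oplus>\<^bsub>B\<^esub> h \<otimes>\<^bsub>B\<^esub> g"
    proof (rule B_eqI)
      fix z assume z: "z \<in> carrier M"
      show "((f \<oplus>\<^bsub>B\<^esub> h) \<otimes>\<^bsub>B\<^esub> g) z = (f \<otimes>\<^bsub>B\<^esub> g \<oplus>\<^bsub>B\<^esub> h \<otimes>\<^bsub>B\<^esub> g) z"
        unfolding coeff_add[OF z] cm[OF B.M.a_closed[OF f h] g z Xa[OF X(3,5)] X(4)]
          cm[OF f g z X(3,4)] cm[OF h g z X(5,4)]
        by (subst R.finsum_addf[symmetric])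
          (auto simp: ev XM coeff_add R.l_distr simp del: R.add.finprod_multf intro!: R.finsum_cong')
    qed (use f h g B_mult_closed in auto)
    show "f \<otimes>\<^bsub>B\<^esub> (g \<oplus>\<^bsub>B\<^esub> h) = f \<otimes>\<^bsub>B\<^esub> g \<oplus>\<^bsub>B\<^esub> f \<otimes>\<^bsub>B\<^esub> h"
    proof (rule B_eqI)
      fix z assume z: "z \<in> carrier M"
      show "(f \<otimes>\<^bsub>B\<^esub> (g \<oplus>\<^bsub>B\<^esub> h)) z = (f \<otimes>\<^bsub>B\<^esub> g \<oplus>\<^bsub>B\<^esub> f \<otimes>\<^bsub>B\<^esub> h) z"
        unfolding coeff_add[OF z] cm[OF f B.M.a_closed[OF g h] z X(3) Xa[OF X(4,5)]]
          cm[OF f g z X(3,4)] cm[OF f h z X(3,5)]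
        by (subst R.finsum_addf[symmetric])
          (auto simp: ev XM coeff_add R.r_distr simp del: R.add.finprod_multf intro!: R.finsum_cong')
    qed (use f h g B_mult_closed in auto)
  }
  fix c
  assume c: "c \<in> carrier R"
  have fin: "finite (supp R M f)" "supp R M f \<subseteq> carrier M" "finite (supp R M g)" "supp R M g \<subseteq> carrier M"
    using finite_supp[OF f] finite_supp[OF g] by (auto simp: supp_def)
  have ev: "x \<in> supp R M f \<Longrightarrow> f x \<in> carrier R" "x \<in> supp R M g \<Longrightarrow> g x \<in> carrier R" for x
    using fin coeff_closed[OF f] coeff_closed[OF g] by auto
  have XM: "x \<in> supp R M f \<Longrightarrow> x \<in> carrier M" "x \<in> supp R M g \<Longrightarrow> x \<in> carrier M" for x
    using fin by auto
  have Xs: "supp R M (c \<odot>\<^bsub>B\<^esub> x) \<subseteq> supp R M x" for x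
    using c by (auto simp: supp_def coeff_smult)
  note cm = coeff_mult[OF _ _ _ fin(1,2) _ fin(3,4)]
  show "(c \<odot>\<^bsub>B\<^esub> f) \<otimes>\<^bsub>B\<^esub> g = c \<odot>\<^bsub>B\<^esub> (f \<otimes>\<^bsub>B\<^esub> g)"
  proof (rule B_eqI)
    fix z assume z: "z \<in> carrier M"
    show "((c \<odot>\<^bsub>B\<^esub> f) \<otimes>\<^bsub>B\<^esub> g) z = (c \<odot>\<^bsub>B\<^esub> (f \<otimes>\<^bsub>B\<^esub> g)) z"
      unfolding coeff_smult[OF z] cm[OF B.smult_closed[OF c f] g z Xs order_refl]
        cm[OF f g z order_refl order_refl]
      using c fin by (subst R.finsum_rdistr)
        (auto simp: ev XM coeff_smult R.m_assoc simp del: R.add.finprod_multf intro!: R.finsum_cong')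
  qed (use c f g B_mult_closed in auto)
  show "f \<otimes>\<^bsub>B\<^esub> (c \<odot>\<^bsub>B\<^esub> g) = c \<odot>\<^bsub>B\<^esub> (f \<otimes>\<^bsub>B\<^esub> g)"
  proof (rule B_eqI)
    fix z assume z: "z \<in> carrier M"
    show "(f \<otimes>\<^bsub>B\<^esub> (c \<odot>\<^bsub>B\<^esub> g)) z = (c \<odot>\<^bsub>B\<^esub> (f \<otimes>\<^bsub>B\<^esub> g)) z"
      unfolding coeff_smult[OF z] cm[OF f B.smult_closed[OF c g] z order_refl Xs]
        cm[OF f g z order_refl order_refl]
      using c fin by (subst R.finsum_rdistr)
        (auto simp: ev XM coeff_smult R.m_lcomm simp del: R.add.finprod_multf intro!: R.finsum_cong')
  qed (use c f g B_mult_closed in auto)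
qed

sublocale B: bilinear_algebra R B by (rule B_bilinear)

lemma delta_closed [simp]: "delta R M x \<in> carrier B"
  by (rule carrierI[of _ "{x}"]) (auto simp: delta_def)

lemma coeff_delta: "y \<in> carrier M \<Longrightarrow> delta R M x y = (if y = x then \<one> else \<zero>)"
  by (simp add: delta_def)

lemma supp_delta: "supp R M (delta R M x) \<subseteq> {x}"
  by (auto simp: supp_def delta_def)

lemma delta_mult:
  assumes x: "x \<in> carrier M" and y: "y \<in> carrier M"
  shows "delta R M x \<otimes>\<^bsub>B\<^esub> delta R M y = delta R M (x \<otimes>\<^bsub>M\<^esub> y)"
proof (rule B_eqI)
  fix z assume z: "z \<in> carrier M"
  have "(delta R M x \<otimes>\<^bsub>B\<^esub> delta R M y) z
    = (\<Oplus>p\<in>{x} \<times> {y}. if fst p \<otimes>\<^bsub>M\<^esub> snd p = z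
        then delta R M x (fst p) \<otimes> delta R M y (snd p) else \<zero>)"
    using x y supp_delta by (intro coeff_mult[OF _ _ z]) auto
  also have "\<dots> = (if x \<otimes>\<^bsub>M\<^esub> y = z then \<one> else \<zero>)"
    using x y by (simp add: coeff_delta)
  finally show "(delta R M x \<otimes>\<^bsub>B\<^esub> delta R M y) z = delta R M (x \<otimes>\<^bsub>M\<^esub> y) z"
    using z by (auto simp: coeff_delta)
qed (auto intro: B_mult_closed)

text \<open>
  Induction on the support: subtracting \<open>f x \<odot> delta x\<close> removes \<open>x\<close> from the support of \<open>f\<close>.
\<close>

lemma deltas_span:
  assumes N: "submodule N R B" and D: "\<And>x. x \<in> carrier M \<Longrightarrow> delta R M x \<in> N"
  shows "carrier B \<subseteq> N"
proof
  fix f assume f: "f \<in> carrier B"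
  have "f \<in> N" if "finite F" "f \<in> carrier B" "supp R M f \<subseteq> F" for F
    using that
  proof (induction F arbitrary: f rule: finite_induct)
    case empty
    then have "f = \<zero>\<^bsub>B\<^esub>" by (intro B_eqI) (auto simp: coeff_zero intro: coeff_supp)
    then show ?case using B.submodule_zero[OF N] by simp
  next
    case (insert x F)
    show ?case
    proof (cases "x \<in> carrier M")
      case True
      define g where "g = (\<lambda>y\<in>carrier M. if y = x then \<zero> else f y)"
      have g: "g \<in> carrier B" using insert.prems(1)
        by (intro carrierI[of _ "supp R M f"]) (auto simp: finite_supp g_def coeff_supp coeff_closed)
      have "supp R M g \<subseteq> F" using insert.prems(2) by (auto simp: g_def supp_def)
      then have "g \<in> N" using insert.IH g by blast
      moreover have "f = g \<oplus>\<^bsub>B\<^esub> f x \<odot>\<^bsub>B\<^esub> delta R M x"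
        using True insert.prems(1) g
        by (intro B_eqI) (auto simp: coeff_add coeff_smult coeff_delta g_def coeff_closed)
      moreover have "f x \<odot>\<^bsub>B\<^esub> delta R M x \<in> N"
        using D[OF True] coeff_closed[OF insert.prems(1) True] by (intro B.submoduleE(4)[OF N]) auto
      ultimately show ?thesis using B.submoduleE(5)[OF N] by metis
    next
      case False
      then have "supp R M f \<subseteq> F" using insert.prems(2) by (auto simp: supp_def)
      then show ?thesis using insert by auto
    qed
  qed
  then show "f \<in> N" using f finite_supp by blast
qed

end

lemma finsum_self_module [simp]: "finsum (self_module R) f I = finsum R f I"
  by (simp add: finsum_def finprod_def self_module_def)

lemma submodule_lin_image:
  assumes "module R B" and "module R C" and h: "lin_map R B C h"
  shows "submodule (h ` carrier B) R C"
proof -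
  interpret B: module R B by fact
  interpret C: module R C by fact
  show ?thesis
  proof (rule C.submoduleI)
    show "\<zero>\<^bsub>C\<^esub> \<in> h ` carrier B"
      using lin_map_zero[OF assms, symmetric] by (rule image_eqI) simp
    fix y assume "y \<in> h ` carrier B"
    then obtain x where x: "x \<in> carrier B" "y = h x" by auto
    show "\<ominus>\<^bsub>C\<^esub> y \<in> h ` carrier B"
      unfolding x using lin_map_neg[OF assms x(1), symmetric] by (rule image_eqI) (simp add: x)
    show "a \<odot>\<^bsub>C\<^esub> y \<in> h ` carrier B" if "a \<in> carrier R" for a
      unfolding x using lin_mapD(3)[OF h that x(1), symmetric] by (rule image_eqI) (simp add: x that)
    fix y' assume "y' \<in> h ` carrier B"
    then obtain x' where x': "x' \<in> carrier B" "y' = h x'" by auto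
    show "y \<oplus>\<^bsub>C\<^esub> y' \<in> h ` carrier B"
      unfolding x x' using lin_mapD(2)[OF h x(1) x'(1), symmetric] by (rule image_eqI) (simp add: x x')
  qed (use lin_mapD(1)[OF h] in auto)
qed

lemma lin_map_combination:
  assumes B: "module R B" and C: "module R C" and co: "\<And>s. s \<in> S \<Longrightarrow> lin_map R B (self_module R) (co s)"
    and v: "\<And>s. s \<in> S \<Longrightarrow> v s \<in> carrier C" and S: "finite S"
  shows "lin_map R B C (\<lambda>x. \<Oplus>\<^bsub>C\<^esub>s\<in>S. co s x \<odot>\<^bsub>C\<^esub> v s)"
proof -
  interpret B: module R B by fact
  interpret C: module R C by fact
  have coc: "co s x \<in> carrier R" if "s \<in> S" "x \<in> carrier B" for s x
    using lin_mapD(1)[OF co] that by simp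
  show ?thesis
  proof (rule lin_mapI)
    fix x assume x: "x \<in> carrier B"
    show "(\<Oplus>\<^bsub>C\<^esub>s\<in>S. co s x \<odot>\<^bsub>C\<^esub> v s) \<in> carrier C"
      using x v coc by (intro C.finsum_closed) auto
    show "(\<Oplus>\<^bsub>C\<^esub>s\<in>S. co s (x \<oplus>\<^bsub>B\<^esub> y) \<odot>\<^bsub>C\<^esub> v s)
      = (\<Oplus>\<^bsub>C\<^esub>s\<in>S. co s x \<odot>\<^bsub>C\<^esub> v s) \<oplus>\<^bsub>C\<^esub> (\<Oplus>\<^bsub>C\<^esub>s\<in>S. co s y \<odot>\<^bsub>C\<^esub> v s)"
      if y: "y \<in> carrier B" for y
      using x y v coc lin_mapD(2)[OF co x y]
      by (subst C.finsum_addf[symmetric])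
        (auto simp: C.smult_l_distr simp del: C.M.add.finprod_multf intro!: C.finsum_cong')
    show "(\<Oplus>\<^bsub>C\<^esub>s\<in>S. co s (c \<odot>\<^bsub>B\<^esub> x) \<odot>\<^bsub>C\<^esub> v s) = c \<odot>\<^bsub>C\<^esub> (\<Oplus>\<^bsub>C\<^esub>s\<in>S. co s x \<odot>\<^bsub>C\<^esub> v s)"
      if c: "c \<in> carrier R" for c
      using x c v coc lin_mapD(3)[OF co c x] S
      by (subst C.finsum_smult_ldistr) (auto simp: C.smult_assoc1 intro!: C.finsum_cong')
  qed
qed

lemma (in module) finsum_delta:
  assumes "finite I" and "i \<in> I" and "f i \<in> carrier M"
  shows "(\<Oplus>\<^bsub>M\<^esub>j\<in>I. if j = i then f j else \<zero>\<^bsub>M\<^esub>) = f i"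
  using M.finsum_singleton[OF assms(2,1), of f] assms
  by (subst M.add.finprod_mono_neutral_cong_right[of I "{i}"]) auto

context monoid_algebra
begin

definition linear_ext where "linear_ext w f = (\<Oplus>x\<in>supp R M f. f x \<otimes> w x)"

lemma linear_ext_eq:
  assumes w: "\<And>x. x \<in> carrier M \<Longrightarrow> w x \<in> carrier R" and f: "f \<in> carrier B"
    and X: "finite X" "X \<subseteq> carrier M" "supp R M f \<subseteq> X"
  shows "linear_ext w f = (\<Oplus>x\<in>X. f x \<otimes> w x)"
  unfolding linear_ext_def
proof (rule R.add.finprod_mono_neutral_cong_left)
  fix x assume "x \<in> X - supp R M f"
  then show "f x \<otimes> w x = \<zero>" using X w coeff_supp[of x f] by auto
qed (use X w coeff_closed[OF f] in \<open>auto simp: subset_iff\<close>)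

lemma linear_ext_lin:
  assumes w: "\<And>x. x \<in> carrier M \<Longrightarrow> w x \<in> carrier R"
  shows "lin_map R B (self_module R) (linear_ext w)"
proof (rule lin_mapI)
  fix f assume f: "f \<in> carrier B"
  have sub: "supp R M f \<subseteq> carrier M" for f by (auto simp: supp_def)
  note fc = coeff_closed[OF f]
  have "(\<lambda>x. f x \<otimes> w x) \<in> supp R M f \<rightarrow> carrier R"
    using sub[of f] fc w by (auto simp: subset_iff)
  then show "linear_ext w f \<in> carrier (self_module R)"
    unfolding linear_ext_def by (simp add: R.finsum_closed)
  show "linear_ext w (f \<oplus>\<^bsub>B\<^esub> g) = linear_ext w f \<oplus>\<^bsub>self_module R\<^esub> linear_ext w g" if g: "g \<in> carrier B" for g
  proof -
    note gc = coeff_closed[OF g]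
    let ?X = "supp R M f \<union> supp R M g"
    have X: "finite ?X" "?X \<subseteq> carrier M" using sub finite_supp[OF f] finite_supp[OF g] by auto
    have "supp R M (f \<oplus>\<^bsub>B\<^esub> g) \<subseteq> ?X"
      using coeff_supp[of _ f] coeff_supp[of _ g] by (fastforce simp: supp_def coeff_add)
    then have "linear_ext w (f \<oplus>\<^bsub>B\<^esub> g) = (\<Oplus>x\<in>?X. (f \<oplus>\<^bsub>B\<^esub> g) x \<otimes> w x)"
      using linear_ext_eq[OF w B.M.a_closed[OF f g] X] by simp
    also have "\<dots> = (\<Oplus>x\<in>?X. f x \<otimes> w x \<oplus> g x \<otimes> w x)"
      using X(2) fc gc w
      by (intro R.finsum_cong') (auto simp: coeff_add R.l_distr subset_iff)
    also have "\<dots> = (\<Oplus>x\<in>?X. f x \<otimes> w x) \<oplus> (\<Oplus>x\<in>?X. g x \<otimes> w x)"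
      using X(2) fc gc w by (intro R.finsum_addf) (auto simp: subset_iff)
    also have "\<dots> = linear_ext w f \<oplus> linear_ext w g"
      using linear_ext_eq[OF w f X] linear_ext_eq[OF w g X] by simp
    finally show ?thesis by simp
  qed
  show "linear_ext w (c \<odot>\<^bsub>B\<^esub> f) = c \<odot>\<^bsub>self_module R\<^esub> linear_ext w f" if c: "c \<in> carrier R" for c
  proof -
    have "supp R M (c \<odot>\<^bsub>B\<^esub> f) \<subseteq> supp R M f" using c by (auto simp: supp_def coeff_smult)
    then have "linear_ext w (c \<odot>\<^bsub>B\<^esub> f) = (\<Oplus>x\<in>supp R M f. (c \<odot>\<^bsub>B\<^esub> f) x \<otimes> w x)"
      using linear_ext_eq[OF w B.smult_closed[OF c f] finite_supp[OF f] sub] by simp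
    also have "\<dots> = (\<Oplus>x\<in>supp R M f. c \<otimes> (f x \<otimes> w x))"
      using sub[of f] fc w c
      by (intro R.finsum_cong') (auto simp: coeff_smult R.m_assoc subset_iff)
    also have "\<dots> = c \<otimes> linear_ext w f"
      unfolding linear_ext_def using sub[of f] fc w c finite_supp[OF f]
      by (intro R.finsum_rdistr[symmetric]) (auto simp: subset_iff)
    finally show ?thesis by simp
  qed
qed

lemma linear_ext_delta:
  assumes w: "\<And>x. x \<in> carrier M \<Longrightarrow> w x \<in> carrier R" and y: "y \<in> carrier M"
  shows "linear_ext w (delta R M y) = w y"
  using linear_ext_eq[OF w delta_closed, where X = "{y}"] y w supp_delta by (simp add: coeff_delta)

end

section \<open>Quotients of bilinear algebras\<close>

lemma bilinear_algebra_image: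
  assumes "bilinear_algebra R B"
    and surj: "carrier Q = \<pi> ` carrier B"
    and zero: "\<zero>\<^bsub>Q\<^esub> = \<pi> \<zero>\<^bsub>B\<^esub>"
    and add: "\<And>x y. x \<in> carrier B \<Longrightarrow> y \<in> carrier B \<Longrightarrow> \<pi> x \<oplus>\<^bsub>Q\<^esub> \<pi> y = \<pi> (x \<oplus>\<^bsub>B\<^esub> y)"
    and mult: "\<And>x y. x \<in> carrier B \<Longrightarrow> y \<in> carrier B \<Longrightarrow> \<pi> x \<otimes>\<^bsub>Q\<^esub> \<pi> y = \<pi> (x \<otimes>\<^bsub>B\<^esub> y)"
    and smult: "\<And>c x. c \<in> carrier R \<Longrightarrow> x \<in> carrier B \<Longrightarrow> c \<odot>\<^bsub>Q\<^esub> \<pi> x = \<pi> (c \<odot>\<^bsub>B\<^esub> x)"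
  shows "bilinear_algebra R Q"
proof -
  interpret B: bilinear_algebra R B by fact
  have Qx: "\<exists>x\<in>carrier B. X = \<pi> x" if "X \<in> carrier Q" for X using that surj by auto
  have \<pi>c: "\<pi> x \<in> carrier Q" if "x \<in> carrier B" for x using that surj by auto
  have "abelian_group Q"
  proof (rule abelian_groupI)
    fix X assume "X \<in> carrier Q"
    then obtain x where x: "x \<in> carrier B" "X = \<pi> x" using Qx by auto
    show "\<zero>\<^bsub>Q\<^esub> \<oplus>\<^bsub>Q\<^esub> X = X" using x by (simp add: zero add)
    show "\<exists>Y\<in>carrier Q. Y \<oplus>\<^bsub>Q\<^esub> X = \<zero>\<^bsub>Q\<^esub>"
      using x \<pi>c by (intro bexI[of _ "\<pi> (\<ominus>\<^bsub>B\<^esub> x)"]) (auto simp: add zero B.l_neg)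
    fix Y assume "Y \<in> carrier Q"
    then obtain y where y: "y \<in> carrier B" "Y = \<pi> y" using Qx by auto
    show "X \<oplus>\<^bsub>Q\<^esub> Y \<in> carrier Q" using x y \<pi>c by (simp add: add)
    show "X \<oplus>\<^bsub>Q\<^esub> Y = Y \<oplus>\<^bsub>Q\<^esub> X" using x y by (simp add: add B.M.a_comm)
    fix Z assume "Z \<in> carrier Q"
    then obtain z where z: "z \<in> carrier B" "Z = \<pi> z" using Qx by auto
    show "X \<oplus>\<^bsub>Q\<^esub> Y \<oplus>\<^bsub>Q\<^esub> Z = X \<oplus>\<^bsub>Q\<^esub> (Y \<oplus>\<^bsub>Q\<^esub> Z)" using x y z by (simp add: add B.M.a_assoc)
  qed (simp add: zero \<pi>c)
  then have "module R Q"
  proof (rule moduleI[OF B.R.is_cring])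
    fix X assume "X \<in> carrier Q"
    then obtain x where x: "x \<in> carrier B" "X = \<pi> x" using Qx by auto
    show "\<one>\<^bsub>R\<^esub> \<odot>\<^bsub>Q\<^esub> X = X" using x by (simp add: smult)
    fix a assume a: "a \<in> carrier R"
    show "a \<odot>\<^bsub>Q\<^esub> X \<in> carrier Q" using a x \<pi>c by (simp add: smult)
    {
      fix Y assume "Y \<in> carrier Q"
      then obtain y where y: "y \<in> carrier B" "Y = \<pi> y" using Qx by auto
      show "a \<odot>\<^bsub>Q\<^esub> (X \<oplus>\<^bsub>Q\<^esub> Y) = a \<odot>\<^bsub>Q\<^esub> X \<oplus>\<^bsub>Q\<^esub> a \<odot>\<^bsub>Q\<^esub> Y"
        using a x y by (simp add: add smult B.smult_r_distr)
    }
    fix b assume b: "b \<in> carrier R"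
    show "(a \<oplus>\<^bsub>R\<^esub> b) \<odot>\<^bsub>Q\<^esub> X = a \<odot>\<^bsub>Q\<^esub> X \<oplus>\<^bsub>Q\<^esub> b \<odot>\<^bsub>Q\<^esub> X"
      using a b x by (simp add: add smult B.smult_l_distr)
    show "(a \<otimes>\<^bsub>R\<^esub> b) \<odot>\<^bsub>Q\<^esub> X = a \<odot>\<^bsub>Q\<^esub> (b \<odot>\<^bsub>Q\<^esub> X)"
      using a b x by (simp add: smult B.smult_assoc1)
  qed
  moreover have "bilinear_algebra_axioms R Q"
  proof
    fix X Y assume "X \<in> carrier Q" "Y \<in> carrier Q"
    then obtain x y where xy: "x \<in> carrier B" "X = \<pi> x" "y \<in> carrier B" "Y = \<pi> y"
      using Qx by meson
    show "X \<otimes>\<^bsub>Q\<^esub> Y \<in> carrier Q" using xy \<pi>c by (simp add: mult)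
    {
      fix Z assume "Z \<in> carrier Q"
      then obtain z where z: "z \<in> carrier B" "Z = \<pi> z" using Qx by auto
      show "(X \<oplus>\<^bsub>Q\<^esub> Z) \<otimes>\<^bsub>Q\<^esub> Y = X \<otimes>\<^bsub>Q\<^esub> Y \<oplus>\<^bsub>Q\<^esub> Z \<otimes>\<^bsub>Q\<^esub> Y"
        using xy z by (simp add: mult add B.bilin_add_left)
      show "X \<otimes>\<^bsub>Q\<^esub> (Y \<oplus>\<^bsub>Q\<^esub> Z) = X \<otimes>\<^bsub>Q\<^esub> Y \<oplus>\<^bsub>Q\<^esub> X \<otimes>\<^bsub>Q\<^esub> Z"
        using xy z by (simp add: mult add B.bilin_add_right)
    }
    fix c assume c: "c \<in> carrier R"
    show "(c \<odot>\<^bsub>Q\<^esub> X) \<otimes>\<^bsub>Q\<^esub> Y = c \<odot>\<^bsub>Q\<^esub> (X \<otimes>\<^bsub>Q\<^esub> Y)"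
      using xy c by (simp add: mult smult B.bilin_smult_left)
    show "X \<otimes>\<^bsub>Q\<^esub> (c \<odot>\<^bsub>Q\<^esub> Y) = c \<odot>\<^bsub>Q\<^esub> (X \<otimes>\<^bsub>Q\<^esub> Y)"
      using xy c by (simp add: mult smult B.bilin_smult_right)
  qed
  ultimately show ?thesis by (rule bilinear_algebra.intro)
qed

definition descend :: "('x \<Rightarrow> 'y) \<Rightarrow> 'x set \<Rightarrow> 'y" where
  "descend h X = h (SOME x. x \<in> X)"

locale bilinear_ideal = bilinear_algebra R B for R (structure) and B (structure) + fixes I
  assumes I_submodule: "submodule I R B"
    and I_left: "i \<in> I \<Longrightarrow> x \<in> carrier B \<Longrightarrow> i \<otimes>\<^bsub>B\<^esub> x \<in> I"
    and I_right: "x \<in> carrier B \<Longrightarrow> i \<in> I \<Longrightarrow> x \<otimes>\<^bsub>B\<^esub> i \<in> I"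
begin

sublocale abelian_subgroup I B
  using submodule.axioms(1)[OF I_submodule] M.abelian_group_axioms
  by (intro abelian_subgroupI3 additive_subgroup.intro)

abbreviation \<pi> where "\<pi> x \<equiv> I +>\<^bsub>B\<^esub> x"

lemma I_carrier: "i \<in> I \<Longrightarrow> i \<in> carrier B"
  using submoduleE(1)[OF I_submodule] by auto

lemma coset_mem:
  assumes "x \<in> carrier B"
  shows "y \<in> \<pi> x \<longleftrightarrow> (\<exists>i\<in>I. y = i \<oplus>\<^bsub>B\<^esub> x)"
  by (auto simp: a_r_coset_def')

lemma coset_absorb:
  assumes "x \<in> carrier B" and "i \<in> I"
  shows "\<pi> (i \<oplus>\<^bsub>B\<^esub> x) = \<pi> x"
proof -
  have "i \<oplus>\<^bsub>B\<^esub> x \<in> \<pi> x" using coset_mem[OF assms(1)] assms(2) by blast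
  then show ?thesis using a_repr_independence'[OF _ assms(1)] by metis
qed

lemma coset_self: "x \<in> carrier B \<Longrightarrow> x \<in> \<pi> x"
  using coset_mem[of x x] submodule_zero[OF I_submodule] by force

lemma coset_zero: "\<pi> \<zero>\<^bsub>B\<^esub> = I"
  using I_carrier by (force simp: a_r_coset_def')

lemma coset_in_I: "x \<in> I \<Longrightarrow> \<pi> x = I"
  using coset_absorb[of "\<zero>\<^bsub>B\<^esub>" x] I_carrier[of x] coset_zero by simp

lemma union_coset_const:
  assumes "x \<in> carrier B" and "\<And>i. i \<in> I \<Longrightarrow> f (i \<oplus>\<^bsub>B\<^esub> x) = C"
  shows "(\<Union>y\<in>\<pi> x. f y) = C"
proof -
  have "f y = C" if "y \<in> \<pi> x" for y using that coset_mem[OF assms(1)] assms(2) by auto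
  then show ?thesis using coset_self[OF assms(1)] by blast
qed

abbreviation Q where "Q \<equiv> quot_alg R B I"

lemma quot_mult:
  assumes x: "x \<in> carrier B" and y: "y \<in> carrier B"
  shows "\<pi> x \<otimes>\<^bsub>Q\<^esub> \<pi> y = \<pi> (x \<otimes>\<^bsub>B\<^esub> y)"
proof -
  have "\<pi> ((i \<oplus>\<^bsub>B\<^esub> x) \<otimes>\<^bsub>B\<^esub> (j \<oplus>\<^bsub>B\<^esub> y)) = \<pi> (x \<otimes>\<^bsub>B\<^esub> y)" if "i \<in> I" "j \<in> I" for i j
  proof -
    have ic: "i \<in> carrier B" "j \<in> carrier B" using that I_carrier by auto
    have "(i \<oplus>\<^bsub>B\<^esub> x) \<otimes>\<^bsub>B\<^esub> (j \<oplus>\<^bsub>B\<^esub> y)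
      = (i \<otimes>\<^bsub>B\<^esub> (j \<oplus>\<^bsub>B\<^esub> y)) \<oplus>\<^bsub>B\<^esub> (x \<otimes>\<^bsub>B\<^esub> j \<oplus>\<^bsub>B\<^esub> x \<otimes>\<^bsub>B\<^esub> y)"
      using ic x y by (simp add: bilin_add_left bilin_add_right M.a_ac)
    moreover have "i \<otimes>\<^bsub>B\<^esub> (j \<oplus>\<^bsub>B\<^esub> y) \<in> I" using that ic y by (intro I_left) auto
    moreover have "x \<otimes>\<^bsub>B\<^esub> j \<in> I" using that x by (intro I_right)
    ultimately show ?thesis using ic x y by (simp add: coset_absorb)
  qed
  then have "(\<Union>a\<in>\<pi> x. \<Union>b\<in>\<pi> y. \<pi> (a \<otimes>\<^bsub>B\<^esub> b)) = \<pi> (x \<otimes>\<^bsub>B\<^esub> y)"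
    using x y by (intro union_coset_const) auto
  then show ?thesis by (simp add: quot_alg_def FactRing_def rcoset_mult_def)
qed

lemma quot_smult:
  assumes c: "c \<in> carrier R" and x: "x \<in> carrier B"
  shows "c \<odot>\<^bsub>Q\<^esub> \<pi> x = \<pi> (c \<odot>\<^bsub>B\<^esub> x)"
proof -
  have "\<pi> (c \<odot>\<^bsub>B\<^esub> (i \<oplus>\<^bsub>B\<^esub> x)) = \<pi> (c \<odot>\<^bsub>B\<^esub> x)" if i: "i \<in> I" for i
    using c x i I_carrier submoduleE(4)[OF I_submodule c i]
    by (simp add: smult_r_distr coset_absorb)
  then show ?thesis using x by (simp add: quot_alg_def union_coset_const)
qed

lemma quot_add:
  assumes "x \<in> carrier B" and "y \<in> carrier B"
  shows "\<pi> x \<oplus>\<^bsub>Q\<^esub> \<pi> y = \<pi> (x \<oplus>\<^bsub>B\<^esub> y)"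
  using assms by (simp add: quot_alg_def FactRing_def a_rcos_sum)

lemma quot_zero: "\<zero>\<^bsub>Q\<^esub> = I"
  by (simp add: quot_alg_def FactRing_def)

lemma quot_carrier: "carrier Q = \<pi> ` carrier B"
  by (auto simp: quot_alg_def FactRing_def A_RCOSETS_def')

lemma quot_one: "\<one>\<^bsub>Q\<^esub> = \<pi> \<one>\<^bsub>B\<^esub>"
  by (simp add: quot_alg_def FactRing_def)

lemma quot_bilinear: "bilinear_algebra R Q"
  by (rule bilinear_algebra_image[OF bilinear_algebra_axioms quot_carrier])
    (simp_all add: quot_zero coset_zero quot_add quot_mult quot_smult)

lemma descend_coset:
  assumes C: "module R C" and h: "lin_map R B C h" and vanish: "\<And>i. i \<in> I \<Longrightarrow> h i = \<zero>\<^bsub>C\<^esub>"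
    and x: "x \<in> carrier B"
  shows "descend h (\<pi> x) = h x"
proof -
  interpret C: module R C by fact
  have "(SOME y. y \<in> \<pi> x) \<in> \<pi> x" using coset_self[OF x] by (rule someI)
  then obtain i where "i \<in> I" "(SOME y. y \<in> \<pi> x) = i \<oplus>\<^bsub>B\<^esub> x" using coset_mem[OF x] by auto
  then show ?thesis
    using lin_mapD[OF h] x I_carrier vanish by (simp add: descend_def)
qed

lemma descend_lin_map:
  assumes C: "module R C" and h: "lin_map R B C h" and vanish: "\<And>i. i \<in> I \<Longrightarrow> h i = \<zero>\<^bsub>C\<^esub>"
  shows "lin_map R Q C (descend h)"
  using lin_mapD[OF h] descend_coset[OF assms]
  by (intro lin_mapI) (auto simp: quot_carrier quot_add quot_smult)

end

section \<open>Algebras with an inverse semigroup as a basis\<close>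

text \<open>
  A finite inverse semigroup with zero, given by the set \<open>S\<close> of its nonzero elements, sits
  linearly independent in the algebra \<open>E\<close>, with \<open>\<zero>\<^bsub>E\<^esub>\<close> as its zero; the functionals \<open>coord s\<close> are
  dual to \<open>S\<close>. Its nonzero idempotents \<open>e p\<close> are labelled by a finite poset \<open>P\<close>, whose order is
  the reverse of the natural order of idempotents, and \<open>l s\<close>, \<open>r s\<close> are the labels of
  \<open>s \<otimes> iv s\<close>, \<open>iv s \<otimes> s\<close>. Elements \<open>s\<close> with \<open>l s = p\<close> and \<open>r s = q\<close> are the arrows from \<open>p\<close>
  to \<open>q\<close> of a groupoid, in which only arrows with \<open>r s = l t\<close> compose. For \<open>q\<close> above \<open>l s\<close>
  the product \<open>e q \<otimes> s\<close> is the restriction of \<open>s\<close> to \<open>q\<close>.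

  The two products are compared through \<open>le_range_act\<close>: the restriction of \<open>s\<close> to \<open>q\<close> is
  composable in the groupoid with a restriction of \<open>t\<close> exactly if \<open>s \<otimes> t\<close> is nonzero and has
  a restriction to \<open>q\<close>. The weights \<open>w p q\<close> are the values of the Moebius function of \<open>P\<close>.
\<close>

locale inverse_semigroup_basis = bilinear_algebra R E
  for R :: "('k, 'r) ring_scheme" (structure) and E :: "('k, 'e, 'm) module_scheme" (structure) +
  fixes S :: "'e set" and P :: "'p set" and le :: "'p \<Rightarrow> 'p \<Rightarrow> bool" and bot :: 'p
    and l r :: "'e \<Rightarrow> 'p" and e :: "'p \<Rightarrow> 'e" and iv :: "'e \<Rightarrow> 'e"
    and coord :: "'e \<Rightarrow> 'e \<Rightarrow> 'k" and w :: "'p \<Rightarrow> 'p \<Rightarrow> 'k"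
    and link :: "('p \<times> 'p) set" and rep :: "'p set \<Rightarrow> 'p" and enum :: "'p set \<Rightarrow> nat \<Rightarrow> 'p"
  assumes nontrivial: "\<one> \<noteq> \<zero>"
    and S_finite: "finite S" and S_sub: "S \<subseteq> carrier E" and P_finite: "finite P"
    and le_refl: "p \<in> P \<Longrightarrow> le p p"
    and le_trans: "p \<in> P \<Longrightarrow> q \<in> P \<Longrightarrow> x \<in> P \<Longrightarrow> le p q \<Longrightarrow> le q x \<Longrightarrow> le p x"
    and le_antisym: "p \<in> P \<Longrightarrow> q \<in> P \<Longrightarrow> le p q \<Longrightarrow> le q p \<Longrightarrow> p = q"
    and bot: "bot \<in> P" "p \<in> P \<Longrightarrow> le bot p"
    and w_closed: "p \<in> P \<Longrightarrow> q \<in> P \<Longrightarrow> w p q \<in> carrier R"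
    and w_sum: "p \<in> P \<Longrightarrow> q \<in> P \<Longrightarrow> le p q \<Longrightarrow>
      (\<Oplus>x\<in>{x \<in> P. le p x \<and> le x q}. w p x) = (if p = q then \<one> else \<zero>)"
    and coord_lin: "s \<in> S \<Longrightarrow> lin_map R E (self_module R) (coord s)"
    and coord_dual: "s \<in> S \<Longrightarrow> t \<in> S \<Longrightarrow> coord s t = (if s = t then \<one> else \<zero>)"
    and l_P: "s \<in> S \<Longrightarrow> l s \<in> P" and r_P: "s \<in> S \<Longrightarrow> r s \<in> P"
    and e_S: "p \<in> P \<Longrightarrow> e p \<in> S" and l_e: "p \<in> P \<Longrightarrow> l (e p) = p" and r_e: "p \<in> P \<Longrightarrow> r (e p) = p"
    and e_left: "s \<in> S \<Longrightarrow> e (l s) \<otimes>\<^bsub>E\<^esub> s = s" and e_right: "s \<in> S \<Longrightarrow> s \<otimes>\<^bsub>E\<^esub> e (r s) = s"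
    and S_mult: "s \<in> S \<Longrightarrow> t \<in> S \<Longrightarrow> s \<otimes>\<^bsub>E\<^esub> t \<in> S \<or> s \<otimes>\<^bsub>E\<^esub> t = \<zero>\<^bsub>E\<^esub>"
    and S_assoc: "s \<in> S \<Longrightarrow> t \<in> S \<Longrightarrow> u \<in> S \<Longrightarrow> (s \<otimes>\<^bsub>E\<^esub> t) \<otimes>\<^bsub>E\<^esub> u = s \<otimes>\<^bsub>E\<^esub> (t \<otimes>\<^bsub>E\<^esub> u)"
    and comp_S: "s \<in> S \<Longrightarrow> t \<in> S \<Longrightarrow> r s = l t \<Longrightarrow> s \<otimes>\<^bsub>E\<^esub> t \<in> S"
    and l_comp: "s \<in> S \<Longrightarrow> t \<in> S \<Longrightarrow> r s = l t \<Longrightarrow> l (s \<otimes>\<^bsub>E\<^esub> t) = l s"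
    and r_comp: "s \<in> S \<Longrightarrow> t \<in> S \<Longrightarrow> r s = l t \<Longrightarrow> r (s \<otimes>\<^bsub>E\<^esub> t) = r t"
    and iv_S: "s \<in> S \<Longrightarrow> iv s \<in> S" and l_iv: "s \<in> S \<Longrightarrow> l (iv s) = r s" and r_iv: "s \<in> S \<Longrightarrow> r (iv s) = l s"
    and iv_right: "s \<in> S \<Longrightarrow> s \<otimes>\<^bsub>E\<^esub> iv s = e (l s)" and iv_left: "s \<in> S \<Longrightarrow> iv s \<otimes>\<^bsub>E\<^esub> s = e (r s)"
    and act_S: "s \<in> S \<Longrightarrow> q \<in> P \<Longrightarrow> le (l s) q \<Longrightarrow> e q \<otimes>\<^bsub>E\<^esub> s \<in> S"
    and l_act: "s \<in> S \<Longrightarrow> q \<in> P \<Longrightarrow> le (l s) q \<Longrightarrow> l (e q \<otimes>\<^bsub>E\<^esub> s) = q"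
    and e_mult: "p \<in> P \<Longrightarrow> q \<in> P \<Longrightarrow> le p q \<Longrightarrow> e q \<otimes>\<^bsub>E\<^esub> e p = e q"
    and le_l_mult: "s \<in> S \<Longrightarrow> t \<in> S \<Longrightarrow> s \<otimes>\<^bsub>E\<^esub> t \<in> S \<Longrightarrow> le (l s) (l (s \<otimes>\<^bsub>E\<^esub> t))"
    and le_range_act: "s \<in> S \<Longrightarrow> t \<in> S \<Longrightarrow> q \<in> P \<Longrightarrow> le (l s) q \<Longrightarrow>
      le (l t) (r (e q \<otimes>\<^bsub>E\<^esub> s)) \<longleftrightarrow> s \<otimes>\<^bsub>E\<^esub> t \<in> S \<and> le (l (s \<otimes>\<^bsub>E\<^esub> t)) q"
    and link_def: "link = {(p, q). p \<in> P \<and> q \<in> P \<and> (\<exists>s\<in>S. l s = p \<and> r s = q)}"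
    and rep_in: "c \<in> P // link \<Longrightarrow> rep c \<in> c"
    and enum_bij: "c \<in> P // link \<Longrightarrow> bij_betw (enum c) {..<card c} c"
begin

lemma zero_notin_S: "\<zero>\<^bsub>E\<^esub> \<notin> S"
proof
  assume z: "\<zero>\<^bsub>E\<^esub> \<in> S"
  then have "coord \<zero>\<^bsub>E\<^esub> \<zero>\<^bsub>E\<^esub> = \<zero>"
    using lin_map_zero[OF module_axioms R.self_module coord_lin[OF z]] by simp
  then show False using coord_dual[OF z z] nontrivial by simp
qed

lemma S_E: "s \<in> S \<Longrightarrow> s \<in> carrier E" using S_sub by auto

lemma mult_S_iff: "s \<in> S \<Longrightarrow> t \<in> S \<Longrightarrow> s \<otimes>\<^bsub>E\<^esub> t \<notin> S \<longleftrightarrow> s \<otimes>\<^bsub>E\<^esub> t = \<zero>\<^bsub>E\<^esub>"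
  using S_mult zero_notin_S by auto

subsection \<open>The groupoid algebra\<close>

lemma equiv_link: "equiv P link"
proof (rule equivI)
  show "link \<subseteq> P \<times> P" by (auto simp: link_def)
  show "refl_on P link" using e_S l_e r_e by (auto simp: refl_on_def link_def)
  show "sym link" using iv_S l_iv r_iv by (fastforce simp: sym_def link_def)
  show "trans link"
  proof (rule transI)
    fix p q x assume "(p, q) \<in> link" "(q, x) \<in> link"
    then obtain s t where "s \<in> S" "t \<in> S" "l s = p" "r s = q" "l t = q" "r t = x"
      by (auto simp: link_def)
    then show "(p, x) \<in> link"
      using comp_S[of s t] l_comp[of s t] r_comp[of s t] l_P r_P by (auto simp: link_def)
  qed
qed

definition cls where "cls p = link `` {p}"

lemma cls_quot: "p \<in> P \<Longrightarrow> cls p \<in> P // link" by (auto simp: cls_def quotient_def)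

lemma mem_cls: "p \<in> P \<Longrightarrow> p \<in> cls p" using equiv_class_self[OF equiv_link] by (simp add: cls_def)

lemma cls_eqI: "c \<in> P // link \<Longrightarrow> p \<in> c \<Longrightarrow> cls p = c"
  using equiv_link unfolding cls_def
  by (metis Image_singleton_iff equiv_class_eq_iff quotientE)

lemma class_sub: "c \<in> P // link \<Longrightarrow> c \<subseteq> P" using in_quotient_imp_subset[OF equiv_link] by auto

lemma cls_link: "s \<in> S \<Longrightarrow> cls (l s) = cls (r s)"
  unfolding cls_def using l_P r_P by (intro equiv_class_eq[OF equiv_link]) (auto simp: link_def)

lemma rep_P: "c \<in> P // link \<Longrightarrow> rep c \<in> P" using rep_in class_sub by auto

lemma enum_P: "c \<in> P // link \<Longrightarrow> i < card c \<Longrightarrow> enum c i \<in> P"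
  using bij_betwE[OF enum_bij] class_sub by blast

lemma cls_enum: "c \<in> P // link \<Longrightarrow> i < card c \<Longrightarrow> cls (enum c i) = c"
  using bij_betwE[OF enum_bij] cls_eqI by blast

lemma enum_inj: "c \<in> P // link \<Longrightarrow> i < card c \<Longrightarrow> j < card c \<Longrightarrow> enum c i = enum c j \<longleftrightarrow> i = j"
  using enum_bij[of c] by (auto simp: bij_betw_def inj_on_def)

definition idx where "idx p = (THE i. i < card (cls p) \<and> enum (cls p) i = p)"

lemma idx: assumes "p \<in> P" shows "idx p < card (cls p)" "enum (cls p) (idx p) = p"
proof -
  have "\<exists>i<card (cls p). enum (cls p) i = p"
    using enum_bij[OF cls_quot[OF assms]] mem_cls[OF assms]
    by (metis bij_betw_imp_surj_on imageE lessThan_iff)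
  then have "\<exists>!i. i < card (cls p) \<and> enum (cls p) i = p"
    using enum_inj[OF cls_quot[OF assms]] by metis
  from theI'[OF this] show "idx p < card (cls p)" "enum (cls p) (idx p) = p"
    by (auto simp: idx_def)
qed

lemma idx_eq: "c \<in> P // link \<Longrightarrow> i < card c \<Longrightarrow> idx (enum c i) = i"
  using idx[OF enum_P] cls_enum enum_inj by metis

definition arrow where "arrow p = (SOME s. s \<in> S \<and> l s = rep (cls p) \<and> r s = p)"

lemma arrow: assumes "p \<in> P" shows "arrow p \<in> S" "l (arrow p) = rep (cls p)" "r (arrow p) = p"
proof -
  have "rep (cls p) \<in> cls p" by (rule rep_in[OF cls_quot[OF assms]])
  then have "(rep (cls p), p) \<in> link"
    using equiv_link by (auto simp: cls_def equiv_def sym_def)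
  then have "\<exists>s. s \<in> S \<and> l s = rep (cls p) \<and> r s = p" by (auto simp: link_def)
  from someI_ex[OF this] show "arrow p \<in> S" "l (arrow p) = rep (cls p)" "r (arrow p) = p"
    by (auto simp: arrow_def)
qed

definition \<Gamma> where "\<Gamma> c = \<lparr>carrier = {s \<in> S. l s = rep c \<and> r s = rep c}, mult = mult E, one = e (rep c)\<rparr>"

definition blk where "blk c = mat_alg (card c) (monoid_alg R (\<Gamma> c))"

abbreviation D where "D \<equiv> dsum_alg (P // link) blk"

lemma \<Gamma>_monoid_algebra: "monoid_algebra R (\<Gamma> c)"
  by unfold_locales (auto simp: \<Gamma>_def intro: comp_S simp: l_comp r_comp)

lemma blk_bilinear: "bilinear_algebra R (blk c)"
  unfolding blk_def
  by (intro mat_alg_bilinear monoid_algebra.B_bilinear \<Gamma>_monoid_algebra)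

lemma D_bilinear: "bilinear_algebra R D"
  by (intro dsum_alg_bilinear blk_bilinear R.is_cring)

sublocale D: bilinear_algebra R D by (rule D_bilinear)

text \<open>
  The groupoid algebra is a direct sum of matrix algebras: \<open>arrow p\<close> is an arrow from the
  representative of the linkage class of \<open>p\<close> to \<open>p\<close>, and composition with these arrows carries
  an arrow \<open>s\<close> to an element of the vertex group of the representative.
\<close>

definition tag where "tag s = (arrow (l s) \<otimes>\<^bsub>E\<^esub> s) \<otimes>\<^bsub>E\<^esub> iv (arrow (r s))"

lemma tag_\<Gamma>:
  assumes s: "s \<in> S" shows "tag s \<in> carrier (\<Gamma> (cls (l s)))"
  using s arrow[OF l_P[OF s]] arrow[OF r_P[OF s]] cls_link[OF s]
  by (simp add: tag_def \<Gamma>_def comp_S l_comp r_comp iv_S l_iv r_iv)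

lemma cancel_left:
  assumes "s \<in> S" "t \<in> S" "r s = l t" shows "iv s \<otimes>\<^bsub>E\<^esub> (s \<otimes>\<^bsub>E\<^esub> t) = t"
  using assms S_assoc[of "iv s" s t] by (simp add: iv_S iv_left e_left)

lemma cancel_left':
  assumes "s \<in> S" "t \<in> S" "l s = l t" shows "s \<otimes>\<^bsub>E\<^esub> (iv s \<otimes>\<^bsub>E\<^esub> t) = t"
  using assms S_assoc[of s "iv s" t] by (simp add: iv_S iv_right e_left)

lemma cancel_right:
  assumes "s \<in> S" "t \<in> S" "r s = l t" shows "(s \<otimes>\<^bsub>E\<^esub> t) \<otimes>\<^bsub>E\<^esub> iv t = s"
  using assms S_assoc[of s t "iv t"] by (simp add: iv_S iv_right) (metis e_right)

lemma cancel_right':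
  assumes "s \<in> S" "t \<in> S" "r s = r t" shows "(s \<otimes>\<^bsub>E\<^esub> iv t) \<otimes>\<^bsub>E\<^esub> t = s"
  using assms S_assoc[of s "iv t" t] by (simp add: iv_S iv_left) (metis e_right)

lemma tag_inj:
  assumes s: "s \<in> S" and t: "t \<in> S" and "l s = l t" and "r s = r t" and "tag s = tag t"
  shows "s = t"
proof -
  have "iv (arrow (l u)) \<otimes>\<^bsub>E\<^esub> (tag u \<otimes>\<^bsub>E\<^esub> arrow (r u)) = u" if u: "u \<in> S" for u
  proof -
    have "tag u \<otimes>\<^bsub>E\<^esub> arrow (r u) = arrow (l u) \<otimes>\<^bsub>E\<^esub> u"
      unfolding tag_def using u arrow[OF l_P[OF u]] arrow[OF r_P[OF u]]
      by (intro cancel_right') (auto simp: comp_S r_comp)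
    then show ?thesis using u arrow[OF l_P[OF u]] by (simp add: cancel_left)
  qed
  then show ?thesis using assms by metis
qed

lemma tag_surj:
  assumes p: "p \<in> P" and q: "q \<in> P" and pq: "cls p = cls q" and g: "g \<in> carrier (\<Gamma> (cls p))"
  shows "\<exists>s\<in>S. l s = p \<and> r s = q \<and> tag s = g"
proof -
  have gS: "g \<in> S" "l g = rep (cls p)" "r g = rep (cls p)" using g by (auto simp: \<Gamma>_def)
  define s where "s = (iv (arrow p) \<otimes>\<^bsub>E\<^esub> g) \<otimes>\<^bsub>E\<^esub> arrow q"
  have 1: "iv (arrow p) \<otimes>\<^bsub>E\<^esub> g \<in> S" "l (iv (arrow p) \<otimes>\<^bsub>E\<^esub> g) = p" "r (iv (arrow p) \<otimes>\<^bsub>E\<^esub> g) = rep (cls p)"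
    using arrow[OF p] gS by (auto simp: comp_S iv_S r_iv l_iv l_comp r_comp)
  then have s: "s \<in> S" "l s = p" "r s = q"
    using arrow[OF q] pq by (auto simp: s_def comp_S l_comp r_comp)
  have "tag s = arrow p \<otimes>\<^bsub>E\<^esub> (s \<otimes>\<^bsub>E\<^esub> iv (arrow q))"
    using s arrow[OF p] arrow[OF q] by (simp add: tag_def S_assoc iv_S)
  also have "s \<otimes>\<^bsub>E\<^esub> iv (arrow q) = iv (arrow p) \<otimes>\<^bsub>E\<^esub> g"
    unfolding s_def using 1 arrow[OF q] pq by (intro cancel_right) auto
  also have "arrow p \<otimes>\<^bsub>E\<^esub> (iv (arrow p) \<otimes>\<^bsub>E\<^esub> g) = g" using arrow[OF p] gS by (intro cancel_left') auto
  finally show ?thesis using s by auto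
qed

lemma tag_mult:
  assumes s: "s \<in> S" and t: "t \<in> S" and st: "r s = l t"
  shows "tag s \<otimes>\<^bsub>E\<^esub> tag t = tag (s \<otimes>\<^bsub>E\<^esub> t)"
proof -
  note ss = arrow[OF l_P[OF s]] arrow[OF r_P[OF s]] arrow[OF r_P[OF t]]
  have c: "cls (l s) = cls (l t)" "cls (l t) = cls (r t)" using cls_link s t st by auto
  have "tag s \<otimes>\<^bsub>E\<^esub> tag t
    = (arrow (l s) \<otimes>\<^bsub>E\<^esub> s) \<otimes>\<^bsub>E\<^esub> (iv (arrow (r s)) \<otimes>\<^bsub>E\<^esub> (arrow (r s) \<otimes>\<^bsub>E\<^esub> (t \<otimes>\<^bsub>E\<^esub> iv (arrow (r t)))))"
    using s t ss st by (simp add: tag_def S_assoc comp_S iv_S l_comp r_comp l_iv r_iv)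
  also have "iv (arrow (r s)) \<otimes>\<^bsub>E\<^esub> (arrow (r s) \<otimes>\<^bsub>E\<^esub> (t \<otimes>\<^bsub>E\<^esub> iv (arrow (r t)))) = t \<otimes>\<^bsub>E\<^esub> iv (arrow (r t))"
    using s t ss st by (intro cancel_left) (auto simp: comp_S iv_S l_comp r_comp l_iv r_iv)
  also have "(arrow (l s) \<otimes>\<^bsub>E\<^esub> s) \<otimes>\<^bsub>E\<^esub> (t \<otimes>\<^bsub>E\<^esub> iv (arrow (r t))) = tag (s \<otimes>\<^bsub>E\<^esub> t)"
    using s t ss st by (simp add: tag_def S_assoc comp_S iv_S l_comp r_comp l_iv r_iv)
  finally show ?thesis .
qed

lemma tag_e:
  assumes p: "p \<in> P" shows "tag (e p) = e (rep (cls p))"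
proof -
  have "arrow p \<otimes>\<^bsub>E\<^esub> e p = arrow p" using e_right[of "arrow p"] arrow[OF p] by simp
  then show ?thesis using arrow[OF p] p by (simp add: tag_def l_e r_e iv_right)
qed

text \<open>
  As a matrix, an arrow from \<open>p\<close> to \<open>q\<close> has a single nonzero entry, in the row of \<open>p\<close> and the
  column of \<open>q\<close>.
\<close>

definition munit where
  "munit s = dsum_inj (P // link) blk (cls (l s))
     (\<lambda>(i, j)\<in>{..<card (cls (l s))} \<times> {..<card (cls (l s))}.
        if i = idx (l s) \<and> j = idx (r s) then delta R (\<Gamma> (cls (l s))) (tag s)
        else \<zero>\<^bsub>monoid_alg R (\<Gamma> (cls (l s)))\<^esub>)"

lemma munit_entry:
  assumes s: "s \<in> S" and c: "c \<in> P // link" and i: "i < card c" and j: "j < card c"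
  shows "munit s c (i, j) = (if l s = enum c i \<and> r s = enum c j then delta R (\<Gamma> c) (tag s)
    else \<zero>\<^bsub>monoid_alg R (\<Gamma> c)\<^esub>)"
proof (cases "c = cls (l s)")
  case True
  then have "i = idx (l s) \<longleftrightarrow> l s = enum c i" "j = idx (r s) \<longleftrightarrow> r s = enum c j"
    using idx_eq[OF c i] idx_eq[OF c j] idx[OF l_P[OF s]] idx[OF r_P[OF s]] cls_link[OF s] by metis+
  then show ?thesis using True c i j by (simp add: munit_def dsum_inj_def)
next
  case False
  then have "l s \<noteq> enum c i" using cls_enum[OF c i] by metis
  then show ?thesis using False c i j by (simp add: munit_def dsum_inj_def blk_def mat_alg_def)
qed

lemma D_carrierI:
  assumes "X \<in> extensional (P // link)"
    and "\<And>c. c \<in> P // link \<Longrightarrow> X c \<in> extensional ({..<card c} \<times> {..<card c})"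
    and "\<And>c i j. c \<in> P // link \<Longrightarrow> i < card c \<Longrightarrow> j < card c \<Longrightarrow> X c (i, j) \<in> carrier (monoid_alg R (\<Gamma> c))"
  shows "X \<in> carrier D"
  using assms by (auto simp: dsum_alg_def blk_def mat_alg_def PiE_iff)

lemma D_entry:
  assumes "X \<in> carrier D" and "c \<in> P // link" and "i < card c" and "j < card c"
  shows "X c (i, j) \<in> carrier (monoid_alg R (\<Gamma> c))"
proof -
  have "X c \<in> carrier (blk c)" using assms(1,2) by (auto simp: dsum_alg_def)
  then show ?thesis using assms(3,4) by (auto simp: blk_def mat_alg_def)
qed

lemma D_eqI:
  assumes X: "X \<in> carrier D" and Y: "Y \<in> carrier D"
    and eq: "\<And>c i j. c \<in> P // link \<Longrightarrow> i < card c \<Longrightarrow> j < card c \<Longrightarrow> X c (i, j) = Y c (i, j)"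
  shows "X = Y"
proof (rule PiE_ext)
  show "X \<in> (\<Pi>\<^sub>E c\<in>P // link. carrier (blk c))" "Y \<in> (\<Pi>\<^sub>E c\<in>P // link. carrier (blk c))"
    using X Y by (auto simp: dsum_alg_def)
  fix c assume c: "c \<in> P // link"
  show "X c = Y c"
  proof (rule PiE_ext)
    have "X c \<in> carrier (blk c)" "Y c \<in> carrier (blk c)"
      using X Y c by (auto simp: dsum_alg_def)
    then show "X c \<in> (\<Pi>\<^sub>E _\<in>{..<card c} \<times> {..<card c}. carrier (monoid_alg R (\<Gamma> c)))"
      "Y c \<in> (\<Pi>\<^sub>E _\<in>{..<card c} \<times> {..<card c}. carrier (monoid_alg R (\<Gamma> c)))"
      by (simp_all add: blk_def mat_alg_def)
  qed (use eq c in auto)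
qed

lemma munit_D: "s \<in> S \<Longrightarrow> munit s \<in> carrier D"
proof (rule D_carrierI)
  fix c i j assume s: "s \<in> S" and cij: "c \<in> P // link" "i < card c" "j < card c"
  interpret monoid_algebra R "\<Gamma> c" by (rule \<Gamma>_monoid_algebra)
  show "munit s c (i, j) \<in> carrier (monoid_alg R (\<Gamma> c))"
    unfolding munit_entry[OF s cij] by simp
qed (auto simp: munit_def dsum_inj_def blk_def mat_alg_def)

lemma D_mult_entry:
  assumes "c \<in> P // link" "i < card c" "j < card c"
  shows "(X \<otimes>\<^bsub>D\<^esub> Y) c (i, j) = (\<Oplus>\<^bsub>monoid_alg R (\<Gamma> c)\<^esub>m\<in>{..<card c}. X c (i, m) \<otimes>\<^bsub>monoid_alg R (\<Gamma> c)\<^esub> Y c (m, j))"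
  using assms by (simp add: dsum_alg_def blk_def mat_alg_def)

lemma munit_mult:
  assumes s: "s \<in> S" and t: "t \<in> S"
  shows "munit s \<otimes>\<^bsub>D\<^esub> munit t = (if r s = l t then munit (s \<otimes>\<^bsub>E\<^esub> t) else \<zero>\<^bsub>D\<^esub>)" (is "?L = ?R")
proof (rule D_eqI)
  show "?L \<in> carrier D" "?R \<in> carrier D"
    using s t comp_S by (auto intro!: munit_D D.bilin_closed)
  fix c i j assume cij: "c \<in> P // link" "i < card c" "j < card c"
  interpret \<Gamma>: monoid_algebra R "\<Gamma> c" by (rule \<Gamma>_monoid_algebra)
  have zero: "\<zero>\<^bsub>D\<^esub> c (i, j) = \<zero>\<^bsub>\<Gamma>.B\<^esub>" using cij by (simp add: dsum_alg_def blk_def mat_alg_def)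
  have tg: "tag s \<in> carrier (\<Gamma> c)" if "l s = enum c i" using that tag_\<Gamma>[OF s] cls_enum cij by metis
  have tg': "tag t \<in> carrier (\<Gamma> c)" if "r t = enum c j"
    using that tag_\<Gamma>[OF t] cls_enum cij cls_link[OF t] by metis
  have summand: "munit s c (i, m) \<otimes>\<^bsub>\<Gamma>.B\<^esub> munit t c (m, j) =
      (if l s = enum c i \<and> r t = enum c j \<and> r s = enum c m \<and> l t = enum c m
       then delta R (\<Gamma> c) (tag s \<otimes>\<^bsub>E\<^esub> tag t) else \<zero>\<^bsub>\<Gamma>.B\<^esub>)" if m: "m < card c" for m
    using tg tg' \<Gamma>.delta_mult[of "tag s" "tag t"]
    by (simp add: munit_entry[OF s cij(1,2) m] munit_entry[OF t cij(1) m cij(3)]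
        \<Gamma>.B.mult_zero_left \<Gamma>.B.mult_zero_right) (simp add: \<Gamma>_def)
  have L: "?L c (i, j) = (\<Oplus>\<^bsub>\<Gamma>.B\<^esub>m\<in>{..<card c}.
      if l s = enum c i \<and> r t = enum c j \<and> r s = enum c m \<and> l t = enum c m
       then delta R (\<Gamma> c) (tag s \<otimes>\<^bsub>E\<^esub> tag t) else \<zero>\<^bsub>\<Gamma>.B\<^esub>)"
    unfolding D_mult_entry[OF cij] by (intro \<Gamma>.B.M.finsum_cong') (auto simp: summand)
  show "?L c (i, j) = ?R c (i, j)"
  proof (cases "r s = l t \<and> l s = enum c i \<and> r t = enum c j")
    case True
    then have "cls (r s) = c" using cls_link[OF s] cls_enum cij by metis
    then have m: "idx (r s) < card c" "enum c (idx (r s)) = r s" using idx[OF r_P[OF s]] by auto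
    then have "r s = enum c m \<longleftrightarrow> m = idx (r s)" if "m < card c" for m
      using enum_inj[OF cij(1) that m(1)] by auto
    then have "?L c (i, j) = (\<Oplus>\<^bsub>\<Gamma>.B\<^esub>m\<in>{..<card c}. if m = idx (r s)
        then delta R (\<Gamma> c) (tag s \<otimes>\<^bsub>E\<^esub> tag t) else \<zero>\<^bsub>\<Gamma>.B\<^esub>)"
      unfolding L using True by (intro \<Gamma>.B.M.finsum_cong') auto
    also have "\<dots> = delta R (\<Gamma> c) (tag s \<otimes>\<^bsub>E\<^esub> tag t)"
      using m by (subst \<Gamma>.B.finsum_delta) auto
    also have "\<dots> = munit (s \<otimes>\<^bsub>E\<^esub> t) c (i, j)"
      using True s t by (simp add: munit_entry[OF comp_S cij] l_comp r_comp tag_mult)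
    finally show ?thesis using True by simp
  next
    case False
    then have "?L c (i, j) = \<zero>\<^bsub>\<Gamma>.B\<^esub>"
      unfolding L by (intro \<Gamma>.B.M.add.finprod_one_eqI) auto
    moreover have "munit (s \<otimes>\<^bsub>E\<^esub> t) c (i, j) = \<zero>\<^bsub>\<Gamma>.B\<^esub>" if "r s = l t"
      unfolding munit_entry[OF comp_S[OF s t that] cij] using False s t that by (auto simp: l_comp r_comp)
    ultimately show ?thesis using zero by simp
  qed
qed

text \<open>The coordinates of a direct sum of matrices with respect to the matrix units.\<close>

definition ev where "ev s X = X (cls (l s)) (idx (l s), idx (r s)) (tag s)"

lemma entry_lin:
  assumes "c \<in> P // link" "i < card c" "j < card c" "g \<in> carrier (\<Gamma> c)"
  shows "lin_map R D (self_module R) (\<lambda>X. X c (i, j) g)"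
proof -
  interpret \<Gamma>: monoid_algebra R "\<Gamma> c" by (rule \<Gamma>_monoid_algebra)
  show ?thesis
  proof (rule lin_mapI)
    fix X assume X: "X \<in> carrier D"
    show "X c (i, j) g \<in> carrier (self_module R)"
      using \<Gamma>.coeff_closed[OF D_entry[OF X assms(1-3)] assms(4)] by simp
  qed (use assms in \<open>simp_all add: dsum_alg_def blk_def mat_alg_def \<Gamma>.coeff_add \<Gamma>.coeff_smult\<close>)
qed

lemma ev_lin: "s \<in> S \<Longrightarrow> lin_map R D (self_module R) (ev s)"
  unfolding ev_def using idx(1)[OF r_P] cls_link
  by (intro entry_lin cls_quot tag_\<Gamma> idx(1) l_P) simp_all

lemma ev_closed: "s \<in> S \<Longrightarrow> X \<in> carrier D \<Longrightarrow> ev s X \<in> carrier R"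
  using lin_mapD(1)[OF ev_lin] by simp

lemma munit_coeff:
  assumes s: "s \<in> S" and t: "t \<in> S"
  shows "munit s (cls (l t)) (idx (l t), idx (r t)) (tag t) = (if s = t then \<one> else \<zero>)"
proof -
  note c = cls_quot[OF l_P[OF t]] idx(1)[OF l_P[OF t]] idx(1)[OF r_P[OF t], folded cls_link[OF t]]
  interpret \<Gamma>: monoid_algebra R "\<Gamma> (cls (l t))" by (rule \<Gamma>_monoid_algebra)
  show ?thesis
    unfolding munit_entry[OF s c] using tag_inj[OF s t] tag_\<Gamma>[OF t] idx(2)[OF l_P[OF t]]
      idx(2)[OF r_P[OF t], folded cls_link[OF t]]
    by (auto simp: \<Gamma>.coeff_zero \<Gamma>.coeff_delta)
qed

lemma ev_munit: "s \<in> S \<Longrightarrow> t \<in> S \<Longrightarrow> ev t (munit s) = (if s = t then \<one> else \<zero>)"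
  by (simp add: ev_def munit_coeff)

lemma D_eqI_ev:
  assumes X: "X \<in> carrier D" and Y: "Y \<in> carrier D" and eq: "\<And>s. s \<in> S \<Longrightarrow> ev s X = ev s Y"
  shows "X = Y"
proof (rule D_eqI[OF X Y])
  fix c i j assume cij: "c \<in> P // link" "i < card c" "j < card c"
  interpret \<Gamma>: monoid_algebra R "\<Gamma> c" by (rule \<Gamma>_monoid_algebra)
  show "X c (i, j) = Y c (i, j)"
  proof (rule \<Gamma>.B_eqI[OF D_entry[OF X cij] D_entry[OF Y cij]])
    fix g assume "g \<in> carrier (\<Gamma> c)"
    then obtain s where s: "s \<in> S" "l s = enum c i" "r s = enum c j" "tag s = g"
      using tag_surj[OF enum_P[OF cij(1,2)] enum_P[OF cij(1,3)]] cls_enum cij by metis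
    show "X c (i, j) g = Y c (i, j) g"
      using eq[OF s(1)] s idx_eq cij cls_enum by (simp add: ev_def)
  qed
qed

lemma D_expand:
  assumes X: "X \<in> carrier D"
  shows "(\<Oplus>\<^bsub>D\<^esub>s\<in>S. ev s X \<odot>\<^bsub>D\<^esub> munit s) = X"
proof (rule D_eqI_ev)
  have terms: "(\<lambda>s. ev s X \<odot>\<^bsub>D\<^esub> munit s) \<in> S \<rightarrow> carrier D"
    using ev_closed[OF _ X] munit_D by auto
  then show "(\<Oplus>\<^bsub>D\<^esub>s\<in>S. ev s X \<odot>\<^bsub>D\<^esub> munit s) \<in> carrier D" by (rule D.M.finsum_closed)
  fix t assume t: "t \<in> S"
  have "ev t (\<Oplus>\<^bsub>D\<^esub>s\<in>S. ev s X \<odot>\<^bsub>D\<^esub> munit s) = (\<Oplus>s\<in>S. ev t (ev s X \<odot>\<^bsub>D\<^esub> munit s))"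
    using lin_map_finsum[OF D.module_axioms R.self_module ev_lin[OF t] terms] by simp
  also have "\<dots> = (\<Oplus>s\<in>S. if s = t then ev s X else \<zero>)"
    using ev_closed[OF _ X] lin_mapD(3)[OF ev_lin[OF t]] munit_D t
    by (intro R.finsum_cong') (auto simp: ev_munit)
  also have "\<dots> = ev t X"
    using module.finsum_delta[OF R.self_module S_finite t, of "\<lambda>s. ev s X",
        unfolded self_module_simps finsum_self_module] ev_closed[OF t X] by simp
  finally show "ev t (\<Oplus>\<^bsub>D\<^esub>s\<in>S. ev s X \<odot>\<^bsub>D\<^esub> munit s) = ev t X" .
qed (fact X)


subsection \<open>From the inverse semigroup to the groupoid\<close>

lemma restriction_act:
  assumes s: "s \<in> S" and q: "q \<in> P" "le (l s) q" and x: "x \<in> P" "le q x"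
  shows "e x \<otimes>\<^bsub>E\<^esub> (e q \<otimes>\<^bsub>E\<^esub> s) = e x \<otimes>\<^bsub>E\<^esub> s" "le (l s) x"
proof -
  show "e x \<otimes>\<^bsub>E\<^esub> (e q \<otimes>\<^bsub>E\<^esub> s) = e x \<otimes>\<^bsub>E\<^esub> s"
    using S_assoc[OF e_S[OF x(1)] e_S[OF q(1)] s] e_mult[OF q(1) x] by simp
  show "le (l s) x" using le_trans[OF l_P[OF s] q(1) x(1) q(2) x(2)] .
qed

definition above where "above p = {q \<in> P. le p q}"

lemma above_finite: "finite (above p)" using P_finite by (simp add: above_def)

lemma aboveD: "q \<in> above p \<Longrightarrow> q \<in> P" "q \<in> above p \<Longrightarrow> le p q" by (auto simp: above_def)

lemma above_munit: "s \<in> S \<Longrightarrow> q \<in> above (l s) \<Longrightarrow> munit (e q \<otimes>\<^bsub>E\<^esub> s) \<in> carrier D"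
  by (intro munit_D act_S) (auto simp: above_def)

text \<open>
  An element \<open>s\<close> of the inverse semigroup goes to the sum of the arrows given by all its
  restrictions. This formula is extended linearly from \<open>S\<close> by means of the coordinates.
\<close>

definition psi where "psi x = (\<Oplus>\<^bsub>D\<^esub>s\<in>S. coord s x \<odot>\<^bsub>D\<^esub> (\<Oplus>\<^bsub>D\<^esub>q\<in>above (l s). munit (e q \<otimes>\<^bsub>E\<^esub> s)))"

lemma psi_lin: "lin_map R E D psi"
  unfolding psi_def
  by (rule lin_map_combination[OF module_axioms D.module_axioms coord_lin _ S_finite])
    (auto intro!: D.M.finsum_closed above_munit)

lemma psi_S:
  assumes s: "s \<in> S" shows "psi s = (\<Oplus>\<^bsub>D\<^esub>q\<in>above (l s). munit (e q \<otimes>\<^bsub>E\<^esub> s))"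
proof -
  let ?v = "\<lambda>s. \<Oplus>\<^bsub>D\<^esub>q\<in>above (l s). munit (e q \<otimes>\<^bsub>E\<^esub> s)"
  have v: "?v t \<in> carrier D" if "t \<in> S" for t using that by (intro D.M.finsum_closed) (auto intro: above_munit)
  have "psi s = (\<Oplus>\<^bsub>D\<^esub>t\<in>S. if t = s then ?v t else \<zero>\<^bsub>D\<^esub>)"
    unfolding psi_def using s v by (intro D.M.finsum_cong') (auto simp: coord_dual)
  also have "\<dots> = ?v s" using v[OF s] by (rule D.finsum_delta[OF S_finite s, where f = ?v])
  finally show ?thesis .
qed

text \<open>
  Expanding the product on the right over the restrictions of \<open>s\<close> and \<open>t\<close>, the restriction of
  \<open>s\<close> to \<open>q\<close> composes with at most one restriction of \<open>t\<close>, namely the one to its range. By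
  \<open>le_range_act\<close> the surviving \<open>q\<close> are those to which \<open>s \<otimes> t\<close> restricts.
\<close>

lemma psi_mult_S:
  assumes s: "s \<in> S" and t: "t \<in> S"
  shows "psi (s \<otimes>\<^bsub>E\<^esub> t) = psi s \<otimes>\<^bsub>D\<^esub> psi t"
proof -
  let ?s = "\<lambda>q. e q \<otimes>\<^bsub>E\<^esub> s" and ?t = "\<lambda>q. e q \<otimes>\<^bsub>E\<^esub> t"
  have sS: "?s q \<in> S" if "q \<in> above (l s)" for q using that s by (intro act_S) (auto simp: above_def)
  have tS: "?t q \<in> S" if "q \<in> above (l t)" for q using that t by (intro act_S) (auto simp: above_def)
  have lt: "l (?t q) = q" if "q \<in> above (l t)" for q using that t by (intro l_act) (auto simp: above_def)
  have closed: "munit (?s q) \<otimes>\<^bsub>D\<^esub> munit (?t x) \<in> carrier D" if "q \<in> above (l s)" "x \<in> above (l t)" for q x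
    using that sS tS munit_D by auto
  have "psi s \<otimes>\<^bsub>D\<^esub> psi t = (\<Oplus>\<^bsub>D\<^esub>q\<in>above (l s). munit (?s q) \<otimes>\<^bsub>D\<^esub> psi t)"
    unfolding psi_S[OF s] using lin_mapD(1)[OF psi_lin S_E[OF t]] s
    by (intro lin_map_finsum[OF D.module_axioms D.module_axioms D.lin_map_mult_right]) (auto intro: above_munit)
  also have "\<dots> = (\<Oplus>\<^bsub>D\<^esub>q\<in>above (l s). \<Oplus>\<^bsub>D\<^esub>x\<in>above (l t). munit (?s q) \<otimes>\<^bsub>D\<^esub> munit (?t x))"
    unfolding psi_S[OF t] using s t
    by (intro D.M.finsum_cong' refl
        lin_map_finsum[OF D.module_axioms D.module_axioms D.lin_map_mult_left])
      (auto intro!: closed D.M.finsum_closed above_munit)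
  also have "\<dots> = (\<Oplus>\<^bsub>D\<^esub>q\<in>above (l s). if s \<otimes>\<^bsub>E\<^esub> t \<in> S \<and> le (l (s \<otimes>\<^bsub>E\<^esub> t)) q
      then munit (e q \<otimes>\<^bsub>E\<^esub> (s \<otimes>\<^bsub>E\<^esub> t)) else \<zero>\<^bsub>D\<^esub>)"
  proof (rule D.M.finsum_cong')
    fix q assume q: "q \<in> above (l s)"
    let ?x = "r (?s q)"
    have xP: "?x \<in> P" using r_P sS[OF q] by auto
    have inner: "(\<Oplus>\<^bsub>D\<^esub>x\<in>above (l t). munit (?s q) \<otimes>\<^bsub>D\<^esub> munit (?t x))
        = (\<Oplus>\<^bsub>D\<^esub>x\<in>above (l t). if x = ?x then munit (?s q \<otimes>\<^bsub>E\<^esub> ?t x) else \<zero>\<^bsub>D\<^esub>)"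
      using sS[OF q] tS by (intro D.M.finsum_cong') (auto simp: munit_mult lt comp_S intro!: munit_D)
    have key: "le (l t) ?x \<longleftrightarrow> s \<otimes>\<^bsub>E\<^esub> t \<in> S \<and> le (l (s \<otimes>\<^bsub>E\<^esub> t)) q"
      using le_range_act[OF s t] q by (auto simp: above_def)
    show "(\<Oplus>\<^bsub>D\<^esub>x\<in>above (l t). munit (?s q) \<otimes>\<^bsub>D\<^esub> munit (?t x))
      = (if s \<otimes>\<^bsub>E\<^esub> t \<in> S \<and> le (l (s \<otimes>\<^bsub>E\<^esub> t)) q
        then munit (e q \<otimes>\<^bsub>E\<^esub> (s \<otimes>\<^bsub>E\<^esub> t)) else \<zero>\<^bsub>D\<^esub>)"
    proof (cases "le (l t) ?x")
      case True
      then have x: "?x \<in> above (l t)" using xP by (simp add: above_def)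
      have c: "?s q \<otimes>\<^bsub>E\<^esub> ?t ?x \<in> S" using lt[OF x] by (intro comp_S[OF sS[OF q] tS[OF x]]) simp
      have "?s q \<otimes>\<^bsub>E\<^esub> ?t ?x = (?s q \<otimes>\<^bsub>E\<^esub> e ?x) \<otimes>\<^bsub>E\<^esub> t"
        by (rule S_assoc[OF sS[OF q] e_S[OF xP] t, symmetric])
      also have "\<dots> = e q \<otimes>\<^bsub>E\<^esub> (s \<otimes>\<^bsub>E\<^esub> t)"
        using e_right[OF sS[OF q]] S_assoc[OF e_S[OF aboveD(1)[OF q]] s t] by simp
      finally have eq: "?s q \<otimes>\<^bsub>E\<^esub> ?t ?x = e q \<otimes>\<^bsub>E\<^esub> (s \<otimes>\<^bsub>E\<^esub> t)" .
      have "(\<Oplus>\<^bsub>D\<^esub>x\<in>above (l t). if x = ?x then munit (?s q \<otimes>\<^bsub>E\<^esub> ?t x) else \<zero>\<^bsub>D\<^esub>) = munit (?s q \<otimes>\<^bsub>E\<^esub> ?t ?x)"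
        using munit_D[OF c] x by (intro D.finsum_delta[OF above_finite])
      then show ?thesis using inner key True eq by simp
    next
      case False
      then have "?x \<notin> above (l t)" by (simp add: above_def)
      then show ?thesis unfolding inner using key False
        by (subst D.M.add.finprod_one_eqI) auto
    qed
  qed (use s t in \<open>auto intro!: munit_D act_S simp: above_def\<close>)
  also have "\<dots> = psi (s \<otimes>\<^bsub>E\<^esub> t)"
  proof (cases "s \<otimes>\<^bsub>E\<^esub> t \<in> S")
    case True
    have sub: "above (l (s \<otimes>\<^bsub>E\<^esub> t)) = {q \<in> above (l s). s \<otimes>\<^bsub>E\<^esub> t \<in> S \<and> le (l (s \<otimes>\<^bsub>E\<^esub> t)) q}"
      using le_trans[OF l_P[OF s] l_P[OF True] _ le_l_mult[OF s t True]] True by (auto simp: above_def)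
    show ?thesis unfolding psi_S[OF True] unfolding sub
      using True by (intro D.finsum_if[symmetric] above_finite) (auto intro!: munit_D act_S simp: above_def)
  next
    case False
    then show ?thesis
      using mult_S_iff[OF s t] lin_map_zero[OF module_axioms D.module_axioms psi_lin] by simp
  qed
  finally show ?thesis by simp
qed

abbreviation span_S where "span_S \<equiv> lin_span R E S"

lemma span_S_submodule: "submodule span_S R E" by (rule lin_span_submodule[OF S_sub])

lemma span_S_E: "x \<in> span_S \<Longrightarrow> x \<in> carrier E" using lin_span_carrier[OF S_sub] by auto

lemma S_span_S: "s \<in> S \<Longrightarrow> s \<in> span_S" using lin_span_incl by auto

lemma span_S_mult:
  assumes x: "x \<in> span_S" and y: "y \<in> span_S" shows "x \<otimes>\<^bsub>E\<^esub> y \<in> span_S"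
proof (rule lin_span_mult[OF S_sub S_sub span_S_submodule _ x y])
  fix s t assume "s \<in> S" "t \<in> S"
  from S_mult[OF this] show "s \<otimes>\<^bsub>E\<^esub> t \<in> span_S"
    using S_span_S submodule_zero[OF span_S_submodule] by auto
qed

lemma psi_mult:
  assumes x: "x \<in> span_S" and y: "y \<in> span_S"
  shows "psi (x \<otimes>\<^bsub>E\<^esub> y) = psi x \<otimes>\<^bsub>D\<^esub> psi y"
proof -
  note psic = lin_mapD(1)[OF psi_lin]
  have 1: "psi (s \<otimes>\<^bsub>E\<^esub> y) = psi s \<otimes>\<^bsub>D\<^esub> psi y" if s: "s \<in> S" for s
  proof -
    have "submodule {z \<in> carrier E. psi (s \<otimes>\<^bsub>E\<^esub> z) = psi s \<otimes>\<^bsub>D\<^esub> psi z} R E"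
      by (intro submodule_equalizer[OF module_axioms D.module_axioms]
          lin_map_comp[OF lin_map_mult_left psi_lin] lin_map_comp[OF psi_lin D.lin_map_mult_left] psic S_E s)
    then have "span_S \<subseteq> {z \<in> carrier E. psi (s \<otimes>\<^bsub>E\<^esub> z) = psi s \<otimes>\<^bsub>D\<^esub> psi z}"
      using psi_mult_S[OF s] S_E by (intro lin_span_min) auto
    then show ?thesis using y by auto
  qed
  have "submodule {z \<in> carrier E. psi (z \<otimes>\<^bsub>E\<^esub> y) = psi z \<otimes>\<^bsub>D\<^esub> psi y} R E"
    by (intro submodule_equalizer[OF module_axioms D.module_axioms]
        lin_map_comp[OF lin_map_mult_right psi_lin] lin_map_comp[OF psi_lin D.lin_map_mult_right]
        psic span_S_E y)
  then have "span_S \<subseteq> {z \<in> carrier E. psi (z \<otimes>\<^bsub>E\<^esub> y) = psi z \<otimes>\<^bsub>D\<^esub> psi y}"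
    using 1 S_E by (intro lin_span_min) auto
  then show ?thesis using x by auto
qed

subsection \<open>Moebius inversion\<close>

text \<open>
  The preimage of a single arrow under \<open>psi\<close>: the arrow is the sum of all its restrictions,
  corrected by the Moebius function.
\<close>

definition moeb where "moeb s = (\<Oplus>\<^bsub>E\<^esub>q\<in>above (l s). w (l s) q \<odot>\<^bsub>E\<^esub> (e q \<otimes>\<^bsub>E\<^esub> s))"

lemma moeb_span_S:
  assumes s: "s \<in> S" shows "moeb s \<in> span_S"
  unfolding moeb_def
proof (intro submodule_finsum[OF span_S_submodule] Pi_I submoduleE(4)[OF span_S_submodule])
  fix q assume "q \<in> above (l s)"
  then have q: "q \<in> P" "le (l s) q" by (auto simp: above_def)
  show "w (l s) q \<in> carrier R" by (rule w_closed[OF l_P[OF s] q(1)])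
  show "e q \<otimes>\<^bsub>E\<^esub> s \<in> span_S" by (rule S_span_S[OF act_S[OF s q]])
qed

lemma psi_moeb:
  assumes s: "s \<in> S" shows "psi (moeb s) = munit s"
proof -
  let ?p = "l s"
  have wc: "w ?p q \<in> carrier R" if "q \<in> above ?p" for q using that w_closed l_P[OF s] by (auto simp: above_def)
  have qS: "e q \<otimes>\<^bsub>E\<^esub> s \<in> S" if "q \<in> above ?p" for q using that s by (intro act_S) (auto simp: above_def)
  have "psi (moeb s) = (\<Oplus>\<^bsub>D\<^esub>q\<in>above ?p. psi (w ?p q \<odot>\<^bsub>E\<^esub> (e q \<otimes>\<^bsub>E\<^esub> s)))"
    unfolding moeb_def using wc qS S_E by (intro lin_map_finsum[OF module_axioms D.module_axioms psi_lin]) auto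
  also have "\<dots> = (\<Oplus>\<^bsub>D\<^esub>q\<in>above ?p. \<Oplus>\<^bsub>D\<^esub>x\<in>above ?p.
      if le q x then w ?p q \<odot>\<^bsub>D\<^esub> munit (e x \<otimes>\<^bsub>E\<^esub> s) else \<zero>\<^bsub>D\<^esub>)"
  proof (rule D.M.finsum_cong')
    fix q assume q: "q \<in> above ?p"
    have ab: "above (l (e q \<otimes>\<^bsub>E\<^esub> s)) = {x \<in> above ?p. le q x}"
      using q l_act[OF s, of q] restriction_act(2)[OF s, of q] by (auto simp: above_def)
    have "psi (w ?p q \<odot>\<^bsub>E\<^esub> (e q \<otimes>\<^bsub>E\<^esub> s)) = w ?p q \<odot>\<^bsub>D\<^esub> psi (e q \<otimes>\<^bsub>E\<^esub> s)"
      using lin_mapD(3)[OF psi_lin wc[OF q] S_E[OF qS[OF q]]] .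
    also have "psi (e q \<otimes>\<^bsub>E\<^esub> s) = (\<Oplus>\<^bsub>D\<^esub>x\<in>{x \<in> above ?p. le q x}. munit (e x \<otimes>\<^bsub>E\<^esub> s))"
      unfolding psi_S[OF qS[OF q]] ab
      using q restriction_act(1)[OF s, of q] s
      by (intro D.M.finsum_cong') (auto simp: aboveD intro!: above_munit)
    also have "w ?p q \<odot>\<^bsub>D\<^esub> \<dots> = (\<Oplus>\<^bsub>D\<^esub>x\<in>{x \<in> above ?p. le q x}. w ?p q \<odot>\<^bsub>D\<^esub> munit (e x \<otimes>\<^bsub>E\<^esub> s))"
      using wc[OF q] above_finite above_munit[OF s] by (intro D.finsum_smult_ldistr) auto
    also have "\<dots> = (\<Oplus>\<^bsub>D\<^esub>x\<in>above ?p. if le q x then w ?p q \<odot>\<^bsub>D\<^esub> munit (e x \<otimes>\<^bsub>E\<^esub> s) else \<zero>\<^bsub>D\<^esub>)"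
      using wc[OF q] above_munit[OF s] by (intro D.finsum_if above_finite) auto
    finally show "psi (w ?p q \<odot>\<^bsub>E\<^esub> (e q \<otimes>\<^bsub>E\<^esub> s)) = \<dots>" .
  qed (use wc above_munit[OF s] in \<open>auto intro!: D.M.finsum_closed\<close>)
  also have "\<dots> = (\<Oplus>\<^bsub>D\<^esub>x\<in>above ?p. \<Oplus>\<^bsub>D\<^esub>q\<in>above ?p.
      if le q x then w ?p q \<odot>\<^bsub>D\<^esub> munit (e x \<otimes>\<^bsub>E\<^esub> s) else \<zero>\<^bsub>D\<^esub>)"
    using wc above_munit[OF s] by (intro D.finsum_swap above_finite) auto
  also have "\<dots> = (\<Oplus>\<^bsub>D\<^esub>x\<in>above ?p. if x = ?p then munit (e x \<otimes>\<^bsub>E\<^esub> s) else \<zero>\<^bsub>D\<^esub>)"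
  proof (rule D.M.finsum_cong')
    fix x assume x: "x \<in> above ?p"
    note m = above_munit[OF s x]
    have set: "{q \<in> above ?p. le q x} = {q \<in> P. le ?p q \<and> le q x}" by (auto simp: above_def)
    have "(\<Oplus>\<^bsub>D\<^esub>q\<in>above ?p. if le q x then w ?p q \<odot>\<^bsub>D\<^esub> munit (e x \<otimes>\<^bsub>E\<^esub> s) else \<zero>\<^bsub>D\<^esub>)
      = (\<Oplus>\<^bsub>D\<^esub>q\<in>{q \<in> above ?p. le q x}. w ?p q \<odot>\<^bsub>D\<^esub> munit (e x \<otimes>\<^bsub>E\<^esub> s))"
      using wc m by (intro D.finsum_if[symmetric] above_finite) auto
    also have "\<dots> = (\<Oplus>q\<in>{q \<in> above ?p. le q x}. w ?p q) \<odot>\<^bsub>D\<^esub> munit (e x \<otimes>\<^bsub>E\<^esub> s)"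
    proof -
      have "lin_map R (self_module R) D (\<lambda>c. c \<odot>\<^bsub>D\<^esub> munit (e x \<otimes>\<^bsub>E\<^esub> s))"
        using m by (intro lin_mapI) (auto simp: D.smult_l_distr D.smult_assoc1)
      then show ?thesis
        using lin_map_finsum[OF R.self_module D.module_axioms, of "\<lambda>c. c \<odot>\<^bsub>D\<^esub> munit (e x \<otimes>\<^bsub>E\<^esub> s)"
            "w ?p" "{q \<in> above ?p. le q x}"] wc by auto
    qed
    also have "\<dots> = (if x = ?p then munit (e x \<otimes>\<^bsub>E\<^esub> s) else \<zero>\<^bsub>D\<^esub>)"
      unfolding set using w_sum[OF l_P[OF s] aboveD[OF x]] m by auto
    finally show "(\<Oplus>\<^bsub>D\<^esub>q\<in>above ?p. if le q x then w ?p q \<odot>\<^bsub>D\<^esub> munit (e x \<otimes>\<^bsub>E\<^esub> s) else \<zero>\<^bsub>D\<^esub>)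
      = (if x = ?p then munit (e x \<otimes>\<^bsub>E\<^esub> s) else \<zero>\<^bsub>D\<^esub>)" .
  qed (use above_munit[OF s] in auto)
  also have "\<dots> = munit (e ?p \<otimes>\<^bsub>E\<^esub> s)"
    using above_munit[OF s] l_P[OF s] le_refl[OF l_P[OF s]]
    by (intro D.finsum_delta[OF above_finite]) (auto simp: above_def)
  finally show ?thesis using e_left[OF s] by simp
qed

definition phi where "phi X = (\<Oplus>\<^bsub>E\<^esub>s\<in>S. ev s X \<odot>\<^bsub>E\<^esub> moeb s)"

lemma phi_lin: "lin_map R D E phi"
  unfolding phi_def
  by (rule lin_map_combination[OF D.module_axioms module_axioms ev_lin _ S_finite])
    (auto intro: span_S_E moeb_span_S)

lemma phi_span_S: "X \<in> carrier D \<Longrightarrow> phi X \<in> span_S"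
  unfolding phi_def
  by (intro submodule_finsum[OF span_S_submodule] Pi_I submoduleE(4)[OF span_S_submodule] ev_closed moeb_span_S)

lemma psi_phi:
  assumes X: "X \<in> carrier D" shows "psi (phi X) = X"
proof -
  have "psi (phi X) = (\<Oplus>\<^bsub>D\<^esub>s\<in>S. psi (ev s X \<odot>\<^bsub>E\<^esub> moeb s))"
    unfolding phi_def using ev_closed[OF _ X] moeb_span_S span_S_E
    by (intro lin_map_finsum[OF module_axioms D.module_axioms psi_lin]) auto
  also have "\<dots> = (\<Oplus>\<^bsub>D\<^esub>s\<in>S. ev s X \<odot>\<^bsub>D\<^esub> munit s)"
    using ev_closed[OF _ X] moeb_span_S span_S_E lin_mapD(3)[OF psi_lin] munit_D
    by (intro D.M.finsum_cong') (auto simp: psi_moeb)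
  finally show ?thesis using D_expand[OF X] by simp
qed

lemma phi_munit:
  assumes s: "s \<in> S" shows "phi (munit s) = moeb s"
proof -
  have "phi (munit s) = (\<Oplus>\<^bsub>E\<^esub>t\<in>S. if t = s then moeb t else \<zero>\<^bsub>E\<^esub>)"
    unfolding phi_def using s moeb_span_S span_S_E by (intro M.finsum_cong') (auto simp: ev_munit)
  also have "\<dots> = moeb s" using span_S_E[OF moeb_span_S[OF s]] by (rule finsum_delta[OF S_finite s, where f = moeb])
  finally show ?thesis .
qed

text \<open>
  Downward induction on \<open>l s\<close>: since \<open>w p p = \<one>\<close>, \<open>moeb s\<close> is \<open>s\<close> plus a combination of
  proper restrictions of \<open>s\<close>.
\<close>

lemma S_phi_image: "s \<in> S \<Longrightarrow> s \<in> phi ` carrier D"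
proof (induction "card (above (l s))" arbitrary: s rule: less_induct)
  case less
  note s = less.prems
  let ?N = "phi ` carrier D" and ?p = "l s"
  note N = submodule_lin_image[OF D.module_axioms module_axioms phi_lin]
  have wc: "w ?p q \<in> carrier R" if "q \<in> above ?p" for q using that w_closed l_P[OF s] by (auto simp: above_def)
  have qS: "e q \<otimes>\<^bsub>E\<^esub> s \<in> S" if "q \<in> above ?p" for q using that s by (intro act_S) (auto simp: above_def)
  have "moeb s \<in> ?N" using phi_munit[OF s] munit_D[OF s] by (metis imageI)
  have p: "?p \<in> above ?p" using l_P[OF s] le_refl by (auto simp: above_def)
  have rest: "(\<Oplus>\<^bsub>E\<^esub>q\<in>above ?p - {?p}. w ?p q \<odot>\<^bsub>E\<^esub> (e q \<otimes>\<^bsub>E\<^esub> s)) \<in> ?N"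
  proof (intro submodule_finsum[OF N] Pi_I submoduleE(4)[OF N])
    fix q assume q: "q \<in> above ?p - {?p}"
    have lq: "l (e q \<otimes>\<^bsub>E\<^esub> s) = q" using q s by (intro l_act) (auto simp: above_def)
    have "above q \<subset> above ?p"
      using q p l_P[OF s] le_trans[OF l_P[OF s], of q] le_antisym[OF l_P[OF s], of q]
      by (auto simp: above_def)
    then have "card (above (l (e q \<otimes>\<^bsub>E\<^esub> s))) < card (above ?p)"
      unfolding lq by (rule psubset_card_mono[OF above_finite])
    then show "e q \<otimes>\<^bsub>E\<^esub> s \<in> ?N" using less.hyps qS q by blast
    show "w ?p q \<in> carrier R" using wc q by auto
  qed
  \<comment> \<open>The defining sum of the Moebius function over a one-element interval.\<close>
  have wpp: "w ?p ?p = \<one>"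
  proof -
    have "{x \<in> P. le ?p x \<and> le x ?p} = {?p}"
      using l_P[OF s] le_refl le_antisym by auto
    then show ?thesis using w_sum[OF l_P[OF s] l_P[OF s] le_refl[OF l_P[OF s]]] wc[OF p] by simp
  qed
  have "moeb s = s \<oplus>\<^bsub>E\<^esub> (\<Oplus>\<^bsub>E\<^esub>q\<in>above ?p - {?p}. w ?p q \<odot>\<^bsub>E\<^esub> (e q \<otimes>\<^bsub>E\<^esub> s))"
  proof -
    have "moeb s = (\<Oplus>\<^bsub>E\<^esub>q\<in>insert ?p (above ?p - {?p}). w ?p q \<odot>\<^bsub>E\<^esub> (e q \<otimes>\<^bsub>E\<^esub> s))"
      unfolding moeb_def using p by (simp add: insert_absorb)
    also have "\<dots> = w ?p ?p \<odot>\<^bsub>E\<^esub> (e ?p \<otimes>\<^bsub>E\<^esub> s)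
        \<oplus>\<^bsub>E\<^esub> (\<Oplus>\<^bsub>E\<^esub>q\<in>above ?p - {?p}. w ?p q \<odot>\<^bsub>E\<^esub> (e q \<otimes>\<^bsub>E\<^esub> s))"
      using above_finite wc qS S_E p by (intro M.finsum_insert) auto
    finally show ?thesis using wpp e_left[OF s] S_E[OF s] by simp
  qed
  then have "s = moeb s \<oplus>\<^bsub>E\<^esub> \<ominus>\<^bsub>E\<^esub> (\<Oplus>\<^bsub>E\<^esub>q\<in>above ?p - {?p}. w ?p q \<odot>\<^bsub>E\<^esub> (e q \<otimes>\<^bsub>E\<^esub> s))"
    using S_E[OF s] subsetD[OF submoduleE(1)[OF N] rest] by (simp only:) (simp add: M.a_assoc M.r_neg)
  then show ?case
    using submoduleE(5)[OF N \<open>moeb s \<in> ?N\<close> submoduleE(3)[OF N rest]] by simp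
qed

lemma phi_image: "phi ` carrier D = span_S"
proof
  show "phi ` carrier D \<subseteq> span_S" using phi_span_S by auto
  show "span_S \<subseteq> phi ` carrier D"
    by (intro lin_span_min submodule_lin_image[OF D.module_axioms module_axioms phi_lin] subsetI S_phi_image)
qed

lemma phi_psi:
  assumes "x \<in> span_S" shows "phi (psi x) = x"
proof -
  obtain X where "X \<in> carrier D" "x = phi X" using assms unfolding phi_image[symmetric] by blast
  then show ?thesis by (simp add: psi_phi)
qed

lemma B_one: "\<one>\<^bsub>monoid_alg R (\<Gamma> c)\<^esub> = delta R (\<Gamma> c) (e (rep c))"
  by (simp add: monoid_alg_simps) (simp add: \<Gamma>_def)

text \<open>
  The restrictions of the largest idempotent are all idempotents, and these are the diagonal
  matrix units.
\<close>

lemma psi_e_bot: "psi (e bot) = \<one>\<^bsub>D\<^esub>"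
proof -
  have ab: "above bot = P" using bot by (auto simp: above_def)
  have "psi (e bot) = (\<Oplus>\<^bsub>D\<^esub>q\<in>P. munit (e q))"
    unfolding psi_S[OF e_S[OF bot(1)]] l_e[OF bot(1)] ab
    using bot e_mult e_S munit_D by (intro D.M.finsum_cong') auto
  also have "\<dots> = \<one>\<^bsub>D\<^esub>"
  proof (rule D_eqI)
    show "(\<Oplus>\<^bsub>D\<^esub>q\<in>P. munit (e q)) \<in> carrier D" using e_S munit_D by (intro D.M.finsum_closed) auto
    show "\<one>\<^bsub>D\<^esub> \<in> carrier D"
    proof (rule D_carrierI)
      fix c i j assume "c \<in> P // link" "i < card c" "j < card c"
      interpret \<Gamma>: monoid_algebra R "\<Gamma> c" by (rule \<Gamma>_monoid_algebra)
      show "\<one>\<^bsub>D\<^esub> c (i, j) \<in> carrier (monoid_alg R (\<Gamma> c))"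
        using \<open>c \<in> _\<close> \<open>i < _\<close> \<open>j < _\<close>
        by (simp add: dsum_alg_def blk_def mat_alg_def B_one)
    qed (simp_all add: dsum_alg_def blk_def mat_alg_def)
    fix c i j assume cij: "c \<in> P // link" "i < card c" "j < card c"
    interpret \<Gamma>: monoid_algebra R "\<Gamma> c" by (rule \<Gamma>_monoid_algebra)
    have one: "\<one>\<^bsub>\<Gamma>.B\<^esub> \<in> carrier \<Gamma>.B" by (simp add: B_one)
    have tags: "tag (e (enum c i)) = e (rep c)" using tag_e[OF enum_P[OF cij(1,2)]] cls_enum[OF cij(1,2)] by simp
    have lin: "lin_map R D \<Gamma>.B (\<lambda>X. X c (i, j))"
      using D_entry[OF _ cij] cij by (intro lin_mapI) (simp_all add: dsum_alg_def blk_def mat_alg_def)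
    have "(\<Oplus>\<^bsub>D\<^esub>q\<in>P. munit (e q)) c (i, j) = (\<Oplus>\<^bsub>\<Gamma>.B\<^esub>q\<in>P. munit (e q) c (i, j))"
      using e_S munit_D by (intro lin_map_finsum[OF D.module_axioms \<Gamma>.B_module lin]) auto
    also have "\<dots> = (\<Oplus>\<^bsub>\<Gamma>.B\<^esub>q\<in>P. if q = enum c i then (if i = j then \<one>\<^bsub>\<Gamma>.B\<^esub> else \<zero>\<^bsub>\<Gamma>.B\<^esub>) else \<zero>\<^bsub>\<Gamma>.B\<^esub>)"
      using enum_inj[OF cij] one tags
      by (intro \<Gamma>.B.M.finsum_cong') (auto simp: munit_entry[OF e_S cij] l_e r_e B_one)
    also have "\<dots> = (if i = j then \<one>\<^bsub>\<Gamma>.B\<^esub> else \<zero>\<^bsub>\<Gamma>.B\<^esub>)"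
      using enum_P[OF cij(1,2)] one by (subst \<Gamma>.B.finsum_delta[OF P_finite]) auto
    also have "\<dots> = \<one>\<^bsub>D\<^esub> c (i, j)" using cij by (simp add: dsum_alg_def blk_def mat_alg_def)
    finally show "(\<Oplus>\<^bsub>D\<^esub>q\<in>P. munit (e q)) c (i, j) = \<one>\<^bsub>D\<^esub> c (i, j)" .
  qed
  finally show ?thesis .
qed

theorem phi_iso:
  assumes one: "\<one>\<^bsub>E\<^esub> = e bot"
  shows "alg_iso R D (E\<lparr>carrier := span_S\<rparr>) phi"
proof -
  have bij: "bij_betw phi (carrier D) span_S"
    unfolding bij_betw_def using phi_image inj_on_inverseI[of "carrier D" psi phi, OF psi_phi] by simp
  have mult: "phi (X \<otimes>\<^bsub>D\<^esub> Y) = phi X \<otimes>\<^bsub>E\<^esub> phi Y" if "X \<in> carrier D" "Y \<in> carrier D" for X Y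
    using phi_psi[OF span_S_mult[OF phi_span_S[OF that(1)] phi_span_S[OF that(2)]]]
      psi_mult[OF phi_span_S[OF that(1)] phi_span_S[OF that(2)]] psi_phi that by simp
  have "phi \<one>\<^bsub>D\<^esub> = \<one>\<^bsub>E\<^esub>"
    using phi_psi[OF S_span_S[OF e_S[OF bot(1)]]] psi_e_bot one by simp
  then show ?thesis
    using lin_mapD[OF phi_lin] bij mult phi_span_S
    by (simp add: alg_iso_def ring_iso_def ring_hom_def)
qed

text \<open>
  A diagonal matrix unit with entry the identity is the identity arrow at \<open>enum c i\<close>, and its
  image is the Moebius inversion of the idempotents above.
\<close>

theorem phi_diag_idem:
  assumes c: "c \<in> P // link" and i: "i < card c"
  shows "phi (dsum_inj (P // link) blk c (diag_idem (card c) (monoid_alg R (\<Gamma> c)) i))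
    = (\<Oplus>\<^bsub>E\<^esub>q\<in>{q \<in> P. le (enum c i) q}. w (enum c i) q \<odot>\<^bsub>E\<^esub> e q)"
proof -
  let ?p = "enum c i"
  have p: "?p \<in> P" "cls ?p = c" "idx ?p = i" using enum_P cls_enum idx_eq c i by auto
  have "dsum_inj (P // link) blk c (diag_idem (card c) (monoid_alg R (\<Gamma> c)) i) = munit (e ?p)"
    unfolding munit_def l_e[OF p(1)] r_e[OF p(1)] tag_e[OF p(1)] p(2,3) diag_idem_def B_one ..
  then have "phi (dsum_inj (P // link) blk c (diag_idem (card c) (monoid_alg R (\<Gamma> c)) i)) = moeb (e ?p)"
    using phi_munit[OF e_S[OF p(1)]] by simp
  also have "\<dots> = (\<Oplus>\<^bsub>E\<^esub>q\<in>{q \<in> P. le ?p q}. w ?p q \<odot>\<^bsub>E\<^esub> e q)"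
    unfolding moeb_def l_e[OF p(1)] above_def
    using p(1) w_closed e_mult S_E e_S by (intro M.finsum_cong') auto
  finally show ?thesis .
qed

end

section \<open>Fibered bisets\<close>

locale fb_context = A: comm_group A + G: group G
  for A :: "('a, 'm) monoid_scheme" and G :: "('g, 'n) monoid_scheme"
begin

definition T where "T = A \<times>\<times> G \<times>\<times> G"
abbreviation iA where "iA a \<equiv> inv\<^bsub>A\<^esub> a"
abbreviation iG where "iG a \<equiv> inv\<^bsub>G\<^esub> a"
abbreviation oA where "oA \<equiv> \<one>\<^bsub>A\<^esub>"
abbreviation oG where "oG \<equiv> \<one>\<^bsub>G\<^esub>"

lemma T_group: "group T"
  unfolding T_def by (intro DirProd_group A.group_axioms G.group_axioms)

sublocale T: group T by (rule T_group)

lemma T_carrier [simp]: "(a, g, h) \<in> carrier T \<longleftrightarrow> a \<in> carrier A \<and> g \<in> carrier G \<and> h \<in> carrier G"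
  by (simp add: T_def DirProd_def)

lemma T_mult [simp]:
  "(a, g, h) \<otimes>\<^bsub>T\<^esub> (a', g', h') = (a \<otimes>\<^bsub>A\<^esub> a', g \<otimes>\<^bsub>G\<^esub> g', h \<otimes>\<^bsub>G\<^esub> h')"
  by (simp add: T_def DirProd_def)

lemma T_one: "\<one>\<^bsub>T\<^esub> = (oA, oG, oG)" by (simp add: T_def DirProd_def)

lemma T_inv [simp]:
  "a \<in> carrier A \<Longrightarrow> g \<in> carrier G \<Longrightarrow> h \<in> carrier G \<Longrightarrow> inv\<^bsub>T\<^esub> (a, g, h) = (iA a, iG g, iG h)"
  using DirProd_group[OF G.group_axioms G.group_axioms]
  by (simp add: T_def inv_DirProd A.group_axioms G.group_axioms)

lemma T_cases: "t \<in> carrier T \<Longrightarrow> (\<And>a g h. t = (a, g, h) \<Longrightarrow> a \<in> carrier A \<Longrightarrow> g \<in> carrier G \<Longrightarrow> h \<in> carrier G \<Longrightarrow> thesis) \<Longrightarrow> thesis"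
  by (cases t) auto

abbreviation fib where "fib X \<equiv> fibered_biset A G G X"
abbreviation iso (infix "\<cong>\<^sub>f" 50) where "X \<cong>\<^sub>f Y \<equiv> fb_isomorphic A G G X Y"

lemma fibered_biset_iff: "fib X \<longleftrightarrow> group_action T (pts X) (act X) \<and>
    (\<forall>x \<in> pts X. stabilizer A (\<lambda>a. act X (a, oG, oG)) x = {oA}) \<and>
    finite (orbits A (pts X) (\<lambda>a. act X (a, oG, oG)))"
  by (simp add: fibered_biset_def T_def)

lemma iso_iff: "X \<cong>\<^sub>f Y \<longleftrightarrow> (\<exists>f. bij_betw f (pts X) (pts Y) \<and>
    (\<forall>t \<in> carrier T. \<forall>x \<in> pts X. f (act X t x) = act Y t (f x)))"
  by (simp add: fb_isomorphic_def T_def)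

lemma fibI:
  assumes closed: "\<And>t x. t \<in> carrier T \<Longrightarrow> x \<in> pts X \<Longrightarrow> act X t x \<in> pts X"
    and comp: "\<And>t t' x. t \<in> carrier T \<Longrightarrow> t' \<in> carrier T \<Longrightarrow> x \<in> pts X
      \<Longrightarrow> act X (t \<otimes>\<^bsub>T\<^esub> t') x = act X t (act X t' x)"
    and one: "\<And>x. x \<in> pts X \<Longrightarrow> act X \<one>\<^bsub>T\<^esub> x = x"
    and ext: "\<And>t. t \<in> carrier T \<Longrightarrow> act X t \<in> extensional (pts X)"
    and free: "\<And>a x. a \<in> carrier A \<Longrightarrow> x \<in> pts X \<Longrightarrow> act X (a, oG, oG) x = x \<Longrightarrow> a = oA"
    and fin: "finite F" and gen: "\<And>x. x \<in> pts X \<Longrightarrow> \<exists>y\<in>F \<inter> pts X. \<exists>a\<in>carrier A. x = act X (a, oG, oG) y"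
  shows "fib X"
proof -
  have bij: "bij_betw (act X t) (pts X) (pts X)" if t: "t \<in> carrier T" for t
  proof (rule bij_betw_byWitness[where f' = "act X (inv\<^bsub>T\<^esub> t)"])
    show "\<forall>x\<in>pts X. act X (inv\<^bsub>T\<^esub> t) (act X t x) = x"
      using comp[of "inv\<^bsub>T\<^esub> t" t] t one by (metis T.inv_closed T.l_inv)
    show "\<forall>x\<in>pts X. act X t (act X (inv\<^bsub>T\<^esub> t) x) = x"
      using comp[of t "inv\<^bsub>T\<^esub> t"] t one by (metis T.inv_closed T.r_inv)
  qed (use closed[OF t] closed[OF T.inv_closed[OF t]] in auto)
  have Bij: "act X t \<in> Bij (pts X)" if "t \<in> carrier T" for t
    using bij[OF that] ext[OF that] by (simp add: Bij_def)
  have "group_action T (pts X) (act X)"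
  proof (intro group_action.intro group_hom.intro group_hom_axioms.intro homI T_group group_BijGroup)
    show "act X t \<in> carrier (BijGroup (pts X))" if "t \<in> carrier T" for t
      using Bij[OF that] by (simp add: BijGroup_def)
    fix t t' assume t: "t \<in> carrier T" and t': "t' \<in> carrier T"
    have "act X (t \<otimes>\<^bsub>T\<^esub> t') = compose (pts X) (act X t) (act X t')"
    proof (rule extensionalityI[OF ext compose_extensional])
      show "act X (t \<otimes>\<^bsub>T\<^esub> t') x = compose (pts X) (act X t) (act X t') x" if "x \<in> pts X" for x
        using comp[OF t t' that] that by (simp add: compose_eq)
    qed (use t t' in auto)
    then show "act X (t \<otimes>\<^bsub>T\<^esub> t') = act X t \<otimes>\<^bsub>BijGroup (pts X)\<^esub> act X t'"
      using Bij t t' by (simp add: BijGroup_def)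
  qed
  moreover have "finite (orbits A (pts X) (\<lambda>a. act X (a, oG, oG)))"
  proof (rule finite_subset)
    show "orbits A (pts X) (\<lambda>a. act X (a, oG, oG)) \<subseteq> (\<lambda>y. orbit A (\<lambda>a. act X (a, oG, oG)) y) ` F"
    proof
      fix w assume "w \<in> orbits A (pts X) (\<lambda>a. act X (a, oG, oG))"
      then obtain x where x: "x \<in> pts X" "w = orbit A (\<lambda>a. act X (a, oG, oG)) x" by (auto simp: orbits_def)
      then obtain y a where y: "y \<in> F" "y \<in> pts X" "a \<in> carrier A" "x = act X (a, oG, oG) y" using gen by blast
      have 1: "act X (b, oG, oG) x = act X (b \<otimes>\<^bsub>A\<^esub> a, oG, oG) y" if "b \<in> carrier A" for b
        using comp[of "(b, oG, oG)" "(a, oG, oG)" y] y that by simp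
      have "w = orbit A (\<lambda>a. act X (a, oG, oG)) y"
      proof
        show "w \<subseteq> orbit A (\<lambda>a. act X (a, oG, oG)) y"
          using x(2) 1 y(3) by (auto simp: orbit_def)
        show "orbit A (\<lambda>a. act X (a, oG, oG)) y \<subseteq> w"
        proof
          fix z assume "z \<in> orbit A (\<lambda>a. act X (a, oG, oG)) y"
          then obtain b where b: "b \<in> carrier A" "z = act X (b, oG, oG) y" by (auto simp: orbit_def)
          then have "z = act X (b \<otimes>\<^bsub>A\<^esub> iA a, oG, oG) x"
            using 1[of "b \<otimes>\<^bsub>A\<^esub> iA a"] y(3) by (simp add: A.m_assoc)
          then show "z \<in> w" using b y(3) x(2) by (auto simp: orbit_def)
        qed
      qed
      then show "w \<in> (\<lambda>y. orbit A (\<lambda>a. act X (a, oG, oG)) y) ` F" using y(1) by auto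
    qed
  qed (use fin in auto)
  moreover have "stabilizer A (\<lambda>a. act X (a, oG, oG)) x = {oA}" if "x \<in> pts X" for x
    using free[OF _ that] one[OF that] by (auto simp: stabilizer_def T_one)
  ultimately show ?thesis by (simp add: fibered_biset_iff)
qed

lemma fibD:
  assumes "fib X"
  shows "\<And>t x. t \<in> carrier T \<Longrightarrow> x \<in> pts X \<Longrightarrow> act X t x \<in> pts X"
    and "\<And>t t' x. t \<in> carrier T \<Longrightarrow> t' \<in> carrier T \<Longrightarrow> x \<in> pts X
      \<Longrightarrow> act X t (act X t' x) = act X (t \<otimes>\<^bsub>T\<^esub> t') x"
    and "\<And>x. x \<in> pts X \<Longrightarrow> act X (oA, oG, oG) x = x"
    and "\<And>t. t \<in> carrier T \<Longrightarrow> act X t \<in> extensional (pts X)"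
    and "\<And>a x. a \<in> carrier A \<Longrightarrow> x \<in> pts X \<Longrightarrow> act X (a, oG, oG) x = x \<Longrightarrow> a = oA"
    and "\<exists>F. finite F \<and> F \<subseteq> pts X \<and> (\<forall>x\<in>pts X. \<exists>y\<in>F. \<exists>a\<in>carrier A. x = act X (a, oG, oG) y)"
proof -
  interpret group_action T "pts X" "act X" using assms by (simp add: fibered_biset_iff)
  show closed: "act X t x \<in> pts X" if "t \<in> carrier T" "x \<in> pts X" for t x
    using element_image[OF that] by simp
  show comp: "act X t (act X t' x) = act X (t \<otimes>\<^bsub>T\<^esub> t') x"
    if "t \<in> carrier T" "t' \<in> carrier T" "x \<in> pts X" for t t' x
    using composition_rule[OF that(3,1,2)] by simp
  show one: "act X (oA, oG, oG) x = x" if "x \<in> pts X" for x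
    using fun_cong[OF id_eq_one, of x] that by (simp add: T_one)
  show "act X t \<in> extensional (pts X)" if "t \<in> carrier T" for t
    using bij_prop0[OF that] by (simp add: Bij_def)
  show "a = oA" if "a \<in> carrier A" "x \<in> pts X" "act X (a, oG, oG) x = x" for a x
    using assms that by (auto simp: fibered_biset_iff stabilizer_def)
  let ?orb = "\<lambda>x. orbit A (\<lambda>a. act X (a, oG, oG)) x"
  let ?F = "(\<lambda>w. SOME y. y \<in> pts X \<and> w = ?orb y) ` (?orb ` pts X)"
  have fin: "finite (?orb ` pts X)"
    using assms by (simp add: fibered_biset_iff orbits_def setcompr_eq_image)
  have ch: "(SOME y. y \<in> pts X \<and> ?orb x = ?orb y) \<in> pts X \<and> ?orb x = ?orb (SOME y. y \<in> pts X \<and> ?orb x = ?orb y)"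
    if "x \<in> pts X" for x
    using someI[of "\<lambda>y. y \<in> pts X \<and> ?orb x = ?orb y" x] that by simp
  show "\<exists>F. finite F \<and> F \<subseteq> pts X \<and> (\<forall>x\<in>pts X. \<exists>y\<in>F. \<exists>a\<in>carrier A. x = act X (a, oG, oG) y)"
  proof (intro exI conjI ballI)
    show "finite ?F" using fin by simp
    show "?F \<subseteq> pts X" using ch by auto
    fix x assume x: "x \<in> pts X"
    let ?y = "SOME y. y \<in> pts X \<and> ?orb x = ?orb y"
    have "x \<in> ?orb x" using one[OF x] by (force simp: orbit_def)
    then have "x \<in> ?orb ?y" using ch[OF x] by simp
    then have "\<exists>a\<in>carrier A. x = act X (a, oG, oG) ?y" by (auto simp: orbit_def)
    then show "\<exists>y\<in>?F. \<exists>a\<in>carrier A. x = act X (a, oG, oG) y" using x by blast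
  qed
qed

definition stab where "stab X x = {t \<in> carrier T. act X t x = x}"

subsection \<open>Embeddings and isomorphisms\<close>

text \<open>
  Equivariant injections: disjoint unions are recognised by a pair of embeddings with
  complementary images, and isomorphisms are the surjective embeddings.
\<close>

definition emb where
  "emb X Y f \<longleftrightarrow> f \<in> pts X \<rightarrow> pts Y \<and> inj_on f (pts X) \<and>
     (\<forall>t\<in>carrier T. \<forall>x\<in>pts X. f (act X t x) = act Y t (f x))"

lemma embD:
  assumes "emb X Y f"
  shows "\<And>x. x \<in> pts X \<Longrightarrow> f x \<in> pts Y"
    and "\<And>x y. x \<in> pts X \<Longrightarrow> y \<in> pts X \<Longrightarrow> f x = f y \<longleftrightarrow> x = y"
    and "\<And>t x. t \<in> carrier T \<Longrightarrow> x \<in> pts X \<Longrightarrow> f (act X t x) = act Y t (f x)"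
  using assms by (auto simp: emb_def inj_on_def)

lemma iso_iff_emb: "X \<cong>\<^sub>f Y \<longleftrightarrow> (\<exists>f. emb X Y f \<and> f ` pts X = pts Y)"
  unfolding iso_iff emb_def bij_betw_def by blast

lemma emb_stab: "emb X Y f \<Longrightarrow> fib X \<Longrightarrow> x \<in> pts X \<Longrightarrow> stab Y (f x) = stab X x"
  using embD(2,3)[of X Y f] fibD(1)[of X] unfolding stab_def by (metis (no_types, lifting))

lemma iso_sym:
  assumes X: "fib X" and "X \<cong>\<^sub>f Y" shows "Y \<cong>\<^sub>f X"
proof -
  obtain f where f: "bij_betw f (pts X) (pts Y)"
    and eq: "\<And>t x. t \<in> carrier T \<Longrightarrow> x \<in> pts X \<Longrightarrow> f (act X t x) = act Y t (f x)"
    using assms(2) unfolding iso_iff by blast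
  let ?g = "inv_into (pts X) f"
  have "?g (act Y t y) = act X t (?g y)" if t: "t \<in> carrier T" and y: "y \<in> pts Y" for t y
  proof -
    have g: "?g y \<in> pts X" "f (?g y) = y"
      using y f by (auto simp: bij_betw_def inv_into_into f_inv_into_f)
    then have "act Y t y = f (act X t (?g y))" using eq[OF t g(1)] by simp
    then show ?thesis using fibD(1)[OF X t g(1)] f by (simp add: bij_betw_def inv_into_f_f)
  qed
  then show ?thesis
    unfolding iso_iff using bij_betw_inv_into[OF f] by blast
qed

lemma iso_trans: "X \<cong>\<^sub>f Y \<Longrightarrow> Y \<cong>\<^sub>f Z \<Longrightarrow> X \<cong>\<^sub>f Z"
proof -
  assume "X \<cong>\<^sub>f Y" "Y \<cong>\<^sub>f Z"
  then obtain f g where f: "bij_betw f (pts X) (pts Y)" and g: "bij_betw g (pts Y) (pts Z)"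
    and eqs: "\<forall>t\<in>carrier T. \<forall>x\<in>pts X. f (act X t x) = act Y t (f x)"
      "\<forall>t\<in>carrier T. \<forall>x\<in>pts Y. g (act Y t x) = act Z t (g x)"
    unfolding iso_iff by blast
  show "X \<cong>\<^sub>f Z"
    unfolding iso_iff
    using bij_betw_trans[OF f g] eqs bij_betwE[OF f] by (intro exI[of _ "g \<circ> f"]) auto
qed

text \<open>
  A point of a fibered biset is determined by one of finitely many representatives of
  \<open>A\<close>-orbits and an element of \<open>A\<close>. Hence every fibered biset has an isomorphic copy on the
  type \<open>'a \<times> nat\<close>, over which the isomorphism classes range.
\<close>

lemma transport:
  fixes h :: "'x \<Rightarrow> 'y"
  assumes X: "fib X" and h: "inj_on h (pts X)"
  shows "\<exists>Y :: ('a, 'g, 'g, 'y) fbiset. fib Y \<and> X \<cong>\<^sub>f Y"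
proof -
  let ?i = "inv_into (pts X) h"
  define Y where "Y = \<lparr>pts = h ` pts X, act = (\<lambda>t. \<lambda>z\<in>h ` pts X. h (act X t (?i z)))\<rparr>"
  have ih: "?i (h x) = x" if "x \<in> pts X" for x using h that by simp
  have Yp: "pts Y = h ` pts X" by (simp add: Y_def)
  have Ya: "act Y t (h x) = h (act X t x)" if "x \<in> pts X" for t x
    using that ih by (simp add: Y_def)
  obtain F where F: "finite F" "F \<subseteq> pts X"
    "\<forall>x\<in>pts X. \<exists>y\<in>F. \<exists>a\<in>carrier A. x = act X (a, oG, oG) y"
    using fibD(6)[OF X] by blast
  have "fib Y"
  proof (rule fibI[where F = "h ` F"])
    fix x assume "x \<in> pts Y"
    then obtain u where u: "u \<in> pts X" "x = h u" by (auto simp: Yp)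
    show "act Y \<one>\<^bsub>T\<^esub> x = x" using u fibD(3)[OF X] by (simp add: Ya T_one)
    show "\<exists>y\<in>h ` F \<inter> pts Y. \<exists>a\<in>carrier A. x = act Y (a, oG, oG) y"
    proof -
      obtain y a where "y \<in> F" "a \<in> carrier A" "u = act X (a, oG, oG) y" using F(3) u(1) by blast
      then show ?thesis
        using u F(2) Ya[of y] Yp by (intro bexI[of _ "h y"] bexI[of _ a]) auto
    qed
    fix t assume t: "t \<in> carrier T"
    show "act Y t x \<in> pts Y" using u t fibD(1)[OF X] by (simp add: Ya Yp)
    fix t' assume t': "t' \<in> carrier T"
    show "act Y (t \<otimes>\<^bsub>T\<^esub> t') x = act Y t (act Y t' x)"
      using u t t' fibD(1)[OF X] fibD(2)[OF X] by (simp add: Ya)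
  next
    fix a x assume a: "a \<in> carrier A" and "x \<in> pts Y" and eq: "act Y (a, oG, oG) x = x"
    then obtain u where u: "u \<in> pts X" "x = h u" by (auto simp: Yp)
    have "act X (a, oG, oG) u = u"
      using eq u a h fibD(1)[OF X, of "(a, oG, oG)" u] by (simp add: Ya inj_on_eq_iff)
    then show "a = oA" using fibD(5)[OF X a u(1)] by simp
  qed (use F in \<open>auto simp: Y_def\<close>)
  moreover have "X \<cong>\<^sub>f Y"
    unfolding iso_iff using h Ya by (intro exI[of _ h]) (auto simp: Yp bij_betw_def)
  ultimately show ?thesis by blast
qed

lemma nat_model:
  assumes X: "fib X"
  shows "\<exists>Y :: ('a, 'g, 'g, 'a \<times> nat) fbiset. fib Y \<and> X \<cong>\<^sub>f Y"
proof -
  obtain F where F: "finite F" "F \<subseteq> pts X"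
    "\<forall>x\<in>pts X. \<exists>y\<in>F. \<exists>a\<in>carrier A. x = act X (a, oG, oG) y"
    using fibD(6)[OF X] by blast
  obtain \<nu> :: "_ \<Rightarrow> nat" where \<nu>: "inj_on \<nu> F"
    using F(1) finite_imp_inj_to_nat_seg by metis
  have "\<exists>p. snd p \<in> F \<and> x = act X (fst p, oG, oG) (snd p)" if "x \<in> pts X" for x
    using F(3) that by force
  then obtain c where c: "\<And>x. x \<in> pts X \<Longrightarrow> snd (c x) \<in> F \<and> x = act X (fst (c x), oG, oG) (snd (c x))"
    by metis
  have "inj_on (\<lambda>x. (fst (c x), \<nu> (snd (c x)))) (pts X)"
  proof (rule inj_onI)
    fix x y assume x: "x \<in> pts X" and y: "y \<in> pts X"
      and eq: "(fst (c x), \<nu> (snd (c x))) = (fst (c y), \<nu> (snd (c y)))"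
    then have "fst (c x) = fst (c y)" "snd (c x) = snd (c y)"
      using c[OF x] c[OF y] \<nu> by (auto simp: inj_on_eq_iff)
    then show "x = y" using c[OF x] c[OF y] by metis
  qed
  from transport[OF X this] show ?thesis .
qed

abbreviation M where "M \<equiv> fb_monoid A G"

lemma class_mem: "fib Y \<Longrightarrow> Y \<in> fb_class A G X \<longleftrightarrow> X \<cong>\<^sub>f Y"
  by (simp add: fb_class_def)

lemma class_eqI: "fib X \<Longrightarrow> X \<cong>\<^sub>f Y \<Longrightarrow> fb_class A G X = fb_class A G Y"
  using iso_sym[of X Y] iso_trans[of X Y] iso_trans[of Y X] unfolding fb_class_def by blast

lemma class_eqD:
  assumes X: "fib X" and Y: "fib Y" and eq: "fb_class A G X = fb_class A G Y"
  shows "X \<cong>\<^sub>f Y"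
proof -
  obtain Z :: "('a, 'g, 'g, 'a \<times> nat) fbiset" where Z: "fib Z" "Y \<cong>\<^sub>f Z" using nat_model[OF Y] by blast
  then have "Z \<in> fb_class A G X" using eq by (simp add: class_mem)
  then have "X \<cong>\<^sub>f Z" using Z by (simp add: class_mem)
  then show ?thesis using iso_trans iso_sym[OF Y Z(2)] by blast
qed

lemma class_carrier:
  assumes X: "fib X" shows "fb_class A G X \<in> carrier M"
proof -
  obtain Z :: "('a, 'g, 'g, 'a \<times> nat) fbiset" where Z: "fib Z" "X \<cong>\<^sub>f Z" using nat_model[OF X] by blast
  then show ?thesis using class_eqI[OF X Z(2)] by (auto simp: fb_monoid_def)
qed

lemma carrier_class:
  assumes "C \<in> carrier M"
  obtains X :: "('a, 'g, 'g, 'a \<times> nat) fbiset" where "fib X" "C = fb_class A G X"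
  using assms by (auto simp: fb_monoid_def)

subsection \<open>Disjoint unions\<close>

lemma union_fib:
  assumes X: "fib X" and Y: "fib Y"
  shows "fib (union_fb X Y)"
proof -
  obtain F where F: "finite F" "F \<subseteq> pts X"
    "\<forall>x\<in>pts X. \<exists>y\<in>F. \<exists>a\<in>carrier A. x = act X (a, oG, oG) y"
    using fibD(6)[OF X] by blast
  obtain F' where F': "finite F'" "F' \<subseteq> pts Y"
    "\<forall>x\<in>pts Y. \<exists>y\<in>F'. \<exists>a\<in>carrier A. x = act Y (a, oG, oG) y"
    using fibD(6)[OF Y] by blast
  show ?thesis
  proof (rule fibI[where F = "F <+> F'"])
    fix x assume x: "x \<in> pts (union_fb X Y)"
    show "\<exists>y\<in>(F <+> F') \<inter> pts (union_fb X Y). \<exists>a\<in>carrier A. x = act (union_fb X Y) (a, oG, oG) y"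
    proof (cases x)
      case (Inl u)
      then obtain y a where "y \<in> F" "a \<in> carrier A" "u = act X (a, oG, oG) y"
        using x F(3) by (auto simp: union_fb_def)
      then show ?thesis using F(2) Inl by (intro bexI[of _ "Inl y"] bexI[of _ a]) (auto simp: union_fb_def)
    next
      case (Inr u)
      then obtain y a where "y \<in> F'" "a \<in> carrier A" "u = act Y (a, oG, oG) y"
        using x F'(3) by (auto simp: union_fb_def)
      then show ?thesis using F'(2) Inr by (intro bexI[of _ "Inr y"] bexI[of _ a]) (auto simp: union_fb_def)
    qed
  qed (use F(1) F'(1) X Y in \<open>auto simp: union_fb_def fibD T_one dest: fibD(5)\<close>)
qed

lemma emb_union: "fib X \<Longrightarrow> emb X (union_fb X Y) Inl" "fib Y \<Longrightarrow> emb Y (union_fb X Y) Inr"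
  by (auto simp: emb_def union_fb_def dest: fibD(1))

lemma iso_unionI:
  assumes f: "emb X Z f" and g: "emb Y Z g"
    and disj: "f ` pts X \<inter> g ` pts Y = {}" and cover: "f ` pts X \<union> g ` pts Y = pts Z"
  shows "union_fb X Y \<cong>\<^sub>f Z"
  unfolding iso_iff
proof (intro exI conjI)
  let ?h = "case_sum f g"
  show "bij_betw ?h (pts (union_fb X Y)) (pts Z)"
  proof (rule bij_betw_imageI)
    show "inj_on ?h (pts (union_fb X Y))"
      using disj embD(2)[OF f] embD(2)[OF g] by (auto simp: inj_on_def union_fb_def) blast+
    show "?h ` pts (union_fb X Y) = pts Z"
      unfolding cover[symmetric] by (force simp: union_fb_def)
  qed
  show "\<forall>t\<in>carrier T. \<forall>x\<in>pts (union_fb X Y). ?h (act (union_fb X Y) t x) = act Z t (?h x)"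
    using embD(3)[OF f] embD(3)[OF g] by (auto simp: union_fb_def)
qed

end

context fb_context
begin

lemma act_eq_iff:
  assumes X: "fib X" and x: "x \<in> pts X" and t: "t \<in> carrier T" and t': "t' \<in> carrier T"
  shows "act X t x = act X t' x \<longleftrightarrow> inv\<^bsub>T\<^esub> t' \<otimes>\<^bsub>T\<^esub> t \<in> stab X x"
proof -
  have "act X (inv\<^bsub>T\<^esub> t' \<otimes>\<^bsub>T\<^esub> t) x = act X (inv\<^bsub>T\<^esub> t') (act X t x)"
    using fibD(2)[OF X] x t t' by simp
  moreover have "act X (inv\<^bsub>T\<^esub> t') (act X t' x) = x"
    using fibD(2)[OF X, of "inv\<^bsub>T\<^esub> t'" t' x] fibD(3)[OF X x] x t' by (simp add: T.l_inv T_one)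
  moreover have "act X t' (act X (inv\<^bsub>T\<^esub> t') (act X t x)) = act X t x"
    using fibD(2)[OF X, of t' "inv\<^bsub>T\<^esub> t'" "act X t x"] fibD(3)[OF X] fibD(1)[OF X t x] t'
    by (simp add: T.r_inv T_one)
  ultimately show ?thesis using t t' by (auto simp: stab_def)
qed

subsection \<open>Transitive fibered bisets\<close>

definition transitive where
  "transitive X \<longleftrightarrow> (\<forall>x\<in>pts X. \<forall>y\<in>pts X. \<exists>t\<in>carrier T. y = act X t x)"

lemma iso_of_stab:
  assumes X: "fib X" "transitive X" "x \<in> pts X" and Y: "fib Y" "transitive Y" "y \<in> pts Y"
    and eq: "stab X x = stab Y y"
  shows "X \<cong>\<^sub>f Y"
proof -
  define c where "c z = (SOME t. t \<in> carrier T \<and> z = act X t x)" for z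
  have c: "c z \<in> carrier T" "act X (c z) x = z" if "z \<in> pts X" for z
  proof -
    have "\<exists>t. t \<in> carrier T \<and> z = act X t x" using X(2,3) that unfolding transitive_def by blast
    from someI_ex[OF this] show "c z \<in> carrier T" "act X (c z) x = z" unfolding c_def by simp_all
  qed
  have key: "act X t x = act X t' x \<longleftrightarrow> act Y t y = act Y t' y" if "t \<in> carrier T" "t' \<in> carrier T" for t t'
    using act_eq_iff[OF X(1,3) that] act_eq_iff[OF Y(1,3) that] eq by simp
  let ?f = "\<lambda>z. act Y (c z) y"
  have f: "?f (act X t x) = act Y t y" if t: "t \<in> carrier T" for t
    using key[OF c(1)[OF fibD(1)[OF X(1) t X(3)]] t] c(2)[OF fibD(1)[OF X(1) t X(3)]] by blast
  have "bij_betw ?f (pts X) (pts Y)"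
  proof (rule bij_betw_imageI)
    show "inj_on ?f (pts X)"
    proof (rule inj_onI)
      fix z z' assume z: "z \<in> pts X" and z': "z' \<in> pts X" and "?f z = ?f z'"
      then have "act X (c z) x = act X (c z') x" using key[OF c(1)[OF z] c(1)[OF z']] by blast
      then show "z = z'" unfolding c(2)[OF z] c(2)[OF z'] .
    qed
    show "?f ` pts X = pts Y"
    proof
      show "?f ` pts X \<subseteq> pts Y" using fibD(1)[OF Y(1) c(1) Y(3)] by blast
      show "pts Y \<subseteq> ?f ` pts X"
      proof
        fix z assume "z \<in> pts Y"
        then obtain t where "t \<in> carrier T" "z = act Y t y" using Y(2,3) unfolding transitive_def by blast
        then show "z \<in> ?f ` pts X" using f[symmetric] fibD(1)[OF X(1) _ X(3)] by blast
      qed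
    qed
  qed
  moreover have "?f (act X t z) = act Y t (?f z)" if t: "t \<in> carrier T" and z: "z \<in> pts X" for t z
  proof -
    have "act X t z = act X (t \<otimes>\<^bsub>T\<^esub> c z) x" using fibD(2)[OF X(1) t c(1)[OF z] X(3)] unfolding c(2)[OF z] .
    then have "?f (act X t z) = act Y (t \<otimes>\<^bsub>T\<^esub> c z) y" using f[OF T.m_closed[OF t c(1)[OF z]]] by (simp only:)
    then show ?thesis using fibD(2)[OF Y(1) t c(1)[OF z] Y(3)] by (simp only:)
  qed
  ultimately show ?thesis unfolding iso_iff by blast
qed

text \<open>
  The coset space of \<open>W\<close> is free over \<open>A\<close> exactly if \<open>W\<close> meets \<open>A\<close> trivially.
\<close>

definition A_free where "A_free W \<longleftrightarrow> (\<forall>a. (a, oG, oG) \<in> W \<longrightarrow> a = oA)"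

definition cosets_fb where
  "cosets_fb W = \<lparr>pts = lcosets\<^bsub>T\<^esub> W, act = (\<lambda>t. \<lambda>c\<in>lcosets\<^bsub>T\<^esub> W. t <#\<^bsub>T\<^esub> c)\<rparr>"

context
  fixes W assumes W: "subgroup W T"
begin

lemma cosets_pts: "pts (cosets_fb W) = (\<lambda>t. t <#\<^bsub>T\<^esub> W) ` carrier T"
  by (auto simp: cosets_fb_def LCOSETS_def)

lemma cosets_act: "t \<in> carrier T \<Longrightarrow> s \<in> carrier T
  \<Longrightarrow> act (cosets_fb W) t (s <#\<^bsub>T\<^esub> W) = (t \<otimes>\<^bsub>T\<^esub> s) <#\<^bsub>T\<^esub> W"
  using subgroup.subset[OF W] by (simp add: cosets_fb_def LCOSETS_def T.lcos_m_assoc) blast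

lemma coset_eq_iff:
  assumes t: "t \<in> carrier T" and s: "s \<in> carrier T"
  shows "t <#\<^bsub>T\<^esub> W = s <#\<^bsub>T\<^esub> W \<longleftrightarrow> inv\<^bsub>T\<^esub> s \<otimes>\<^bsub>T\<^esub> t \<in> W"
proof
  assume "t <#\<^bsub>T\<^esub> W = s <#\<^bsub>T\<^esub> W"
  moreover have "t \<in> t <#\<^bsub>T\<^esub> W" using subgroup.one_closed[OF W] t by (force simp: l_coset_def)
  ultimately obtain v where v: "v \<in> W" "t = s \<otimes>\<^bsub>T\<^esub> v" by (auto simp: l_coset_def)
  then have "inv\<^bsub>T\<^esub> s \<otimes>\<^bsub>T\<^esub> t = v"
    using s subgroup.mem_carrier[OF W] by (simp add: T.m_assoc[symmetric] T.l_inv)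
  then show "inv\<^bsub>T\<^esub> s \<otimes>\<^bsub>T\<^esub> t \<in> W" using v by simp
next
  assume v: "inv\<^bsub>T\<^esub> s \<otimes>\<^bsub>T\<^esub> t \<in> W"
  have "t = s \<otimes>\<^bsub>T\<^esub> (inv\<^bsub>T\<^esub> s \<otimes>\<^bsub>T\<^esub> t)" using s t by (simp add: T.m_assoc[symmetric] T.r_inv)
  then have "t \<in> s <#\<^bsub>T\<^esub> W" using v by (auto simp: l_coset_def)
  then show "t <#\<^bsub>T\<^esub> W = s <#\<^bsub>T\<^esub> W" using T.l_repr_independence[OF _ s W] by simp
qed

lemma W_coset: "\<one>\<^bsub>T\<^esub> <#\<^bsub>T\<^esub> W = W"
  using T.lcos_mult_one[OF subgroup.subset[OF W]] .

lemma cosets_base: "W \<in> pts (cosets_fb W)"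
  using W_coset by (auto simp: cosets_pts image_iff intro!: bexI[of _ "\<one>\<^bsub>T\<^esub>"])

lemma cosets_act_base: "t \<in> carrier T \<Longrightarrow> act (cosets_fb W) t W = t <#\<^bsub>T\<^esub> W"
  using cosets_act[of t "\<one>\<^bsub>T\<^esub>"] W_coset by simp

lemma cosets_stab: "stab (cosets_fb W) W = W"
proof -
  have "act (cosets_fb W) t W = W \<longleftrightarrow> t \<in> W" if "t \<in> carrier T" for t
    using coset_eq_iff[OF that T.one_closed] cosets_act_base[OF that] W_coset that by simp
  then show ?thesis using subgroup.subset[OF W] by (auto simp: stab_def)
qed

lemma cosets_transitive: "transitive (cosets_fb W)"
  unfolding transitive_def cosets_pts
proof clarify
  fix t s assume t: "t \<in> carrier T" and s: "s \<in> carrier T"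
  show "\<exists>u\<in>carrier T. s <#\<^bsub>T\<^esub> W = act (cosets_fb W) u (t <#\<^bsub>T\<^esub> W)"
    using t s by (intro bexI[of _ "s \<otimes>\<^bsub>T\<^esub> inv\<^bsub>T\<^esub> t"]) (simp_all add: cosets_act T.m_assoc T.l_inv)
qed

lemma cosets_fib:
  assumes G: "finite (carrier G)" and A_free: "A_free W"
  shows "fib (cosets_fb W)"
proof (rule fibI[where F = "(\<lambda>(g, h). (oA, g, h) <#\<^bsub>T\<^esub> W) ` (carrier G \<times> carrier G)"])
  show "finite ((\<lambda>(g, h). (oA, g, h) <#\<^bsub>T\<^esub> W) ` (carrier G \<times> carrier G))" using G by simp
  show "act (cosets_fb W) t \<in> extensional (pts (cosets_fb W))" for t by (simp add: cosets_fb_def)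
  fix x assume "x \<in> pts (cosets_fb W)"
  then obtain s where s: "s \<in> carrier T" "x = s <#\<^bsub>T\<^esub> W" by (auto simp: cosets_pts)
  show "act (cosets_fb W) \<one>\<^bsub>T\<^esub> x = x" using s by (simp add: cosets_act)
  obtain a g h where agh: "s = (a, g, h)" "a \<in> carrier A" "g \<in> carrier G" "h \<in> carrier G"
    using s(1) by (rule T_cases)
  have "x = act (cosets_fb W) (a, oG, oG) ((oA, g, h) <#\<^bsub>T\<^esub> W)"
    using s agh by (simp add: cosets_act)
  then show "\<exists>y\<in>(\<lambda>(g, h). (oA, g, h) <#\<^bsub>T\<^esub> W) ` (carrier G \<times> carrier G) \<inter> pts (cosets_fb W).
      \<exists>a\<in>carrier A. x = act (cosets_fb W) (a, oG, oG) y"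
    using agh by (intro bexI[of _ "(oA, g, h) <#\<^bsub>T\<^esub> W"] bexI[of _ a]) (auto simp: cosets_pts)
  fix t assume t: "t \<in> carrier T"
  show "act (cosets_fb W) t x \<in> pts (cosets_fb W)" using s t by (auto simp: cosets_act cosets_pts)
  fix t' assume t': "t' \<in> carrier T"
  show "act (cosets_fb W) (t \<otimes>\<^bsub>T\<^esub> t') x = act (cosets_fb W) t (act (cosets_fb W) t' x)"
    using s t t' by (simp add: cosets_act T.m_assoc)
next
  fix a x assume a: "a \<in> carrier A" and "x \<in> pts (cosets_fb W)" and eq: "act (cosets_fb W) (a, oG, oG) x = x"
  then obtain s where s: "s \<in> carrier T" "x = s <#\<^bsub>T\<^esub> W" by (auto simp: cosets_pts)
  obtain b g h where bgh: "s = (b, g, h)" "b \<in> carrier A" "g \<in> carrier G" "h \<in> carrier G"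
    using s(1) by (rule T_cases)
  have "inv\<^bsub>T\<^esub> s \<otimes>\<^bsub>T\<^esub> ((a, oG, oG) \<otimes>\<^bsub>T\<^esub> s) \<in> W"
    using eq a s coset_eq_iff[of "(a, oG, oG) \<otimes>\<^bsub>T\<^esub> s" s] by (simp add: cosets_act)
  moreover have "inv\<^bsub>T\<^esub> s \<otimes>\<^bsub>T\<^esub> ((a, oG, oG) \<otimes>\<^bsub>T\<^esub> s) = (a, oG, oG)"
    using bgh a by (simp add: A.m_comm[of a b] A.m_assoc[symmetric] A.l_inv G.l_inv)
  ultimately show "a = oA" using A_free by (simp add: A_free_def)
qed

end

subsection \<open>Counting orbits of a given type\<close>

definition torbit where "torbit X x = (\<lambda>t. act X t x) ` carrier T"

text \<open>
  The number of orbits that contain a point with stabilizer exactly \<open>W\<close>. It is additive and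
  invariant under isomorphism, so it defines a functional on the Grothendieck group; a
  transitive biset has value 1 if \<open>W\<close> is one of its stabilizers and 0 otherwise.
\<close>

definition orbit_count where
  "orbit_count W X = card (torbit X ` {x \<in> pts X. stab X x = W})"

lemma torbit_finite:
  assumes X: "fib X" shows "finite (torbit X ` pts X)"
proof -
  obtain F where F: "finite F" "F \<subseteq> pts X"
    "\<forall>x\<in>pts X. \<exists>y\<in>F. \<exists>a\<in>carrier A. x = act X (a, oG, oG) y"
    using fibD(6)[OF X] by blast
  have "torbit X ` pts X \<subseteq> torbit X ` F"
  proof
    fix w assume "w \<in> torbit X ` pts X"
    then obtain x where x: "x \<in> pts X" "w = torbit X x" by auto
    then obtain y a where y: "y \<in> F" "a \<in> carrier A" "x = act X (a, oG, oG) y" using F(3) by blast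
    have "torbit X x = torbit X y"
    proof
      show "torbit X x \<subseteq> torbit X y"
      proof
        fix z assume "z \<in> torbit X x"
        then obtain t where t: "t \<in> carrier T" "z = act X t x" by (auto simp: torbit_def)
        have a: "(a, oG, oG) \<in> carrier T" using y by simp
        have "z = act X (t \<otimes>\<^bsub>T\<^esub> (a, oG, oG)) y"
          unfolding t(2) y(3) using y(1) F(2) t(1) a by (intro fibD(2)[OF X]) auto
        then show "z \<in> torbit X y" unfolding torbit_def using T.m_closed[OF t(1) a] by (rule image_eqI)
      qed
      show "torbit X y \<subseteq> torbit X x"
      proof
        fix z assume "z \<in> torbit X y"
        then obtain t where t: "t \<in> carrier T" "z = act X t y" by (auto simp: torbit_def)
        let ?u = "t \<otimes>\<^bsub>T\<^esub> inv\<^bsub>T\<^esub> (a, oG, oG)"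
        have a: "(a, oG, oG) \<in> carrier T" using y by simp
        have "act X ?u x = act X (?u \<otimes>\<^bsub>T\<^esub> (a, oG, oG)) y"
          unfolding y(3) using y(1) F(2) t(1) a by (intro fibD(2)[OF X] T.m_closed T.inv_closed) auto
        also have "?u \<otimes>\<^bsub>T\<^esub> (a, oG, oG) = t"
          using t(1) a by (simp only: T.m_assoc T.inv_closed T.l_inv T.r_one)
        finally have "z = act X ?u x" using t(2) by simp
        moreover have "?u \<in> carrier T" using t(1) a by (intro T.m_closed T.inv_closed)
        ultimately show "z \<in> torbit X x" unfolding torbit_def by (rule image_eqI)
      qed
    qed
    then show "w \<in> torbit X ` F" using y x by auto
  qed
  then show ?thesis by (rule finite_subset) (simp add: F(1))
qed

lemma orbit_count_emb:
  assumes X: "fib X" and f: "emb X Z f"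
  shows "card (torbit Z ` {z \<in> f ` pts X. stab Z z = W}) = orbit_count W X"
proof -
  have orb: "torbit Z (f x) = f ` torbit X x" if "x \<in> pts X" for x
    unfolding torbit_def image_image by (rule image_cong[OF refl]) (simp add: embD(3)[OF f _ that])
  have S: "{z \<in> f ` pts X. stab Z z = W} = f ` {x \<in> pts X. stab X x = W}"
    by (auto simp: emb_stab[OF f X])
  have "torbit Z ` {z \<in> f ` pts X. stab Z z = W} = (\<lambda>o'. f ` o') ` torbit X ` {x \<in> pts X. stab X x = W}"
    unfolding S image_image by (rule image_cong[OF refl]) (simp add: orb)
  moreover have "inj_on (\<lambda>o'. f ` o') (torbit X ` {x \<in> pts X. stab X x = W})"
  proof (rule inj_on_subset[OF inj_on_image_Pow])
    show "inj_on f (pts X)" using f by (simp add: emb_def)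
    show "torbit X ` {x \<in> pts X. stab X x = W} \<subseteq> Pow (pts X)"
    proof clarify
      fix x y assume "x \<in> pts X" "y \<in> torbit X x"
      then show "y \<in> pts X" unfolding torbit_def using fibD(1)[OF X] by blast
    qed
  qed
  ultimately show ?thesis by (simp add: orbit_count_def card_image)
qed

lemma orbit_count_iso:
  assumes "fib X" and "X \<cong>\<^sub>f Y" shows "orbit_count W Y = orbit_count W X"
proof -
  obtain f where f: "emb X Y f" "f ` pts X = pts Y" using assms(2) by (auto simp: iso_iff_emb)
  show ?thesis using orbit_count_emb[OF assms(1) f(1), of W] f(2) by (simp add: orbit_count_def)
qed

lemma orbit_count_union:
  assumes X: "fib X" and Y: "fib Y"
  shows "orbit_count W (union_fb X Y) = orbit_count W X + orbit_count W Y"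
proof -
  let ?Z = "union_fb X Y"
  let ?O = "\<lambda>P. torbit ?Z ` {z \<in> P. stab ?Z z = W}"
  have Z: "fib ?Z" by (rule union_fib[OF X Y])
  have pts: "pts ?Z = Inl ` pts X \<union> Inr ` pts Y" by (auto simp: union_fb_def)
  have inO: "z \<in> torbit ?Z z" if "z \<in> pts ?Z" for z
    unfolding torbit_def using fibD(3)[OF Z that, symmetric] by (rule image_eqI) simp
  have side: "torbit ?Z (Inl x) \<subseteq> range Inl" "torbit ?Z (Inr y) \<subseteq> range Inr"
    if "x \<in> pts X" "y \<in> pts Y" for x y
    using that by (auto simp: torbit_def union_fb_def)
  have "?O (Inl ` pts X) \<inter> ?O (Inr ` pts Y) = {}"
  proof (rule ccontr)
    assume "?O (Inl ` pts X) \<inter> ?O (Inr ` pts Y) \<noteq> {}"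
    then obtain x y where xy: "x \<in> pts X" "y \<in> pts Y" "torbit ?Z (Inl x) = torbit ?Z (Inr y)" by auto
    then have "Inl x \<in> torbit ?Z (Inr y)" using inO[of "Inl x"] by (auto simp: pts)
    then show False using side(2)[OF xy(1,2)] by auto
  qed
  moreover have "finite (?O (Inl ` pts X))" "finite (?O (Inr ` pts Y))"
    by (rule finite_subset[OF _ torbit_finite[OF Z]]; auto simp: pts)+
  moreover have "?O (pts ?Z) = ?O (Inl ` pts X) \<union> ?O (Inr ` pts Y)" by (auto simp: pts)
  ultimately have "card (?O (pts ?Z)) = card (?O (Inl ` pts X)) + card (?O (Inr ` pts Y))"
    by (simp add: card_Un_disjoint)
  then show ?thesis
    unfolding orbit_count_emb[OF X emb_union(1)[OF X]] orbit_count_emb[OF Y emb_union(2)[OF Y]]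
    by (simp add: orbit_count_def)
qed

lemma orbit_count_transitive:
  assumes X: "fib X" "transitive X"
  shows "orbit_count W X = (if \<exists>x\<in>pts X. stab X x = W then 1 else 0)"
proof (cases "\<exists>x\<in>pts X. stab X x = W")
  case True
  have "torbit X x = pts X" if "x \<in> pts X" for x
    using that X(2) fibD(1)[OF X(1)] by (auto simp: torbit_def transitive_def image_iff)
  then have "torbit X ` {x \<in> pts X. stab X x = W} = {pts X}" using True by auto
  then show ?thesis using True by (simp add: orbit_count_def)
next
  case False
  then have "{x \<in> pts X. stab X x = W} = {}" by auto
  then have "orbit_count W X = 0" unfolding orbit_count_def by (simp only: image_empty card.empty)
  then show ?thesis using False by auto
qed

end

context fb_context
begin

subsection \<open>The tensor product\<close>

lemma act_act:
  assumes "fib X" and "x \<in> pts X" and "a \<in> carrier A" "g \<in> carrier G" "h \<in> carrier G"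
    and "a' \<in> carrier A" "g' \<in> carrier G" "h' \<in> carrier G"
  shows "act X (a, g, h) (act X (a', g', h') x) = act X (a \<otimes>\<^bsub>A\<^esub> a', g \<otimes>\<^bsub>G\<^esub> g', h \<otimes>\<^bsub>G\<^esub> h') x"
  using fibD(2)[OF assms(1), of "(a, g, h)" "(a', g', h')" x] assms by simp

lemma act_pts:
  assumes "fib X" and "x \<in> pts X" and "a \<in> carrier A" "g \<in> carrier G" "h \<in> carrier G"
  shows "act X (a, g, h) x \<in> pts X"
  using fibD(1)[OF assms(1) _ assms(2), of "(a, g, h)"] assms by simp

abbreviation tens where "tens X Y \<equiv> tensor_fb A G G G X Y"

text \<open>
  The composition of relations from \<open>G\<close> to \<open>G\<close> with labels in \<open>A\<close>. On stabilizers it describes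
  the tensor product.
\<close>

definition rel_comp where
  "rel_comp W W' = {(a \<otimes>\<^bsub>A\<^esub> b, g, i) | a b g h i. (a, g, h) \<in> W \<and> (b, h, i) \<in> W'}"

text \<open>
  The action of \<open>A \<times> G\<close> whose orbits make up the tensor product: \<open>A\<close> acts on the two factors
  in opposite directions.
\<close>

definition orb where
  "orb X Y x y = (\<lambda>(a, h). (act X (iA a, oG, h) x, act Y (a, h, oG) y)) ` (carrier A \<times> carrier G)"

lemma tensor_orbits_eq:
  "tensor_orbits A G G G X Y = (\<lambda>(x, y). orb X Y x y) ` (pts X \<times> pts Y)"
proof -
  have "orbit (A \<times>\<times> G) (\<lambda>(a, h) (x, y). (act X (iA a, oG, h) x, act Y (a, h, oG) y)) (x, y) = orb X Y x y" for x y
    by (auto simp: orbit_def orb_def DirProd_def)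
  then show ?thesis unfolding tensor_orbits_def orbits_def by force
qed

context
  fixes X :: "('a, 'g, 'g, 'x) fbiset" and Y :: "('a, 'g, 'g, 'y) fbiset"
  assumes X: "fib X" and Y: "fib Y"
begin

lemma orb_shift_sub:
  assumes x: "x \<in> pts X" and y: "y \<in> pts Y" and a: "a \<in> carrier A" and h: "h \<in> carrier G"
  shows "orb X Y (act X (iA a, oG, h) x) (act Y (a, h, oG) y) \<subseteq> orb X Y x y"
proof
  fix z assume "z \<in> orb X Y (act X (iA a, oG, h) x) (act Y (a, h, oG) y)"
  then obtain b k where b: "b \<in> carrier A" and k: "k \<in> carrier G"
    and z: "z = (act X (iA b, oG, k) (act X (iA a, oG, h) x), act Y (b, k, oG) (act Y (a, h, oG) y))"
    by (auto simp: orb_def)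
  have "z = (act X (iA (b \<otimes>\<^bsub>A\<^esub> a), oG, k \<otimes>\<^bsub>G\<^esub> h) x, act Y (b \<otimes>\<^bsub>A\<^esub> a, k \<otimes>\<^bsub>G\<^esub> h, oG) y)"
    unfolding z using x y a b h k by (simp add: act_act[OF X] act_act[OF Y] A.inv_mult)
  then show "z \<in> orb X Y x y"
    unfolding orb_def using a b h k by (intro image_eqI[of _ _ "(b \<otimes>\<^bsub>A\<^esub> a, k \<otimes>\<^bsub>G\<^esub> h)"]) simp_all
qed

lemma orb_shift:
  assumes x: "x \<in> pts X" and y: "y \<in> pts Y" and a: "a \<in> carrier A" and h: "h \<in> carrier G"
  shows "orb X Y (act X (iA a, oG, h) x) (act Y (a, h, oG) y) = orb X Y x y"
proof
  let ?x = "act X (iA a, oG, h) x" and ?y = "act Y (a, h, oG) y"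
  have "orb X Y (act X (iA (iA a), oG, iG h) ?x) (act Y (iA a, iG h, oG) ?y) \<subseteq> orb X Y ?x ?y"
    using x y a h by (intro orb_shift_sub) (simp_all add: act_pts[OF X] act_pts[OF Y])
  also have "act X (iA (iA a), oG, iG h) ?x = x"
    using x a h by (simp add: act_act[OF X] A.r_inv G.l_inv fibD(3)[OF X])
  also have "act Y (iA a, iG h, oG) ?y = y"
    using y a h by (simp add: act_act[OF Y] A.l_inv G.l_inv fibD(3)[OF Y])
  finally show "orb X Y x y \<subseteq> orb X Y ?x ?y" .
qed (rule orb_shift_sub[OF assms])

lemma orb_self:
  assumes "x \<in> pts X" and "y \<in> pts Y" shows "(x, y) \<in> orb X Y x y"
  unfolding orb_def using assms fibD(3)[OF X] fibD(3)[OF Y]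
  by (intro image_eqI[of _ _ "(oA, oG)"]) simp_all

lemma orb_eq_iff:
  assumes x: "x \<in> pts X" and y: "y \<in> pts Y" and x': "x' \<in> pts X" and y': "y' \<in> pts Y"
  shows "orb X Y x' y' = orb X Y x y \<longleftrightarrow>
    (\<exists>a\<in>carrier A. \<exists>h\<in>carrier G. x' = act X (iA a, oG, h) x \<and> y' = act Y (a, h, oG) y)"
proof
  assume "orb X Y x' y' = orb X Y x y"
  then have "(x', y') \<in> orb X Y x y" using orb_self[OF x' y'] by simp
  then show "\<exists>a\<in>carrier A. \<exists>h\<in>carrier G. x' = act X (iA a, oG, h) x \<and> y' = act Y (a, h, oG) y"
    by (auto simp: orb_def)
next
  assume "\<exists>a\<in>carrier A. \<exists>h\<in>carrier G. x' = act X (iA a, oG, h) x \<and> y' = act Y (a, h, oG) y"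
  then show "orb X Y x' y' = orb X Y x y" using orb_shift[OF x y] by blast
qed

abbreviation tact where "tact \<equiv> tensor_act A G X Y"

lemma tact_orb:
  assumes x: "x \<in> pts X" and y: "y \<in> pts Y" and t: "c \<in> carrier A" "g \<in> carrier G" "i \<in> carrier G"
  shows "tact (c, g, i) (orb X Y x y) = orb X Y (act X (c, g, oG) x) (act Y (oA, oG, i) y)"
proof -
  have "(act X (c, g, oG) (act X (iA a, oG, h) x), act Y (oA, oG, i) (act Y (a, h, oG) y))
    = (act X (iA a, oG, h) (act X (c, g, oG) x), act Y (a, h, oG) (act Y (oA, oG, i) y))"
    if "a \<in> carrier A" "h \<in> carrier G" for a h
    using x y t that by (simp add: act_act[OF X] act_act[OF Y] A.m_comm)
  then show ?thesis
    unfolding orb_def tensor_act_def prod.case image_image by (intro image_cong refl) (auto simp del: prod.inject)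
qed

lemma tens_act: "w \<in> pts (tens X Y) \<Longrightarrow> act (tens X Y) t w = tact t w"
  by (simp add: tensor_fb_def Let_def)

lemma tens_pts_iff:
  "w \<in> pts (tens X Y) \<longleftrightarrow> (\<exists>x\<in>pts X. \<exists>y\<in>pts Y. w = orb X Y x y) \<and>
     (\<forall>a\<in>carrier A. tact (a, oG, oG) w = w \<longrightarrow> a = oA)"
proof -
  have "tact (oA, oG, oG) (orb X Y x y) = orb X Y x y" if "x \<in> pts X" "y \<in> pts Y" for x y
    using that fibD(3)[OF X] fibD(3)[OF Y] by (simp add: tact_orb)
  then show ?thesis by (auto simp: tensor_fb_def Let_def tensor_orbits_eq stabilizer_def)
qed

lemma tens_ptsE:
  assumes "w \<in> pts (tens X Y)"
  obtains x y where "x \<in> pts X" "y \<in> pts Y" "w = orb X Y x y"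
  using assms by (auto simp: tens_pts_iff)

lemma tact_tact:
  assumes w: "x \<in> pts X" "y \<in> pts Y" "w = orb X Y x y" and t: "t \<in> carrier T" and t': "t' \<in> carrier T"
  shows "tact t (tact t' w) = tact (t \<otimes>\<^bsub>T\<^esub> t') w"
proof -
  obtain c g i where 1: "t = (c, g, i)" "c \<in> carrier A" "g \<in> carrier G" "i \<in> carrier G" using t by (rule T_cases)
  obtain c' g' i' where 2: "t' = (c', g', i')" "c' \<in> carrier A" "g' \<in> carrier G" "i' \<in> carrier G" using t' by (rule T_cases)
  show ?thesis using w 1 2
    by (simp add: tact_orb act_pts[OF X] act_pts[OF Y] act_act[OF X] act_act[OF Y])
qed

lemma tact_pts:
  assumes w: "w \<in> pts (tens X Y)" and t: "t \<in> carrier T" shows "tact t w \<in> pts (tens X Y)"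
proof -
  obtain x y where xy: "x \<in> pts X" "y \<in> pts Y" "w = orb X Y x y" using w by (rule tens_ptsE)
  obtain c g i where cgi: "t = (c, g, i)" "c \<in> carrier A" "g \<in> carrier G" "i \<in> carrier G" using t by (rule T_cases)
  have "\<exists>x\<in>pts X. \<exists>y\<in>pts Y. tact t w = orb X Y x y"
    using xy cgi by (intro bexI[of _ "act X (c, g, oG) x"] bexI[of _ "act Y (oA, oG, i) y"])
      (simp_all add: tact_orb act_pts[OF X] act_pts[OF Y])
  moreover have "a = oA" if a: "a \<in> carrier A" and eq: "tact (a, oG, oG) (tact t w) = tact t w" for a
  proof -
    have aT: "(a, oG, oG) \<in> carrier T" using a by simp
    have comm: "(a, oG, oG) \<otimes>\<^bsub>T\<^esub> t = t \<otimes>\<^bsub>T\<^esub> (a, oG, oG)" using cgi a by (simp add: A.m_comm)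
    have canc: "tact (inv\<^bsub>T\<^esub> t) (tact t v) = v" if "x \<in> pts X" "y \<in> pts Y" "v = orb X Y x y" for v x y
      using tact_tact[OF that T.inv_closed[OF t] t] t that fibD(3)[OF X] fibD(3)[OF Y]
      by (simp add: T.l_inv T_one tact_orb)
    have v: "tact (a, oG, oG) w = orb X Y (act X (a, oG, oG) x) (act Y (oA, oG, oG) y)"
      unfolding xy(3) using xy a by (intro tact_orb) auto
    have "tact t (tact (a, oG, oG) w) = tact t w"
      using eq tact_tact[OF xy aT t] tact_tact[OF xy t aT] comm by simp
    then have "tact (a, oG, oG) w = w"
      using canc[OF _ _ v] canc[OF xy] xy a act_pts[OF X] act_pts[OF Y] by (metis A.one_closed G.one_closed)
    then show ?thesis using w a by (simp add: tens_pts_iff)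
  qed
  ultimately show ?thesis by (simp add: tens_pts_iff)
qed

lemma tens_fib: "fib (tens X Y)"
proof -
  obtain F where F: "finite F" "F \<subseteq> pts X"
    "\<forall>x\<in>pts X. \<exists>y\<in>F. \<exists>a\<in>carrier A. x = act X (a, oG, oG) y"
    using fibD(6)[OF X] by blast
  obtain F' where F': "finite F'" "F' \<subseteq> pts Y"
    "\<forall>x\<in>pts Y. \<exists>y\<in>F'. \<exists>a\<in>carrier A. x = act Y (a, oG, oG) y"
    using fibD(6)[OF Y] by blast
  show ?thesis
  proof (rule fibI[where F = "(\<lambda>(x, y). orb X Y x y) ` (F \<times> F')"])
    show "finite ((\<lambda>(x, y). orb X Y x y) ` (F \<times> F'))" using F(1) F'(1) by simp
    show "act (tens X Y) t \<in> extensional (pts (tens X Y))" for t by (simp add: tensor_fb_def Let_def)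
    show "a = oA" if "a \<in> carrier A" "w \<in> pts (tens X Y)" "act (tens X Y) (a, oG, oG) w = w" for a w
      using that by (simp add: tens_act) (simp add: tens_pts_iff)
    fix w assume w: "w \<in> pts (tens X Y)"
    obtain x y where xy: "x \<in> pts X" "y \<in> pts Y" "w = orb X Y x y" using w by (rule tens_ptsE)
    show "act (tens X Y) \<one>\<^bsub>T\<^esub> w = w"
      using w xy fibD(3)[OF X] fibD(3)[OF Y] by (simp add: tens_act T_one tact_orb)
    obtain u a where u: "u \<in> F" "a \<in> carrier A" "x = act X (a, oG, oG) u" using F(3) xy(1) by blast
    obtain v b where v: "v \<in> F'" "b \<in> carrier A" "y = act Y (b, oG, oG) v" using F'(3) xy(2) by blast
    have uv: "u \<in> pts X" "v \<in> pts Y" using u v F F' by auto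
    let ?t = "(a \<otimes>\<^bsub>A\<^esub> b, oG, oG)"
    have t: "?t \<in> carrier T" using u v by simp
    have eq: "w = tact ?t (orb X Y u v)"
    proof -
      have "tact ?t (orb X Y u v) = orb X Y (act X ?t u) v"
        using uv u v fibD(3)[OF Y] by (simp add: tact_orb)
      also have "\<dots> = orb X Y (act X (iA b, oG, oG) (act X ?t u)) (act Y (b, oG, oG) v)"
        using uv u v by (intro orb_shift[symmetric]) (simp_all add: act_pts[OF X])
      also have "act X (iA b, oG, oG) (act X ?t u) = x"
        using uv u v by (simp add: act_act[OF X] A.m_comm[of a b]) (simp add: A.m_assoc[symmetric] A.l_inv)
      finally show ?thesis using xy v by simp
    qed
    have "orb X Y u v = tact (inv\<^bsub>T\<^esub> ?t) w"
      unfolding eq using tact_tact[OF uv refl T.inv_closed[OF t] t] t uv fibD(3)[OF X] fibD(3)[OF Y]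
      by (simp add: T.l_inv T_one tact_orb del: T_inv)
    then have mem: "orb X Y u v \<in> pts (tens X Y)" using tact_pts[OF w T.inv_closed[OF t]] by simp
    show "\<exists>z\<in>(\<lambda>(x, y). orb X Y x y) ` (F \<times> F') \<inter> pts (tens X Y). \<exists>a\<in>carrier A. w = act (tens X Y) (a, oG, oG) z"
    proof (intro bexI)
      show "w = act (tens X Y) ?t (orb X Y u v)" using eq mem by (simp add: tens_act)
      show "a \<otimes>\<^bsub>A\<^esub> b \<in> carrier A" using u v by simp
      show "orb X Y u v \<in> (\<lambda>(x, y). orb X Y x y) ` (F \<times> F') \<inter> pts (tens X Y)"
        using mem u v by auto
    qed
    fix t assume t: "t \<in> carrier T"
    show "act (tens X Y) t w \<in> pts (tens X Y)" using tact_pts[OF w t] w by (simp add: tens_act)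
    fix t' assume t': "t' \<in> carrier T"
    show "act (tens X Y) (t \<otimes>\<^bsub>T\<^esub> t') w = act (tens X Y) t (act (tens X Y) t' w)"
      using tact_tact[OF xy t t'] w tact_pts[OF w t'] by (simp add: tens_act)
  qed
qed

text \<open>
  An element \<open>(c, g, i)\<close> fixes the orbit of \<open>(x, y)\<close> exactly if its effect on \<open>(x, y)\<close> is undone by
  some element \<open>(a, h)\<close> of \<open>A \<times> G\<close>, and then \<open>(c a, g, h\<^sup>-\<^sup>1)\<close> fixes \<open>x\<close> and \<open>(a\<^sup>-\<^sup>1, h\<^sup>-\<^sup>1, i)\<close>
  fixes \<open>y\<close>.
\<close>

lemma tact_fix_iff:
  assumes x: "x \<in> pts X" and y: "y \<in> pts Y" and t: "t \<in> carrier T"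
  shows "tact t (orb X Y x y) = orb X Y x y \<longleftrightarrow> t \<in> rel_comp (stab X x) (stab Y y)"
proof -
  obtain c g i where cgi: "t = (c, g, i)" "c \<in> carrier A" "g \<in> carrier G" "i \<in> carrier G" using t by (rule T_cases)
  have "tact t (orb X Y x y) = orb X Y x y \<longleftrightarrow>
    (\<exists>a\<in>carrier A. \<exists>h\<in>carrier G. act X (c, g, oG) x = act X (iA a, oG, h) x
      \<and> act Y (oA, oG, i) y = act Y (a, h, oG) y)"
    using x y cgi by (simp add: tact_orb orb_eq_iff act_pts[OF X] act_pts[OF Y])
  also have "\<dots> \<longleftrightarrow> (\<exists>a\<in>carrier A. \<exists>h\<in>carrier G. (c \<otimes>\<^bsub>A\<^esub> a, g, iG h) \<in> stab X x \<and> (iA a, iG h, i) \<in> stab Y y)"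
    using x y cgi by (intro bex_cong refl) (simp add: act_eq_iff[OF X] act_eq_iff[OF Y] A.m_comm)
  also have "\<dots> \<longleftrightarrow> t \<in> rel_comp (stab X x) (stab Y y)"
  proof
    assume "\<exists>a\<in>carrier A. \<exists>h\<in>carrier G. (c \<otimes>\<^bsub>A\<^esub> a, g, iG h) \<in> stab X x \<and> (iA a, iG h, i) \<in> stab Y y"
    then obtain a h where a: "a \<in> carrier A"
      and st: "(c \<otimes>\<^bsub>A\<^esub> a, g, iG h) \<in> stab X x" "(iA a, iG h, i) \<in> stab Y y" by blast
    have "t = ((c \<otimes>\<^bsub>A\<^esub> a) \<otimes>\<^bsub>A\<^esub> iA a, g, i)" using a cgi by (simp add: A.m_assoc A.r_inv)
    then show "t \<in> rel_comp (stab X x) (stab Y y)" unfolding rel_comp_def using st by blast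
  next
    assume "t \<in> rel_comp (stab X x) (stab Y y)"
    then obtain a b h where st: "(a, g, h) \<in> stab X x" "(b, h, i) \<in> stab Y y" and c: "c = a \<otimes>\<^bsub>A\<^esub> b"
      using cgi(1) by (auto simp: rel_comp_def)
    have cc: "a \<in> carrier A" "b \<in> carrier A" "h \<in> carrier G" using st by (auto simp: stab_def)
    have "c \<otimes>\<^bsub>A\<^esub> iA b = a" using cc c by (simp add: A.m_assoc A.r_inv)
    then show "\<exists>a\<in>carrier A. \<exists>h\<in>carrier G. (c \<otimes>\<^bsub>A\<^esub> a, g, iG h) \<in> stab X x \<and> (iA a, iG h, i) \<in> stab Y y"
      using st cc by (intro bexI[of _ "iA b"] bexI[of _ "iG h"]) simp_all
  qed
  finally show ?thesis .
qed

lemma orb_in_pts_iff: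
  assumes x: "x \<in> pts X" and y: "y \<in> pts Y"
  shows "orb X Y x y \<in> pts (tens X Y) \<longleftrightarrow> A_free (rel_comp (stab X x) (stab Y y))"
proof -
  have "a \<in> carrier A" if "(a, oG, oG) \<in> rel_comp (stab X x) (stab Y y)" for a
    using that by (auto simp: rel_comp_def stab_def)
  then show ?thesis
    using x y tact_fix_iff[OF x y] by (auto simp: tens_pts_iff A_free_def)
qed

lemma tens_stab:
  assumes x: "x \<in> pts X" and y: "y \<in> pts Y" and mem: "orb X Y x y \<in> pts (tens X Y)"
  shows "stab (tens X Y) (orb X Y x y) = rel_comp (stab X x) (stab Y y)"
proof (intro subset_antisym subsetI)
  fix t assume "t \<in> stab (tens X Y) (orb X Y x y)"
  then have t: "t \<in> carrier T" "tact t (orb X Y x y) = orb X Y x y" using tens_act[OF mem] by (auto simp: stab_def)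
  show "t \<in> rel_comp (stab X x) (stab Y y)" using tact_fix_iff[OF x y t(1)] t(2) by simp
next
  fix t assume r: "t \<in> rel_comp (stab X x) (stab Y y)"
  then have t: "t \<in> carrier T" by (auto simp: rel_comp_def stab_def)
  then show "t \<in> stab (tens X Y) (orb X Y x y)"
    using tact_fix_iff[OF x y t] tens_act[OF mem] r unfolding stab_def[of "tens X Y"] by simp
qed

text \<open>
  The orbits of a tensor product of transitive bisets correspond to double cosets in the
  middle group of the second projection of one stabilizer and the first projection of the
  other. If the first of these is the whole group, a single orbit is left.
\<close>

lemma orb_translate:
  assumes x: "x \<in> pts X" "transitive X" and y: "y \<in> pts Y" "transitive Y"
    and covers: "\<And>h. h \<in> carrier G \<Longrightarrow> \<exists>a g. (a, g, h) \<in> stab X x"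
    and x': "x' \<in> pts X" and y': "y' \<in> pts Y"
  shows "\<exists>t\<in>carrier T. orb X Y x' y' = tact t (orb X Y x y)"
proof -
  obtain s where "s \<in> carrier T" "x' = act X s x" using x x' unfolding transitive_def by blast
  then obtain a g k where s: "x' = act X (a, g, k) x" "a \<in> carrier A" "g \<in> carrier G" "k \<in> carrier G"
    by (cases s) auto
  obtain s' where "s' \<in> carrier T" "y' = act Y s' y" using y y' unfolding transitive_def by blast
  then obtain b h i where s': "y' = act Y (b, h, i) y" "b \<in> carrier A" "h \<in> carrier G" "i \<in> carrier G"
    by (cases s') auto
  \<comment> \<open>The middle entry needed to pass from \<open>(x', y')\<close> to \<open>(x, y)\<close> is supplied by the stabilizer of \<open>x\<close>.\<close>
  obtain c f where fx: "(c, f, iG h \<otimes>\<^bsub>G\<^esub> k) \<in> stab X x" using covers[of "iG h \<otimes>\<^bsub>G\<^esub> k"] s s' by auto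
  then have cc: "c \<in> carrier A" "f \<in> carrier G" and fixed: "act X (c, f, iG h \<otimes>\<^bsub>G\<^esub> k) x = x"
    by (auto simp: stab_def)
  let ?t = "((b \<otimes>\<^bsub>A\<^esub> a) \<otimes>\<^bsub>A\<^esub> iA c, g \<otimes>\<^bsub>G\<^esub> iG f, i)"
  have "orb X Y x' y' = orb X Y (act X (iA (iA b), oG, iG h) x') (act Y (iA b, iG h, oG) y')"
    using x' y' s' by (intro orb_shift[symmetric]) simp_all
  also have "act Y (iA b, iG h, oG) y' = act Y (oA, oG, i) y"
    using y s' by (simp add: act_act[OF Y] A.l_inv G.l_inv)
  also have "act X (iA (iA b), oG, iG h) x' = act X (b \<otimes>\<^bsub>A\<^esub> a, g, iG h \<otimes>\<^bsub>G\<^esub> k) x"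
    using x s s' by (simp add: act_act[OF X])
  also have "\<dots> = act X ((b \<otimes>\<^bsub>A\<^esub> a) \<otimes>\<^bsub>A\<^esub> iA c, g \<otimes>\<^bsub>G\<^esub> iG f, oG) (act X (c, f, iG h \<otimes>\<^bsub>G\<^esub> k) x)"
    using x s s' cc by (simp add: act_act[OF X] A.m_assoc G.m_assoc A.l_inv G.l_inv)
  also have "\<dots> = act X ((b \<otimes>\<^bsub>A\<^esub> a) \<otimes>\<^bsub>A\<^esub> iA c, g \<otimes>\<^bsub>G\<^esub> iG f, oG) x" by (simp only: fixed)
  also have "orb X Y \<dots> (act Y (oA, oG, i) y) = tact ?t (orb X Y x y)"
    using x y s s' cc by (intro tact_orb[symmetric]) simp_all
  finally have "orb X Y x' y' = tact ?t (orb X Y x y)" .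
  moreover have "?t \<in> carrier T" using s s' cc by simp
  ultimately show ?thesis by blast
qed

end

end

context fb_context
begin

subsection \<open>Functoriality of the tensor product\<close>

text \<open>
  Orbits with a nontrivial stabilizer in \<open>A\<close> are discarded in a tensor product; embeddings
  preserve this stabilizer, so they restrict to the remaining orbits.
\<close>

lemma tens_emb:
  assumes X: "fib X" and X': "fib X'" and Y: "fib Y" and Y': "fib Y'"
    and f: "emb X X' f" and g: "emb Y Y' g"
  defines "F \<equiv> (\<lambda>w. map_prod f g ` w)"
  shows "emb (tens X Y) (tens X' Y') F"
    and "F ` pts (tens X Y) = {w \<in> pts (tens X' Y'). \<exists>x\<in>pts X. \<exists>y\<in>pts Y. w = orb X' Y' (f x) (g y)}"
proof -
  note fp = embD(1)[OF f] and gp = embD(1)[OF g]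
  have Fcl: "F (orb X Y x y) = orb X' Y' (f x) (g y)" if "x \<in> pts X" "y \<in> pts Y" for x y
  proof -
    have "map_prod f g (case p of (a, h) \<Rightarrow> (act X (iA a, oG, h) x, act Y (a, h, oG) y))
      = (case p of (a, h) \<Rightarrow> (act X' (iA a, oG, h) (f x), act Y' (a, h, oG) (g y)))"
      if "p \<in> carrier A \<times> carrier G" for p
      using that embD(3)[OF f _ \<open>x \<in> pts X\<close>] embD(3)[OF g _ \<open>y \<in> pts Y\<close>] by auto
    then show ?thesis unfolding F_def orb_def image_image by (rule image_cong[OF refl])
  qed
  have pts: "orb X' Y' (f x) (g y) \<in> pts (tens X' Y') \<longleftrightarrow> orb X Y x y \<in> pts (tens X Y)"
    if "x \<in> pts X" "y \<in> pts Y" for x y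
    using that orb_in_pts_iff[OF X Y that] orb_in_pts_iff[OF X' Y' fp gp, OF that]
      emb_stab[OF f X that(1)] emb_stab[OF g Y that(2)] by simp
  have inj: "orb X' Y' (f x) (g y) = orb X' Y' (f x') (g y') \<longleftrightarrow> orb X Y x y = orb X Y x' y'"
    if "x \<in> pts X" "y \<in> pts Y" "x' \<in> pts X" "y' \<in> pts Y" for x y x' y'
  proof -
    have "f x = act X' (iA a, oG, h) (f x') \<longleftrightarrow> x = act X (iA a, oG, h) x'"
      "g y = act Y' (a, h, oG) (g y') \<longleftrightarrow> y = act Y (a, h, oG) y'"
      if "a \<in> carrier A" "h \<in> carrier G" for a h
      using that \<open>x \<in> pts X\<close> \<open>x' \<in> pts X\<close> \<open>y \<in> pts Y\<close> \<open>y' \<in> pts Y\<close>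
      by (simp_all add: embD(3)[OF f, symmetric] embD(3)[OF g, symmetric] embD(2)[OF f] embD(2)[OF g]
          act_pts[OF X] act_pts[OF Y])
    then show ?thesis
      using orb_eq_iff[OF X Y that(3,4,1,2)]
        orb_eq_iff[OF X' Y' fp gp fp gp, OF that(3,4,1,2)] by simp
  qed
  show "emb (tens X Y) (tens X' Y') F"
    unfolding emb_def
  proof (intro conjI ballI inj_onI Pi_I)
    fix w assume w: "w \<in> pts (tens X Y)"
    obtain x y where xy: "x \<in> pts X" "y \<in> pts Y" "w = orb X Y x y" by (rule tens_ptsE[OF X Y w])
    show Fw: "F w \<in> pts (tens X' Y')" using w pts[OF xy(1,2)] unfolding xy(3) Fcl[OF xy(1,2)] by simp
    show "F (act (tens X Y) t w) = act (tens X' Y') t (F w)" if t: "t \<in> carrier T" for t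
    proof -
      obtain c g' i where t: "t = (c, g', i)" "c \<in> carrier A" "g' \<in> carrier G" "i \<in> carrier G"
        using t by (rule T_cases)
      have "act (tens X' Y') t (F w) = tensor_act A G X' Y' t (F w)"
        using tens_act[OF X' Y' Fw] .
      also have "\<dots> = orb X' Y' (act X' (c, g', oG) (f x)) (act Y' (oA, oG, i) (g y))"
        unfolding xy(3) Fcl[OF xy(1,2)] t(1)
        using xy t fp gp by (intro tact_orb[OF X' Y']) auto
      also have "\<dots> = orb X' Y' (f (act X (c, g', oG) x)) (g (act Y (oA, oG, i) y))"
        using xy t by (simp add: embD(3)[OF f] embD(3)[OF g])
      also have "\<dots> = F (orb X Y (act X (c, g', oG) x) (act Y (oA, oG, i) y))"
        using xy t by (intro Fcl[symmetric] act_pts[OF X] act_pts[OF Y]) auto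
      also have "orb X Y (act X (c, g', oG) x) (act Y (oA, oG, i) y) = tensor_act A G X Y t w"
        unfolding xy(3) t(1) using xy t by (intro tact_orb[OF X Y, symmetric]) auto
      finally show ?thesis using tens_act[OF X Y w] by simp
    qed
    fix w' assume w': "w' \<in> pts (tens X Y)" and eq: "F w = F w'"
    obtain x' y' where xy': "x' \<in> pts X" "y' \<in> pts Y" "w' = orb X Y x' y'" by (rule tens_ptsE[OF X Y w'])
    show "w = w'" using eq inj[OF xy(1,2) xy'(1,2)] unfolding xy(3) xy'(3) Fcl[OF xy(1,2)] Fcl[OF xy'(1,2)] by simp
  qed
  show "F ` pts (tens X Y) = {w \<in> pts (tens X' Y'). \<exists>x\<in>pts X. \<exists>y\<in>pts Y. w = orb X' Y' (f x) (g y)}"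
  proof (intro subset_antisym subsetI)
    fix v assume "v \<in> F ` pts (tens X Y)"
    then obtain w where w: "w \<in> pts (tens X Y)" "v = F w" by blast
    obtain x y where xy: "x \<in> pts X" "y \<in> pts Y" "w = orb X Y x y" by (rule tens_ptsE[OF X Y w(1)])
    show "v \<in> {w \<in> pts (tens X' Y'). \<exists>x\<in>pts X. \<exists>y\<in>pts Y. w = orb X' Y' (f x) (g y)}"
    proof -
      have "v = orb X' Y' (f x) (g y)" using w(2) xy(3) Fcl[OF xy(1,2)] by simp
      moreover have "v \<in> pts (tens X' Y')" using w(1) pts[OF xy(1,2)] xy(3) calculation by simp
      ultimately show ?thesis using xy(1,2) by blast
    qed
  next
    fix v assume "v \<in> {w \<in> pts (tens X' Y'). \<exists>x\<in>pts X. \<exists>y\<in>pts Y. w = orb X' Y' (f x) (g y)}"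
    then obtain x y where xy: "x \<in> pts X" "y \<in> pts Y" "v = orb X' Y' (f x) (g y)"
      and v: "v \<in> pts (tens X' Y')" by blast
    then have "orb X Y x y \<in> pts (tens X Y)" using pts[OF xy(1,2)] by simp
    then show "v \<in> F ` pts (tens X Y)" unfolding xy(3) Fcl[OF xy(1,2), symmetric] by (rule imageI)
  qed
qed

lemma emb_id: "emb X X id"
  by (simp add: emb_def)

lemma tens_iso:
  assumes X: "fib X" and X': "fib X'" and Y: "fib Y" and Y': "fib Y'"
    and "X \<cong>\<^sub>f X'" and "Y \<cong>\<^sub>f Y'"
  shows "tens X Y \<cong>\<^sub>f tens X' Y'"
proof -
  obtain f g where f: "emb X X' f" "f ` pts X = pts X'" and g: "emb Y Y' g" "g ` pts Y = pts Y'"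
    using assms(5,6) unfolding iso_iff_emb by blast
  note e = tens_emb[OF X X' Y Y' f(1) g(1)]
  have "\<exists>x\<in>pts X. \<exists>y\<in>pts Y. w = orb X' Y' (f x) (g y)" if "w \<in> pts (tens X' Y')" for w
    using tens_ptsE[OF X' Y' that] f(2) g(2) by (metis imageE)
  then have "(\<lambda>w. map_prod f g ` w) ` pts (tens X Y) = pts (tens X' Y')" unfolding e(2) by blast
  then show ?thesis using e(1) unfolding iso_iff_emb by blast
qed

lemma tens_union_left:
  assumes X: "fib X" and X': "fib X'" and Y: "fib Y"
  shows "union_fb (tens X Y) (tens X' Y) \<cong>\<^sub>f tens (union_fb X X') Y"
proof (rule iso_unionI)
  let ?Z = "union_fb X X'"
  have Z: "fib ?Z" by (rule union_fib[OF X X'])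
  note e1 = tens_emb[OF X Z Y Y emb_union(1)[OF X] emb_id]
  note e2 = tens_emb[OF X' Z Y Y emb_union(2)[OF X'] emb_id]
  show "emb (tens X Y) (tens ?Z Y) (\<lambda>w. map_prod Inl id ` w)"
    "emb (tens X' Y) (tens ?Z Y) (\<lambda>w. map_prod Inr id ` w)" using e1(1) e2(1) by auto
  have pts: "pts ?Z = Inl ` pts X \<union> Inr ` pts X'" by (auto simp: union_fb_def)
  show "(\<lambda>w. map_prod Inl id ` w) ` pts (tens X Y) \<union> (\<lambda>w. map_prod Inr id ` w) ` pts (tens X' Y) = pts (tens ?Z Y)"
  proof (intro subset_antisym subsetI)
    fix w assume w: "w \<in> pts (tens ?Z Y)"
    obtain z y where "z \<in> pts ?Z" "y \<in> pts Y" "w = orb ?Z Y z y" by (rule tens_ptsE[OF Z Y w])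
    then show "w \<in> (\<lambda>w. map_prod Inl id ` w) ` pts (tens X Y) \<union> (\<lambda>w. map_prod Inr id ` w) ` pts (tens X' Y)"
      unfolding e1(2) e2(2) using w pts by auto
  qed (use e1(2) e2(2) in auto)
  show "(\<lambda>w. map_prod Inl id ` w) ` pts (tens X Y) \<inter> (\<lambda>w. map_prod Inr id ` w) ` pts (tens X' Y) = {}"
  proof (rule ccontr)
    assume "\<not> ?thesis"
    then obtain w w' where w: "w \<in> pts (tens X Y)" "w' \<in> pts (tens X' Y)"
      and eq: "map_prod Inl id ` w = map_prod (Inr :: 'c \<Rightarrow> 'b + 'c) id ` w'" by blast
    obtain x y where "x \<in> pts X" "y \<in> pts Y" "w = orb X Y x y" by (rule tens_ptsE[OF X Y w(1)])
    then have "(x, y) \<in> w" using orb_self[OF X Y] by simp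
    then have "(Inl x, y) \<in> map_prod (Inr :: 'c \<Rightarrow> 'b + 'c) id ` w'" unfolding eq[symmetric] by force
    then show False by auto
  qed
qed

lemma tens_union_right:
  assumes X: "fib X" and X': "fib X'" and Y: "fib Y"
  shows "union_fb (tens Y X) (tens Y X') \<cong>\<^sub>f tens Y (union_fb X X')"
proof (rule iso_unionI)
  let ?Z = "union_fb X X'"
  have Z: "fib ?Z" by (rule union_fib[OF X X'])
  note e1 = tens_emb[OF Y Y X Z emb_id emb_union(1)[OF X]]
  note e2 = tens_emb[OF Y Y X' Z emb_id emb_union(2)[OF X']]
  show "emb (tens Y X) (tens Y ?Z) (\<lambda>w. map_prod id Inl ` w)"
    "emb (tens Y X') (tens Y ?Z) (\<lambda>w. map_prod id Inr ` w)" using e1(1) e2(1) by auto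
  have pts: "pts ?Z = Inl ` pts X \<union> Inr ` pts X'" by (auto simp: union_fb_def)
  show "(\<lambda>w. map_prod id Inl ` w) ` pts (tens Y X) \<union> (\<lambda>w. map_prod id Inr ` w) ` pts (tens Y X') = pts (tens Y ?Z)"
  proof (intro subset_antisym subsetI)
    fix w assume w: "w \<in> pts (tens Y ?Z)"
    obtain y z where "y \<in> pts Y" "z \<in> pts ?Z" "w = orb Y ?Z y z" by (rule tens_ptsE[OF Y Z w])
    then show "w \<in> (\<lambda>w. map_prod id Inl ` w) ` pts (tens Y X) \<union> (\<lambda>w. map_prod id Inr ` w) ` pts (tens Y X')"
      unfolding e1(2) e2(2) using w pts by auto
  qed (use e1(2) e2(2) in auto)
  show "(\<lambda>w. map_prod id Inl ` w) ` pts (tens Y X) \<inter> (\<lambda>w. map_prod id Inr ` w) ` pts (tens Y X') = {}"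
  proof (rule ccontr)
    assume "\<not> ?thesis"
    then obtain w w' where w: "w \<in> pts (tens Y X)" "w' \<in> pts (tens Y X')"
      and eq: "map_prod id Inl ` w = map_prod id (Inr :: 'c \<Rightarrow> 'b + 'c) ` w'" by blast
    obtain y x where "y \<in> pts Y" "x \<in> pts X" "w = orb Y X y x" by (rule tens_ptsE[OF Y X w(1)])
    then have "(y, x) \<in> w" using orb_self[OF Y X] by simp
    then have "(y, Inl x) \<in> map_prod id (Inr :: 'c \<Rightarrow> 'b + 'c) ` w'" unfolding eq[symmetric] by force
    then show False by auto
  qed
qed

lemma union_iso:
  assumes X: "fib X" and X': "fib X'" and Y: "fib Y" and Y': "fib Y'"
    and "X \<cong>\<^sub>f X'" and "Y \<cong>\<^sub>f Y'"
  shows "union_fb X Y \<cong>\<^sub>f union_fb X' Y'"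
proof -
  obtain f g where f: "emb X X' f" "f ` pts X = pts X'" and g: "emb Y Y' g" "g ` pts Y = pts Y'"
    using assms(5,6) unfolding iso_iff_emb by blast
  show ?thesis
  proof (rule iso_unionI)
    show "emb X (union_fb X' Y') (\<lambda>x. Inl (f x))" "emb Y (union_fb X' Y') (\<lambda>y. Inr (g y))"
      using f g by (auto simp: emb_def union_fb_def inj_on_def)
  qed (use f(2) g(2) in \<open>auto simp: union_fb_def\<close>)
qed

lemma M_mult:
  assumes X: "fib X" and Y: "fib Y"
  shows "fb_class A G X \<otimes>\<^bsub>M\<^esub> fb_class A G Y = fb_class A G (tens X Y)"
proof -
  have eq: "fb_class A G (tens X' Y') = fb_class A G (tens X Y)"
    if "X' \<in> fb_class A G X" "Y' \<in> fb_class A G Y" for X' Y'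
  proof -
    have "fib X'" "fib Y'" "X \<cong>\<^sub>f X'" "Y \<cong>\<^sub>f Y'" using that by (auto simp: fb_class_def)
    then show ?thesis by (intro class_eqI[symmetric] tens_fib X Y tens_iso)
  qed
  obtain X' :: "('a, 'g, 'g, 'a \<times> nat) fbiset" where "fib X'" "X \<cong>\<^sub>f X'" using nat_model[OF X] by blast
  then have X': "X' \<in> fb_class A G X" by (simp add: class_mem)
  obtain Y' :: "('a, 'g, 'g, 'a \<times> nat) fbiset" where "fib Y'" "Y \<cong>\<^sub>f Y'" using nat_model[OF Y] by blast
  then have Y': "Y' \<in> fb_class A G Y" by (simp add: class_mem)
  have "fb_class A G X \<otimes>\<^bsub>M\<^esub> fb_class A G Y
    = (\<Union>X'\<in>fb_class A G X. \<Union>Y'\<in>fb_class A G Y. fb_class A G (tens X' Y'))"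
    by (simp add: fb_monoid_def)
  also have "\<dots> = fb_class A G (tens X Y)" using eq X' Y' by blast
  finally show ?thesis .
qed

end

locale fb_algebra = fb_context A G + k: cring k
  for A :: "('a, 'm) monoid_scheme" and G :: "('g, 'n) monoid_scheme" and k :: "('k, 'r) ring_scheme" +
  assumes G_finite: "finite (carrier G)"
begin

sublocale kM: monoid_algebra k M
proof
  fix C C' assume "C \<in> carrier M" "C' \<in> carrier M"
  then obtain X X' :: "('a, 'g, 'g, 'a \<times> nat) fbiset"
    where "fib X" "C = fb_class A G X" "fib X'" "C' = fb_class A G X'" by (metis carrier_class)
  then show "C \<otimes>\<^bsub>M\<^esub> C' \<in> carrier M" by (simp add: M_mult class_carrier tens_fib)
qed

abbreviation kB where "kB \<equiv> monoid_alg k M"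

definition class_delta where "class_delta X = delta k M (fb_class A G X)"

lemma class_delta_closed [simp]: "class_delta X \<in> carrier kB" by (simp add: class_delta_def)

lemma class_delta_iso: "fib X \<Longrightarrow> X \<cong>\<^sub>f Y \<Longrightarrow> class_delta X = class_delta Y"
  unfolding class_delta_def by (subst class_eqI) auto

lemma class_delta_mult: "fib X \<Longrightarrow> fib Y \<Longrightarrow> class_delta X \<otimes>\<^bsub>kB\<^esub> class_delta Y = class_delta (tens X Y)"
  by (simp add: class_delta_def kM.delta_mult class_carrier M_mult)

abbreviation I where "I \<equiv> groth_rel k A G"

lemma I_def': "I = lin_span k kB {class_delta (union_fb X Y) \<ominus>\<^bsub>kB\<^esub> (class_delta X \<oplus>\<^bsub>kB\<^esub> class_delta Y)
        | (X :: ('a, 'g, 'g, 'a \<times> nat) fbiset) (Y :: ('a, 'g, 'g, 'a \<times> nat) fbiset). fib X \<and> fib Y}"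
  by (simp add: groth_rel_def class_delta_def)

lemma I_gen:
  assumes X: "fib X" and Y: "fib Y"
  shows "class_delta (union_fb X Y) \<ominus>\<^bsub>kB\<^esub> (class_delta X \<oplus>\<^bsub>kB\<^esub> class_delta Y) \<in> I"
proof -
  obtain X' :: "('a, 'g, 'g, 'a \<times> nat) fbiset" where X': "fib X'" "X \<cong>\<^sub>f X'" using nat_model[OF X] by blast
  obtain Y' :: "('a, 'g, 'g, 'a \<times> nat) fbiset" where Y': "fib Y'" "Y \<cong>\<^sub>f Y'" using nat_model[OF Y] by blast
  have "class_delta X = class_delta X'" "class_delta Y = class_delta Y'" "class_delta (union_fb X Y) = class_delta (union_fb X' Y')"
    using class_delta_iso[OF X X'(2)] class_delta_iso[OF Y Y'(2)]
      class_delta_iso[OF union_fib[OF X Y] union_iso[OF X X'(1) Y Y'(1) X'(2) Y'(2)]] by auto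
  then show ?thesis unfolding I_def' using X'(1) Y'(1) by (intro subsetD[OF kM.B.lin_span_incl]) auto
qed

lemma I_sub: "submodule I k kB"
  unfolding I_def' by (intro kM.B.lin_span_submodule) (auto intro: kM.B.M.minus_closed)

lemma kB_span: "carrier kB \<subseteq> lin_span k kB (delta k M ` carrier M)"
proof (rule kM.deltas_span)
  show "submodule (lin_span k kB (delta k M ` carrier M)) k kB" by (rule kM.B.lin_span_submodule) auto
  show "delta k M x \<in> lin_span k kB (delta k M ` carrier M)" if "x \<in> carrier M" for x
    using that by (intro subsetD[OF kM.B.lin_span_incl] imageI)
qed

lemma class_delta_ideal:
  assumes X: "fib X" and Y: "fib Y" and Z: "fib Z"
  shows "(class_delta (union_fb X Y) \<ominus>\<^bsub>kB\<^esub> (class_delta X \<oplus>\<^bsub>kB\<^esub> class_delta Y)) \<otimes>\<^bsub>kB\<^esub> class_delta Z \<in> I"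
    and "class_delta Z \<otimes>\<^bsub>kB\<^esub> (class_delta (union_fb X Y) \<ominus>\<^bsub>kB\<^esub> (class_delta X \<oplus>\<^bsub>kB\<^esub> class_delta Y)) \<in> I"
proof -
  have U: "fib (union_fb X Y)" by (rule union_fib[OF X Y])
  have 1: "class_delta (tens (union_fb X Y) Z) = class_delta (union_fb (tens X Z) (tens Y Z))"
    by (intro class_delta_iso[symmetric] tens_union_left union_fib tens_fib X Y Z)
  have 2: "class_delta (tens Z (union_fb X Y)) = class_delta (union_fb (tens Z X) (tens Z Y))"
    by (intro class_delta_iso[symmetric] tens_union_right union_fib tens_fib X Y Z)
  have "(class_delta (union_fb X Y) \<ominus>\<^bsub>kB\<^esub> (class_delta X \<oplus>\<^bsub>kB\<^esub> class_delta Y)) \<otimes>\<^bsub>kB\<^esub> class_delta Z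
    = class_delta (union_fb (tens X Z) (tens Y Z)) \<ominus>\<^bsub>kB\<^esub> (class_delta (tens X Z) \<oplus>\<^bsub>kB\<^esub> class_delta (tens Y Z))"
    unfolding lin_map_minus[OF kM.B_module kM.B_module kM.B.lin_map_mult_right[OF class_delta_closed],
        OF class_delta_closed kM.B.M.a_closed[OF class_delta_closed class_delta_closed]]
    by (simp add: kM.B.bilin_add_left class_delta_mult X Y Z U 1)
  then show "(class_delta (union_fb X Y) \<ominus>\<^bsub>kB\<^esub> (class_delta X \<oplus>\<^bsub>kB\<^esub> class_delta Y)) \<otimes>\<^bsub>kB\<^esub> class_delta Z \<in> I"
    by (simp only: I_gen[OF tens_fib[OF X Z] tens_fib[OF Y Z]])
  have "class_delta Z \<otimes>\<^bsub>kB\<^esub> (class_delta (union_fb X Y) \<ominus>\<^bsub>kB\<^esub> (class_delta X \<oplus>\<^bsub>kB\<^esub> class_delta Y))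
    = class_delta (union_fb (tens Z X) (tens Z Y)) \<ominus>\<^bsub>kB\<^esub> (class_delta (tens Z X) \<oplus>\<^bsub>kB\<^esub> class_delta (tens Z Y))"
    unfolding lin_map_minus[OF kM.B_module kM.B_module kM.B.lin_map_mult_left[OF class_delta_closed],
        OF class_delta_closed kM.B.M.a_closed[OF class_delta_closed class_delta_closed]]
    by (simp add: kM.B.bilin_add_right class_delta_mult X Y Z U 2)
  then show "class_delta Z \<otimes>\<^bsub>kB\<^esub> (class_delta (union_fb X Y) \<ominus>\<^bsub>kB\<^esub> (class_delta X \<oplus>\<^bsub>kB\<^esub> class_delta Y)) \<in> I"
    by (simp only: I_gen[OF tens_fib[OF Z X] tens_fib[OF Z Y]])
qed

sublocale E: bilinear_ideal k kB I
proof (intro bilinear_ideal.intro bilinear_ideal_axioms.intro kM.B_bilinear I_sub)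
  have delta: "d \<in> delta k M ` carrier M \<Longrightarrow> \<exists>Z :: ('a, 'g, 'g, 'a \<times> nat) fbiset. fib Z \<and> d = class_delta Z" for d
    unfolding class_delta_def by (auto elim: carrier_class)
  have gens: "{class_delta (union_fb X Y) \<ominus>\<^bsub>kB\<^esub> (class_delta X \<oplus>\<^bsub>kB\<^esub> class_delta Y)
        | (X :: ('a, 'g, 'g, 'a \<times> nat) fbiset) (Y :: ('a, 'g, 'g, 'a \<times> nat) fbiset). fib X \<and> fib Y}
      \<subseteq> carrier kB" by (auto intro: kM.B.M.minus_closed)
  have deltas: "delta k M ` carrier M \<subseteq> carrier kB" by auto
  fix i x assume "i \<in> I" "x \<in> carrier kB"
  then have i: "i \<in> lin_span k kB {class_delta (union_fb X Y) \<ominus>\<^bsub>kB\<^esub> (class_delta X \<oplus>\<^bsub>kB\<^esub> class_delta Y)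
        | (X :: ('a, 'g, 'g, 'a \<times> nat) fbiset) (Y :: ('a, 'g, 'g, 'a \<times> nat) fbiset). fib X \<and> fib Y}"
    and x: "x \<in> lin_span k kB (delta k M ` carrier M)" using kB_span by (auto simp: I_def')
  show "i \<otimes>\<^bsub>kB\<^esub> x \<in> I"
  proof (rule kM.B.lin_span_mult[OF gens deltas I_sub _ i x], clarify)
    fix C assume "C \<in> carrier M"
    then obtain Z :: "('a, 'g, 'g, 'a \<times> nat) fbiset" where Z: "fib Z" "delta k M C = class_delta Z" using delta by blast
    fix X Y :: "('a, 'g, 'g, 'a \<times> nat) fbiset" assume "fib X" "fib Y"
    then show "(class_delta (union_fb X Y) \<ominus>\<^bsub>kB\<^esub> (class_delta X \<oplus>\<^bsub>kB\<^esub> class_delta Y)) \<otimes>\<^bsub>kB\<^esub> delta k M C \<in> I"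
      unfolding Z(2) using Z(1) by (rule class_delta_ideal(1))
  qed
  show "x \<otimes>\<^bsub>kB\<^esub> i \<in> I"
  proof (rule kM.B.lin_span_mult[OF deltas gens I_sub _ x i], clarify)
    fix C assume "C \<in> carrier M"
    then obtain Z :: "('a, 'g, 'g, 'a \<times> nat) fbiset" where Z: "fib Z" "delta k M C = class_delta Z" using delta by blast
    fix X Y :: "('a, 'g, 'g, 'a \<times> nat) fbiset" assume "fib X" "fib Y"
    then show "delta k M C \<otimes>\<^bsub>kB\<^esub> (class_delta (union_fb X Y) \<ominus>\<^bsub>kB\<^esub> (class_delta X \<oplus>\<^bsub>kB\<^esub> class_delta Y)) \<in> I"
      unfolding Z(2) using Z(1) by (rule class_delta_ideal(2))
  qed
qed

text \<open>
  Two copies of the empty biset form the empty biset, so its class \<open>c\<close> satisfies \<open>c = c + c\<close> in the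
  Grothendieck group.
\<close>

lemma class_delta_empty:
  assumes X: "fib X" and empty: "pts X = {}" shows "class_delta X \<in> I"
proof -
  have "union_fb X X \<cong>\<^sub>f X"
    using empty by (simp add: iso_iff union_fb_def bij_betw_def Plus_def)
  then have "class_delta (union_fb X X) = class_delta X" by (rule class_delta_iso[OF union_fib[OF X X]])
  then have "class_delta X \<ominus>\<^bsub>kB\<^esub> (class_delta X \<oplus>\<^bsub>kB\<^esub> class_delta X) \<in> I" using I_gen[OF X X] by simp
  moreover have "class_delta X = \<ominus>\<^bsub>kB\<^esub> (class_delta X \<ominus>\<^bsub>kB\<^esub> (class_delta X \<oplus>\<^bsub>kB\<^esub> class_delta X))"
    by (simp add: a_minus_def kM.B.M.minus_add kM.B.M.a_assoc[symmetric] kM.B.M.r_neg)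
  ultimately show ?thesis using kM.B.submoduleE(3)[OF I_sub] by metis
qed

subsection \<open>Linear independence of classes of transitive bisets\<close>

text \<open>
  A class is a set of bisets on one fixed type; \<open>orbit_count\<close> is evaluated at any of them.
\<close>

definition class_count where
  "class_count W C = [orbit_count W (SOME X :: ('a, 'g, 'g, 'a \<times> nat) fbiset. fib X \<and> C = fb_class A G X)] \<cdot>\<^bsub>k\<^esub> \<one>\<^bsub>k\<^esub>"

lemma nat_multiple_closed: "[(n::nat)] \<cdot>\<^bsub>k\<^esub> \<one>\<^bsub>k\<^esub> \<in> carrier k"
  using k.add.nat_pow_closed[OF k.one_closed, of n] by (simp add: add_pow_def)

lemma nat_multiple_add:
  "[(m + n :: nat)] \<cdot>\<^bsub>k\<^esub> \<one>\<^bsub>k\<^esub> = [m] \<cdot>\<^bsub>k\<^esub> \<one>\<^bsub>k\<^esub> \<oplus>\<^bsub>k\<^esub> [n] \<cdot>\<^bsub>k\<^esub> \<one>\<^bsub>k\<^esub>"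
  using k.add.nat_pow_mult[OF k.one_closed, of m n] by (simp add: add_pow_def)

lemma class_count_class:
  assumes X: "fib X" shows "class_count W (fb_class A G X) = [orbit_count W X] \<cdot>\<^bsub>k\<^esub> \<one>\<^bsub>k\<^esub>"
proof -
  let ?Y = "SOME Y :: ('a, 'g, 'g, 'a \<times> nat) fbiset. fib Y \<and> fb_class A G X = fb_class A G Y"
  have "\<exists>Y :: ('a, 'g, 'g, 'a \<times> nat) fbiset. fib Y \<and> fb_class A G X = fb_class A G Y"
    using carrier_class[OF class_carrier[OF X]] by metis
  from someI_ex[OF this] have "fib ?Y" "fb_class A G X = fb_class A G ?Y" by auto
  then have "orbit_count W ?Y = orbit_count W X" using orbit_count_iso[OF X class_eqD[OF X]] by blast
  then show ?thesis by (simp add: class_count_def)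
qed

lemma class_count_closed: "class_count W C \<in> carrier k"
  by (simp add: class_count_def nat_multiple_closed)

definition count_fun where "count_fun W = kM.linear_ext (class_count W)"

lemma count_fun_lin: "lin_map k kB (self_module k) (count_fun W)"
  unfolding count_fun_def by (intro kM.linear_ext_lin class_count_closed)

lemma count_fun_class_delta: "fib X \<Longrightarrow> count_fun W (class_delta X) = [orbit_count W X] \<cdot>\<^bsub>k\<^esub> \<one>\<^bsub>k\<^esub>"
  by (simp add: count_fun_def class_delta_def kM.linear_ext_delta class_count_closed class_carrier class_count_class)

lemma count_fun_I: "i \<in> I \<Longrightarrow> count_fun W i = \<zero>\<^bsub>k\<^esub>"
proof -
  assume i: "i \<in> I"
  have "lin_map k kB (self_module k) (\<lambda>_. \<zero>\<^bsub>k\<^esub>)" by (rule lin_mapI) auto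
  from submodule_equalizer[OF kM.B_module k.self_module count_fun_lin this]
  have N: "submodule {x \<in> carrier kB. count_fun W x = \<zero>\<^bsub>k\<^esub>} k kB" .
  have gen: "count_fun W (class_delta (union_fb X Y) \<ominus>\<^bsub>kB\<^esub> (class_delta X \<oplus>\<^bsub>kB\<^esub> class_delta Y)) = \<zero>\<^bsub>k\<^esub>" if X: "fib X" and Y: "fib Y"
    for X Y :: "('a, 'g, 'g, 'a \<times> nat) fbiset"
  proof -
    have "count_fun W (class_delta (union_fb X Y) \<ominus>\<^bsub>kB\<^esub> (class_delta X \<oplus>\<^bsub>kB\<^esub> class_delta Y))
      = count_fun W (class_delta (union_fb X Y)) \<oplus>\<^bsub>k\<^esub> \<ominus>\<^bsub>self_module k\<^esub> (count_fun W (class_delta X) \<oplus>\<^bsub>k\<^esub> count_fun W (class_delta Y))"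
      using lin_map_minus[OF kM.B_module k.self_module count_fun_lin, of "class_delta (union_fb X Y)" "class_delta X \<oplus>\<^bsub>kB\<^esub> class_delta Y"]
        lin_mapD(2)[OF count_fun_lin, of "class_delta X" "class_delta Y"] by (simp add: a_minus_def)
    also have "\<dots> = \<zero>\<^bsub>k\<^esub>"
    proof -
      interpret s: module k "self_module k" by (rule k.self_module)
      have "count_fun W (class_delta (union_fb X Y)) = count_fun W (class_delta X) \<oplus>\<^bsub>k\<^esub> count_fun W (class_delta Y)"
        using union_fib[OF X Y] X Y
        by (simp add: count_fun_class_delta orbit_count_union nat_multiple_add)
      moreover have "count_fun W (class_delta X) \<oplus>\<^bsub>k\<^esub> count_fun W (class_delta Y) \<in> carrier k"
        using X Y by (simp add: count_fun_class_delta nat_multiple_closed)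
      ultimately show ?thesis using s.M.r_neg by simp
    qed
    finally show ?thesis .
  qed
  have "I \<subseteq> {x \<in> carrier kB. count_fun W x = \<zero>\<^bsub>k\<^esub>}"
    unfolding I_def' using gen by (intro kM.B.lin_span_min[OF N]) (auto intro: kM.B.M.minus_closed)
  then show ?thesis using i by auto
qed

text \<open>
  On the Grothendieck algebra, \<open>coordf W\<close> is the functional counting orbits of type \<open>W\<close>.
\<close>

definition coordf where "coordf W = descend (count_fun W)"

lemma E_alg_eq: "E_alg k A G = E.Q" by (simp add: E_alg_def)

lemma coordf_lin: "lin_map k E.Q (self_module k) (coordf W)"
  unfolding coordf_def using count_fun_I by (intro E.descend_lin_map k.self_module count_fun_lin) simp

lemma coordf_class_delta: "fib X \<Longrightarrow> coordf W (I +>\<^bsub>kB\<^esub> class_delta X) = [orbit_count W X] \<cdot>\<^bsub>k\<^esub> \<one>\<^bsub>k\<^esub>"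
  unfolding coordf_def using E.descend_coset[OF k.self_module count_fun_lin, of W "class_delta X"] count_fun_I count_fun_class_delta by simp

end

section \<open>Pairs as subgroups\<close>

text \<open>
  The subgroup \<open>U\<^sub>\<phi>\<close> of a pair \<open>(U, \<phi>)\<close>; the inverse is the one in its definition.
\<close>

definition graph where "graph A p = (\<lambda>x. (inv\<^bsub>A\<^esub> (snd p x), x)) ` fst p"

locale pair_context = A: comm_group A + H: group H
  for A :: "('a, 'm) monoid_scheme" and H :: "('h, 'n) monoid_scheme"
begin

lemma AH_group: "group (A \<times>\<times> H)"
  by (intro DirProd_group A.group_axioms H.group_axioms)

sublocale AH: group "A \<times>\<times> H" by (rule AH_group)

lemma pairD:
  assumes "p \<in> pairs A H"
  shows "subgroup (fst p) H" and "x \<in> fst p \<Longrightarrow> x \<in> carrier H" and "x \<in> fst p \<Longrightarrow> snd p x \<in> carrier A"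
    and "x \<in> fst p \<Longrightarrow> y \<in> fst p \<Longrightarrow> snd p (x \<otimes>\<^bsub>H\<^esub> y) = snd p x \<otimes>\<^bsub>A\<^esub> snd p y"
    and "snd p \<in> extensional (fst p)" and "snd p \<one>\<^bsub>H\<^esub> = \<one>\<^bsub>A\<^esub>"
proof -
  obtain K \<kappa> where p: "p = (K, \<kappa>)" by (cases p)
  have K: "subgroup K H" and \<kappa>: "\<kappa> \<in> hom (H\<lparr>carrier := K\<rparr>) A" "\<kappa> \<in> extensional K"
    using assms by (auto simp: p pairs_def chars_def)
  show "subgroup (fst p) H" "x \<in> fst p \<Longrightarrow> x \<in> carrier H" "x \<in> fst p \<Longrightarrow> snd p x \<in> carrier A"
    "x \<in> fst p \<Longrightarrow> y \<in> fst p \<Longrightarrow> snd p (x \<otimes>\<^bsub>H\<^esub> y) = snd p x \<otimes>\<^bsub>A\<^esub> snd p y"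
    "snd p \<in> extensional (fst p)"
    using K \<kappa> subgroup.mem_carrier[OF K] by (auto simp: p hom_def)
  have 1: "\<one>\<^bsub>H\<^esub> \<in> K" using subgroup.one_closed[OF K] .
  then have "\<kappa> \<one>\<^bsub>H\<^esub> \<in> carrier A" using \<kappa>(1) by (auto simp: hom_def)
  moreover have "\<kappa> \<one>\<^bsub>H\<^esub> = \<kappa> \<one>\<^bsub>H\<^esub> \<otimes>\<^bsub>A\<^esub> \<kappa> \<one>\<^bsub>H\<^esub>"
    using hom_mult[OF \<kappa>(1), of "\<one>\<^bsub>H\<^esub>" "\<one>\<^bsub>H\<^esub>"] 1 by simp
  ultimately have "\<kappa> \<one>\<^bsub>H\<^esub> = \<one>\<^bsub>A\<^esub>" by (simp add: A.l_cancel_one')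
  then show "snd p \<one>\<^bsub>H\<^esub> = \<one>\<^bsub>A\<^esub>" by (simp add: p)
qed

lemma mem_graph:
  assumes "p \<in> pairs A H"
  shows "(a, x) \<in> graph A p \<longleftrightarrow> x \<in> fst p \<and> a \<in> carrier A \<and> snd p x = inv\<^bsub>A\<^esub> a"
  using pairD(3)[OF assms] by (auto simp: graph_def image_iff)

lemma graph_subgroup:
  assumes p: "p \<in> pairs A H" shows "subgroup (graph A p) (A \<times>\<times> H)"
proof (rule AH.subgroupI)
  note K = pairD(1)[OF p]
  show "graph A p \<subseteq> carrier (A \<times>\<times> H)" using pairD(2,3)[OF p] by (auto simp: graph_def)
  show "graph A p \<noteq> {}" using subgroup.one_closed[OF K] by (auto simp: graph_def)
  fix u assume "u \<in> graph A p"
  then obtain a x where u: "u = (a, x)" "x \<in> fst p" "a \<in> carrier A" "snd p x = inv\<^bsub>A\<^esub> a"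
    using mem_graph[OF p] by (cases u) auto
  have ix: "inv\<^bsub>H\<^esub> x \<in> fst p" using u(2) K by (rule subgroup.m_inv_closed[rotated])
  have "snd p x \<otimes>\<^bsub>A\<^esub> snd p (inv\<^bsub>H\<^esub> x) = \<one>\<^bsub>A\<^esub>"
    using pairD(4)[OF p u(2) ix] pairD(2)[OF p u(2)] pairD(6)[OF p] by simp
  then have "snd p (inv\<^bsub>H\<^esub> x) = a"
    using u pairD(3)[OF p ix] by (metis A.inv_equality A.inv_inv A.m_comm A.inv_closed)
  then show "inv\<^bsub>A \<times>\<times> H\<^esub> u \<in> graph A p"
    using u ix pairD(2)[OF p u(2)]
    by (simp add: inv_DirProd A.group_axioms H.group_axioms mem_graph[OF p])
  fix v assume "v \<in> graph A p"
  then obtain b y where v: "v = (b, y)" "y \<in> fst p" "b \<in> carrier A" "snd p y = inv\<^bsub>A\<^esub> b"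
    using mem_graph[OF p] by (cases v) auto
  show "u \<otimes>\<^bsub>A \<times>\<times> H\<^esub> v \<in> graph A p"
    using u v subgroup.m_closed[OF K u(2) v(2)]
    by (simp add: mem_graph[OF p] pairD(4)[OF p] A.inv_mult)
qed

lemma graph_inj:
  assumes p: "p \<in> pairs A H" and q: "q \<in> pairs A H"
  shows "graph A p \<subseteq> graph A q \<longleftrightarrow> pair_le p q"
proof
  assume sub: "graph A p \<subseteq> graph A q"
  have 1: "x \<in> fst q \<and> snd q x = snd p x" if x: "x \<in> fst p" for x
  proof -
    have "(inv\<^bsub>A\<^esub> (snd p x), x) \<in> graph A q" using sub x by (auto simp: graph_def)
    then show ?thesis using pairD(3)[OF p x] by (simp add: mem_graph[OF q])
  qed
  have "snd p = restrict (snd q) (fst p)"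
    using 1 pairD(5)[OF p] by (intro extensionalityI[OF _ restrict_extensional]) auto
  then show "pair_le p q" using 1 by (auto simp: pair_le_def)
next
  assume le: "pair_le p q"
  then have "snd p x = snd q x" if "x \<in> fst p" for x using that unfolding pair_le_def by simp
  then show "graph A p \<subseteq> graph A q"
    using le unfolding graph_def pair_le_def by force
qed

lemma graph_eq_iff:
  assumes p: "p \<in> pairs A H" and q: "q \<in> pairs A H"
  shows "graph A p = graph A q \<longleftrightarrow> p = q"
proof
  assume "graph A p = graph A q"
  then have "pair_le p q" "pair_le q p" using graph_inj[OF p q] graph_inj[OF q p] by auto
  then have "fst p = fst q" "snd p = restrict (snd q) (fst p)" by (auto simp: pair_le_def)
  then show "p = q" using pairD(5)[OF q] by (intro prod_eqI) (auto simp: extensional_restrict)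
qed simp

text \<open>
  Two elements of \<open>N\<close> over the same element of \<open>H\<close> differ by an element of \<open>A\<close>; hence \<open>N\<close> is a
  graph over its projection to \<open>H\<close>.
\<close>

lemma graph_surj:
  assumes N: "subgroup N (A \<times>\<times> H)" and triv: "\<And>a. (a, \<one>\<^bsub>H\<^esub>) \<in> N \<Longrightarrow> a = \<one>\<^bsub>A\<^esub>"
  shows "\<exists>p\<in>pairs A H. graph A p = N"
proof -
  have c: "a \<in> carrier A" "x \<in> carrier H" if "(a, x) \<in> N" for a x
    using subgroup.subset[OF N] that by auto
  have m: "(a \<otimes>\<^bsub>A\<^esub> b, x \<otimes>\<^bsub>H\<^esub> y) \<in> N" if "(a, x) \<in> N" "(b, y) \<in> N" for a b x y
    using subgroup.m_closed[OF N that] by simp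
  have i: "(inv\<^bsub>A\<^esub> a, inv\<^bsub>H\<^esub> x) \<in> N" if "(a, x) \<in> N" for a x
    using subgroup.m_inv_closed[OF N that] c[OF that]
    by (simp add: inv_DirProd A.group_axioms H.group_axioms)
  have u: "a = b" if "(a, x) \<in> N" "(b, x) \<in> N" for a b x
  proof -
    have "(a \<otimes>\<^bsub>A\<^esub> inv\<^bsub>A\<^esub> b, \<one>\<^bsub>H\<^esub>) \<in> N" using m[OF that(1) i[OF that(2)]] c[OF that(1)] by (simp add: H.r_inv)
    from triv[OF this] show ?thesis using c[OF that(1)] c[OF that(2)] by (metis A.inv_closed A.inv_equality A.inv_inv)
  qed
  define K where "K = snd ` N"
  have "\<forall>x\<in>K. \<exists>a. (a, x) \<in> N" by (auto simp: K_def)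
  then obtain f where f: "\<And>x. x \<in> K \<Longrightarrow> (f x, x) \<in> N" by metis
  define \<kappa> where "\<kappa> = (\<lambda>x\<in>K. inv\<^bsub>A\<^esub> (f x))"
  have sub: "subgroup K H"
  proof (rule H.subgroupI)
    show "K \<subseteq> carrier H" using c by (auto simp: K_def)
    show "K \<noteq> {}" using subgroup.one_closed[OF N] by (auto simp: K_def)
    show "inv\<^bsub>H\<^esub> x \<in> K" if "x \<in> K" for x using i[OF f[OF that]] by (force simp: K_def)
    show "x \<otimes>\<^bsub>H\<^esub> y \<in> K" if "x \<in> K" "y \<in> K" for x y using m[OF f[OF that(1)] f[OF that(2)]] by (force simp: K_def)
  qed
  have "\<kappa> \<in> hom (H\<lparr>carrier := K\<rparr>) A"
  proof (rule homI)
    fix x y assume xy: "x \<in> carrier (H\<lparr>carrier := K\<rparr>)" "y \<in> carrier (H\<lparr>carrier := K\<rparr>)"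
    have "f (x \<otimes>\<^bsub>H\<^esub> y) = f x \<otimes>\<^bsub>A\<^esub> f y"
      using u[OF f m[OF f f]] xy subgroup.m_closed[OF sub] by simp
    then show "\<kappa> (x \<otimes>\<^bsub>H\<lparr>carrier := K\<rparr>\<^esub> y) = \<kappa> x \<otimes>\<^bsub>A\<^esub> \<kappa> y"
      using xy c[OF f] subgroup.m_closed[OF sub] by (simp add: \<kappa>_def A.inv_mult)
  qed (use c[OF f] in \<open>auto simp: \<kappa>_def\<close>)
  then have p: "(K, \<kappa>) \<in> pairs A H" using sub by (simp add: pairs_def chars_def \<kappa>_def)
  have g: "inv\<^bsub>A\<^esub> (\<kappa> x) = f x" if "x \<in> K" for x using that c[OF f[OF that]] by (simp add: \<kappa>_def)
  have "graph A (K, \<kappa>) = N"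
  proof (intro subset_antisym subrelI)
    show "(a, x) \<in> N" if "(a, x) \<in> graph A (K, \<kappa>)" for a x
      using that f g by (auto simp: graph_def)
    show "(a, x) \<in> graph A (K, \<kappa>)" if ax: "(a, x) \<in> N" for a x
    proof -
      have x: "x \<in> K" using ax by (force simp: K_def)
      then have "a = f x" using u[OF ax f] by simp
      then show ?thesis using g[OF x] x by (auto simp: graph_def image_iff)
    qed
  qed
  then show ?thesis using p by blast
qed

end

section \<open>Covering subgroups and their composition\<close>

context fb_context
begin

lemma cancel_simps [simp]:
  "x \<in> carrier G \<Longrightarrow> y \<in> carrier G \<Longrightarrow> x \<otimes>\<^bsub>G\<^esub> (iG x \<otimes>\<^bsub>G\<^esub> y) = y"
  "x \<in> carrier G \<Longrightarrow> y \<in> carrier G \<Longrightarrow> iG x \<otimes>\<^bsub>G\<^esub> (x \<otimes>\<^bsub>G\<^esub> y) = y"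
  "a \<in> carrier A \<Longrightarrow> b \<in> carrier A \<Longrightarrow> a \<otimes>\<^bsub>A\<^esub> (iA a \<otimes>\<^bsub>A\<^esub> b) = b"
  "a \<in> carrier A \<Longrightarrow> b \<in> carrier A \<Longrightarrow> iA a \<otimes>\<^bsub>A\<^esub> (a \<otimes>\<^bsub>A\<^esub> b) = b"
  by (simp_all add: G.m_assoc[symmetric] A.m_assoc[symmetric] G.l_inv G.r_inv A.l_inv A.r_inv)

definition covers where
  "covers W \<longleftrightarrow> subgroup W T \<and> (\<forall>g\<in>carrier G. \<exists>a h. (a, g, h) \<in> W) \<and> (\<forall>h\<in>carrier G. \<exists>a g. (a, g, h) \<in> W)"

lemma coversD:
  assumes "covers W"
  shows "subgroup W T"
    and "(a, g, h) \<in> W \<Longrightarrow> a \<in> carrier A" "(a, g, h) \<in> W \<Longrightarrow> g \<in> carrier G" "(a, g, h) \<in> W \<Longrightarrow> h \<in> carrier G"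
    and "(a, g, h) \<in> W \<Longrightarrow> (a', g', h') \<in> W \<Longrightarrow> (a \<otimes>\<^bsub>A\<^esub> a', g \<otimes>\<^bsub>G\<^esub> g', h \<otimes>\<^bsub>G\<^esub> h') \<in> W"
    and "(a, g, h) \<in> W \<Longrightarrow> (iA a, iG g, iG h) \<in> W"
    and "(oA, oG, oG) \<in> W"
    and "g \<in> carrier G \<Longrightarrow> \<exists>a h. (a, g, h) \<in> W"
    and "h \<in> carrier G \<Longrightarrow> \<exists>a g. (a, g, h) \<in> W"
proof -
  show W: "subgroup W T" using assms by (simp add: covers_def)
  show c: "(a, g, h) \<in> W \<Longrightarrow> a \<in> carrier A" "(a, g, h) \<in> W \<Longrightarrow> g \<in> carrier G" "(a, g, h) \<in> W \<Longrightarrow> h \<in> carrier G"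
    using subgroup.subset[OF W] by auto
  show "(a, g, h) \<in> W \<Longrightarrow> (a', g', h') \<in> W \<Longrightarrow> (a \<otimes>\<^bsub>A\<^esub> a', g \<otimes>\<^bsub>G\<^esub> g', h \<otimes>\<^bsub>G\<^esub> h') \<in> W"
    using subgroup.m_closed[OF W, of "(a, g, h)" "(a', g', h')"] by simp
  show "(a, g, h) \<in> W \<Longrightarrow> (iA a, iG g, iG h) \<in> W"
    using subgroup.m_inv_closed[OF W, of "(a, g, h)"] c by simp
  show "(oA, oG, oG) \<in> W" using subgroup.one_closed[OF W] by (simp add: T_one)
  show "g \<in> carrier G \<Longrightarrow> \<exists>a h. (a, g, h) \<in> W" "h \<in> carrier G \<Longrightarrow> \<exists>a g. (a, g, h) \<in> W"
    using assms by (auto simp: covers_def)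
qed

lemma rel_compI: "(a, g, h) \<in> W \<Longrightarrow> (b, h, i) \<in> W' \<Longrightarrow> c = a \<otimes>\<^bsub>A\<^esub> b \<Longrightarrow> (c, g, i) \<in> rel_comp W W'"
  by (auto simp: rel_comp_def)

lemma rel_compE:
  assumes "(c, g, i) \<in> rel_comp W W'"
  obtains a b h where "(a, g, h) \<in> W" "(b, h, i) \<in> W'" "c = a \<otimes>\<^bsub>A\<^esub> b"
  using assms by (auto simp: rel_comp_def)

lemma triple_subsetI: "(\<And>a g h. (a, g, h) \<in> U \<Longrightarrow> (a, g, h) \<in> V) \<Longrightarrow> U \<subseteq> V"
  by auto

lemma coversI:
  assumes "\<And>a g h. (a, g, h) \<in> W \<Longrightarrow> a \<in> carrier A \<and> g \<in> carrier G \<and> h \<in> carrier G"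
    and "\<And>a g h a' g' h'. (a, g, h) \<in> W \<Longrightarrow> (a', g', h') \<in> W \<Longrightarrow> (a \<otimes>\<^bsub>A\<^esub> a', g \<otimes>\<^bsub>G\<^esub> g', h \<otimes>\<^bsub>G\<^esub> h') \<in> W"
    and "\<And>a g h. (a, g, h) \<in> W \<Longrightarrow> (iA a, iG g, iG h) \<in> W"
    and "\<And>g. g \<in> carrier G \<Longrightarrow> \<exists>a h. (a, g, h) \<in> W"
    and "\<And>h. h \<in> carrier G \<Longrightarrow> \<exists>a g. (a, g, h) \<in> W"
  shows "covers W"
proof -
  have "subgroup W T"
  proof (rule T.subgroupI)
    show "W \<subseteq> carrier T" using assms(1) by (intro triple_subsetI) simp
    show "W \<noteq> {}" using assms(4)[OF G.one_closed] by auto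
    fix u assume "u \<in> W"
    then obtain a g h where u: "u = (a, g, h)" "(a, g, h) \<in> W" by (cases u) auto
    then show "inv\<^bsub>T\<^esub> u \<in> W" using assms(1)[OF u(2)] assms(3)[OF u(2)] by simp
    fix v assume "v \<in> W"
    then obtain a' g' h' where v: "v = (a', g', h')" "(a', g', h') \<in> W" by (cases v) auto
    show "u \<otimes>\<^bsub>T\<^esub> v \<in> W" using assms(2)[OF u(2) v(2)] u(1) v(1) by simp
  qed
  then show ?thesis using assms(4,5) by (simp add: covers_def)
qed

lemma rel_comp_covers:
  assumes W: "covers W" and W': "covers W'" shows "covers (rel_comp W W')"
proof (rule coversI)
  fix c g i assume "(c, g, i) \<in> rel_comp W W'"
  then obtain a b h where 1: "(a, g, h) \<in> W" "(b, h, i) \<in> W'" "c = a \<otimes>\<^bsub>A\<^esub> b" by (rule rel_compE)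
  note cc = coversD(2-4)[OF W 1(1)] coversD(2-4)[OF W' 1(2)]
  show "c \<in> carrier A \<and> g \<in> carrier G \<and> i \<in> carrier G" using cc 1(3) by simp
  show "(iA c, iG g, iG i) \<in> rel_comp W W'"
    using coversD(6)[OF W 1(1)] coversD(6)[OF W' 1(2)] cc 1(3) by (intro rel_compI) (simp_all add: A.inv_mult)
  fix c' g' i' assume "(c', g', i') \<in> rel_comp W W'"
  then obtain a' b' h' where 2: "(a', g', h') \<in> W" "(b', h', i') \<in> W'" "c' = a' \<otimes>\<^bsub>A\<^esub> b'" by (rule rel_compE)
  note cc' = coversD(2-4)[OF W 2(1)] coversD(2-4)[OF W' 2(2)]
  show "(c \<otimes>\<^bsub>A\<^esub> c', g \<otimes>\<^bsub>G\<^esub> g', i \<otimes>\<^bsub>G\<^esub> i') \<in> rel_comp W W'"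
  proof (rule rel_compI[OF coversD(5)[OF W 1(1) 2(1)] coversD(5)[OF W' 1(2) 2(2)]])
    show "c \<otimes>\<^bsub>A\<^esub> c' = (a \<otimes>\<^bsub>A\<^esub> a') \<otimes>\<^bsub>A\<^esub> (b \<otimes>\<^bsub>A\<^esub> b')"
      unfolding 1(3) 2(3) using cc(1,4) cc'(1,4) by (simp add: A.m_ac)
  qed
next
  fix g assume "g \<in> carrier G"
  then obtain a h where 1: "(a, g, h) \<in> W" using coversD(8)[OF W] by blast
  then obtain b i where "(b, h, i) \<in> W'" using coversD(8)[OF W' coversD(4)[OF W 1]] by blast
  from rel_compI[OF 1 this refl] show "\<exists>a h. (a, g, h) \<in> rel_comp W W'" by blast
next
  fix i assume "i \<in> carrier G"
  then obtain b h where 1: "(b, h, i) \<in> W'" using coversD(9)[OF W'] by blast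
  then obtain a g where "(a, g, h) \<in> W" using coversD(9)[OF W coversD(3)[OF W' 1]] by blast
  from rel_compI[OF this 1 refl] show "\<exists>a g. (a, g, i) \<in> rel_comp W W'" by blast
qed

lemma rel_comp_assoc:
  assumes W: "covers W" and W': "covers W'" and W'': "covers W''"
  shows "rel_comp (rel_comp W W') W'' = rel_comp W (rel_comp W' W'')"
proof (intro subset_antisym triple_subsetI)
  fix c g j assume "(c, g, j) \<in> rel_comp (rel_comp W W') W''"
  then obtain a b d h i where 1: "(a, g, h) \<in> W" "(b, h, i) \<in> W'" "(d, i, j) \<in> W''" "c = (a \<otimes>\<^bsub>A\<^esub> b) \<otimes>\<^bsub>A\<^esub> d"
    by (elim rel_compE) auto
  then show "(c, g, j) \<in> rel_comp W (rel_comp W' W'')"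
    using coversD(2)[OF W 1(1)] coversD(2)[OF W' 1(2)] coversD(2)[OF W'' 1(3)]
    by (intro rel_compI[OF 1(1) rel_compI[OF 1(2,3) refl]]) (simp add: A.m_assoc)
next
  fix c g j assume "(c, g, j) \<in> rel_comp W (rel_comp W' W'')"
  then obtain a b d h i where 1: "(a, g, h) \<in> W" "(b, h, i) \<in> W'" "(d, i, j) \<in> W''" "c = a \<otimes>\<^bsub>A\<^esub> (b \<otimes>\<^bsub>A\<^esub> d)"
    by (elim rel_compE) auto
  then show "(c, g, j) \<in> rel_comp (rel_comp W W') W''"
    using coversD(2)[OF W 1(1)] coversD(2)[OF W' 1(2)] coversD(2)[OF W'' 1(3)]
    by (intro rel_compI[OF rel_compI[OF 1(1,2) refl] 1(3)]) (simp add: A.m_assoc)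
qed

text \<open>
  If \<open>W\<close> is the graph of \<open>(U, \<phi>)\<close>, these are the graphs of \<open>(k\<^sub>1(U), \<phi>\<^sub>1)\<close> and \<open>(k\<^sub>2(U), \<phi>\<^sub>2)\<close>.
  The inverse in the second accounts for the inverse in \<open>\<phi>(g, h) = \<phi>\<^sub>1(g) \<phi>\<^sub>2(h)\<^sup>-\<^sup>1\<close>.
\<close>

definition lker where "lker W = {(a, g). (a, g, oG) \<in> W}"
definition rker where "rker W = {(a, h). a \<in> carrier A \<and> (iA a, oG, h) \<in> W}"

text \<open>
  Those \<open>stable\<close> subgroups that meet \<open>A\<close> trivially are the graphs of the fixed pairs.
\<close>

definition stable where
  "stable N \<longleftrightarrow> subgroup N (A \<times>\<times> G) \<and> (\<forall>a g x. (a, g) \<in> N \<longrightarrow> x \<in> carrier G \<longrightarrow> (a, x \<otimes>\<^bsub>G\<^esub> g \<otimes>\<^bsub>G\<^esub> iG x) \<in> N)"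

text \<open>
  If \<open>N\<close> is the graph of the fixed pair \<open>(K, \<kappa>)\<close>, then \<open>diag N\<close> is the graph of
  \<open>(\<Delta>\<^sub>K(G), \<phi>\<^sub>\<kappa>)\<close>, the subgroup of the idempotent \<open>e\<^bsub>(K, \<kappa>)\<^esub>\<close>; and \<open>opp\<close> gives the inverse
  in the semigroup of covering subgroups.
\<close>

definition diag where "diag N = {(a, g, h). g \<in> carrier G \<and> h \<in> carrier G \<and> (a, g \<otimes>\<^bsub>G\<^esub> iG h) \<in> N}"
definition opp where "opp W = {(a, g, h). a \<in> carrier A \<and> (iA a, h, g) \<in> W}"

lemma stableD:
  assumes "stable N"
  shows "subgroup N (A \<times>\<times> G)" and "(a, g) \<in> N \<Longrightarrow> a \<in> carrier A" and "(a, g) \<in> N \<Longrightarrow> g \<in> carrier G"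
    and "(a, g) \<in> N \<Longrightarrow> (b, h) \<in> N \<Longrightarrow> (a \<otimes>\<^bsub>A\<^esub> b, g \<otimes>\<^bsub>G\<^esub> h) \<in> N"
    and "(a, g) \<in> N \<Longrightarrow> (iA a, iG g) \<in> N" and "(oA, oG) \<in> N"
    and "(a, g) \<in> N \<Longrightarrow> x \<in> carrier G \<Longrightarrow> (a, x \<otimes>\<^bsub>G\<^esub> g \<otimes>\<^bsub>G\<^esub> iG x) \<in> N"
    and "(a, g) \<in> N \<Longrightarrow> x \<in> carrier G \<Longrightarrow> (a, iG x \<otimes>\<^bsub>G\<^esub> g \<otimes>\<^bsub>G\<^esub> x) \<in> N"
proof -
  show N: "subgroup N (A \<times>\<times> G)" using assms by (simp add: stable_def)
  show c: "(a, g) \<in> N \<Longrightarrow> a \<in> carrier A" "(a, g) \<in> N \<Longrightarrow> g \<in> carrier G"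
    using subgroup.subset[OF N] by auto
  show "(a, g) \<in> N \<Longrightarrow> (b, h) \<in> N \<Longrightarrow> (a \<otimes>\<^bsub>A\<^esub> b, g \<otimes>\<^bsub>G\<^esub> h) \<in> N"
    using subgroup.m_closed[OF N, of "(a, g)" "(b, h)"] by simp
  show "(a, g) \<in> N \<Longrightarrow> (iA a, iG g) \<in> N"
    using subgroup.m_inv_closed[OF N, of "(a, g)"] c by (simp add: inv_DirProd A.group_axioms G.group_axioms)
  show "(oA, oG) \<in> N" using subgroup.one_closed[OF N] by simp
  show "(a, g) \<in> N \<Longrightarrow> x \<in> carrier G \<Longrightarrow> (a, x \<otimes>\<^bsub>G\<^esub> g \<otimes>\<^bsub>G\<^esub> iG x) \<in> N" for x
    using assms by (simp add: stable_def)
  from this[of "iG x"] show "(a, g) \<in> N \<Longrightarrow> x \<in> carrier G \<Longrightarrow> (a, iG x \<otimes>\<^bsub>G\<^esub> g \<otimes>\<^bsub>G\<^esub> x) \<in> N" by simp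
qed

lemma stableI:
  assumes "\<And>a g. (a, g) \<in> N \<Longrightarrow> a \<in> carrier A \<and> g \<in> carrier G"
    and "(oA, oG) \<in> N"
    and "\<And>a g b h. (a, g) \<in> N \<Longrightarrow> (b, h) \<in> N \<Longrightarrow> (a \<otimes>\<^bsub>A\<^esub> b, g \<otimes>\<^bsub>G\<^esub> h) \<in> N"
    and "\<And>a g. (a, g) \<in> N \<Longrightarrow> (iA a, iG g) \<in> N"
    and "\<And>a g x. (a, g) \<in> N \<Longrightarrow> x \<in> carrier G \<Longrightarrow> (a, x \<otimes>\<^bsub>G\<^esub> g \<otimes>\<^bsub>G\<^esub> iG x) \<in> N"
  shows "stable N"
proof -
  interpret AG: group "A \<times>\<times> G" by (intro DirProd_group A.group_axioms G.group_axioms)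
  have "subgroup N (A \<times>\<times> G)"
  proof (rule AG.subgroupI)
    show "N \<subseteq> carrier (A \<times>\<times> G)" using assms(1) by auto
    show "N \<noteq> {}" using assms(2) by auto
    fix u assume "u \<in> N"
    then obtain a g where u: "u = (a, g)" "(a, g) \<in> N" by (cases u) auto
    show "inv\<^bsub>A \<times>\<times> G\<^esub> u \<in> N"
      using u assms(1)[OF u(2)] assms(4)[OF u(2)] by (simp add: inv_DirProd A.group_axioms G.group_axioms)
    fix v assume "v \<in> N"
    then show "u \<otimes>\<^bsub>A \<times>\<times> G\<^esub> v \<in> N" using u assms(3) by (cases v) auto
  qed
  then show ?thesis using assms(5) by (simp add: stable_def)
qed

lemma opp_covers: assumes W: "covers W" shows "covers (opp W)"
proof (rule coversI)
  fix a g h assume "(a, g, h) \<in> opp W"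
  then have 1: "a \<in> carrier A" "(iA a, h, g) \<in> W" by (auto simp: opp_def)
  note cc = coversD(3,4)[OF W 1(2)]
  show "a \<in> carrier A \<and> g \<in> carrier G \<and> h \<in> carrier G" using 1 cc by simp
  show "(iA a, iG g, iG h) \<in> opp W" using coversD(6)[OF W 1(2)] 1 by (simp add: opp_def)
  fix a' g' h' assume "(a', g', h') \<in> opp W"
  then have 2: "a' \<in> carrier A" "(iA a', h', g') \<in> W" by (auto simp: opp_def)
  show "(a \<otimes>\<^bsub>A\<^esub> a', g \<otimes>\<^bsub>G\<^esub> g', h \<otimes>\<^bsub>G\<^esub> h') \<in> opp W"
    using coversD(5)[OF W 1(2) 2(2)] 1 2 by (simp add: opp_def A.inv_mult)
next
  fix g assume "g \<in> carrier G"
  then obtain a h where "(a, h, g) \<in> W" using coversD(9)[OF W] by blast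
  then have "(iA a, g, h) \<in> opp W" using coversD(2)[OF W] by (simp add: opp_def)
  then show "\<exists>a h. (a, g, h) \<in> opp W" by blast
next
  fix h assume "h \<in> carrier G"
  then obtain a g where "(a, h, g) \<in> W" using coversD(8)[OF W] by blast
  then have "(iA a, g, h) \<in> opp W" using coversD(2)[OF W] by (simp add: opp_def)
  then show "\<exists>a g. (a, g, h) \<in> opp W" by blast
qed

lemma lker_opp: assumes W: "covers W" shows "lker (opp W) = rker W"
  by (auto simp: lker_def rker_def opp_def)

lemma rker_opp: assumes W: "covers W" shows "rker (opp W) = lker W"
  using coversD(2)[OF W] by (auto simp: lker_def rker_def opp_def)

lemma lker_norm: assumes W: "covers W" shows "stable (lker W)"
proof (rule stableI)
  fix a g assume "(a, g) \<in> lker W"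
  then have 1: "(a, g, oG) \<in> W" by (simp add: lker_def)
  note cc = coversD(2,3)[OF W 1]
  show "a \<in> carrier A \<and> g \<in> carrier G" using cc by simp
  show "(iA a, iG g) \<in> lker W" using coversD(6)[OF W 1] by (simp add: lker_def)
  show "(a \<otimes>\<^bsub>A\<^esub> b, g \<otimes>\<^bsub>G\<^esub> h) \<in> lker W" if "(b, h) \<in> lker W" for b h
    using coversD(5)[OF W 1, of b h oG] that by (simp add: lker_def)
  show "(a, x \<otimes>\<^bsub>G\<^esub> g \<otimes>\<^bsub>G\<^esub> iG x) \<in> lker W" if x: "x \<in> carrier G" for x
  proof -
    obtain c h where 2: "(c, x, h) \<in> W" using coversD(8)[OF W x] by blast
    have "((c \<otimes>\<^bsub>A\<^esub> a) \<otimes>\<^bsub>A\<^esub> iA c, (x \<otimes>\<^bsub>G\<^esub> g) \<otimes>\<^bsub>G\<^esub> iG x, (h \<otimes>\<^bsub>G\<^esub> oG) \<otimes>\<^bsub>G\<^esub> iG h) \<in> W"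
      by (intro coversD(5)[OF W] coversD(6)[OF W] 1 2)
    moreover have "(c \<otimes>\<^bsub>A\<^esub> a) \<otimes>\<^bsub>A\<^esub> iA c = a" "(h \<otimes>\<^bsub>G\<^esub> oG) \<otimes>\<^bsub>G\<^esub> iG h = oG"
      using cc coversD(2,4)[OF W 2] by (simp_all add: A.m_assoc A.m_comm[of c] A.l_inv G.r_inv)
    ultimately show ?thesis by (simp add: lker_def)
  qed
qed (use coversD(7)[OF W] in \<open>simp add: lker_def\<close>)

lemma rker_norm: "covers W \<Longrightarrow> stable (rker W)"
  using lker_norm[OF opp_covers] lker_opp by simp

lemma A_free_lker: "A_free W \<longleftrightarrow> (\<forall>a. (a, oG) \<in> lker W \<longrightarrow> a = oA)"
  by (simp add: A_free_def lker_def)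

lemma A_free_rker: "covers W \<Longrightarrow> A_free W \<longleftrightarrow> (\<forall>a. (a, oG) \<in> rker W \<longrightarrow> a = oA)"
proof
  assume W: "covers W"
  show "\<forall>a. (a, oG) \<in> rker W \<longrightarrow> a = oA" if "A_free W"
    using that by (auto simp: A_free_def rker_def)
  show "A_free W" if *: "\<forall>a. (a, oG) \<in> rker W \<longrightarrow> a = oA"
    unfolding A_free_def
  proof (intro allI impI)
    fix a assume a: "(a, oG, oG) \<in> W"
    then have "(iA a, oG) \<in> rker W" using coversD(2)[OF W a] by (simp add: rker_def)
    then show "a = oA" using * coversD(2)[OF W a] by (metis A.inv_inv A.inv_one)
  qed
qed

lemma A_free_opp: "covers W \<Longrightarrow> A_free W \<Longrightarrow> A_free (opp W)"
  using A_free_lker[of "opp W"] A_free_rker[of W] lker_opp[of W] by simp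

lemma diag_covers: assumes N: "stable N" shows "covers (diag N)"
proof (rule coversI)
  fix a g h assume "(a, g, h) \<in> diag N"
  then have 1: "g \<in> carrier G" "h \<in> carrier G" "(a, g \<otimes>\<^bsub>G\<^esub> iG h) \<in> N" by (auto simp: diag_def)
  show "a \<in> carrier A \<and> g \<in> carrier G \<and> h \<in> carrier G" using 1 stableD(2)[OF N 1(3)] by simp
  have "(iA a, iG g \<otimes>\<^bsub>G\<^esub> iG (g \<otimes>\<^bsub>G\<^esub> iG h) \<otimes>\<^bsub>G\<^esub> g) \<in> N"
    by (intro stableD(8)[OF N] stableD(5)[OF N] 1)
  moreover have "iG g \<otimes>\<^bsub>G\<^esub> iG (g \<otimes>\<^bsub>G\<^esub> iG h) \<otimes>\<^bsub>G\<^esub> g = iG g \<otimes>\<^bsub>G\<^esub> iG (iG h)"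
    using 1 by (simp add: G.inv_mult_group G.m_assoc G.l_inv)
  ultimately show "(iA a, iG g, iG h) \<in> diag N" using 1 by (simp add: diag_def)
  fix a' g' h' assume "(a', g', h') \<in> diag N"
  then have 2: "g' \<in> carrier G" "h' \<in> carrier G" "(a', g' \<otimes>\<^bsub>G\<^esub> iG h') \<in> N" by (auto simp: diag_def)
  have "(a \<otimes>\<^bsub>A\<^esub> a', (g \<otimes>\<^bsub>G\<^esub> iG h) \<otimes>\<^bsub>G\<^esub> (h \<otimes>\<^bsub>G\<^esub> (g' \<otimes>\<^bsub>G\<^esub> iG h') \<otimes>\<^bsub>G\<^esub> iG h)) \<in> N"
    by (intro stableD(4)[OF N] stableD(7)[OF N] 1 2)
  moreover have "(g \<otimes>\<^bsub>G\<^esub> iG h) \<otimes>\<^bsub>G\<^esub> (h \<otimes>\<^bsub>G\<^esub> (g' \<otimes>\<^bsub>G\<^esub> iG h') \<otimes>\<^bsub>G\<^esub> iG h) = (g \<otimes>\<^bsub>G\<^esub> g') \<otimes>\<^bsub>G\<^esub> iG (h \<otimes>\<^bsub>G\<^esub> h')"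
    using 1 2 by (simp add: G.inv_mult_group G.m_assoc)
  ultimately show "(a \<otimes>\<^bsub>A\<^esub> a', g \<otimes>\<^bsub>G\<^esub> g', h \<otimes>\<^bsub>G\<^esub> h') \<in> diag N" using 1 2 by (simp add: diag_def)
next
  fix g assume "g \<in> carrier G"
  then have "(oA, g, g) \<in> diag N" using stableD(6)[OF N] by (simp add: diag_def G.r_inv)
  then show "\<exists>a h. (a, g, h) \<in> diag N" "\<exists>a h. (a, h, g) \<in> diag N" by blast+
qed

lemma lker_diag: assumes N: "stable N" shows "lker (diag N) = N"
  using stableD(3)[OF N] by (auto simp: lker_def diag_def)

lemma rker_diag: assumes N: "stable N" shows "rker (diag N) = N"
proof -
  have "a \<in> carrier A \<and> h \<in> carrier G \<and> (iA a, oG \<otimes>\<^bsub>G\<^esub> iG h) \<in> N \<longleftrightarrow> (a, h) \<in> N" for a h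
    using stableD(2,3)[OF N, of a h] stableD(5)[OF N, of a h] stableD(5)[OF N, of "iA a" "iG h"] by auto
  then show ?thesis by (auto simp: rker_def diag_def)
qed

lemma opp_opp: assumes W: "covers W" shows "opp (opp W) = W"
  using coversD(2)[OF W] by (auto simp: opp_def)

lemma opp_rel_comp:
  assumes W: "covers W" and W': "covers W'" shows "opp (rel_comp W W') = rel_comp (opp W') (opp W)"
proof (intro subset_antisym triple_subsetI)
  fix c g i assume "(c, g, i) \<in> opp (rel_comp W W')"
  then have c: "c \<in> carrier A" "(iA c, i, g) \<in> rel_comp W W'" by (auto simp: opp_def)
  then obtain a b h where 1: "(a, i, h) \<in> W" "(b, h, g) \<in> W'" "iA c = a \<otimes>\<^bsub>A\<^esub> b" by (elim rel_compE)
  note cc = coversD(2)[OF W 1(1)] coversD(2)[OF W' 1(2)]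
  have "c = iA b \<otimes>\<^bsub>A\<^esub> iA a" using 1(3) c cc by (metis A.inv_inv A.inv_mult A.m_comm)
  then show "(c, g, i) \<in> rel_comp (opp W') (opp W)"
    using 1 cc by (intro rel_compI[where h = h and a = "iA b" and b = "iA a"]) (simp_all add: opp_def)
next
  fix c g i assume "(c, g, i) \<in> rel_comp (opp W') (opp W)"
  then obtain a b h where 1: "(a, g, h) \<in> opp W'" "(b, h, i) \<in> opp W" "c = a \<otimes>\<^bsub>A\<^esub> b" by (rule rel_compE)
  then have 2: "a \<in> carrier A" "b \<in> carrier A" "(iA a, h, g) \<in> W'" "(iA b, i, h) \<in> W" by (auto simp: opp_def)
  have "(iA c, i, g) \<in> rel_comp W W'"
    using 2 1(3) by (intro rel_compI[OF 2(4,3)]) (simp add: A.inv_mult A.m_comm)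
  then show "(c, g, i) \<in> opp (rel_comp W W')" using 2 1(3) by (simp add: opp_def)
qed

lemma diag_comp_mem:
  assumes N: "stable N" and W: "covers W"
  shows "(c, g, i) \<in> rel_comp (diag N) W \<longleftrightarrow> (\<exists>a x b g'. (a, x) \<in> N \<and> (b, g', i) \<in> W \<and> c = a \<otimes>\<^bsub>A\<^esub> b \<and> g = x \<otimes>\<^bsub>G\<^esub> g')"
proof
  assume "(c, g, i) \<in> rel_comp (diag N) W"
  then obtain a b h where 1: "(a, g, h) \<in> diag N" "(b, h, i) \<in> W" "c = a \<otimes>\<^bsub>A\<^esub> b" by (rule rel_compE)
  then have "(a, g \<otimes>\<^bsub>G\<^esub> iG h) \<in> N" "g = (g \<otimes>\<^bsub>G\<^esub> iG h) \<otimes>\<^bsub>G\<^esub> h"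
    by (auto simp: diag_def G.m_assoc G.l_inv)
  then show "\<exists>a x b g'. (a, x) \<in> N \<and> (b, g', i) \<in> W \<and> c = a \<otimes>\<^bsub>A\<^esub> b \<and> g = x \<otimes>\<^bsub>G\<^esub> g'" using 1 by blast
next
  assume "\<exists>a x b g'. (a, x) \<in> N \<and> (b, g', i) \<in> W \<and> c = a \<otimes>\<^bsub>A\<^esub> b \<and> g = x \<otimes>\<^bsub>G\<^esub> g'"
  then obtain a x b g' where 1: "(a, x) \<in> N" "(b, g', i) \<in> W" "c = a \<otimes>\<^bsub>A\<^esub> b" "g = x \<otimes>\<^bsub>G\<^esub> g'" by blast
  have "(a, g, g') \<in> diag N"
    using 1 stableD(3)[OF N 1(1)] coversD(3)[OF W 1(2)] by (simp add: diag_def G.m_assoc G.r_inv)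
  then show "(c, g, i) \<in> rel_comp (diag N) W" using 1(2,3) by (rule rel_compI)
qed

lemma diag_lker_comp: assumes W: "covers W" shows "rel_comp (diag (lker W)) W = W"
proof (intro subset_antisym triple_subsetI)
  fix c g i assume "(c, g, i) \<in> rel_comp (diag (lker W)) W"
  then obtain a x b g' where "(a, x, oG) \<in> W" "(b, g', i) \<in> W" "c = a \<otimes>\<^bsub>A\<^esub> b" "g = x \<otimes>\<^bsub>G\<^esub> g'"
    unfolding diag_comp_mem[OF lker_norm[OF W] W] by (auto simp: lker_def)
  then show "(c, g, i) \<in> W" using coversD(5)[OF W, of a x oG b g' i] coversD(4)[OF W] by simp
next
  fix c g i assume "(c, g, i) \<in> W"
  moreover have "(oA, oG) \<in> lker W" by (rule stableD(6)[OF lker_norm[OF W]])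
  ultimately show "(c, g, i) \<in> rel_comp (diag (lker W)) W"
    unfolding diag_comp_mem[OF lker_norm[OF W] W] using coversD(2,3)[OF W]
    by (intro exI[of _ oA] exI[of _ oG] exI[of _ c] exI[of _ g]) auto
qed

lemma opp_diag: assumes N: "stable N" shows "opp (diag N) = diag N"
proof -
  have "a \<in> carrier A \<and> (iA a, h \<otimes>\<^bsub>G\<^esub> iG g) \<in> N \<longleftrightarrow> (a, g \<otimes>\<^bsub>G\<^esub> iG h) \<in> N" if "g \<in> carrier G" "h \<in> carrier G" for a g h
    using stableD(5)[OF N, of "iA a" "h \<otimes>\<^bsub>G\<^esub> iG g"] stableD(5)[OF N, of a "g \<otimes>\<^bsub>G\<^esub> iG h"]
      stableD(2)[OF N, of a "g \<otimes>\<^bsub>G\<^esub> iG h"] that by (auto simp: G.inv_mult_group)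
  then show ?thesis by (auto simp: opp_def diag_def)
qed

lemma comp_diag_rker: assumes W: "covers W" shows "rel_comp W (diag (rker W)) = W"
proof -
  have "opp (rel_comp (diag (lker (opp W))) (opp W)) = opp (opp W)" using diag_lker_comp[OF opp_covers[OF W]] by simp
  then show ?thesis
    using opp_rel_comp[OF diag_covers[OF rker_norm[OF W]] opp_covers[OF W]] opp_diag[OF rker_norm[OF W]] opp_opp[OF W]
    by (simp add: lker_opp[OF W])
qed

lemma comp_opp: assumes W: "covers W" shows "rel_comp W (opp W) = diag (lker W)"
proof (intro subset_antisym triple_subsetI)
  fix c g i assume "(c, g, i) \<in> rel_comp W (opp W)"
  then obtain a b h where 1: "(a, g, h) \<in> W" "(b, h, i) \<in> opp W" "c = a \<otimes>\<^bsub>A\<^esub> b" by (rule rel_compE)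
  then have 2: "b \<in> carrier A" "(iA b, i, h) \<in> W" by (auto simp: opp_def)
  have "(a \<otimes>\<^bsub>A\<^esub> iA (iA b), g \<otimes>\<^bsub>G\<^esub> iG i, h \<otimes>\<^bsub>G\<^esub> iG h) \<in> W" by (intro coversD(5)[OF W] coversD(6)[OF W] 1 2)
  then have "(c, g \<otimes>\<^bsub>G\<^esub> iG i, oG) \<in> W" using 1 2 coversD(4)[OF W 1(1)] by (simp add: G.r_inv)
  then show "(c, g, i) \<in> diag (lker W)" using coversD(3)[OF W] 1 2 by (auto simp: diag_def lker_def)
next
  fix c g i assume "(c, g, i) \<in> diag (lker W)"
  then have 1: "g \<in> carrier G" "i \<in> carrier G" "(c, g \<otimes>\<^bsub>G\<^esub> iG i, oG) \<in> W" by (auto simp: diag_def lker_def)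
  obtain b h where 2: "(b, i, h) \<in> W" using coversD(8)[OF W 1(2)] by blast
  note cc = coversD(2,4)[OF W 2] coversD(2)[OF W 1(3)]
  have "(c \<otimes>\<^bsub>A\<^esub> b, (g \<otimes>\<^bsub>G\<^esub> iG i) \<otimes>\<^bsub>G\<^esub> i, oG \<otimes>\<^bsub>G\<^esub> h) \<in> W" by (intro coversD(5)[OF W] 1 2)
  then have "(c \<otimes>\<^bsub>A\<^esub> b, g, h) \<in> W" using 1 cc by (simp add: G.m_assoc G.l_inv)
  moreover have "(iA b, h, i) \<in> opp W" using 2 cc by (simp add: opp_def)
  moreover have "c = (c \<otimes>\<^bsub>A\<^esub> b) \<otimes>\<^bsub>A\<^esub> iA b" using cc by (simp add: A.m_assoc A.r_inv)
  ultimately show "(c, g, i) \<in> rel_comp W (opp W)" by (rule rel_compI)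
qed

lemma opp_comp: assumes W: "covers W" shows "rel_comp (opp W) W = diag (rker W)"
  using comp_opp[OF opp_covers[OF W]] opp_opp[OF W] lker_opp[OF W] by simp

lemma lker_comp_mono:
  assumes W: "covers W" and W': "covers W'" shows "lker W \<subseteq> lker (rel_comp W W')"
proof clarify
  fix a g assume "(a, g) \<in> lker W"
  then have "(a, g, oG) \<in> W" by (simp add: lker_def)
  then have "(a, g, oG) \<in> rel_comp W W'" using coversD(7)[OF W'] coversD(2)[OF W] by (intro rel_compI) auto
  then show "(a, g) \<in> lker (rel_comp W W')" by (simp add: lker_def)
qed

lemma lker_comp_eq:
  assumes W: "covers W" and W': "covers W'" and eq: "rker W = lker W'" shows "lker (rel_comp W W') = lker W"
proof (intro subset_antisym lker_comp_mono[OF W W'])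
  show "lker (rel_comp W W') \<subseteq> lker W"
  proof clarify
    fix c g assume "(c, g) \<in> lker (rel_comp W W')"
    then have "(c, g, oG) \<in> rel_comp W W'" by (simp add: lker_def)
    then obtain a b h where 1: "(a, g, h) \<in> W" "(b, h, oG) \<in> W'" "c = a \<otimes>\<^bsub>A\<^esub> b" by (rule rel_compE)
    then have "(b, h) \<in> rker W" unfolding eq by (simp add: lker_def)
    then have 2: "b \<in> carrier A" "(iA b, oG, h) \<in> W" by (auto simp: rker_def)
    have "(a \<otimes>\<^bsub>A\<^esub> iA (iA b), g \<otimes>\<^bsub>G\<^esub> iG oG, h \<otimes>\<^bsub>G\<^esub> iG h) \<in> W" by (intro coversD(5)[OF W] coversD(6)[OF W] 1 2)
    then show "(c, g) \<in> lker W" using 1 2 coversD(3,4)[OF W 1(1)] by (simp add: lker_def G.r_inv)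
  qed
qed

lemma rker_comp_eq:
  assumes W: "covers W" and W': "covers W'" and eq: "rker W = lker W'" shows "rker (rel_comp W W') = rker W'"
  using lker_comp_eq[OF opp_covers[OF W'] opp_covers[OF W]] opp_rel_comp[OF W W']
    lker_opp[OF rel_comp_covers[OF W W']] lker_opp[OF W'] lker_opp[OF W] rker_opp[OF W'] eq by simp

lemma lker_act:
  assumes W: "covers W" and N: "stable N" and sub: "lker W \<subseteq> N" shows "lker (rel_comp (diag N) W) = N"
proof (intro subset_antisym)
  show "N \<subseteq> lker (rel_comp (diag N) W)" using lker_comp_mono[OF diag_covers[OF N] W] lker_diag[OF N] by simp
  show "lker (rel_comp (diag N) W) \<subseteq> N"
  proof clarify
    fix c g assume "(c, g) \<in> lker (rel_comp (diag N) W)"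
    then obtain a x b g' where 1: "(a, x) \<in> N" "(b, g', oG) \<in> W" "c = a \<otimes>\<^bsub>A\<^esub> b" "g = x \<otimes>\<^bsub>G\<^esub> g'"
      by (auto simp: lker_def diag_comp_mem[OF N W])
    then have "(b, g') \<in> N" using sub by (auto simp: lker_def)
    then show "(c, g) \<in> N" unfolding 1(3,4) by (rule stableD(4)[OF N 1(1)])
  qed
qed

lemma diag_comp_diag:
  assumes N: "stable N" and N': "stable N'" and sub: "N \<subseteq> N'" shows "rel_comp (diag N') (diag N) = diag N'"
proof (intro subset_antisym triple_subsetI)
  fix c g i assume "(c, g, i) \<in> rel_comp (diag N') (diag N)"
  then obtain a b h where "(a, g, h) \<in> diag N'" "(b, h, i) \<in> diag N" "c = a \<otimes>\<^bsub>A\<^esub> b" by (rule rel_compE)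
  then have 1: "g \<in> carrier G" "h \<in> carrier G" "i \<in> carrier G" "(a, g \<otimes>\<^bsub>G\<^esub> iG h) \<in> N'" "(b, h \<otimes>\<^bsub>G\<^esub> iG i) \<in> N'"
    "c = a \<otimes>\<^bsub>A\<^esub> b" using sub by (auto simp: diag_def)
  have "(c, (g \<otimes>\<^bsub>G\<^esub> iG h) \<otimes>\<^bsub>G\<^esub> (h \<otimes>\<^bsub>G\<^esub> iG i)) \<in> N'" unfolding 1(6) by (rule stableD(4)[OF N' 1(4,5)])
  then show "(c, g, i) \<in> diag N'" using 1 by (simp add: diag_def G.m_assoc)
next
  fix c g i assume 1: "(c, g, i) \<in> diag N'"
  then have 2: "i \<in> carrier G" "c \<in> carrier A" using stableD(2)[OF N'] by (auto simp: diag_def)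
  then have "(oA, i, i) \<in> diag N" using stableD(6)[OF N] by (simp add: diag_def G.r_inv)
  then show "(c, g, i) \<in> rel_comp (diag N') (diag N)" using 1 2 by (intro rel_compI) auto
qed

text \<open>
  Both sides say that every \<open>(b, h, 1)\<close> in \<open>W'\<close> is matched by an \<open>(a, g, h)\<close> in \<open>W\<close> with
  \<open>(a b, g)\<close> in \<open>N\<close>. Two choices of \<open>(a, g)\<close> differ by an element of the left kernel of \<open>W\<close>,
  which lies in \<open>N\<close>, so that one match is as good as all of them.
\<close>

lemma lker_le_rker_act:
  assumes W: "covers W" and W': "covers W'" and N: "stable N" and sub: "lker W \<subseteq> N"
  shows "lker W' \<subseteq> rker (rel_comp (diag N) W) \<longleftrightarrow> lker (rel_comp W W') \<subseteq> N"
proof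
  assume *: "lker W' \<subseteq> rker (rel_comp (diag N) W)"
  show "lker (rel_comp W W') \<subseteq> N"
  proof clarify
    fix c g assume "(c, g) \<in> lker (rel_comp W W')"
    then have "(c, g, oG) \<in> rel_comp W W'" by (simp add: lker_def)
    then obtain a b h where 1: "(a, g, h) \<in> W" "(b, h, oG) \<in> W'" "c = a \<otimes>\<^bsub>A\<^esub> b" by (rule rel_compE)
    then have "(b, h) \<in> rker (rel_comp (diag N) W)" using * by (auto simp: lker_def)
    then have "b \<in> carrier A" "(iA b, oG, h) \<in> rel_comp (diag N) W" by (auto simp: rker_def)
    then obtain a' x b' g' where 2: "b \<in> carrier A" "(a', x) \<in> N" "(b', g', h) \<in> W" "iA b = a' \<otimes>\<^bsub>A\<^esub> b'" "oG = x \<otimes>\<^bsub>G\<^esub> g'"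
      unfolding diag_comp_mem[OF N W] by blast
    note cc = stableD(2,3)[OF N 2(2)] coversD(2-4)[OF W 2(3)] coversD(2-4)[OF W 1(1)]
    have "(a \<otimes>\<^bsub>A\<^esub> iA b', g \<otimes>\<^bsub>G\<^esub> iG g', h \<otimes>\<^bsub>G\<^esub> iG h) \<in> W" by (intro coversD(5)[OF W] coversD(6)[OF W] 1 2)
    then have "(a \<otimes>\<^bsub>A\<^esub> iA b', g \<otimes>\<^bsub>G\<^esub> iG g') \<in> N" using sub cc by (auto simp: lker_def G.r_inv)
    from stableD(4)[OF N this stableD(5)[OF N 2(2)]]
    have "((a \<otimes>\<^bsub>A\<^esub> iA b') \<otimes>\<^bsub>A\<^esub> iA a', (g \<otimes>\<^bsub>G\<^esub> iG g') \<otimes>\<^bsub>G\<^esub> iG x) \<in> N" .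
    moreover have "(a \<otimes>\<^bsub>A\<^esub> iA b') \<otimes>\<^bsub>A\<^esub> iA a' = c"
    proof -
      have "b = iA (a' \<otimes>\<^bsub>A\<^esub> b')" using 2(1,4) by (metis A.inv_inv)
      then show ?thesis using cc 1(3) by (simp add: A.inv_mult A.m_assoc A.m_comm[of "iA a'"])
    qed
    moreover have "(g \<otimes>\<^bsub>G\<^esub> iG g') \<otimes>\<^bsub>G\<^esub> iG x = g"
    proof -
      have "iG g' \<otimes>\<^bsub>G\<^esub> iG x = iG (x \<otimes>\<^bsub>G\<^esub> g')" using cc by (simp add: G.inv_mult_group)
      then show ?thesis using cc by (simp add: G.m_assoc 2(5)[symmetric])
    qed
    ultimately show "(c, g) \<in> N" by simp
  qed
next
  assume *: "lker (rel_comp W W') \<subseteq> N"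
  show "lker W' \<subseteq> rker (rel_comp (diag N) W)"
  proof clarify
    fix b h assume "(b, h) \<in> lker W'"
    then have 1: "(b, h, oG) \<in> W'" by (simp add: lker_def)
    obtain a g where 2: "(a, g, h) \<in> W" using coversD(9)[OF W coversD(3)[OF W' 1]] by blast
    have "(a \<otimes>\<^bsub>A\<^esub> b, g, oG) \<in> rel_comp W W'" using 2 1 by (rule rel_compI) simp
    then have "(a \<otimes>\<^bsub>A\<^esub> b, g) \<in> N" using * by (auto simp: lker_def)
    from stableD(5)[OF N this] have n: "(iA (a \<otimes>\<^bsub>A\<^esub> b), iG g) \<in> N" .
    note cc = coversD(2-4)[OF W 2] coversD(2-4)[OF W' 1]
    have "(iA b, oG, h) \<in> rel_comp (diag N) W"
      unfolding diag_comp_mem[OF N W]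
      using n 2 cc by (intro exI[of _ "iA (a \<otimes>\<^bsub>A\<^esub> b)"] exI[of _ "iG g"] exI[of _ a] exI[of _ g])
        (simp add: A.inv_mult_group A.m_assoc A.l_inv G.l_inv)
    then show "(b, h) \<in> rker (rel_comp (diag N) W)" using cc by (simp add: rker_def)
  qed
qed

lemma not_A_free_comp_left: "covers W \<Longrightarrow> covers W' \<Longrightarrow> \<not> A_free W \<Longrightarrow> \<not> A_free (rel_comp W W')"
  using lker_comp_mono[of W W'] unfolding A_free_lker by blast

lemma not_A_free_comp_right:
  assumes W: "covers W" and W': "covers W'" and ng: "\<not> A_free W'" shows "\<not> A_free (rel_comp W W')"
proof -
  obtain a where "(a, oG, oG) \<in> W'" "a \<noteq> oA" using ng by (auto simp: A_free_def)
  then have "(a, oG, oG) \<in> rel_comp W W'" "a \<noteq> oA"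
    using coversD(7)[OF W] coversD(2)[OF W'] by (auto intro!: rel_compI)
  then show ?thesis by (auto simp: A_free_def)
qed

end

section \<open>The classes of covering transitive bisets\<close>

context fb_context
begin

sublocale PG: pair_context A G ..

lemma PT_context: "pair_context A (G \<times>\<times> G)"
  by (intro pair_context.intro A.comm_group_axioms DirProd_group G.group_axioms)

sublocale PT: pair_context A "G \<times>\<times> G" by (rule PT_context)

lemma trans_fb_eq: "trans_fb A G G u = cosets_fb (graph A u)"
  by (cases u) (simp add: trans_fb_def cosets_fb_def graph_def T_def Let_def)

lemma graph_T: "u \<in> pairs A (G \<times>\<times> G) \<Longrightarrow> subgroup (graph A u) T"
  using PT.graph_subgroup[of u] by (simp add: T_def)

definition covering_pairs where
  "covering_pairs = {u \<in> pairs A (G \<times>\<times> G). fst ` fst u = carrier G \<and> snd ` fst u = carrier G}"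

lemma covering_pairs_covers:
  assumes u: "u \<in> covering_pairs" shows "covers (graph A u)" and "A_free (graph A u)"
proof -
  have p: "u \<in> pairs A (G \<times>\<times> G)" and im: "fst ` fst u = carrier G" "snd ` fst u = carrier G"
    using u by (auto simp: covering_pairs_def)
  have "\<exists>a h. (a, g, h) \<in> graph A u" if g: "g \<in> carrier G" for g
  proof -
    have "g \<in> fst ` fst u" using im(1) g by simp
    then obtain h where "(g, h) \<in> fst u" by force
    then have "(iA (snd u (g, h)), g, h) \<in> graph A u" by (auto simp: graph_def)
    then show ?thesis by blast
  qed
  moreover have "\<exists>a g. (a, g, h) \<in> graph A u" if h: "h \<in> carrier G" for h
  proof -
    have "h \<in> snd ` fst u" using im(2) h by simp
    then obtain g where "(g, h) \<in> fst u" by force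
    then have "(iA (snd u (g, h)), g, h) \<in> graph A u" by (auto simp: graph_def)
    then show ?thesis by blast
  qed
  ultimately show "covers (graph A u)" using graph_T[OF p] by (simp add: covers_def)
  show "A_free (graph A u)"
    unfolding A_free_def
  proof (intro allI impI)
    fix a assume "(a, oG, oG) \<in> graph A u"
    then have "a \<in> carrier A" "iA a = oA" using PT.mem_graph[OF p, of a "(oG, oG)"] PT.pairD(6)[OF p] by auto
    then show "a = oA" by (metis A.inv_inv A.inv_one)
  qed
qed

lemma covers_covering_pairs:
  assumes W: "covers W" "A_free W" shows "\<exists>u\<in>covering_pairs. graph A u = W"
proof -
  have "subgroup W (A \<times>\<times> (G \<times>\<times> G))" using coversD(1)[OF W(1)] by (simp add: T_def)
  moreover have "a = oA" if "(a, \<one>\<^bsub>G \<times>\<times> G\<^esub>) \<in> W" for a using that W(2) by (simp add: A_free_def)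
  ultimately obtain u where u: "u \<in> pairs A (G \<times>\<times> G)" "graph A u = W" using PT.graph_surj by blast
  have U: "(g, h) \<in> fst u \<longleftrightarrow> (\<exists>a. (a, g, h) \<in> W)" for g h
    using u(2) unfolding graph_def by force
  have "fst ` fst u = carrier G"
  proof (intro subset_antisym subsetI)
    fix g assume "g \<in> fst ` fst u"
    then obtain h where "(g, h) \<in> fst u" by auto
    then show "g \<in> carrier G" using U coversD(3)[OF W(1)] by blast
  next
    fix g assume "g \<in> carrier G"
    then obtain a h where "(a, g, h) \<in> W" using coversD(8)[OF W(1)] by blast
    then have "(g, h) \<in> fst u" using U by blast
    then show "g \<in> fst ` fst u" by force
  qed
  moreover have "snd ` fst u = carrier G"
  proof (intro subset_antisym subsetI)
    fix h assume "h \<in> snd ` fst u"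
    then obtain g where "(g, h) \<in> fst u" by auto
    then show "h \<in> carrier G" using U coversD(4)[OF W(1)] by blast
  next
    fix h assume "h \<in> carrier G"
    then obtain a g where "(a, g, h) \<in> W" using coversD(9)[OF W(1)] by blast
    then have "(g, h) \<in> fst u" using U by blast
    then show "h \<in> snd ` fst u" by force
  qed
  ultimately show ?thesis using u unfolding covering_pairs_def by blast
qed

subsection \<open>Kernels and fixed pairs\<close>

abbreviation P where "P \<equiv> fixed_pairs A G"

lemma P_pairs: "p \<in> P \<Longrightarrow> p \<in> pairs A G" by (auto simp: fixed_pairs_def)

lemma P_graph:
  assumes p: "p \<in> P" shows "stable (graph A p)" and "(a, oG) \<in> graph A p \<Longrightarrow> a = oA"
proof -
  note pp = P_pairs[OF p]
  obtain K \<kappa> where K: "p = (K, \<kappa>)" by (cases p)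
  have nK: "K \<lhd> G" and inv: "\<And>g x. g \<in> carrier G \<Longrightarrow> x \<in> K \<Longrightarrow> \<kappa> (g \<otimes>\<^bsub>G\<^esub> x \<otimes>\<^bsub>G\<^esub> iG g) = \<kappa> x"
    using p by (auto simp: K fixed_pairs_def)
  interpret K: normal K G by (rule nK)
  have "(a, x \<otimes>\<^bsub>G\<^esub> g \<otimes>\<^bsub>G\<^esub> iG x) \<in> graph A p" if "(a, g) \<in> graph A p" "x \<in> carrier G" for a g x
    using that K.inv_op_closed2[of x g] inv[of x g] by (simp add: PG.mem_graph[OF pp, unfolded K] K)
  then show "stable (graph A p)" using PG.graph_subgroup[OF pp] by (simp add: stable_def)
  show "a = oA" if "(a, oG) \<in> graph A p"
  proof -
    have "a \<in> carrier A" "iA a = oA" using that PG.mem_graph[OF pp, of a oG] PG.pairD(6)[OF pp] by auto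
    then show ?thesis by (metis A.inv_inv A.inv_one)
  qed
qed

lemma stable_P:
  assumes N: "stable N" and triv: "\<And>a. (a, oG) \<in> N \<Longrightarrow> a = oA"
  shows "\<exists>p\<in>P. graph A p = N"
proof -
  obtain p where pp: "p \<in> pairs A G" and gp: "graph A p = N" using PG.graph_surj[OF stableD(1)[OF N] triv] by blast
  obtain K \<kappa> where K: "p = (K, \<kappa>)" by (cases p)
  have sub: "subgroup K G" using PG.pairD(1)[OF pp] by (simp add: K)
  have conj: "x \<otimes>\<^bsub>G\<^esub> g \<otimes>\<^bsub>G\<^esub> iG x \<in> K \<and> \<kappa> (x \<otimes>\<^bsub>G\<^esub> g \<otimes>\<^bsub>G\<^esub> iG x) = \<kappa> g" if g: "g \<in> K" and x: "x \<in> carrier G" for g x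
  proof -
    have \<kappa>g: "\<kappa> g \<in> carrier A" using PG.pairD(3)[OF pp, of g] g by (simp add: K)
    have "(iA (\<kappa> g), g) \<in> N" using g gp by (auto simp: K graph_def)
    from stableD(7)[OF N this x] have "(iA (\<kappa> g), x \<otimes>\<^bsub>G\<^esub> g \<otimes>\<^bsub>G\<^esub> iG x) \<in> graph A p" by (simp add: gp)
    then show ?thesis using \<kappa>g by (simp add: PG.mem_graph[OF pp, unfolded K] K)
  qed
  have "K \<lhd> G" using sub conj by (auto simp: G.normal_inv_iff)
  then have "p \<in> P" using pp conj by (auto simp: fixed_pairs_def K)
  then show ?thesis using gp by blast
qed

lemma P_eq_iff: "p \<in> P \<Longrightarrow> q \<in> P \<Longrightarrow> graph A p = graph A q \<longleftrightarrow> p = q"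
  using PG.graph_eq_iff P_pairs by blast

lemma P_le_iff: "p \<in> P \<Longrightarrow> q \<in> P \<Longrightarrow> pair_le p q \<longleftrightarrow> graph A p \<subseteq> graph A q"
  using PG.graph_inj P_pairs by blast

lemma lker_P: "covers W \<Longrightarrow> A_free W \<Longrightarrow> \<exists>p\<in>P. graph A p = lker W"
  using stable_P[OF lker_norm] by (simp add: A_free_lker)

lemma rker_P: "covers W \<Longrightarrow> A_free W \<Longrightarrow> \<exists>p\<in>P. graph A p = rker W"
  using stable_P[OF rker_norm] by (simp add: A_free_rker)

lemma diag_A_free: "p \<in> P \<Longrightarrow> A_free (diag (graph A p))"
  using P_graph lker_diag by (auto simp: A_free_lker)

lemma Delta_graph:
  assumes p: "p \<in> P" shows "graph A (Delta_pair G p) = diag (graph A p)"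
proof -
  note pp = P_pairs[OF p]
  obtain K \<kappa> where K: "p = (K, \<kappa>)" by (cases p)
  have sub: "subgroup K G" using PG.pairD(1)[OF pp] by (simp add: K)
  have nK: "K \<lhd> G" using p by (auto simp: K fixed_pairs_def)
  have coset: "g <#\<^bsub>G\<^esub> K = h <#\<^bsub>G\<^esub> K \<longleftrightarrow> g \<otimes>\<^bsub>G\<^esub> iG h \<in> K" if "g \<in> carrier G" "h \<in> carrier G" for g h
  proof -
    have "g <#\<^bsub>G\<^esub> K = K #>\<^bsub>G\<^esub> g" "h <#\<^bsub>G\<^esub> K = K #>\<^bsub>G\<^esub> h"
      using normal.coset_eq[OF nK] that by auto
    moreover have "K #>\<^bsub>G\<^esub> g = K #>\<^bsub>G\<^esub> h \<longleftrightarrow> g \<otimes>\<^bsub>G\<^esub> iG h \<in> K"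
    proof
      assume "K #>\<^bsub>G\<^esub> g = K #>\<^bsub>G\<^esub> h"
      then have "g \<in> K #>\<^bsub>G\<^esub> h" using subgroup.rcos_module_imp G.rcos_self[OF that(1) sub] by simp
      then show "g \<otimes>\<^bsub>G\<^esub> iG h \<in> K" using subgroup.rcos_module_imp[OF sub G.group_axioms that(2)] by simp
    next
      assume "g \<otimes>\<^bsub>G\<^esub> iG h \<in> K"
      then have "g \<in> K #>\<^bsub>G\<^esub> h" using subgroup.rcos_module_rev[OF sub G.group_axioms that(2,1)] by simp
      then show "K #>\<^bsub>G\<^esub> g = K #>\<^bsub>G\<^esub> h" using G.repr_independence[OF _ that(2) sub] by simp
    qed
    ultimately show ?thesis by simp
  qed
  have Kc: "x \<in> carrier G" "\<kappa> x \<in> carrier A" if "x \<in> K" for x using that PG.pairD(2,3)[OF pp, of x] by (auto simp: K)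
  have "(a, g, h) \<in> graph A (Delta_pair G p) \<longleftrightarrow> (a, g, h) \<in> diag (graph A p)" for a g h
  proof -
    have "(a, g, h) \<in> graph A (Delta_pair G p) \<longleftrightarrow>
        g \<in> carrier G \<and> h \<in> carrier G \<and> g \<otimes>\<^bsub>G\<^esub> iG h \<in> K \<and> a = iA (\<kappa> (g \<otimes>\<^bsub>G\<^esub> iG h))"
      using coset by (auto simp: graph_def Delta_pair_def Let_def K image_iff)
    also have "\<dots> \<longleftrightarrow> (a, g, h) \<in> diag (graph A p)"
      by (auto simp: diag_def graph_def K image_iff)
    finally show ?thesis .
  qed
  then show ?thesis by auto
qed

lemma l_data_iff:
  assumes u: "u \<in> pairs A (G \<times>\<times> G)" and p: "p \<in> pairs A G"
  shows "l_data G u = (carrier G, p) \<longleftrightarrow> fst ` fst u = carrier G \<and> lker (graph A u) = graph A p"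
proof -
  obtain U \<phi> where U: "u = (U, \<phi>)" by (cases u)
  obtain K \<kappa> where K: "p = (K, \<kappa>)" by (cases p)
  have c: "\<phi> x \<in> carrier A" if "x \<in> U" for x using PT.pairD(3)[OF u, of x] that by (simp add: U)
  have ext: "\<kappa> \<in> extensional K" using PG.pairD(5)[OF p] by (simp add: K)
  have \<kappa>: "\<kappa> x \<in> carrier A" if "x \<in> K" for x using PG.pairD(3)[OF p, of x] that by (simp add: K)
  have lker: "(a, g) \<in> lker (graph A u) \<longleftrightarrow> (g, oG) \<in> U \<and> a = iA (\<phi> (g, oG))" for a g
    by (auto simp: lker_def graph_def U image_iff)
  have gr: "(a, g) \<in> graph A p \<longleftrightarrow> g \<in> K \<and> a = iA (\<kappa> g)" for a g by (auto simp: graph_def K image_iff)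
  have "(k1 G U, \<lambda>g\<in>k1 G U. \<phi> (g, oG)) = (K, \<kappa>) \<longleftrightarrow> lker (graph A u) = graph A p"
  proof
    assume "(k1 G U, \<lambda>g\<in>k1 G U. \<phi> (g, oG)) = (K, \<kappa>)"
    then have 1: "k1 G U = K" "(\<lambda>g\<in>K. \<phi> (g, oG)) = \<kappa>" by auto
    have "(a, g) \<in> lker (graph A u) \<longleftrightarrow> (a, g) \<in> graph A p" for a g
      unfolding lker gr 1(2)[symmetric] using 1(1) by (auto simp: k1_def)
    then show "lker (graph A u) = graph A p" by auto
  next
    assume eq: "lker (graph A u) = graph A p"
    have 1: "k1 G U = K"
    proof (intro subset_antisym subsetI)
      show "g \<in> K" if "g \<in> k1 G U" for g
        using that lker[of "iA (\<phi> (g, oG))" g] gr[of "iA (\<phi> (g, oG))" g] eq by (simp add: k1_def)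
      show "g \<in> k1 G U" if "g \<in> K" for g
        using that lker[of "iA (\<kappa> g)" g] gr[of "iA (\<kappa> g)" g] eq by (simp add: k1_def)
    qed
    have "\<phi> (g, oG) = \<kappa> g" if g: "g \<in> K" for g
    proof -
      have gU: "(g, oG) \<in> U" using g 1 by (auto simp: k1_def)
      have "iA (\<phi> (g, oG)) = iA (\<kappa> g)" using lker[of "iA (\<kappa> g)" g] gr[of "iA (\<kappa> g)" g] eq g by simp
      then show ?thesis using c[OF gU] \<kappa>[OF g] by (metis A.inv_inv)
    qed
    then have "(\<lambda>g\<in>K. \<phi> (g, oG)) = \<kappa>" using ext by (intro extensionalityI[OF restrict_extensional]) auto
    then show "(k1 G U, \<lambda>g\<in>k1 G U. \<phi> (g, oG)) = (K, \<kappa>)" using 1 by simp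
  qed
  then show ?thesis by (auto simp: l_data_def U K)
qed

lemma r_data_iff:
  assumes u: "u \<in> pairs A (G \<times>\<times> G)" and p: "p \<in> pairs A G"
  shows "r_data A G u = (carrier G, p) \<longleftrightarrow> snd ` fst u = carrier G \<and> rker (graph A u) = graph A p"
proof -
  obtain U \<phi> where U: "u = (U, \<phi>)" by (cases u)
  obtain K \<kappa> where K: "p = (K, \<kappa>)" by (cases p)
  have c: "\<phi> x \<in> carrier A" if "x \<in> U" for x using PT.pairD(3)[OF u, of x] that by (simp add: U)
  have ext: "\<kappa> \<in> extensional K" using PG.pairD(5)[OF p] by (simp add: K)
  have \<kappa>: "\<kappa> x \<in> carrier A" if "x \<in> K" for x using PG.pairD(3)[OF p, of x] that by (simp add: K)
  have rker: "(a, g) \<in> rker (graph A u) \<longleftrightarrow> (oG, g) \<in> U \<and> a = \<phi> (oG, g)" for a g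
  proof -
    have "(a, g) \<in> rker (graph A u) \<longleftrightarrow> a \<in> carrier A \<and> (oG, g) \<in> U \<and> iA a = iA (\<phi> (oG, g))"
      by (auto simp: rker_def graph_def U image_iff)
    then show ?thesis using c[of "(oG, g)"] by (metis A.inv_inv)
  qed
  have gr: "(a, g) \<in> graph A p \<longleftrightarrow> g \<in> K \<and> a = iA (\<kappa> g)" for a g by (auto simp: graph_def K image_iff)
  have "(k2 G U, \<lambda>g\<in>k2 G U. iA (\<phi> (oG, g))) = (K, \<kappa>) \<longleftrightarrow> rker (graph A u) = graph A p"
  proof
    assume "(k2 G U, \<lambda>g\<in>k2 G U. iA (\<phi> (oG, g))) = (K, \<kappa>)"
    then have 1: "k2 G U = K" "(\<lambda>g\<in>K. iA (\<phi> (oG, g))) = \<kappa>" by auto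
    have "(a, g) \<in> rker (graph A u) \<longleftrightarrow> (a, g) \<in> graph A p" for a g
      unfolding rker gr 1(2)[symmetric] using 1(1) c by (auto simp: k2_def)
    then show "rker (graph A u) = graph A p" by auto
  next
    assume eq: "rker (graph A u) = graph A p"
    have 1: "k2 G U = K"
    proof (intro subset_antisym subsetI)
      show "g \<in> K" if "g \<in> k2 G U" for g
        using that rker[of "\<phi> (oG, g)" g] gr[of "\<phi> (oG, g)" g] eq by (simp add: k2_def)
      show "g \<in> k2 G U" if "g \<in> K" for g
        using that rker[of "iA (\<kappa> g)" g] gr[of "iA (\<kappa> g)" g] eq by (simp add: k2_def)
    qed
    have "iA (\<phi> (oG, g)) = \<kappa> g" if g: "g \<in> K" for g
    proof -
      have "\<phi> (oG, g) = iA (\<kappa> g)" using rker[of "iA (\<kappa> g)" g] gr[of "iA (\<kappa> g)" g] eq g by simp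
      then show ?thesis using \<kappa>[OF g] by simp
    qed
    then have "(\<lambda>g\<in>K. iA (\<phi> (oG, g))) = \<kappa>" using ext by (intro extensionalityI[OF restrict_extensional]) auto
    then show "(k2 G U, \<lambda>g\<in>k2 G U. iA (\<phi> (oG, g))) = (K, \<kappa>)" using 1 by simp
  qed
  then show ?thesis by (auto simp: r_data_def U K)
qed

subsection \<open>Finiteness\<close>

text \<open>
  Two subgroups covering \<open>G\<close> on both sides, with the same image in \<open>G \<times> G\<close> and the same right
  kernel, differ by a homomorphism from \<open>G\<close> to \<open>A\<close>, that is, by a fixed pair with first entry
  \<open>G\<close>. This bounds their number by the number of fixed pairs.
\<close>

definition ratio where
  "ratio W0 W = {(c \<otimes>\<^bsub>A\<^esub> iA b, g) | b c g h. (b, g, h) \<in> W0 \<and> (c, g, h) \<in> W}"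

lemma ratio_norm:
  assumes W0: "covers W0" and W: "covers W" "A_free W" and im: "snd ` W = snd ` W0" and rker: "rker W = rker W0"
  shows "stable (ratio W0 W)" and "(a, oG) \<in> ratio W0 W \<Longrightarrow> a = oA"
proof -
  have E: "\<exists>b c h. (b, g, h) \<in> W0 \<and> (c, g, h) \<in> W \<and> a = c \<otimes>\<^bsub>A\<^esub> iA b" if "(a, g) \<in> ratio W0 W" for a g
    using that by (auto simp: ratio_def)
  have I: "(c \<otimes>\<^bsub>A\<^esub> iA b, g) \<in> ratio W0 W" if "(b, g, h) \<in> W0" "(c, g, h) \<in> W" for b c g h
    using that by (auto simp: ratio_def)
  show "stable (ratio W0 W)"
  proof (rule stableI)
    fix a g assume "(a, g) \<in> ratio W0 W"
    then obtain b c h where 1: "(b, g, h) \<in> W0" "(c, g, h) \<in> W" "a = c \<otimes>\<^bsub>A\<^esub> iA b" using E by blast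
    note cc = coversD(2-4)[OF W0 1(1)] coversD(2)[OF W(1) 1(2)]
    show "a \<in> carrier A \<and> g \<in> carrier G" using 1(3) cc by simp
    have "(iA c \<otimes>\<^bsub>A\<^esub> iA (iA b), iG g) \<in> ratio W0 W"
      by (rule I[OF coversD(6)[OF W0 1(1)] coversD(6)[OF W(1) 1(2)]])
    then show "(iA a, iG g) \<in> ratio W0 W" using 1(3) cc by (simp add: A.inv_mult)
    show "(a \<otimes>\<^bsub>A\<^esub> a', g \<otimes>\<^bsub>G\<^esub> g') \<in> ratio W0 W" if r: "(a', g') \<in> ratio W0 W" for a' g'
    proof -
      obtain b' c' h' where 2: "(b', g', h') \<in> W0" "(c', g', h') \<in> W" "a' = c' \<otimes>\<^bsub>A\<^esub> iA b'" using E[OF r] by blast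
      note cc' = coversD(2)[OF W0 2(1)] coversD(2)[OF W(1) 2(2)]
      have "((c \<otimes>\<^bsub>A\<^esub> c') \<otimes>\<^bsub>A\<^esub> iA (b \<otimes>\<^bsub>A\<^esub> b'), g \<otimes>\<^bsub>G\<^esub> g') \<in> ratio W0 W"
        by (rule I[OF coversD(5)[OF W0 1(1) 2(1)] coversD(5)[OF W(1) 1(2) 2(2)]])
      moreover have "(c \<otimes>\<^bsub>A\<^esub> c') \<otimes>\<^bsub>A\<^esub> iA (b \<otimes>\<^bsub>A\<^esub> b') = a \<otimes>\<^bsub>A\<^esub> a'"
        unfolding 1(3) 2(3) using cc(1,4) cc' by (simp add: A.inv_mult A.m_ac)
      ultimately show ?thesis by simp
    qed
    show "(a, x \<otimes>\<^bsub>G\<^esub> g \<otimes>\<^bsub>G\<^esub> iG x) \<in> ratio W0 W" if x: "x \<in> carrier G" for x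
    proof -
      obtain d y where 2: "(d, x, y) \<in> W0" using coversD(8)[OF W0 x] by blast
      then have "(x, y) \<in> snd ` W" using im by force
      then obtain d' where 3: "(d', x, y) \<in> W" by force
      note cc' = coversD(2)[OF W0 2] coversD(2)[OF W(1) 3]
      have "(((d' \<otimes>\<^bsub>A\<^esub> c) \<otimes>\<^bsub>A\<^esub> iA d') \<otimes>\<^bsub>A\<^esub> iA ((d \<otimes>\<^bsub>A\<^esub> b) \<otimes>\<^bsub>A\<^esub> iA d), x \<otimes>\<^bsub>G\<^esub> g \<otimes>\<^bsub>G\<^esub> iG x) \<in> ratio W0 W"
        by (rule I[OF coversD(5)[OF W0 coversD(5)[OF W0 2 1(1)] coversD(6)[OF W0 2]]
              coversD(5)[OF W(1) coversD(5)[OF W(1) 3 1(2)] coversD(6)[OF W(1) 3]]])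
      moreover have "(d' \<otimes>\<^bsub>A\<^esub> c) \<otimes>\<^bsub>A\<^esub> iA d' = c" "(d \<otimes>\<^bsub>A\<^esub> b) \<otimes>\<^bsub>A\<^esub> iA d = b"
        using cc(1,4) cc' by (simp_all add: A.m_assoc A.m_comm[of d'] A.m_comm[of d] A.l_inv)
      ultimately show ?thesis by (simp add: 1(3))
    qed
  next
    show "(oA, oG) \<in> ratio W0 W" using I[OF coversD(7)[OF W0] coversD(7)[OF W(1)]] by simp
  qed
  show "a = oA" if r: "(a, oG) \<in> ratio W0 W"
  proof -
    obtain b c h where 1: "(b, oG, h) \<in> W0" "(c, oG, h) \<in> W" "a = c \<otimes>\<^bsub>A\<^esub> iA b" using E[OF r] by blast
    note cc = coversD(2)[OF W0 1(1)] coversD(2,4)[OF W(1) 1(2)]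
    have "(iA b, h) \<in> rker W" unfolding rker using 1 cc by (simp add: rker_def)
    then have "(b, oG, h) \<in> W" using cc by (simp add: rker_def)
    then have "(c \<otimes>\<^bsub>A\<^esub> iA b, oG \<otimes>\<^bsub>G\<^esub> iG oG, h \<otimes>\<^bsub>G\<^esub> iG h) \<in> W" by (intro coversD(5)[OF W(1)] coversD(6)[OF W(1)] 1)
    then show "a = oA" using W(2) cc 1(3) by (simp add: A_free_def G.r_inv)
  qed
qed

lemma ratio_inj:
  assumes W0: "covers W0" and W: "covers W" "A_free W" and W': "covers W'" "A_free W'"
    and im: "snd ` W = snd ` W0" "snd ` W' = snd ` W0" and rker: "rker W = rker W0" "rker W' = rker W0"
    and eq: "ratio W0 W = ratio W0 W'"
  shows "W \<subseteq> W'"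
proof (rule triple_subsetI)
  fix c g h assume c: "(c, g, h) \<in> W"
  have "(g, h) \<in> snd ` W0" using im(1)[symmetric] c by force
  then obtain b where b: "(b, g, h) \<in> W0" by force
  then have "(g, h) \<in> snd ` W'" using im(2) by force
  then obtain c' where c': "(c', g, h) \<in> W'" by force
  note cc = coversD(2,3)[OF W(1) c] coversD(2)[OF W0 b] coversD(2)[OF W'(1) c']
  note N = ratio_norm[OF W0 W' im(2) rker(2)]
  have "(c \<otimes>\<^bsub>A\<^esub> iA b, g) \<in> ratio W0 W'" unfolding eq[symmetric] unfolding ratio_def using b c by blast
  moreover have "(c' \<otimes>\<^bsub>A\<^esub> iA b, g) \<in> ratio W0 W'" unfolding ratio_def using b c' by blast
  ultimately have "((c \<otimes>\<^bsub>A\<^esub> iA b) \<otimes>\<^bsub>A\<^esub> iA (c' \<otimes>\<^bsub>A\<^esub> iA b), g \<otimes>\<^bsub>G\<^esub> iG g) \<in> ratio W0 W'"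
    by (rule stableD(4)[OF N(1) _ stableD(5)[OF N(1)]])
  then have 1: "(c \<otimes>\<^bsub>A\<^esub> iA b) \<otimes>\<^bsub>A\<^esub> iA (c' \<otimes>\<^bsub>A\<^esub> iA b) = oA" using N(2) cc by (simp add: G.r_inv)
  have "c \<otimes>\<^bsub>A\<^esub> iA b = c' \<otimes>\<^bsub>A\<^esub> iA b"
    using A.inv_equality[OF 1] cc by simp
  then have "c = c'" using cc by simp
  then show "(c, g, h) \<in> W'" using c' by simp
qed

lemma finite_covers:
  assumes G: "finite (carrier G)" and P: "finite P"
  shows "finite {W. covers W \<and> A_free W}"
proof -
  let ?C = "{W. covers W \<and> A_free W}"
  define th where "th W = (snd ` W, rker W)" for W :: "('a \<times> 'g \<times> 'g) set"
  \<comment> \<open>A base point among the subgroups with given image and right kernel.\<close>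
  define b where "b z = (SOME W. covers W \<and> A_free W \<and> th W = z)" for z
  have b: "covers (b (th W))" "snd ` W = snd ` b (th W)" "rker W = rker (b (th W))" if "W \<in> ?C" for W
  proof -
    have "\<exists>V. covers V \<and> A_free V \<and> th V = th W" using that by auto
    from someI_ex[OF this] show "covers (b (th W))" "snd ` W = snd ` b (th W)" "rker W = rker (b (th W))"
      unfolding b_def th_def by auto
  qed
  let ?f = "\<lambda>W. (th W, ratio (b (th W)) W)"
  have "inj_on ?f ?C"
  proof (rule inj_onI)
    fix W V assume WC: "W \<in> ?C" and VC: "V \<in> ?C" and f: "?f W = ?f V"
    then have W: "covers W" "A_free W" and V: "covers V" "A_free V" by auto
    have th: "th W = th V" using arg_cong[where f = fst, OF f] unfolding fst_conv .
    have rt: "ratio (b (th V)) W = ratio (b (th V)) V"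
      using arg_cong[where f = snd, OF f] unfolding th snd_conv .
    note bW = b[OF WC, unfolded th] and bV = b[OF VC]
    show "W = V"
      by (rule subset_antisym[OF ratio_inj[OF bV(1) W V bW(2) bV(2) bW(3) bV(3) rt]
            ratio_inj[OF bV(1) V W bV(2) bW(2) bV(3) bW(3) rt[symmetric]]])
  qed
  moreover have "finite (?f ` ?C)"
  proof (rule finite_subset)
    show "?f ` ?C \<subseteq> (Pow (carrier G \<times> carrier G) \<times> graph A ` P) \<times> graph A ` P"
    proof (rule image_subsetI)
      fix W assume "W \<in> ?C"
      then have W: "covers W" "A_free W" by auto
      have "snd ` W \<subseteq> carrier G \<times> carrier G" using coversD(3,4)[OF W(1)] by auto
      moreover have "rker W \<in> graph A ` P" using rker_P[OF W] by auto
      moreover have "ratio (b (th W)) W \<in> graph A ` P"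
      proof -
        have "W \<in> ?C" using W by simp
        note bW = b[OF this]
        obtain p where "p \<in> P" "graph A p = ratio (b (th W)) W"
          using stable_P[OF ratio_norm[OF bW(1) W bW(2,3)]] by blast
        then show ?thesis by (metis imageI)
      qed
      ultimately show "(th W, ratio (b (th W)) W) \<in> (Pow (carrier G \<times> carrier G) \<times> graph A ` P) \<times> graph A ` P"
        by (simp add: th_def)
    qed
  qed (use G P in auto)
  ultimately show ?thesis using finite_imageD by blast
qed

end

section \<open>The inverse semigroup of covering classes\<close>

context fb_algebra
begin

abbreviation Q where "Q \<equiv> E.Q"

sublocale Q: bilinear_algebra k Q by (rule E.quot_bilinear)

text \<open>
  The class of the transitive biset of \<open>W\<close>, and zero if the coset space of \<open>W\<close> is not free over
  \<open>A\<close>. With this convention \<open>\<beta>\<close> is multiplicative on all covering subgroups.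
\<close>

definition \<beta> where "\<beta> W = (if A_free W then E.\<pi> (class_delta (cosets_fb W)) else \<zero>\<^bsub>Q\<^esub>)"

lemma \<beta>_closed: "\<beta> W \<in> carrier Q"
  unfolding \<beta>_def using Q.M.zero_closed by (simp add: E.quot_carrier)

lemma cosets_fib': "covers W \<Longrightarrow> A_free W \<Longrightarrow> fib (cosets_fb W)"
  using cosets_fib[OF coversD(1) G_finite] .

lemma std_elem_eq: "std_elem k A G u = E.\<pi> (class_delta (cosets_fb (graph A u)))"
  by (simp add: std_elem_def class_delta_def trans_fb_eq)

lemma std_elem_\<beta>: "u \<in> covering_pairs \<Longrightarrow> std_elem k A G u = \<beta> (graph A u)"
  using covering_pairs_covers by (simp add: std_elem_eq \<beta>_def)

text \<open>
  The tensor product of the two coset spaces is transitive or empty by \<open>orb_translate\<close>. The orbit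
  of the base point has stabilizer \<open>rel_comp W W'\<close> by \<open>tact_fix_iff\<close>, so it survives exactly if
  this subgroup meets \<open>A\<close> trivially.
\<close>

lemma \<beta>_mult:
  assumes W: "covers W" and W': "covers W'"
  shows "\<beta> W \<otimes>\<^bsub>Q\<^esub> \<beta> W' = \<beta> (rel_comp W W')"
proof (cases "A_free W \<and> A_free W'")
  case False
  then have "\<beta> W = \<zero>\<^bsub>Q\<^esub> \<or> \<beta> W' = \<zero>\<^bsub>Q\<^esub>" by (auto simp: \<beta>_def)
  then have "\<beta> W \<otimes>\<^bsub>Q\<^esub> \<beta> W' = \<zero>\<^bsub>Q\<^esub>"
    using Q.mult_zero_left[OF \<beta>_closed] Q.mult_zero_right[OF \<beta>_closed] by auto
  moreover have "\<not> A_free (rel_comp W W')"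
    using False not_A_free_comp_left[OF W W'] not_A_free_comp_right[OF W W'] by auto
  ultimately show ?thesis by (simp add: \<beta>_def[of "rel_comp W W'"])
next
  case True
  let ?X = "cosets_fb W" and ?Y = "cosets_fb W'"
  have X: "fib ?X" and Y: "fib ?Y" using cosets_fib' W W' True by auto
  note sW = coversD(1)[OF W] and sW' = coversD(1)[OF W']
  have x: "W \<in> pts ?X" "transitive ?X" "stab ?X W = W"
    using cosets_base[OF sW] cosets_transitive[OF sW] cosets_stab[OF sW] by auto
  have y: "W' \<in> pts ?Y" "transitive ?Y" "stab ?Y W' = W'"
    using cosets_base[OF sW'] cosets_transitive[OF sW'] cosets_stab[OF sW'] by auto
  have cov': "\<exists>a g. (a, g, h) \<in> stab ?X W" if "h \<in> carrier G" for h
    unfolding x(3) using coversD(9)[OF W that] .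
  let ?c = "orb ?X ?Y W W'"
  have trans: "\<exists>t\<in>carrier T. w = tact ?X ?Y t ?c" if w: "w \<in> pts (tens ?X ?Y)" for w
  proof -
    obtain x' y' where "x' \<in> pts ?X" "y' \<in> pts ?Y" "w = orb ?X ?Y x' y'" by (rule tens_ptsE[OF X Y w])
    then show ?thesis using orb_translate[OF X Y x(1,2) y(1,2) cov'] by blast
  qed
  have c: "?c \<in> pts (tens ?X ?Y) \<longleftrightarrow> A_free (rel_comp W W')"
    using orb_in_pts_iff[OF X Y x(1) y(1)] x(3) y(3) by simp
  have prod: "\<beta> W \<otimes>\<^bsub>Q\<^esub> \<beta> W' = E.\<pi> (class_delta (tens ?X ?Y))"
    using True by (simp add: \<beta>_def E.quot_mult class_delta_mult X Y)
  show ?thesis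
  proof (cases "A_free (rel_comp W W')")
    case A_free: True
    have mem: "?c \<in> pts (tens ?X ?Y)" using c A_free by simp
    note Z = tens_fib[OF X Y]
    have "transitive (tens ?X ?Y)"
      unfolding transitive_def
    proof (intro ballI)
      fix v w assume v: "v \<in> pts (tens ?X ?Y)" and w: "w \<in> pts (tens ?X ?Y)"
      obtain t where t: "t \<in> carrier T" "v = act (tens ?X ?Y) t ?c" using trans[OF v] tens_act[OF X Y mem] by auto
      obtain s where s: "s \<in> carrier T" "w = act (tens ?X ?Y) s ?c" using trans[OF w] tens_act[OF X Y mem] by auto
      have "act (tens ?X ?Y) (s \<otimes>\<^bsub>T\<^esub> inv\<^bsub>T\<^esub> t) v = act (tens ?X ?Y) ((s \<otimes>\<^bsub>T\<^esub> inv\<^bsub>T\<^esub> t) \<otimes>\<^bsub>T\<^esub> t) ?c"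
        unfolding t(2) by (intro fibD(2)[OF Z] T.m_closed T.inv_closed s t mem)
      also have "(s \<otimes>\<^bsub>T\<^esub> inv\<^bsub>T\<^esub> t) \<otimes>\<^bsub>T\<^esub> t = s" using s(1) t(1) by (simp add: T.m_assoc T.l_inv)
      finally have "w = act (tens ?X ?Y) (s \<otimes>\<^bsub>T\<^esub> inv\<^bsub>T\<^esub> t) v" using s(2) by simp
      then show "\<exists>t\<in>carrier T. w = act (tens ?X ?Y) t v" using s(1) t(1) by blast
    qed
    moreover have "stab (tens ?X ?Y) ?c = stab (cosets_fb (rel_comp W W')) (rel_comp W W')"
      using tens_stab[OF X Y x(1) y(1) mem] x(3) y(3) cosets_stab[OF coversD(1)[OF rel_comp_covers[OF W W']]] by simp
    ultimately have iso: "tens ?X ?Y \<cong>\<^sub>f cosets_fb (rel_comp W W')"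
      using mem cosets_fib'[OF rel_comp_covers[OF W W'] A_free]
        cosets_transitive[OF coversD(1)[OF rel_comp_covers[OF W W']]] cosets_base[OF coversD(1)[OF rel_comp_covers[OF W W']]]
      by (intro iso_of_stab[OF Z]) auto
    show ?thesis using prod class_delta_iso[OF Z iso] A_free by (simp add: \<beta>_def[of "rel_comp W W'"])
  next
    case bad: False
    have "pts (tens ?X ?Y) = {}"
    proof (rule equals0I)
      fix w assume w: "w \<in> pts (tens ?X ?Y)"
      obtain t where t: "t \<in> carrier T" "w = tact ?X ?Y t ?c" using trans[OF w] by blast
      have "tact ?X ?Y (inv\<^bsub>T\<^esub> t) w = tact ?X ?Y (inv\<^bsub>T\<^esub> t \<otimes>\<^bsub>T\<^esub> t) ?c"
        unfolding t(2) by (rule tact_tact[OF X Y x(1) y(1) refl T.inv_closed[OF t(1)] t(1)])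
      also have "\<dots> = ?c"
        using t(1) x(1) y(1) fibD(3)[OF X] fibD(3)[OF Y] by (simp add: T.l_inv T_one tact_orb[OF X Y])
      finally show False using tact_pts[OF X Y w T.inv_closed[OF t(1)]] c bad by simp
    qed
    then have "E.\<pi> (class_delta (tens ?X ?Y)) = I" by (intro E.coset_in_I class_delta_empty tens_fib X Y)
    then show ?thesis using prod bad by (simp add: \<beta>_def[of "rel_comp W W'"] E.quot_zero)
  qed
qed

text \<open>
  The stabilizers of points in one orbit are conjugate, and the kernels are normal. Hence the
  kernels depend only on the class of the biset, although \<open>W\<close> is determined by it only up to
  conjugation.
\<close>

lemma kernels_invariant:
  assumes X: "fib X" and x: "x \<in> pts X" and t: "t \<in> carrier T" and W: "covers (stab X x)"
  shows "lker (stab X x) \<subseteq> lker (stab X (act X t x))" and "rker (stab X x) \<subseteq> rker (stab X (act X t x))"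
proof -
  obtain b y z where byz: "t = (b, y, z)" "b \<in> carrier A" "y \<in> carrier G" "z \<in> carrier G" using t by (rule T_cases)
  have move: "s \<in> stab X (act X t x)" if s: "s \<in> carrier T" and m: "inv\<^bsub>T\<^esub> t \<otimes>\<^bsub>T\<^esub> (s \<otimes>\<^bsub>T\<^esub> t) \<in> stab X x" for s
  proof -
    have "act X (s \<otimes>\<^bsub>T\<^esub> t) x = act X t x" using act_eq_iff[OF X x T.m_closed[OF s t] t] m by simp
    then show ?thesis using fibD(2)[OF X s t x] s by (simp add: stab_def)
  qed
  show "lker (stab X x) \<subseteq> lker (stab X (act X t x))"
  proof clarify
    fix a g assume ag: "(a, g) \<in> lker (stab X x)"
    have c: "a \<in> carrier A" "g \<in> carrier G" using stableD(2,3)[OF lker_norm[OF W] ag] by auto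
    have "(a, iG y \<otimes>\<^bsub>G\<^esub> g \<otimes>\<^bsub>G\<^esub> y) \<in> lker (stab X x)" by (rule stableD(8)[OF lker_norm[OF W] ag byz(3)])
    moreover have "inv\<^bsub>T\<^esub> t \<otimes>\<^bsub>T\<^esub> ((a, g, oG) \<otimes>\<^bsub>T\<^esub> t) = (a, iG y \<otimes>\<^bsub>G\<^esub> g \<otimes>\<^bsub>G\<^esub> y, oG)"
      using byz c by (simp add: A.m_comm[of a b] G.m_assoc G.l_inv)
    ultimately have "(a, g, oG) \<in> stab X (act X t x)" using c by (intro move) (simp_all add: lker_def)
    then show "(a, g) \<in> lker (stab X (act X t x))" by (simp add: lker_def)
  qed
  show "rker (stab X x) \<subseteq> rker (stab X (act X t x))"
  proof clarify
    fix a g assume ag: "(a, g) \<in> rker (stab X x)"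
    have c: "a \<in> carrier A" "g \<in> carrier G" using stableD(2,3)[OF rker_norm[OF W] ag] by auto
    have "(a, iG z \<otimes>\<^bsub>G\<^esub> g \<otimes>\<^bsub>G\<^esub> z) \<in> rker (stab X x)" by (rule stableD(8)[OF rker_norm[OF W] ag byz(4)])
    moreover have "inv\<^bsub>T\<^esub> t \<otimes>\<^bsub>T\<^esub> ((iA a, oG, g) \<otimes>\<^bsub>T\<^esub> t) = (iA a, oG, iG z \<otimes>\<^bsub>G\<^esub> g \<otimes>\<^bsub>G\<^esub> z)"
      using byz c by (simp add: A.m_comm[of "iA a" b] G.m_assoc G.l_inv)
    ultimately have "(iA a, oG, g) \<in> stab X (act X t x)" using c by (intro move) (simp_all add: rker_def)
    then show "(a, g) \<in> rker (stab X (act X t x))" using c by (simp add: rker_def)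
  qed
qed

lemma kernels_eq:
  assumes X: "fib X" and x: "x \<in> pts X" and t: "t \<in> carrier T" and W: "covers (stab X x)" "covers (stab X (act X t x))"
  shows "lker (stab X (act X t x)) = lker (stab X x)" and "rker (stab X (act X t x)) = rker (stab X x)"
proof -
  have ret: "act X (inv\<^bsub>T\<^esub> t) (act X t x) = x"
    using fibD(2)[OF X T.inv_closed[OF t] t x] fibD(3)[OF X x] t by (simp add: T.l_inv T_one)
  note 1 = kernels_invariant[OF X x t W(1)]
  note 2 = kernels_invariant[OF X fibD(1)[OF X t x] T.inv_closed[OF t] W(2), unfolded ret]
  show "lker (stab X (act X t x)) = lker (stab X x)" "rker (stab X (act X t x)) = rker (stab X x)"
    using 1 2 by auto
qed

lemma coordf_\<beta>:
  assumes W: "covers W" "A_free W" and V: "covers V" "A_free V"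
  shows "coordf V (\<beta> W) = (if \<exists>x\<in>pts (cosets_fb W). stab (cosets_fb W) x = V then \<one>\<^bsub>k\<^esub> else \<zero>\<^bsub>k\<^esub>)"
proof -
  note fib = cosets_fib'[OF W]
  have "[(1::nat)] \<cdot>\<^bsub>k\<^esub> \<one>\<^bsub>k\<^esub> = \<one>\<^bsub>k\<^esub>" "[(0::nat)] \<cdot>\<^bsub>k\<^esub> \<one>\<^bsub>k\<^esub> = \<zero>\<^bsub>k\<^esub>"
    by (simp_all add: add_pow_def)
  then show ?thesis
    using W(2) coordf_class_delta[OF fib, of V] orbit_count_transitive[OF fib cosets_transitive[OF coversD(1)[OF W(1)]], of V]
    by (simp add: \<beta>_def)
qed

lemma stab_in_cosets:
  assumes W: "covers W" "A_free W" and V: "covers V" "A_free V"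
    and x: "x \<in> pts (cosets_fb W)" "stab (cosets_fb W) x = V"
  shows "\<beta> W = \<beta> V" and "lker W = lker V" and "rker W = rker V"
proof -
  note sW = coversD(1)[OF W(1)] and sV = coversD(1)[OF V(1)]
  note fW = cosets_fib'[OF W] and fV = cosets_fib'[OF V]
  have iso: "cosets_fb W \<cong>\<^sub>f cosets_fb V"
    using x(2) cosets_stab[OF sV] by (intro iso_of_stab[OF fW cosets_transitive[OF sW] x(1) fV cosets_transitive[OF sV] cosets_base[OF sV]]) simp
  show "\<beta> W = \<beta> V" using class_delta_iso[OF fW iso] W V by (simp add: \<beta>_def)
  obtain t where t: "t \<in> carrier T" "x = act (cosets_fb W) t W"
    using cosets_transitive[OF sW] cosets_base[OF sW] x(1) unfolding transitive_def by blast
  have s: "stab (cosets_fb W) W = W" by (rule cosets_stab[OF sW])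
  have "lker (stab (cosets_fb W) (act (cosets_fb W) t W)) = lker (stab (cosets_fb W) W)"
    "rker (stab (cosets_fb W) (act (cosets_fb W) t W)) = rker (stab (cosets_fb W) W)"
    using V(1) W(1) x(2) t(2) s by (intro kernels_eq[OF fW cosets_base[OF sW] t(1)]; simp)+
  then show "lker W = lker V" "rker W = rker V" using x(2) t(2) s by simp_all
qed

definition cov_classes where "cov_classes = \<beta> ` {W. covers W \<and> A_free W}"

lemma cov_classes_eq: "cov_classes = {std_elem k A G (U, \<phi>) | U \<phi>.
    (U, \<phi>) \<in> pairs A (G \<times>\<times> G) \<and> fst ` U = carrier G \<and> snd ` U = carrier G}"
proof (intro subset_antisym subsetI)
  fix s assume "s \<in> cov_classes"
  then obtain W where W: "covers W" "A_free W" "s = \<beta> W" by (auto simp: cov_classes_def)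
  obtain u where u: "u \<in> covering_pairs" "graph A u = W" using covers_covering_pairs[OF W(1,2)] by blast
  then have "s = std_elem k A G u" using W(3) std_elem_\<beta> by simp
  then show "s \<in> {std_elem k A G (U, \<phi>) | U \<phi>.
    (U, \<phi>) \<in> pairs A (G \<times>\<times> G) \<and> fst ` U = carrier G \<and> snd ` U = carrier G}"
    using u(1) unfolding covering_pairs_def by (cases u) auto
next
  fix s assume "s \<in> {std_elem k A G (U, \<phi>) | U \<phi>.
    (U, \<phi>) \<in> pairs A (G \<times>\<times> G) \<and> fst ` U = carrier G \<and> snd ` U = carrier G}"
  then obtain u where "u \<in> covering_pairs" "s = std_elem k A G u" unfolding covering_pairs_def by force
  then show "s \<in> cov_classes" using std_elem_\<beta> covering_pairs_covers by (auto simp: cov_classes_def)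
qed

text \<open>
  A choice of \<open>W\<close> in its conjugacy class; \<open>lS\<close> and \<open>rS\<close> below do not depend on it because the
  kernels are invariants of the class.
\<close>

definition cover_of where "cover_of s = (SOME W. covers W \<and> A_free W \<and> \<beta> W = s)"

lemma cover_of:
  assumes "s \<in> cov_classes" shows "covers (cover_of s)" "A_free (cover_of s)" "\<beta> (cover_of s) = s"
proof -
  have "\<exists>W. covers W \<and> A_free W \<and> \<beta> W = s" using assms by (auto simp: cov_classes_def)
  from someI_ex[OF this] show "covers (cover_of s)" "A_free (cover_of s)" "\<beta> (cover_of s) = s" by (auto simp: cover_of_def)
qed

lemma \<beta>_S: "covers W \<Longrightarrow> A_free W \<Longrightarrow> \<beta> W \<in> cov_classes" by (auto simp: cov_classes_def)

definition pair_of where "pair_of N = (SOME p. p \<in> P \<and> graph A p = N)"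

lemma pair_of: "\<exists>p\<in>P. graph A p = N \<Longrightarrow> pair_of N \<in> P \<and> graph A (pair_of N) = N"
  unfolding pair_of_def by (rule someI_ex) blast

definition lS where "lS s = pair_of (lker (cover_of s))"
definition rS where "rS s = pair_of (rker (cover_of s))"

definition bot_pair where "bot_pair = ({oG}, \<lambda>x\<in>{oG}. oA)"

lemma bot_pair: "bot_pair \<in> P" "p \<in> P \<Longrightarrow> pair_le bot_pair p"
proof -
  have "(\<lambda>x\<in>{oG}. oA) \<in> chars A G {oG}" by (auto simp: chars_def hom_def)
  then have "bot_pair \<in> pairs A G" using G.triv_subgroup by (simp add: bot_pair_def pairs_def)
  then show "bot_pair \<in> P" using G.one_is_normal by (auto simp: bot_pair_def fixed_pairs_def G.r_inv)
  fix p assume "p \<in> P"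
  note pp = P_pairs[OF this]
  show "pair_le bot_pair p"
    using subgroup.one_closed[OF PG.pairD(1)[OF pp]] PG.pairD(6)[OF pp]
    by (auto simp: pair_le_def bot_pair_def intro!: restrict_ext)
qed

definition moebius_wt where "moebius_wt p q = [normal_moebius G (fst p) (fst q)] \<cdot>\<^bsub>k\<^esub> \<one>\<^bsub>k\<^esub>"

lemma e_elem_\<beta>: "p \<in> P \<Longrightarrow> e_elem k A G p = \<beta> (diag (graph A p))"
  using diag_A_free by (simp add: e_elem_def std_elem_eq Delta_graph \<beta>_def)

lemma Q_one: "\<one>\<^bsub>Q\<^esub> = e_elem k A G bot_pair"
proof -
  have "\<one>\<^bsub>M\<^esub> = fb_class A G (trans_fb A G G (Delta_pair G bot_pair))" by (simp add: fb_monoid_def bot_pair_def)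
  then show ?thesis by (simp add: E.quot_one monoid_alg_simps(3) e_elem_def std_elem_def)
qed

text \<open>
  Below a fixed pair, every normal subgroup carries exactly one restricted character. Hence an
  interval of fixed pairs is isomorphic to an interval of normal subgroups.
\<close>

lemma moebius_sum:
  assumes p: "p \<in> P" and q: "q \<in> P" and le: "pair_le p q"
  shows "(\<Sum>x\<in>{x \<in> P. pair_le p x \<and> pair_le x q}. normal_moebius G (fst p) (fst x)) = (if p = q then 1 else 0)"
proof -
  obtain L ll where L: "q = (L, ll)" by (cases q)
  have sub: "fst p \<subseteq> L" and sp: "snd p = restrict ll (fst p)" using le by (auto simp: pair_le_def L)
  let ?X = "{x \<in> P. pair_le p x \<and> pair_le x q}" and ?N = "{N. N \<lhd> G \<and> fst p \<subseteq> N \<and> N \<subseteq> L}"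
  note pq = P_pairs[OF q]
  have nor: "fst x \<lhd> G" if "x \<in> P" for x using that by (auto simp: fixed_pairs_def)
  have bij: "bij_betw fst ?X ?N"
  proof (rule bij_betw_byWitness[where f' = "\<lambda>N. (N, restrict ll N)"])
    show "\<forall>x\<in>?X. (fst x, restrict ll (fst x)) = x" by (auto simp: pair_le_def L)
    show "\<forall>N\<in>?N. fst (N, restrict ll N) = N" by simp
    show "fst ` ?X \<subseteq> ?N" using nor by (auto simp: pair_le_def L)
    show "(\<lambda>N. (N, restrict ll N)) ` ?N \<subseteq> ?X"
    proof (rule image_subsetI)
      fix N assume N: "N \<in> ?N"
      have nN: "N \<lhd> G" and s: "fst p \<subseteq> N" "N \<subseteq> L" using N by auto
      interpret N: normal N G by (rule nN)
      have inL: "x \<in> L" if "x \<in> N" for x using that s by auto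
      have "restrict ll N \<in> hom (G\<lparr>carrier := N\<rparr>) A"
        using PG.pairD(3,4)[OF pq] inL by (intro homI) (auto simp: L)
      then have "(N, restrict ll N) \<in> pairs A G" using N.subgroup_axioms by (simp add: pairs_def chars_def)
      moreover have "ll (g \<otimes>\<^bsub>G\<^esub> x \<otimes>\<^bsub>G\<^esub> iG g) = ll x" if "g \<in> carrier G" "x \<in> N" for g x
        using q that inL by (auto simp: fixed_pairs_def L)
      ultimately have "(N, restrict ll N) \<in> P"
        using nN N.inv_op_closed2 by (auto simp: fixed_pairs_def)
      moreover have "restrict ll (fst p) = restrict (restrict ll N) (fst p)" using s by (intro restrict_ext) auto
      ultimately show "(N, restrict ll N) \<in> ?X" using s sp by (auto simp: pair_le_def L)
    qed
  qed
  have "(\<Sum>x\<in>?X. normal_moebius G (fst p) (fst x)) = (\<Sum>N\<in>?N. normal_moebius G (fst p) N)"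
    by (rule sum.reindex_bij_betw[OF bij])
  also have "\<dots> = (if p = q then 1 else 0)"
  proof (cases "fst p = L")
    case True
    then have "p = q" using sp PG.pairD(5)[OF pq] by (intro prod_eqI) (simp_all add: L extensional_restrict)
    moreover have "?N = {L}" using True nor[OF q] by (auto simp: L)
    ultimately show ?thesis using True by (simp add: normal_moebius.simps)
  next
    case False
    have Lfin: "finite L" using PG.pairD(2)[OF pq] G_finite by (auto simp: L intro: finite_subset)
    have split: "?N = insert L {N. N \<lhd> G \<and> fst p \<subseteq> N \<and> N \<subset> L}" using nor[OF q] sub by (auto simp: L)
    have fin: "finite {N. N \<lhd> G \<and> fst p \<subseteq> N \<and> N \<subset> L}"
      by (rule finite_subset[of _ "Pow L"]) (use Lfin in auto)
    have "(\<Sum>N\<in>?N. normal_moebius G (fst p) N)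
      = normal_moebius G (fst p) L + (\<Sum>N\<in>{N. N \<lhd> G \<and> fst p \<subseteq> N \<and> N \<subset> L}. normal_moebius G (fst p) N)"
      unfolding split using fin by (subst sum.insert) auto
    also have "\<dots> = 0" using False Lfin sub by (subst normal_moebius.simps) simp
    finally show ?thesis using False by (auto simp: L)
  qed
  finally show ?thesis .
qed

end

locale fb_main = fb_algebra +
  assumes P_finite: "finite P" and nontrivial: "\<one>\<^bsub>k\<^esub> \<noteq> \<zero>\<^bsub>k\<^esub>"
begin

lemma \<beta>_kernels:
  assumes W: "covers W" "A_free W" and V: "covers V" "A_free V" and eq: "\<beta> W = \<beta> V"
  shows "lker W = lker V" and "rker W = rker V"
proof -
  have "coordf V (\<beta> V) = \<one>\<^bsub>k\<^esub>"
    using coordf_\<beta>[OF V V] cosets_base[OF coversD(1)[OF V(1)]] cosets_stab[OF coversD(1)[OF V(1)]] by auto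
  then have "coordf V (\<beta> W) \<noteq> \<zero>\<^bsub>k\<^esub>" using eq nontrivial by simp
  then obtain x where "x \<in> pts (cosets_fb W)" "stab (cosets_fb W) x = V" using coordf_\<beta>[OF W V] by (auto split: if_splits)
  then show "lker W = lker V" "rker W = rker V" by (rule stab_in_cosets(2,3)[OF W V])+
qed

lemma \<beta>_nonzero:
  assumes W: "covers W" "A_free W" shows "\<beta> W \<noteq> \<zero>\<^bsub>Q\<^esub>"
proof
  assume z: "\<beta> W = \<zero>\<^bsub>Q\<^esub>"
  have "coordf W (\<beta> W) = \<one>\<^bsub>k\<^esub>"
    using coordf_\<beta>[OF W W] cosets_base[OF coversD(1)[OF W(1)]] cosets_stab[OF coversD(1)[OF W(1)]] by auto
  then show False using lin_map_zero[OF Q.module_axioms k.self_module coordf_lin[of W]] z nontrivial by simp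
qed

lemma \<beta>_in_S: "covers W \<Longrightarrow> \<beta> W \<in> cov_classes \<longleftrightarrow> A_free W"
  using \<beta>_S[of W] \<beta>_nonzero cover_of[of "\<beta> W"] by (auto simp: \<beta>_def[of W])

lemma lS_\<beta>: assumes W: "covers W" "A_free W" shows "lS (\<beta> W) \<in> P" "graph A (lS (\<beta> W)) = lker W"
proof -
  note V = cover_of[OF \<beta>_S[OF W]]
  have "lker (cover_of (\<beta> W)) = lker W" by (rule \<beta>_kernels(1)[OF V(1,2) W V(3)])
  then show "lS (\<beta> W) \<in> P" "graph A (lS (\<beta> W)) = lker W" using pair_of[OF lker_P[OF W]] by (simp_all add: lS_def)
qed

lemma rS_\<beta>: assumes W: "covers W" "A_free W" shows "rS (\<beta> W) \<in> P" "graph A (rS (\<beta> W)) = rker W"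
proof -
  note V = cover_of[OF \<beta>_S[OF W]]
  have "rker (cover_of (\<beta> W)) = rker W" by (rule \<beta>_kernels(2)[OF V(1,2) W V(3)])
  then show "rS (\<beta> W) \<in> P" "graph A (rS (\<beta> W)) = rker W" using pair_of[OF rker_P[OF W]] by (simp_all add: rS_def)
qed

lemma S_E:
  assumes "s \<in> cov_classes" obtains W where "covers W" "A_free W" "s = \<beta> W"
  using assms by (auto simp: cov_classes_def)

lemma e_covers: "p \<in> P \<Longrightarrow> covers (diag (graph A p))"
  using diag_covers P_graph by blast

lemma linkage_eq: "linkage A G = {(p, q). p \<in> P \<and> q \<in> P \<and> (\<exists>s\<in>cov_classes. lS s = p \<and> rS s = q)}"
proof -
  have "(\<exists>u\<in>pairs A (G \<times>\<times> G). l_data G u = (carrier G, p) \<and> r_data A G u = (carrier G, q)) \<longleftrightarrow>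
      (\<exists>s\<in>cov_classes. lS s = p \<and> rS s = q)" if p: "p \<in> P" and q: "q \<in> P" for p q
  proof
    assume "\<exists>u\<in>pairs A (G \<times>\<times> G). l_data G u = (carrier G, p) \<and> r_data A G u = (carrier G, q)"
    then obtain u where u: "u \<in> covering_pairs" "lker (graph A u) = graph A p" "rker (graph A u) = graph A q"
      using l_data_iff[OF _ P_pairs[OF p]] r_data_iff[OF _ P_pairs[OF q]] unfolding covering_pairs_def by blast
    note W = covering_pairs_covers[OF u(1)]
    have "lS (\<beta> (graph A u)) = p" using lS_\<beta>[OF W] u(2) P_eq_iff p by simp
    moreover have "rS (\<beta> (graph A u)) = q" using rS_\<beta>[OF W] u(3) P_eq_iff q by simp
    ultimately show "\<exists>s\<in>cov_classes. lS s = p \<and> rS s = q" using \<beta>_S[OF W] by blast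
  next
    assume "\<exists>s\<in>cov_classes. lS s = p \<and> rS s = q"
    then obtain W where W: "covers W" "A_free W" "lS (\<beta> W) = p" "rS (\<beta> W) = q" by (auto elim: S_E)
    obtain u where u: "u \<in> covering_pairs" "graph A u = W" using covers_covering_pairs[OF W(1,2)] by blast
    have "u \<in> pairs A (G \<times>\<times> G)" "fst ` fst u = carrier G" "snd ` fst u = carrier G"
      using u(1) by (auto simp: covering_pairs_def)
    then show "\<exists>u\<in>pairs A (G \<times>\<times> G). l_data G u = (carrier G, p) \<and> r_data A G u = (carrier G, q)"
      using l_data_iff[OF _ P_pairs[OF p], of u] r_data_iff[OF _ P_pairs[OF q], of u] lS_\<beta>(2)[OF W(1,2)] rS_\<beta>(2)[OF W(1,2)]
        W(3,4) u(2) by (intro bexI[of _ u]) auto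
  qed
  then show ?thesis unfolding linkage_def by blast
qed

text \<open>
  The groups \<open>\<Gamma>\<^bsub>(G, K, \<kappa>)\<^esub>\<close> are the vertex groups of the groupoid.
\<close>

lemma Gamma_carrier:
  assumes p: "p \<in> P"
  shows "carrier (Gamma k A G p) = {s \<in> cov_classes. lS s = p \<and> rS s = p}"
proof (intro subset_antisym subsetI)
  fix s assume "s \<in> carrier (Gamma k A G p)"
  then obtain u where u: "s = std_elem k A G u" "u \<in> pairs A (G \<times>\<times> G)" "l_data G u = (carrier G, p)" "r_data A G u = (carrier G, p)"
    by (auto simp: Gamma_def)
  have uc: "u \<in> covering_pairs" "lker (graph A u) = graph A p" "rker (graph A u) = graph A p"
    using u l_data_iff[OF u(2) P_pairs[OF p]] r_data_iff[OF u(2) P_pairs[OF p]] unfolding covering_pairs_def by auto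
  note W = covering_pairs_covers[OF uc(1)]
  show "s \<in> {s \<in> cov_classes. lS s = p \<and> rS s = p}"
    using lS_\<beta>[OF W] rS_\<beta>[OF W] uc P_eq_iff p \<beta>_S[OF W] u(1) std_elem_\<beta>[OF uc(1)] by simp
next
  fix s assume s: "s \<in> {s \<in> cov_classes. lS s = p \<and> rS s = p}"
  then obtain W where W: "covers W" "A_free W" "s = \<beta> W" by (auto elim: S_E)
  obtain u where u: "u \<in> covering_pairs" "graph A u = W" using covers_covering_pairs[OF W(1,2)] by blast
  have up: "u \<in> pairs A (G \<times>\<times> G)" "fst ` fst u = carrier G" "snd ` fst u = carrier G"
    using u(1) by (auto simp: covering_pairs_def)
  have "l_data G u = (carrier G, p)" "r_data A G u = (carrier G, p)"
    using l_data_iff[OF up(1) P_pairs[OF p]] r_data_iff[OF up(1) P_pairs[OF p]] up u(2) lS_\<beta>(2)[OF W(1,2)] rS_\<beta>(2)[OF W(1,2)] s W(3)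
    by auto
  moreover have "s = std_elem k A G u" using std_elem_\<beta>[OF u(1)] u(2) W(3) by simp
  ultimately show "s \<in> carrier (Gamma k A G p)" using up(1) unfolding Gamma_def partial_object.simps by blast
qed

lemma moebius_wt_sum:
  assumes "p \<in> P" and "q \<in> P" and "pair_le p q"
  shows "(\<Oplus>\<^bsub>k\<^esub>x\<in>{x \<in> P. pair_le p x \<and> pair_le x q}. moebius_wt p x) = (if p = q then \<one>\<^bsub>k\<^esub> else \<zero>\<^bsub>k\<^esub>)"
proof -
  let ?X = "{x \<in> P. pair_le p x \<and> pair_le x q}"
  have "finite ?X" using P_finite by simp
  then have "(\<Oplus>\<^bsub>k\<^esub>x\<in>?X. moebius_wt p x) = [(\<Sum>x\<in>?X. normal_moebius G (fst p) (fst x))] \<cdot>\<^bsub>k\<^esub> \<one>\<^bsub>k\<^esub>"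
    unfolding moebius_wt_def by (intro k.add_pow_int_sum[symmetric]) auto
  then show ?thesis using moebius_sum[OF assms] k.add.int_pow_1[OF k.one_closed] by (auto simp: add_pow_def)
qed

lemma moebius_wt_closed: "moebius_wt p q \<in> carrier k"
  using k.add.int_pow_closed[OF k.one_closed] by (simp add: moebius_wt_def add_pow_def)

lemma inverse_semigroup:
  assumes rep: "\<And>c. c \<in> linkage_classes A G \<Longrightarrow> rep c \<in> c"
    and enum: "\<And>c. c \<in> linkage_classes A G \<Longrightarrow> bij_betw (enum c) {..<card c} c"
  shows "inverse_semigroup_basis k Q cov_classes P pair_le bot_pair lS rS (e_elem k A G) (\<lambda>s. \<beta> (opp (cover_of s)))
    (\<lambda>s. coordf (cover_of s)) moebius_wt (linkage A G) rep enum"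
proof (intro inverse_semigroup_basis.intro inverse_semigroup_basis_axioms.intro E.quot_bilinear)
  note gi = P_le_iff
  show "\<one>\<^bsub>k\<^esub> \<noteq> \<zero>\<^bsub>k\<^esub>" by (rule nontrivial)
  show "finite cov_classes" unfolding cov_classes_def by (intro finite_imageI finite_covers G_finite P_finite)
  show "cov_classes \<subseteq> carrier Q" using \<beta>_closed by (auto simp: cov_classes_def)
  show "finite P" by (rule P_finite)
  show "bot_pair \<in> P" "\<And>p. p \<in> P \<Longrightarrow> pair_le bot_pair p" by (rule bot_pair)+
  show "moebius_wt p q \<in> carrier k" for p q by (rule moebius_wt_closed)
  show "(\<Oplus>\<^bsub>k\<^esub>x\<in>{x \<in> P. pair_le p x \<and> pair_le x q}. moebius_wt p x) = (if p = q then \<one>\<^bsub>k\<^esub> else \<zero>\<^bsub>k\<^esub>)"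
    if "p \<in> P" "q \<in> P" "pair_le p q" for p q by (rule moebius_wt_sum[OF that])
  show "linkage A G = {(p, q). p \<in> P \<and> q \<in> P \<and> (\<exists>s\<in>cov_classes. lS s = p \<and> rS s = q)}" by (rule linkage_eq)
  show "rep c \<in> c" "bij_betw (enum c) {..<card c} c" if "c \<in> P // linkage A G" for c
    using that rep enum by (auto simp: linkage_classes_def)
  show "lin_map k Q (self_module k) (coordf (cover_of s))" for s by (rule coordf_lin)
  fix p assume p: "p \<in> P"
  show "pair_le p p" using gi[OF p p] by simp
  note e = e_elem_\<beta>[OF p] e_covers[OF p] diag_A_free[OF p] P_graph(1)[OF p]
  show "e_elem k A G p \<in> cov_classes" using e \<beta>_S by simp
  show "lS (e_elem k A G p) = p" using e lS_\<beta>[OF e(2,3)] lker_diag[OF e(4)] P_eq_iff[OF _ p] by simp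
  show "rS (e_elem k A G p) = p" using e rS_\<beta>[OF e(2,3)] rker_diag[OF e(4)] P_eq_iff[OF _ p] by simp
  fix q assume q: "q \<in> P"
  show "p = q" if "pair_le p q" "pair_le q p" using that unfolding gi[OF p q] gi[OF q p] P_eq_iff[OF p q, symmetric] by (rule subset_antisym)
  show "e_elem k A G q \<otimes>\<^bsub>Q\<^esub> e_elem k A G p = e_elem k A G q" if "pair_le p q"
    using that gi[OF p q] e_elem_\<beta>[OF p] e_elem_\<beta>[OF q] \<beta>_mult[OF e_covers[OF q] e_covers[OF p]]
      diag_comp_diag[OF P_graph(1)[OF p] P_graph(1)[OF q]] by simp
  fix x assume x: "x \<in> P"
  show "pair_le p x" if "pair_le p q" "pair_le q x" using that unfolding gi[OF p q] gi[OF q x] gi[OF p x] by (rule subset_trans)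
next
  fix s assume s: "s \<in> cov_classes"
  then obtain W where W: "covers W" "A_free W" and sW: "s = \<beta> W" by (rule S_E)
  note l = lS_\<beta>[OF W, folded sW] and r = rS_\<beta>[OF W, folded sW]
  show "lS s \<in> P" "rS s \<in> P" using l r by auto
  show "e_elem k A G (lS s) \<otimes>\<^bsub>Q\<^esub> s = s"
    using e_elem_\<beta>[OF l(1)] l(2) \<beta>_mult[OF diag_covers[OF lker_norm[OF W(1)]] W(1)] diag_lker_comp[OF W(1)] sW by simp
  show "s \<otimes>\<^bsub>Q\<^esub> e_elem k A G (rS s) = s"
    using e_elem_\<beta>[OF r(1)] r(2) \<beta>_mult[OF W(1) diag_covers[OF rker_norm[OF W(1)]]] comp_diag_rker[OF W(1)] sW by simp
  note V = cover_of[OF s]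
  have o: "covers (opp (cover_of s))" "A_free (opp (cover_of s))" using opp_covers V A_free_opp by auto
  show "\<beta> (opp (cover_of s)) \<in> cov_classes" by (rule \<beta>_S[OF o])
  have lV: "graph A (lS s) = lker (cover_of s)" "graph A (rS s) = rker (cover_of s)"
    using lS_\<beta>(2)[OF V(1,2)] rS_\<beta>(2)[OF V(1,2)] V(3) by auto
  show "lS (\<beta> (opp (cover_of s))) = rS s" using lS_\<beta>[OF o] lker_opp[OF V(1)] lV P_eq_iff[OF _ r(1)] by simp
  show "rS (\<beta> (opp (cover_of s))) = lS s" using rS_\<beta>[OF o] rker_opp[OF V(1)] lV P_eq_iff[OF _ l(1)] by simp
  show "s \<otimes>\<^bsub>Q\<^esub> \<beta> (opp (cover_of s)) = e_elem k A G (lS s)"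
    using \<beta>_mult[OF V(1) o(1)] comp_opp[OF V(1)] V(3) e_elem_\<beta>[OF l(1)] lV by simp
  show "\<beta> (opp (cover_of s)) \<otimes>\<^bsub>Q\<^esub> s = e_elem k A G (rS s)"
    using \<beta>_mult[OF o(1) V(1)] opp_comp[OF V(1)] V(3) e_elem_\<beta>[OF r(1)] lV by simp
  have act: "e_elem k A G q \<otimes>\<^bsub>Q\<^esub> s = \<beta> (rel_comp (diag (graph A q)) W)"
    "covers (rel_comp (diag (graph A q)) W)" if q: "q \<in> P" for q
    using e_elem_\<beta>[OF q] \<beta>_mult[OF e_covers[OF q] W(1)] sW rel_comp_covers[OF e_covers[OF q] W(1)] by auto
  have act': "lker (rel_comp (diag (graph A q)) W) = graph A q" "A_free (rel_comp (diag (graph A q)) W)"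
    if q: "q \<in> P" and le: "pair_le (lS s) q" for q
  proof -
    have "lker W \<subseteq> graph A q" using P_le_iff[OF l(1) q] le l(2) by simp
    then show "lker (rel_comp (diag (graph A q)) W) = graph A q" by (rule lker_act[OF W(1) P_graph(1)[OF q]])
    then show "A_free (rel_comp (diag (graph A q)) W)" using P_graph(2)[OF q] by (simp add: A_free_lker)
  qed
  show "e_elem k A G q \<otimes>\<^bsub>Q\<^esub> s \<in> cov_classes" "lS (e_elem k A G q \<otimes>\<^bsub>Q\<^esub> s) = q" if q: "q \<in> P" and le: "pair_le (lS s) q" for q
    using act[OF q] act'[OF q le] \<beta>_S lS_\<beta>[OF act(2)[OF q] act'(2)[OF q le]] P_eq_iff[OF _ q] by auto
  fix t assume t: "t \<in> cov_classes"
  then obtain W' where W': "covers W'" "A_free W'" and tW: "t = \<beta> W'" by (rule S_E)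
  note l' = lS_\<beta>[OF W', folded tW] and r' = rS_\<beta>[OF W', folded tW]
  note c = rel_comp_covers[OF W(1) W'(1)]
  have st: "s \<otimes>\<^bsub>Q\<^esub> t = \<beta> (rel_comp W W')" using \<beta>_mult[OF W(1) W'(1)] sW tW by simp
  show "s \<otimes>\<^bsub>Q\<^esub> t \<in> cov_classes \<or> s \<otimes>\<^bsub>Q\<^esub> t = \<zero>\<^bsub>Q\<^esub>"
    unfolding st using \<beta>_S[OF c] by (auto simp: \<beta>_def)
  show "coordf (cover_of s) t = (if s = t then \<one>\<^bsub>k\<^esub> else \<zero>\<^bsub>k\<^esub>)"
  proof (cases "s = t")
    case True
    then show ?thesis
      using coordf_\<beta>[OF V(1,2) V(1,2)] cosets_base[OF coversD(1)[OF V(1)]] cosets_stab[OF coversD(1)[OF V(1)]] V(3) by auto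
  next
    case False
    then have "\<not> (\<exists>x\<in>pts (cosets_fb W'). stab (cosets_fb W') x = cover_of s)"
      using stab_in_cosets(1)[OF W' V(1,2)] V(3) tW by auto
    then show ?thesis using coordf_\<beta>[OF W' V(1,2)] tW False by simp
  qed
  have comp: "A_free (rel_comp W W')" "lker (rel_comp W W') = lker W" "rker (rel_comp W W') = rker W'" if "rS s = lS t"
  proof -
    have eq: "rker W = lker W'" using that r(2) l'(2) by simp
    show "lker (rel_comp W W') = lker W" "rker (rel_comp W W') = rker W'"
      by (rule lker_comp_eq[OF W(1) W'(1) eq] rker_comp_eq[OF W(1) W'(1) eq])+
    then show "A_free (rel_comp W W')" using W(2) by (simp add: A_free_lker)
  qed
  show "s \<otimes>\<^bsub>Q\<^esub> t \<in> cov_classes" if "rS s = lS t" unfolding st by (rule \<beta>_S[OF c comp(1)[OF that]])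
  show "lS (s \<otimes>\<^bsub>Q\<^esub> t) = lS s" if "rS s = lS t"
    unfolding st using lS_\<beta>[OF c comp(1)[OF that]] comp(2)[OF that] P_eq_iff[OF _ l(1)] l(2) by simp
  show "rS (s \<otimes>\<^bsub>Q\<^esub> t) = rS t" if "rS s = lS t"
    unfolding st using rS_\<beta>[OF c comp(1)[OF that]] comp(3)[OF that] P_eq_iff[OF _ r'(1)] r'(2) by simp
  show "pair_le (lS s) (lS (s \<otimes>\<^bsub>Q\<^esub> t))" if "s \<otimes>\<^bsub>Q\<^esub> t \<in> cov_classes"
  proof -
    have g: "A_free (rel_comp W W')" using that \<beta>_in_S[OF c] unfolding st by simp
    show ?thesis unfolding st using P_le_iff[OF l(1) lS_\<beta>(1)[OF c g]] l(2) lS_\<beta>(2)[OF c g] lker_comp_mono[OF W(1) W'(1)] by simp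
  qed
  show "pair_le (lS t) (rS (e_elem k A G q \<otimes>\<^bsub>Q\<^esub> s)) \<longleftrightarrow> s \<otimes>\<^bsub>Q\<^esub> t \<in> cov_classes \<and> pair_le (lS (s \<otimes>\<^bsub>Q\<^esub> t)) q"
    if q: "q \<in> P" and le: "pair_le (lS s) q" for q
  proof -
    have sub: "lker W \<subseteq> graph A q" using P_le_iff[OF l(1) q] le l(2) by simp
    note rq = rS_\<beta>[OF act(2)[OF q] act'(2)[OF q le]]
    have "pair_le (lS t) (rS (e_elem k A G q \<otimes>\<^bsub>Q\<^esub> s)) \<longleftrightarrow> lker W' \<subseteq> rker (rel_comp (diag (graph A q)) W)"
      unfolding act(1)[OF q] using P_le_iff[OF l'(1) rq(1)] l'(2) rq(2) by simp
    also have "\<dots> \<longleftrightarrow> lker (rel_comp W W') \<subseteq> graph A q" by (rule lker_le_rker_act[OF W(1) W'(1) P_graph(1)[OF q] sub])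
    also have "\<dots> \<longleftrightarrow> s \<otimes>\<^bsub>Q\<^esub> t \<in> cov_classes \<and> pair_le (lS (s \<otimes>\<^bsub>Q\<^esub> t)) q"
    proof
      assume *: "lker (rel_comp W W') \<subseteq> graph A q"
      then have g: "A_free (rel_comp W W')" using P_graph(2)[OF q] by (auto simp: A_free_lker)
      show "s \<otimes>\<^bsub>Q\<^esub> t \<in> cov_classes \<and> pair_le (lS (s \<otimes>\<^bsub>Q\<^esub> t)) q"
        unfolding st using \<beta>_S[OF c g] P_le_iff[OF lS_\<beta>(1)[OF c g] q] lS_\<beta>(2)[OF c g] * by simp
    next
      assume *: "s \<otimes>\<^bsub>Q\<^esub> t \<in> cov_classes \<and> pair_le (lS (s \<otimes>\<^bsub>Q\<^esub> t)) q"
      then have g: "A_free (rel_comp W W')" using \<beta>_in_S[OF c] unfolding st by simp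
      show "lker (rel_comp W W') \<subseteq> graph A q"
        using * P_le_iff[OF lS_\<beta>(1)[OF c g] q] lS_\<beta>(2)[OF c g] unfolding st by simp
    qed
    finally show ?thesis .
  qed
  fix u assume u: "u \<in> cov_classes"
  then obtain W'' where W'': "covers W''" "A_free W''" and uW: "u = \<beta> W''" by (rule S_E)
  show "s \<otimes>\<^bsub>Q\<^esub> t \<otimes>\<^bsub>Q\<^esub> u = s \<otimes>\<^bsub>Q\<^esub> (t \<otimes>\<^bsub>Q\<^esub> u)"
    unfolding sW tW uW
    by (simp add: \<beta>_mult W(1) W'(1) W''(1) rel_comp_covers rel_comp_assoc)
qed

end

section \<open>The isomorphism\<close>

lemma dsum_alg_cong:
  assumes "\<And>j. j \<in> J \<Longrightarrow> B j = B' j"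
  shows "dsum_alg J B = dsum_alg J B'" and "dsum_inj J B = dsum_inj J B'"
proof -
  have 1: "(\<Pi>\<^sub>E j\<in>J. carrier (B j)) = (\<Pi>\<^sub>E j\<in>J. carrier (B' j))"
    using assms by (intro PiE_cong) simp
  have 2: "(\<lambda>j\<in>J. f (B j) j) = (\<lambda>j\<in>J. f (B' j) j)" for f :: "_ \<Rightarrow> _ \<Rightarrow> 'b"
    using assms by (intro restrict_ext) simp
  show "dsum_alg J B = dsum_alg J B'"
    unfolding dsum_alg_def 1 2[of "\<lambda>B j. x j \<otimes>\<^bsub>B\<^esub> y j" for x y] 2[of "\<lambda>B j. \<one>\<^bsub>B\<^esub>"] 2[of "\<lambda>B j. \<zero>\<^bsub>B\<^esub>"]
      2[of "\<lambda>B j. x j \<oplus>\<^bsub>B\<^esub> y j" for x y] 2[of "\<lambda>B j. c \<odot>\<^bsub>B\<^esub> x j" for c x] ..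
  show "dsum_inj J B = dsum_inj J B'"
    unfolding dsum_inj_def 2[of "\<lambda>B j. if j = i then x else \<zero>\<^bsub>B\<^esub>" for i x] ..
qed

context fb_algebra
begin

lemma f_elem_moebius_wt:
  assumes "finite P"
  shows "f_elem k A G p = (\<Oplus>\<^bsub>Q\<^esub>q\<in>{q \<in> P. pair_le p q}. moebius_wt p q \<odot>\<^bsub>Q\<^esub> e_elem k A G q)"
  unfolding f_elem_def E_alg_eq
proof (rule Q.M.finsum_cong')
  have wc: "moebius_wt p q \<in> carrier k" for q
    using k.add.int_pow_closed[OF k.one_closed] by (simp add: moebius_wt_def add_pow_def)
  show "(\<lambda>q. moebius_wt p q \<odot>\<^bsub>Q\<^esub> e_elem k A G q) \<in> {q \<in> P. pair_le p q} \<rightarrow> carrier Q"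
  proof (rule Pi_I)
    fix q assume "q \<in> {q \<in> P. pair_le p q}"
    then show "moebius_wt p q \<odot>\<^bsub>Q\<^esub> e_elem k A G q \<in> carrier Q"
      using \<beta>_closed by (intro Q.smult_closed wc) (simp add: e_elem_\<beta>)
  qed
  fix q assume "q \<in> {q \<in> P. pair_le p q}"
  then have "e_elem k A G q \<in> carrier Q" using \<beta>_closed by (simp add: e_elem_\<beta>)
  then show "[normal_moebius G (fst p) (fst q)] \<cdot>\<^bsub>Q\<^esub> e_elem k A G q = moebius_wt p q \<odot>\<^bsub>Q\<^esub> e_elem k A G q"
    unfolding moebius_wt_def by (rule Q.add_pow_int_smult)
qed simp

lemma Ec_alg_eq: "Ec_alg k A G = Q\<lparr>carrier := lin_span k Q cov_classes\<rparr>"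
  by (simp add: Ec_alg_def E_alg_eq cov_classes_eq)

text \<open>
  If \<open>\<one> = \<zero>\<close> in \<open>k\<close>, classes of bisets are not linearly independent; but then both algebras have
  a single element.
\<close>

lemma trivial_case:
  assumes triv: "\<one>\<^bsub>k\<^esub> = \<zero>\<^bsub>k\<^esub>" and fin: "finite P"
  shows "\<exists>\<Phi>. alg_iso k (dsum_alg (linkage_classes A G) (link_block k A G rep)) (Ec_alg k A G) \<Phi> \<and>
    (\<forall>x p. \<Phi> x = f_elem k A G p)"
proof -
  have Qz: "carrier Q = {\<zero>\<^bsub>Q\<^esub>}"
  proof -
    have "x = \<zero>\<^bsub>Q\<^esub>" if "x \<in> carrier Q" for x
      using Q.smult_one[OF that] Q.smult_l_null[OF that] triv by simp
    then show ?thesis by auto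
  qed
  have kz: "carrier k = {\<zero>\<^bsub>k\<^esub>}" using k.one_zeroD[OF triv] .
  let ?D = "dsum_alg (linkage_classes A G) (link_block k A G rep)"
  have single: "\<exists>d. carrier (monoid_alg k N) = {d}" for N :: "('k, 'a, 'g) E_elem monoid"
  proof -
    have "carrier N \<rightarrow>\<^sub>E {\<zero>\<^bsub>k\<^esub>} = {\<lambda>x\<in>carrier N. \<zero>\<^bsub>k\<^esub>}" by (auto simp: PiE_iff extensional_def fun_eq_iff)
    then show ?thesis by (intro exI[of _ "\<lambda>x\<in>carrier N. \<zero>\<^bsub>k\<^esub>"]) (auto simp: monoid_alg_simps kz supp_def)
  qed
  have pi: "\<exists>d. (\<Pi>\<^sub>E j\<in>J. X j) = {d}" if *: "\<And>j. j \<in> J \<Longrightarrow> \<exists>d. X j = {d}" for J X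
  proof -
    from * have "\<exists>f. \<forall>j\<in>J. X j = {f j}" by (intro bchoice ballI)
    then obtain f where f: "\<And>j. j \<in> J \<Longrightarrow> X j = {f j}" by blast
    have "(\<Pi>\<^sub>E j\<in>J. X j) = (\<Pi>\<^sub>E j\<in>J. {restrict f J j})" using f by (intro PiE_cong) simp
    then show ?thesis using PiE_singleton[of "restrict f J" J] by simp
  qed
  have "\<exists>d. carrier (link_block k A G rep c) = {d}" for c
    unfolding link_block_def mat_alg_def partial_object.simps by (intro pi single)
  then have "\<exists>d. carrier ?D = {d}" unfolding dsum_alg_def partial_object.simps by (intro pi)
  then obtain d where D: "carrier ?D = {d}" by blast
  have "lin_span k Q cov_classes = {\<zero>\<^bsub>Q\<^esub>}"
  proof -
    have sub: "cov_classes \<subseteq> carrier Q" using \<beta>_closed by (auto simp: cov_classes_def)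
    show ?thesis
      using Q.lin_span_carrier[OF sub] Q.submodule_zero[OF Q.lin_span_submodule[OF sub]] Qz by auto
  qed
  then have Ec: "Ec_alg k A G = Q\<lparr>carrier := {\<zero>\<^bsub>Q\<^esub>}\<rparr>" by (simp add: Ec_alg_eq)
  have one: "\<one>\<^bsub>Q\<^esub> = \<zero>\<^bsub>Q\<^esub>" using Qz \<beta>_closed by (simp add: Q_one e_elem_\<beta>[OF bot_pair(1)])
  have "alg_iso k ?D (Ec_alg k A G) (\<lambda>_. \<zero>\<^bsub>Q\<^esub>)"
    unfolding Ec using one Q.mult_zero_left[OF Q.M.zero_closed]
    by (simp add: alg_iso_def ring_iso_def ring_hom_def D bij_betw_def)
  moreover have "f_elem k A G p = \<zero>\<^bsub>Q\<^esub>" for p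
  proof -
    have wc: "moebius_wt p q \<in> carrier k" for q
      using k.add.int_pow_closed[OF k.one_closed] by (simp add: moebius_wt_def add_pow_def)
    have "f_elem k A G p \<in> carrier Q"
      unfolding f_elem_moebius_wt[OF fin]
    proof (intro Q.M.finsum_closed Pi_I Q.smult_closed wc)
      fix q assume "q \<in> {q \<in> P. pair_le p q}"
      then show "e_elem k A G q \<in> carrier Q" using \<beta>_closed by (simp add: e_elem_\<beta>)
    qed
    then show ?thesis using Qz by simp
  qed
  ultimately show ?thesis by metis
qed

end

lemma (in fb_main) nontrivial_case:
  assumes rep: "\<And>c. c \<in> linkage_classes A G \<Longrightarrow> rep c \<in> c"
    and enum: "\<And>c. c \<in> linkage_classes A G \<Longrightarrow> bij_betw (enum c) {..<card c} c"
  shows "\<exists>\<Phi>. alg_iso k (dsum_alg (linkage_classes A G) (link_block k A G rep)) (Ec_alg k A G) \<Phi> \<and>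
    (\<forall>c \<in> linkage_classes A G. \<forall>i < card c.
       \<Phi> (dsum_inj (linkage_classes A G) (link_block k A G rep) c
            (diag_idem (card c) (monoid_alg k (Gamma k A G (rep c))) i))
       = f_elem k A G (enum c i))"
proof -
  interpret S: inverse_semigroup_basis k Q cov_classes P pair_le bot_pair lS rS "e_elem k A G" "\<lambda>s. \<beta> (opp (cover_of s))"
    "\<lambda>s. coordf (cover_of s)" moebius_wt "linkage A G" rep enum
    using inverse_semigroup[OF assms] .
  have J: "linkage_classes A G = P // linkage A G" by (simp add: linkage_classes_def)
  have \<Gamma>: "S.\<Gamma> c = Gamma k A G (rep c)" if "c \<in> P // linkage A G" for c
    using Gamma_carrier[OF S.rep_P[OF that]] by (simp add: S.\<Gamma>_def Gamma_def E_alg_eq)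
  have blk: "S.blk c = link_block k A G rep c" if "c \<in> P // linkage A G" for c
    using \<Gamma>[OF that] by (simp add: S.blk_def link_block_def)
  have D: "dsum_alg (P // linkage A G) (link_block k A G rep) = dsum_alg (P // linkage A G) S.blk"
    "dsum_inj (P // linkage A G) (link_block k A G rep) = dsum_inj (P // linkage A G) S.blk"
    using blk by (auto intro!: dsum_alg_cong)
  show ?thesis
  proof (intro exI conjI ballI allI impI)
    show "alg_iso k (dsum_alg (linkage_classes A G) (link_block k A G rep)) (Ec_alg k A G) S.phi"
      unfolding J D(1) Ec_alg_eq by (rule S.phi_iso[OF Q_one])
    fix c i assume c: "c \<in> linkage_classes A G" and i: "i < card c"
    show "S.phi (dsum_inj (linkage_classes A G) (link_block k A G rep) c
            (diag_idem (card c) (monoid_alg k (Gamma k A G (rep c))) i)) = f_elem k A G (enum c i)"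
      unfolding J D(2) \<Gamma>[OF c[unfolded J], symmetric] f_elem_moebius_wt[OF P_finite]
      by (rule S.phi_diag_idem[OF c[unfolded J] i])
  qed
qed

theorem theorem6p2:
  fixes k :: "'k ring" and A :: "'a monoid" and G :: "'g monoid"
    and rep :: "('g set \<times> ('g \<Rightarrow> 'a)) set \<Rightarrow> 'g set \<times> ('g \<Rightarrow> 'a)"
    and enum :: "('g set \<times> ('g \<Rightarrow> 'a)) set \<Rightarrow> nat \<Rightarrow> 'g set \<times> ('g \<Rightarrow> 'a)"
  assumes "cring k" and "comm_group A" and "group G" and "finite (carrier G)"
    and "finite (fixed_pairs A G)"
    and "\<And>c. c \<in> linkage_classes A G \<Longrightarrow> rep c \<in> c"
    and "\<And>c. c \<in> linkage_classes A G \<Longrightarrow> bij_betw (enum c) {..<card c} c"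
  shows "\<exists>\<Phi>.
    alg_iso k (dsum_alg (linkage_classes A G) (link_block k A G rep)) (Ec_alg k A G) \<Phi> \<and>
    (\<forall>c \<in> linkage_classes A G. \<forall>i < card c.
       \<Phi> (dsum_inj (linkage_classes A G) (link_block k A G rep) c
            (diag_idem (card c) (monoid_alg k (Gamma k A G (rep c))) i))
       = f_elem k A G (enum c i))"
proof -
  interpret fb_algebra A G k
    by (intro fb_algebra.intro fb_context.intro fb_algebra_axioms.intro assms)
  show ?thesis
  proof (cases "\<one>\<^bsub>k\<^esub> = \<zero>\<^bsub>k\<^esub>")
    case True
    then show ?thesis using trivial_case[OF _ assms(5), of rep] by metis
  next
    case False
    interpret fb_main A G k
      by (intro fb_main.intro fb_main_axioms.intro fb_algebra_axioms assms False)
    show ?thesis by (rule nontrivial_case[OF assms(6,7)])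
  qed
qed

end
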